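(* Assume $\rho_i(t)=\rho(t)$ for all $i=1,\dots,n$ and $t\in[0,T]$, with a common process $\rho\not\equiv0$, and assume $\Psi<1$. Then the $n$-agent relative-wealth mean-variance game has a unique Nash equilibrium.
   Context: Setting. $T>0$; $(\Omega,\mathcal F,\mathbb P)$ is a complete probability space carrying a one-dimensional Brownian motion $W$ on $[0,T]$; $\mathbb F$ is the (completed) filtration generated by $W$. $L^2_{\mathbb F}(0,T;\mathbb{R}^m)$: $\mathbb F$-adapted $\mathbb{R}^m$-valued $v$ with $\mathbb E\int_0^T|v|^2\mathrm{d}t<\infty$ (processes equal a.e. a.s. are identified). Parameters. $n\ge2$; for $i=1,\dots,n$: $x_i\in\mathbb{R}$, $\theta_i\in[0,1]$, $\gamma_i>0$. The processes $r,\mu_i$ are $\mathbb F$-adapted, essentially bounded and nonnegative; $\sigma_i$ is $\mathbb F$-adapted with $c^{-1}\le\sigma_i\le c$ a.e. a.s. for some constant $c>0$; $\rho_i=(\mu_i-r)/\sigma_i$. Put $\Psi=\sum_{i=1}^n\frac{\theta_i}{n-1+\theta_i}\in[0,1]$. Standing assumption: for each $i$, $\mathbb E\int_0^T|\rho_i\psi+\xi|^2\mathrm{d}t>0$, where $(\psi,\xi)$ is the unique solution of $\mathrm{d}\psi=-r\psi\,\mathrm{d}t+\xi\,\mathrm{d}W$, $\psi(T)=1$ ($\psi$ bounded and bounded away from $0$, $\xi\in L^2_{\mathbb F}(0,T;\mathbb{R})$). Game. Let $\mathcal U=L^2_{\mathbb F}(0,T;\mathbb{R})$. If agent $i$ uses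 $\pi_i\in\mathcal U$, the wealth $X_i$ solves $\mathrm{d}X_i=[rX_i+\pi_i\sigma_i\rho_i]\mathrm{d}t+\pi_i\sigma_i\,\mathrm{d}W$, $X_i(0)=x_i$. With $\hat X_i=\frac1{n-1}\sum_{k\ne i}X_k$, agent $i$ maximizes $$\hat J_i(\pi_1,\dots,\pi_n)=\mathbb E[X_i(T)-\theta_i\hat X_i(T)]-\tfrac{\gamma_i}{2}\operatorname{Var}[X_i(T)-\theta_i\hat X_i(T)].$$ $\boldsymbol\pi^*\in\mathcal U^n$ is a Nash equilibrium if for every $i$ and every $\pi_i\in\mathcal U$, $\hat J_i(\boldsymbol\pi^* )\ge\hat J_i(\pi_1^*,\dots,\pi_{i-1}^*,\pi_i,\pi_{i+1}^*,\dots,\pi_n^* )$. *)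

theory Defs
  imports "HOL-Probability.Probability"
begin

section \<open>Brownian motion and its completed filtration\<close>

text \<open>A process is a function \<open>v\<close> of time and scenario; only its values at times in \<open>[0,T]\<close>
  matter.\<close>

type_synonym 'a process = "real \<Rightarrow> 'a \<Rightarrow> real"

definition past_events :: "'a measure \<Rightarrow> 'a process \<Rightarrow> real \<Rightarrow> 'a set set" where
  "past_events M W t = {W s -` B \<inter> space M | s B. s \<in> {0..t} \<and> B \<in> sets borel}"

definition brownian_motion :: "'a measure \<Rightarrow> real \<Rightarrow> 'a process \<Rightarrow> bool" where
  "brownian_motion M T W \<longleftrightarrow>
     (\<forall>t\<in>{0..T}. W t \<in> borel_measurable M) \<and>
     (AE \<omega> in M. W 0 \<omega> = 0) \<and>
     (AE \<omega> in M. continuous_on {0..T} (\<lambda>t. W t \<omega>)) \<and>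
     (\<forall>s t. 0 \<le> s \<and> s < t \<and> t \<le> T \<longrightarrow>
        distributed M lborel (\<lambda>\<omega>. W t \<omega> - W s \<omega>) (normal_density 0 (sqrt (t - s))) \<and>
        prob_space.indep_set M
          (sigma_sets (space M) (past_events M W s))
          (sets (vimage_algebra (space M) (\<lambda>\<omega>. W t \<omega> - W s \<omega>) borel)))"

text \<open>The filtration generated by \<open>W\<close>, augmented by the null sets of \<open>M\<close>.\<close>

definition brownian_filtration :: "'a measure \<Rightarrow> 'a process \<Rightarrow> real \<Rightarrow> 'a measure" where
  "brownian_filtration M W t = sigma (space M) (past_events M W t \<union> null_sets M)"

section \<open>Adapted processes\<close>

definition time_scenario :: "'a measure \<Rightarrow> real \<Rightarrow> (real \<times> 'a) measure" where
  "time_scenario M T = restrict_space lborel {0..T} \<Otimes>\<^sub>M M"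

text \<open>Processes are jointly measurable in time and scenario, as is implicit in integrating them
  in time.\<close>

definition adapted :: "'a measure \<Rightarrow> real \<Rightarrow> 'a process \<Rightarrow> 'a process \<Rightarrow> bool" where
  "adapted M T W v \<longleftrightarrow>
     case_prod v \<in> borel_measurable (time_scenario M T) \<and>
     (\<forall>t\<in>{0..T}. v t \<in> borel_measurable (brownian_filtration M W t))"

text \<open>The quantity \<open>E \<integral>\<^sub>0\<^sup>T |v|\<^sup>2 dt\<close>, with value \<open>\<infinity>\<close> allowed.\<close>

definition energy :: "'a measure \<Rightarrow> real \<Rightarrow> 'a process \<Rightarrow> ennreal" where
  "energy M T v = (\<integral>\<^sup>+\<omega>. (\<integral>\<^sup>+t\<in>{0..T}. ennreal ((v t \<omega>)\<^sup>2) \<partial>lborel) \<partial>M)"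

definition L2_adapted :: "'a measure \<Rightarrow> real \<Rightarrow> 'a process \<Rightarrow> 'a process set" where
  "L2_adapted M T W = {v. adapted M T W v \<and> energy M T v < \<infinity>}"

text \<open>Equality almost everywhere, almost surely: the identification made in \<open>L2_adapted\<close>.\<close>

definition same_process :: "'a measure \<Rightarrow> real \<Rightarrow> 'a process \<Rightarrow> 'a process \<Rightarrow> bool" where
  "same_process M T u v \<longleftrightarrow> (AE (t, \<omega>) in time_scenario M T. u t \<omega> = v t \<omega>)"

section \<open>Ito integral and Ito processes\<close>

text \<open>Elementary integrands \<open>\<Sum>j<m. h\<^sub>j 1\<^bsub>(\<tau>\<^sub>j, \<tau>\<^sub>j\<^sub>+\<^sub>1]\<^esub>\<close> with \<open>h\<^sub>j\<close> bounded and known at time \<open>\<tau>\<^sub>j\<close>.\<close>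

definition elementary ::
  "'a measure \<Rightarrow> real \<Rightarrow> 'a process \<Rightarrow> nat \<Rightarrow> (nat \<Rightarrow> real) \<Rightarrow> (nat \<Rightarrow> 'a \<Rightarrow> real) \<Rightarrow> bool" where
  "elementary M T W m \<tau> h \<longleftrightarrow>
     (\<forall>j\<le>m. \<tau> j \<in> {0..T}) \<and> (\<forall>j<m. \<tau> j \<le> \<tau> (Suc j)) \<and>
     (\<forall>j<m. h j \<in> borel_measurable (brownian_filtration M W (\<tau> j)) \<and>
            (\<exists>C. \<forall>\<omega>\<in>space M. \<bar>h j \<omega>\<bar> \<le> C))"

definition elementary_process :: "nat \<Rightarrow> (nat \<Rightarrow> real) \<Rightarrow> (nat \<Rightarrow> 'a \<Rightarrow> real) \<Rightarrow> 'a process" where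
  "elementary_process m \<tau> h t \<omega> = (\<Sum>j<m. h j \<omega> * indicator {\<tau> j<..\<tau> (Suc j)} t)"

definition elementary_integral ::
  "'a process \<Rightarrow> nat \<Rightarrow> (nat \<Rightarrow> real) \<Rightarrow> (nat \<Rightarrow> 'a \<Rightarrow> real) \<Rightarrow> 'a process" where
  "elementary_integral W m \<tau> h t \<omega> =
     (\<Sum>j<m. h j \<omega> * (W (min t (\<tau> (Suc j))) \<omega> - W (min t (\<tau> j)) \<omega>))"

text \<open>\<open>I\<close> is a continuous version of \<open>t \<mapsto> \<integral>\<^sub>0\<^sup>t v dW\<close> for an integrand \<open>v\<close> in \<open>L2_adapted\<close>: the limit in
  mean square of the integrals of elementary integrands converging to \<open>v\<close> in mean square.\<close>

definition is_ito_integral ::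
  "'a measure \<Rightarrow> real \<Rightarrow> 'a process \<Rightarrow> 'a process \<Rightarrow> 'a process \<Rightarrow> bool" where
  "is_ito_integral M T W v I \<longleftrightarrow>
     v \<in> L2_adapted M T W \<and>
     (\<forall>t\<in>{0..T}. I t \<in> borel_measurable (brownian_filtration M W t)) \<and>
     (AE \<omega> in M. continuous_on {0..T} (\<lambda>t. I t \<omega>)) \<and>
     (\<exists>m \<tau> h.
        (\<forall>k::nat. elementary M T W (m k) (\<tau> k) (h k)) \<and>
        (\<lambda>k. energy M T (\<lambda>t \<omega>. elementary_process (m k) (\<tau> k) (h k) t \<omega> - v t \<omega>))
          \<longlonglongrightarrow> 0 \<and>
        (\<forall>t\<in>{0..T}.
           (\<lambda>k. \<integral>\<^sup>+\<omega>. ennreal ((elementary_integral W (m k) (\<tau> k) (h k) t \<omega> - I t \<omega>)\<^sup>2) \<partial>M)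
             \<longlonglongrightarrow> 0))"

text \<open>\<open>dX = a dt + b dW\<close> on \<open>[0,T]\<close>, with \<open>X\<close> adapted and continuous.\<close>

definition has_ito_differential ::
  "'a measure \<Rightarrow> real \<Rightarrow> 'a process \<Rightarrow> 'a process \<Rightarrow> 'a process \<Rightarrow> 'a process \<Rightarrow> bool" where
  "has_ito_differential M T W X a b \<longleftrightarrow>
     (\<forall>t\<in>{0..T}. X t \<in> borel_measurable (brownian_filtration M W t)) \<and>
     (AE \<omega> in M. continuous_on {0..T} (\<lambda>t. X t \<omega>)) \<and>
     (AE \<omega> in M. set_integrable lborel {0..T} (\<lambda>t. a t \<omega>)) \<and>
     (\<exists>I. is_ito_integral M T W b I \<and>
        (AE \<omega> in M. \<forall>t\<in>{0..T}. X t \<omega> = X 0 \<omega> + (LINT s:{0..t}|lborel. a s \<omega>) + I t \<omega>))"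

section \<open>Market\<close>

definition essentially_bounded :: "'a measure \<Rightarrow> real \<Rightarrow> 'a process \<Rightarrow> bool" where
  "essentially_bounded M T v \<longleftrightarrow> (\<exists>C. AE (t, \<omega>) in time_scenario M T. \<bar>v t \<omega>\<bar> \<le> C)"

definition nonnegative :: "'a measure \<Rightarrow> real \<Rightarrow> 'a process \<Rightarrow> bool" where
  "nonnegative M T v \<longleftrightarrow> (AE (t, \<omega>) in time_scenario M T. 0 \<le> v t \<omega>)"

definition risk_premium :: "'a process \<Rightarrow> 'a process \<Rightarrow> 'a process \<Rightarrow> 'a process" where
  "risk_premium r \<mu> \<sigma> t \<omega> = (\<mu> t \<omega> - r t \<omega>) / \<sigma> t \<omega>"

text \<open>The backward equation \<open>d\<psi> = -r \<psi> dt + \<xi> dW\<close>, \<open>\<psi>(T) = 1\<close>. Its solution is unique in the class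
  of pairs with \<open>\<psi>\<close> bounded and bounded away from \<open>0\<close> and \<open>\<xi>\<close> in \<open>L2_adapted\<close>; the latter is part of
  \<open>is_ito_integral\<close>.\<close>

definition bond_bsde_solution ::
  "'a measure \<Rightarrow> real \<Rightarrow> 'a process \<Rightarrow> 'a process \<Rightarrow> 'a process \<Rightarrow> 'a process \<Rightarrow> bool" where
  "bond_bsde_solution M T W r \<psi> \<xi> \<longleftrightarrow>
     has_ito_differential M T W \<psi> (\<lambda>t \<omega>. - r t \<omega> * \<psi> t \<omega>) \<xi> \<and>
     (AE \<omega> in M. \<psi> T \<omega> = 1) \<and>
     (\<exists>c C. 0 < c \<and> (AE \<omega> in M. \<forall>t\<in>{0..T}. c \<le> \<bar>\<psi> t \<omega>\<bar> \<and> \<bar>\<psi> t \<omega>\<bar> \<le> C))"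

definition is_wealth ::
  "'a measure \<Rightarrow> real \<Rightarrow> 'a process \<Rightarrow> 'a process \<Rightarrow> 'a process \<Rightarrow> 'a process \<Rightarrow> real \<Rightarrow>
    'a process \<Rightarrow> 'a process \<Rightarrow> bool" where
  "is_wealth M T W r \<mu> \<sigma> x p X \<longleftrightarrow>
     has_ito_differential M T W X
       (\<lambda>t \<omega>. r t \<omega> * X t \<omega> + p t \<omega> * \<sigma> t \<omega> * risk_premium r \<mu> \<sigma> t \<omega>)
       (\<lambda>t \<omega>. p t \<omega> * \<sigma> t \<omega>) \<and>
     (AE \<omega> in M. X 0 \<omega> = x)"

text \<open>The wealth equation determines its solution up to indistinguishability.\<close>

definition wealth ::
  "'a measure \<Rightarrow> real \<Rightarrow> 'a process \<Rightarrow> 'a process \<Rightarrow> 'a process \<Rightarrow> 'a process \<Rightarrow> real \<Rightarrow>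
    'a process \<Rightarrow> 'a process" where
  "wealth M T W r \<mu> \<sigma> x p = (SOME X. is_wealth M T W r \<mu> \<sigma> x p X)"

section \<open>The game\<close>

text \<open>Agents are numbered \<open>1,\<dots>,n\<close>; families indexed by agents are functions on \<open>nat\<close> whose values
  outside \<open>{1..n}\<close> are irrelevant.\<close>

definition relative_terminal_wealth ::
  "'a measure \<Rightarrow> real \<Rightarrow> 'a process \<Rightarrow> nat \<Rightarrow> 'a process \<Rightarrow> (nat \<Rightarrow> 'a process) \<Rightarrow>
    (nat \<Rightarrow> 'a process) \<Rightarrow> (nat \<Rightarrow> real) \<Rightarrow> (nat \<Rightarrow> real) \<Rightarrow> (nat \<Rightarrow> 'a process) \<Rightarrow> nat \<Rightarrow>
    'a \<Rightarrow> real" where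
  "relative_terminal_wealth M T W n r \<mu> \<sigma> x \<theta> \<pi> i \<omega> =
     (let X = (\<lambda>k. wealth M T W r (\<mu> k) (\<sigma> k) (x k) (\<pi> k))
      in X i T \<omega> - \<theta> i * ((1 / (real n - 1)) * (\<Sum>k\<in>{1..n} - {i}. X k T \<omega>)))"

definition payoff ::
  "'a measure \<Rightarrow> real \<Rightarrow> 'a process \<Rightarrow> nat \<Rightarrow> 'a process \<Rightarrow> (nat \<Rightarrow> 'a process) \<Rightarrow>
    (nat \<Rightarrow> 'a process) \<Rightarrow> (nat \<Rightarrow> real) \<Rightarrow> (nat \<Rightarrow> real) \<Rightarrow> (nat \<Rightarrow> real) \<Rightarrow>
    (nat \<Rightarrow> 'a process) \<Rightarrow> nat \<Rightarrow> real" where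
  "payoff M T W n r \<mu> \<sigma> x \<theta> \<gamma> \<pi> i =
     (let Y = relative_terminal_wealth M T W n r \<mu> \<sigma> x \<theta> \<pi> i
      in prob_space.expectation M Y - \<gamma> i / 2 * prob_space.variance M Y)"

definition nash_equilibrium ::
  "'a measure \<Rightarrow> real \<Rightarrow> 'a process \<Rightarrow> nat \<Rightarrow> 'a process \<Rightarrow> (nat \<Rightarrow> 'a process) \<Rightarrow>
    (nat \<Rightarrow> 'a process) \<Rightarrow> (nat \<Rightarrow> real) \<Rightarrow> (nat \<Rightarrow> real) \<Rightarrow> (nat \<Rightarrow> real) \<Rightarrow>
    (nat \<Rightarrow> 'a process) \<Rightarrow> bool" where
  "nash_equilibrium M T W n r \<mu> \<sigma> x \<theta> \<gamma> \<pi> \<longleftrightarrow>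
     (\<forall>i\<in>{1..n}. \<pi> i \<in> L2_adapted M T W) \<and>
     (\<forall>i\<in>{1..n}. \<forall>p\<in>L2_adapted M T W.
        payoff M T W n r \<mu> \<sigma> x \<theta> \<gamma> (\<pi>(i := p)) i \<le> payoff M T W n r \<mu> \<sigma> x \<theta> \<gamma> \<pi> i)"

definition Psi :: "nat \<Rightarrow> (nat \<Rightarrow> real) \<Rightarrow> real" where
  "Psi n \<theta> = (\<Sum>i=1..n. \<theta> i / (real n - 1 + \<theta> i))"

end

theory Submission
  imports Defs
begin

text \<open>Seen through terminal wealths, the strategies of agent \<open>i\<close> form the affine space \<open>x i * e + S\<close>, where \<open>e\<close> is
  the terminal value of the bond and \<open>S\<close> the space of attainable gains, common to all agents since \<open>\<rho>\<close> is.
  Mean-square estimates backward in time bound a strategy by its gain, so that \<open>S\<close> is closed and strategies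
  are determined by their terminal wealths. No constant other than \<open>0\<close> lies in \<open>S\<close>: discounted gains have
  mean \<open>0\<close> under approximate pricing measures whose densities are bounded in mean square. Hence the
  covariance is an inner product on \<open>S\<close>, complete by closedness, and by Riesz there is \<open>\<eta>\<close> in \<open>S\<close> with
  \<open>E s = Cov (\<eta>, s)\<close> for \<open>s\<close> in \<open>S\<close>. The best-response conditions become linear equations in \<open>S\<close> whose right-hand
  sides are known, and \<open>\<Psi> < 1\<close> makes this system uniquely solvable. Neither Girsanov's theorem nor
  martingale representation is used.\<close>

section \<open>Square-integrable functions\<close>

text \<open>The coefficients are only measurable in time, so they can be neither differentiated nor
  sampled on a grid: pathwise equations are handled by increment estimates that die out under
  refinement, and step approximations come from orthogonal projection. The interest rate is random,
  hence so is \<open>e\<close>; it adds its own covariance term to the best-response condition, and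
  constants must be excluded from undiscounted gains: an attainable constant
  \<open>c \<noteq> 0\<close>, divided by \<open>c\<close> and discounted, would be bounded below by
  a positive number. The backward estimate rests on orthogonality: over a short interval the
  martingale increment is orthogonal to what is known at its left end \<open>a\<close>, while
  Cauchy-Schwarz gives the drift a factor \<open>sqrt (b - a)\<close>, so that the drift is
  absorbed. The step size depends only on \<open>T\<close> and the bound of \<open>\<rho>\<close>,
  which makes the constant uniform over strategies. The pricing densities are products over grid
  cells; each factor raises the second moment by a relative amount proportional to the cell length,
  whence a bound independent of the grid.\<close>

definition L2 :: "'b measure \<Rightarrow> ('b \<Rightarrow> real) set" where
  "L2 N = {f \<in> borel_measurable N. integrable N (\<lambda>x. (f x)\<^sup>2)}"

definition l2norm :: "'b measure \<Rightarrow> ('b \<Rightarrow> real) \<Rightarrow> real" where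
  "l2norm N f = sqrt (\<integral>x. (f x)\<^sup>2 \<partial>N)"

text \<open>Membership in \<open>L2\<close> is part of the notion because the Bochner integral of a
  nonintegrable function is 0, so that a small \<open>l2norm\<close> alone would certify
  nothing.\<close>

definition L2_tends :: "'b measure \<Rightarrow> (nat \<Rightarrow> 'b \<Rightarrow> real) \<Rightarrow> ('b \<Rightarrow> real) \<Rightarrow> bool" where
  "L2_tends N F f \<longleftrightarrow> (\<forall>k. F k \<in> L2 N) \<and> f \<in> L2 N \<and> (\<lambda>k. l2norm N (\<lambda>x. F k x - f x)) \<longlonglongrightarrow> 0"

lemma L2_I: "f \<in> borel_measurable N \<Longrightarrow> integrable N (\<lambda>x. (f x)\<^sup>2) \<Longrightarrow> f \<in> L2 N"
  by (simp add: L2_def)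

lemma L2_measurable: "f \<in> L2 N \<Longrightarrow> f \<in> borel_measurable N"
  by (simp add: L2_def)

lemma L2_integrable_square: "f \<in> L2 N \<Longrightarrow> integrable N (\<lambda>x. (f x)\<^sup>2)"
  by (simp add: L2_def)

lemma L2_integrable_mult:
  assumes "f \<in> L2 N" "g \<in> L2 N"
  shows "integrable N (\<lambda>x. f x * g x)"
proof (rule Bochner_Integration.integrable_bound)
  show "integrable N (\<lambda>x. (f x)\<^sup>2 + (g x)\<^sup>2)"
    using assms by (intro Bochner_Integration.integrable_add L2_integrable_square)
  show "(\<lambda>x. f x * g x) \<in> borel_measurable N"
    using assms[THEN L2_measurable] by measurable
  have "\<bar>a * b\<bar> \<le> a\<^sup>2 + b\<^sup>2" for a b :: real
  proof -
    have "0 \<le> \<bar>a\<bar> * \<bar>b\<bar>" "2 * \<bar>a\<bar> * \<bar>b\<bar> \<le> \<bar>a\<bar>\<^sup>2 + \<bar>b\<bar>\<^sup>2"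
      using sum_squares_bound[of "\<bar>a\<bar>" "\<bar>b\<bar>"] by simp_all
    then show ?thesis unfolding abs_mult power2_abs by linarith
  qed
  then show "AE x in N. norm (f x * g x) \<le> norm ((f x)\<^sup>2 + (g x)\<^sup>2)"
    by (intro AE_I2) (simp add: real_norm_def)
qed

lemma L2_add:
  assumes "f \<in> L2 N" "g \<in> L2 N"
  shows "(\<lambda>x. f x + g x) \<in> L2 N"
proof (rule L2_I)
  show "(\<lambda>x. f x + g x) \<in> borel_measurable N"
    using assms[THEN L2_measurable] by measurable
  have "integrable N (\<lambda>x. (f x)\<^sup>2 + (g x)\<^sup>2 + 2 * (f x * g x))"
    using assms by (intro Bochner_Integration.integrable_add integrable_mult_right
        L2_integrable_square L2_integrable_mult)
  then show "integrable N (\<lambda>x. (f x + g x)\<^sup>2)"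
    by (simp add: power2_sum algebra_simps)
qed

lemma L2_cmult:
  assumes "f \<in> L2 N" shows "(\<lambda>x. c * f x) \<in> L2 N"
proof (rule L2_I)
  show "(\<lambda>x. c * f x) \<in> borel_measurable N"
    using assms[THEN L2_measurable] by measurable
  show "integrable N (\<lambda>x. (c * f x)\<^sup>2)"
    using integrable_mult_right[OF L2_integrable_square[OF assms], of "c\<^sup>2"]
    by (simp add: power_mult_distrib)
qed

lemma L2_uminus: "f \<in> L2 N \<Longrightarrow> (\<lambda>x. - f x) \<in> L2 N"
  using L2_cmult[of f N "-1"] by simp

lemma L2_diff: "f \<in> L2 N \<Longrightarrow> g \<in> L2 N \<Longrightarrow> (\<lambda>x. f x - g x) \<in> L2 N"
  using L2_add[of f N "\<lambda>x. - g x"] L2_uminus[of g N] by simp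

lemma L2_zero: "(\<lambda>x. 0) \<in> L2 N"
  by (simp add: L2_def)

lemma L2_sum: "(\<And>i. i \<in> I \<Longrightarrow> f i \<in> L2 N) \<Longrightarrow> (\<lambda>x. \<Sum>i\<in>I. f i x) \<in> L2 N"
  by (induction I rule: infinite_finite_induct) (auto intro: L2_zero L2_add)

lemma L2_cong_AE:
  assumes "f \<in> L2 N" "g \<in> borel_measurable N" "AE x in N. f x = g x"
  shows "g \<in> L2 N"
proof (rule L2_I[OF assms(2)])
  have "integrable N (\<lambda>x. (f x)\<^sup>2) \<longleftrightarrow> integrable N (\<lambda>x. (g x)\<^sup>2)"
    using assms L2_measurable[OF assms(1)]
    by (intro integrable_cong_AE) (auto elim: eventually_mono)
  then show "integrable N (\<lambda>x. (g x)\<^sup>2)"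
    using assms by (simp add: L2_def)
qed

lemma L2_dominated:
  assumes "f \<in> L2 N" "g \<in> borel_measurable N" "AE x in N. \<bar>g x\<bar> \<le> C * \<bar>f x\<bar>"
  shows "g \<in> L2 N"
proof (rule L2_I[OF assms(2)], rule Bochner_Integration.integrable_bound)
  show "integrable N (\<lambda>x. (C * f x)\<^sup>2)"
    by (rule L2_integrable_square[OF L2_cmult[OF assms(1)]])
  show "(\<lambda>x. (g x)\<^sup>2) \<in> borel_measurable N" using assms(2) by measurable
  show "AE x in N. norm ((g x)\<^sup>2) \<le> norm ((C * f x)\<^sup>2)"
    using assms(3)
  proof eventually_elim
    case (elim x)
    then have "\<bar>g x\<bar> \<le> \<bar>C * f x\<bar>"
      by (simp add: abs_mult) (smt (verit) abs_ge_zero mult_right_mono)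
    then show ?case by (simp add: abs_le_square_iff)
  qed
qed

lemma L2_bounded_mult:
  assumes "f \<in> L2 N" "h \<in> borel_measurable N" "\<And>x. x \<in> space N \<Longrightarrow> \<bar>h x\<bar> \<le> C"
  shows "(\<lambda>x. h x * f x) \<in> L2 N"
proof (rule L2_dominated[OF assms(1)])
  show "(\<lambda>x. h x * f x) \<in> borel_measurable N"
    using assms(2) L2_measurable[OF assms(1)] by measurable
  show "AE x in N. \<bar>h x * f x\<bar> \<le> C * \<bar>f x\<bar>"
    using assms(3) by (intro AE_I2) (simp add: abs_mult mult_right_mono)
qed

lemma (in finite_measure) L2_bounded:
  assumes "f \<in> borel_measurable M" "AE x in M. \<bar>f x\<bar> \<le> C"
  shows "f \<in> L2 M"
proof (rule L2_dominated[OF _ assms(1)])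
  show "(\<lambda>x. 1) \<in> L2 M" by (simp add: L2_def)
  show "AE x in M. \<bar>f x\<bar> \<le> C * \<bar>1\<bar>" using assms(2) by simp
qed

lemma (in finite_measure) L2_const: "(\<lambda>x. c) \<in> L2 M"
  by (simp add: L2_def)

lemma (in finite_measure) L2_integrable: "f \<in> L2 M \<Longrightarrow> integrable M f"
  using L2_integrable_mult[of f M "\<lambda>x. 1"] L2_const[of 1] by simp

section \<open>The mean-square norm, Cauchy-Schwarz and the triangle inequality\<close>

lemma l2norm_nonneg [simp]: "0 \<le> l2norm N f"
  by (simp add: l2norm_def)

lemma l2norm_square: "(l2norm N f)\<^sup>2 = (\<integral>x. (f x)\<^sup>2 \<partial>N)"
  by (simp add: l2norm_def)

lemma l2norm_uminus: "l2norm N (\<lambda>x. - f x) = l2norm N f"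
  by (simp add: l2norm_def)

lemma l2norm_minus_commute: "l2norm N (\<lambda>x. f x - g x) = l2norm N (\<lambda>x. g x - f x)"
  by (simp add: l2norm_def power2_commute)

lemma l2norm_cmult: "l2norm N (\<lambda>x. c * f x) = \<bar>c\<bar> * l2norm N f"
  by (simp add: l2norm_def power_mult_distrib real_sqrt_mult)

lemma l2norm_cong_AE:
  assumes "f \<in> borel_measurable N" "g \<in> borel_measurable N" "AE x in N. f x = g x"
  shows "l2norm N f = l2norm N g"
  unfolding l2norm_def
  using assms by (intro arg_cong[where f=sqrt] integral_cong_AE) (auto elim: eventually_mono)

lemma l2norm_mono:
  assumes "g \<in> L2 N" "f \<in> borel_measurable N" "AE x in N. \<bar>f x\<bar> \<le> \<bar>g x\<bar>"
  shows "l2norm N f \<le> l2norm N g"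
proof -
  have f: "f \<in> L2 N" using L2_dominated[OF assms(1,2), of 1] assms(3) by simp
  have "(\<integral>x. (f x)\<^sup>2 \<partial>N) \<le> (\<integral>x. (g x)\<^sup>2 \<partial>N)"
    using assms(3) L2_integrable_square[OF f] L2_integrable_square[OF assms(1)]
    by (intro integral_mono_AE) (auto elim!: eventually_mono simp: abs_le_square_iff)
  then show ?thesis by (simp add: l2norm_def)
qed

lemma l2norm_eq_0_AE:
  assumes "f \<in> L2 N" "l2norm N f = 0"
  shows "AE x in N. f x = 0"
  using assms integral_nonneg_eq_0_iff_AE[OF L2_integrable_square[OF assms(1)]]
  by (simp add: l2norm_def)

lemma L2_Cauchy_Schwarz:
  assumes "f \<in> L2 N" "g \<in> L2 N"
  shows "\<bar>\<integral>x. f x * g x \<partial>N\<bar> \<le> l2norm N f * l2norm N g"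
proof -
  define A B C where "A = (\<integral>x. (f x)\<^sup>2 \<partial>N)" and "B = (\<integral>x. f x * g x \<partial>N)"
    and "C = (\<integral>x. (g x)\<^sup>2 \<partial>N)"
  have q: "0 \<le> A - 2 * t * B + t\<^sup>2 * C" for t
  proof -
    have "0 \<le> (\<integral>x. (f x - t * g x)\<^sup>2 \<partial>N)" by (intro integral_nonneg_AE) simp
    also have "\<dots> = (\<integral>x. (f x)\<^sup>2 - (2 * t) * (f x * g x) + t\<^sup>2 * (g x)\<^sup>2 \<partial>N)"
      by (simp add: power2_diff algebra_simps)
    also have "\<dots> = A - 2 * t * B + t\<^sup>2 * C"
      using assms unfolding A_def B_def C_def
      by (simp add: L2_integrable_mult L2_integrable_square)
    finally show ?thesis .
  qed
  have nonneg: "0 \<le> A" "0 \<le> C" unfolding A_def C_def by (auto intro: integral_nonneg_AE)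
  have "B\<^sup>2 \<le> A * C"
  proof (cases "C = 0")
    case True
    have "B = 0"
    proof (rule ccontr)
      assume "B \<noteq> 0"
      \<comment> \<open>With \<open>C = 0\<close> the quadratic in \<open>t\<close> degenerates to a
        linear function; at this point it equals -1.\<close>
      then show False using q[of "(A + 1) / (2 * B)"] True by (simp add: field_simps)
    qed
    then show ?thesis using True by simp
  next
    case False
    then have "0 < C" using nonneg by simp
    then show ?thesis using q[of "B / C"] by (simp add: field_simps power2_eq_square)
  qed
  then have "sqrt (B\<^sup>2) \<le> sqrt (A * C)" by (rule real_sqrt_le_mono)
  then show ?thesis by (simp add: A_def B_def C_def l2norm_def real_sqrt_mult)
qed

lemma l2norm_triangle:
  assumes "f \<in> L2 N" "g \<in> L2 N"
  shows "l2norm N (\<lambda>x. f x + g x) \<le> l2norm N f + l2norm N g"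
proof -
  have "(l2norm N (\<lambda>x. f x + g x))\<^sup>2 = (\<integral>x. (f x)\<^sup>2 + 2 * (f x * g x) + (g x)\<^sup>2 \<partial>N)"
    by (simp add: l2norm_square power2_sum algebra_simps)
  also have "\<dots> = (l2norm N f)\<^sup>2 + 2 * (\<integral>x. f x * g x \<partial>N) + (l2norm N g)\<^sup>2"
    using assms by (simp add: l2norm_square L2_integrable_mult L2_integrable_square)
  also have "\<dots> \<le> (l2norm N f + l2norm N g)\<^sup>2"
    using L2_Cauchy_Schwarz[OF assms] by (simp add: power2_sum)
  finally show ?thesis by (rule power2_le_imp_le) simp
qed

lemma l2norm_triangle_diff:
  assumes "f \<in> L2 N" "g \<in> L2 N"
  shows "l2norm N (\<lambda>x. f x - g x) \<le> l2norm N f + l2norm N g"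
  using l2norm_triangle[OF assms(1) L2_uminus[OF assms(2)]] by (simp add: l2norm_uminus)

lemma l2norm_triangle_via:
  assumes "f \<in> L2 N" "g \<in> L2 N" "h \<in> L2 N"
  shows "l2norm N (\<lambda>x. f x - h x) \<le> l2norm N (\<lambda>x. f x - g x) + l2norm N (\<lambda>x. g x - h x)"
  using l2norm_triangle[OF L2_diff[OF assms(1,2)] L2_diff[OF assms(2,3)]] by simp

text \<open>Almost surely convergent subsequences are extracted from L1 convergence; finiteness of
  the measure lets mean-square convergence supply it.\<close>

lemma (in finite_measure) L1_le_l2norm:
  assumes "f \<in> L2 M"
  shows "(\<integral>x. \<bar>f x\<bar> \<partial>M) \<le> sqrt (measure M (space M)) * l2norm M f"
proof -
  have "(\<lambda>x. \<bar>f x\<bar>) \<in> L2 M"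
    using L2_measurable[OF assms] by (intro L2_dominated[OF assms, of _ 1]) auto
  from L2_Cauchy_Schwarz[OF L2_const[of 1] this] show ?thesis
    by (simp add: l2norm_def)
qed

section \<open>Rules for mean-square limits\<close>

lemma L2_tends_I:
  assumes "\<And>k. F k \<in> L2 N" "f \<in> L2 N" "\<And>k. l2norm N (\<lambda>x. F k x - f x) \<le> e k" "e \<longlonglongrightarrow> 0"
  shows "L2_tends N F f"
  unfolding L2_tends_def
  using assms by (auto intro!: tendsto_sandwich[OF _ _ tendsto_const assms(4)])

lemma L2_tends_const: "f \<in> L2 N \<Longrightarrow> L2_tends N (\<lambda>_. f) f"
  by (simp add: L2_tends_def l2norm_def)

lemma L2_tends_add:
  assumes "L2_tends N F f" "L2_tends N G g"
  shows "L2_tends N (\<lambda>k x. F k x + G k x) (\<lambda>x. f x + g x)"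
proof (rule L2_tends_I)
  show "(\<lambda>k. l2norm N (\<lambda>x. F k x - f x) + l2norm N (\<lambda>x. G k x - g x)) \<longlonglongrightarrow> 0"
    using assms unfolding L2_tends_def by (auto intro: tendsto_add_zero)
  show "l2norm N (\<lambda>x. F k x + G k x - (f x + g x))
      \<le> l2norm N (\<lambda>x. F k x - f x) + l2norm N (\<lambda>x. G k x - g x)" for k
    using l2norm_triangle[of "\<lambda>x. F k x - f x" N "\<lambda>x. G k x - g x"] assms
    by (simp add: L2_tends_def L2_diff algebra_simps)
qed (use assms in \<open>auto simp: L2_tends_def intro: L2_add\<close>)

lemma L2_tends_cmult:
  assumes "L2_tends N F f"
  shows "L2_tends N (\<lambda>k x. c * F k x) (\<lambda>x. c * f x)"
proof (rule L2_tends_I)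
  show "(\<lambda>k. \<bar>c\<bar> * l2norm N (\<lambda>x. F k x - f x)) \<longlonglongrightarrow> 0"
    using assms unfolding L2_tends_def by (auto intro: tendsto_mult_right_zero)
  show "l2norm N (\<lambda>x. c * F k x - c * f x) \<le> \<bar>c\<bar> * l2norm N (\<lambda>x. F k x - f x)" for k
    by (simp add: l2norm_cmult[symmetric] right_diff_distrib)
qed (use assms in \<open>auto simp: L2_tends_def intro: L2_cmult\<close>)

lemma L2_tends_diff:
  assumes "L2_tends N F f" "L2_tends N G g"
  shows "L2_tends N (\<lambda>k x. F k x - G k x) (\<lambda>x. f x - g x)"
  using L2_tends_add[OF assms(1) L2_tends_cmult[OF assms(2), of "-1"]] by simp

lemma L2_tends_bounded_mult:
  assumes "L2_tends N F f" "h \<in> borel_measurable N" "\<And>x. x \<in> space N \<Longrightarrow> \<bar>h x\<bar> \<le> C"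
  shows "L2_tends N (\<lambda>k x. h x * F k x) (\<lambda>x. h x * f x)"
proof (rule L2_tends_I)
  show "(\<lambda>k. \<bar>C\<bar> * l2norm N (\<lambda>x. F k x - f x)) \<longlonglongrightarrow> 0"
    using assms unfolding L2_tends_def by (auto intro: tendsto_mult_right_zero)
  show "l2norm N (\<lambda>x. h x * F k x - h x * f x) \<le> \<bar>C\<bar> * l2norm N (\<lambda>x. F k x - f x)" for k
  proof -
    have d: "(\<lambda>x. F k x - f x) \<in> L2 N" using assms(1) by (auto simp: L2_tends_def intro: L2_diff)
    have "l2norm N (\<lambda>x. h x * (F k x - f x)) \<le> l2norm N (\<lambda>x. C * (F k x - f x))"
    proof (rule l2norm_mono[OF L2_cmult[OF d]])
      show "(\<lambda>x. h x * (F k x - f x)) \<in> borel_measurable N"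
        using assms(2) L2_measurable[OF d] by measurable
      show "AE x in N. \<bar>h x * (F k x - f x)\<bar> \<le> \<bar>C * (F k x - f x)\<bar>"
      proof (rule AE_I2)
        fix x assume "x \<in> space N"
        then have "\<bar>h x\<bar> \<le> \<bar>C\<bar>" using assms(3) by fastforce
        then show "\<bar>h x * (F k x - f x)\<bar> \<le> \<bar>C * (F k x - f x)\<bar>"
          by (simp add: abs_mult mult_right_mono)
      qed
    qed
    then show ?thesis unfolding l2norm_cmult by (simp add: right_diff_distrib)
  qed
qed (use assms in \<open>auto simp: L2_tends_def intro: L2_bounded_mult\<close>)

lemma l2norm_reverse_triangle:
  assumes "f \<in> L2 N" "g \<in> L2 N"
  shows "\<bar>l2norm N f - l2norm N g\<bar> \<le> l2norm N (\<lambda>x. f x - g x)"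
  using l2norm_triangle[OF L2_diff[OF assms] assms(2)] l2norm_triangle[OF L2_diff[OF assms(2,1)] assms(1)]
    l2norm_minus_commute[of N f g] by simp

lemma L2_tends_norm:
  assumes "L2_tends N F f"
  shows "(\<lambda>k. l2norm N (F k)) \<longlonglongrightarrow> l2norm N f"
proof (rule Lim_transform2[OF tendsto_const])
  have L: "F k \<in> L2 N" "f \<in> L2 N" for k using assms by (auto simp: L2_tends_def)
  have "(\<lambda>k. l2norm N (F k) - l2norm N f) \<longlonglongrightarrow> 0"
  proof (rule tendsto_0_le)
    show "(\<lambda>k. l2norm N (\<lambda>x. F k x - f x)) \<longlonglongrightarrow> 0" using assms by (simp add: L2_tends_def)
    show "\<forall>\<^sub>F k in sequentially. norm (l2norm N (F k) - l2norm N f)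
        \<le> norm (l2norm N (\<lambda>x. F k x - f x)) * 1"
      using l2norm_reverse_triangle[OF L] by (intro always_eventually) simp
  qed
  then show "(\<lambda>k. l2norm N f - l2norm N (F k)) \<longlonglongrightarrow> 0"
    using tendsto_minus by fastforce
qed

lemma L2_tends_inner:
  assumes "L2_tends N F f" "L2_tends N G g"
  shows "(\<lambda>k. \<integral>x. F k x * G k x \<partial>N) \<longlonglongrightarrow> (\<integral>x. f x * g x \<partial>N)"
proof -
  \<comment> \<open>Polarization reduces continuity of the inner product to continuity of the
    norm.\<close>
  have pol: "(\<integral>x. u x * v x \<partial>N) = ((l2norm N (\<lambda>x. u x + v x))\<^sup>2 - (l2norm N u)\<^sup>2 - (l2norm N v)\<^sup>2) / 2"
    if "u \<in> L2 N" "v \<in> L2 N" for u v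
  proof -
    have "(l2norm N (\<lambda>x. u x + v x))\<^sup>2 = (\<integral>x. (u x)\<^sup>2 + 2 * (u x * v x) + (v x)\<^sup>2 \<partial>N)"
      by (simp add: l2norm_square power2_sum algebra_simps)
    also have "\<dots> = (l2norm N u)\<^sup>2 + 2 * (\<integral>x. u x * v x \<partial>N) + (l2norm N v)\<^sup>2"
      using that by (simp add: l2norm_square L2_integrable_mult L2_integrable_square)
    finally show ?thesis by simp
  qed
  have "(\<lambda>k. ((l2norm N (\<lambda>x. F k x + G k x))\<^sup>2 - (l2norm N (F k))\<^sup>2 - (l2norm N (G k))\<^sup>2) / 2)
     \<longlonglongrightarrow> ((l2norm N (\<lambda>x. f x + g x))\<^sup>2 - (l2norm N f)\<^sup>2 - (l2norm N g)\<^sup>2) / 2"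
    by (intro tendsto_intros L2_tends_norm assms L2_tends_add) simp
  moreover have "F k \<in> L2 N" "G k \<in> L2 N" "f \<in> L2 N" "g \<in> L2 N" for k
    using assms by (auto simp: L2_tends_def)
  ultimately show ?thesis by (simp add: pol)
qed

lemma L2_tends_inner_const:
  assumes "L2_tends N F f" "g \<in> L2 N"
  shows "(\<lambda>k. \<integral>x. F k x * g x \<partial>N) \<longlonglongrightarrow> (\<integral>x. f x * g x \<partial>N)"
  by (rule L2_tends_inner[OF assms(1) L2_tends_const[OF assms(2)]])

text \<open>\<open>F - F\<close> is the zero sequence and converges to \<open>f - g\<close>, whose
  norm is therefore 0.\<close>

lemma L2_tends_unique:
  assumes "L2_tends N F f" "L2_tends N F g"
  shows "AE x in N. f x = g x"
proof -
  have L: "f \<in> L2 N" "g \<in> L2 N" using assms by (auto simp: L2_tends_def)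
  have "(\<lambda>k. l2norm N (\<lambda>x. F k x - F k x)) \<longlonglongrightarrow> l2norm N (\<lambda>x. f x - g x)"
    by (intro L2_tends_norm L2_tends_diff assms)
  then have "l2norm N (\<lambda>x. f x - g x) = 0"
    by (simp add: l2norm_def LIMSEQ_const_iff)
  from l2norm_eq_0_AE[OF L2_diff[OF L] this] show ?thesis by simp
qed

lemma L2_tends_cong_AE:
  assumes "L2_tends N F f" "g \<in> borel_measurable N" "AE x in N. f x = g x"
  shows "L2_tends N F g"
proof -
  have g: "g \<in> L2 N" using L2_cong_AE assms by (auto simp: L2_tends_def)
  have "l2norm N (\<lambda>x. F k x - g x) = l2norm N (\<lambda>x. F k x - f x)" for k
  proof (rule l2norm_cong_AE)
    show "AE x in N. F k x - g x = F k x - f x" using assms(3) by (auto elim: eventually_mono)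
  qed (use assms g in \<open>auto simp: L2_tends_def intro!: L2_measurable L2_diff\<close>)
  then show ?thesis using assms(1) g by (simp add: L2_tends_def)
qed

section \<open>Completeness and orthogonal projection\<close>

lemma (in finite_measure) L2_tends_AE_subseq:
  assumes "L2_tends M F f"
  shows "\<exists>r. strict_mono r \<and> (AE x in M. (\<lambda>k. F (r k) x) \<longlonglongrightarrow> f x)"
proof -
  have L: "F k \<in> L2 M" "f \<in> L2 M" for k using assms by (auto simp: L2_tends_def)
  have "(\<lambda>k. \<integral>x. norm (F k x - f x) \<partial>M) \<longlonglongrightarrow> 0"
  proof (rule tendsto_sandwich[OF _ _ tendsto_const])
    show "(\<lambda>k. sqrt (measure M (space M)) * l2norm M (\<lambda>x. F k x - f x)) \<longlonglongrightarrow> 0"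
      using assms unfolding L2_tends_def by (auto intro: tendsto_mult_right_zero)
    show "\<forall>\<^sub>F k in sequentially. (\<integral>x. norm (F k x - f x) \<partial>M)
        \<le> sqrt (measure M (space M)) * l2norm M (\<lambda>x. F k x - f x)"
      using L1_le_l2norm[OF L2_diff[OF L]] by simp
  qed simp
  then show ?thesis
    using tendsto_L1_AE_subseq[of M "\<lambda>k x. F k x - f x"] L
    by (auto simp: L2_integrable L2_diff LIM_zero_iff)
qed

text \<open>Riesz-Fischer. The limit is exhibited as the pointwise limit of one subsequence instead
  of merely being asserted to exist: for processes this hands measurability with respect to each
  \<open>F t\<close> down from the sequence to its limit.\<close>

lemma (in finite_measure) L2_complete_pointwise:
  assumes F: "\<And>k. F k \<in> L2 M"
    and C: "\<And>e. 0 < e \<Longrightarrow> \<exists>K. \<forall>j\<ge>K. \<forall>k\<ge>K. l2norm M (\<lambda>x. F j x - F k x) < e"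
  shows "\<exists>r. strict_mono r \<and> (AE x in M. convergent (\<lambda>k. F (r k) x)) \<and>
    L2_tends M F (\<lambda>x. lim (\<lambda>k. F (r k) x))"
proof -
  have [measurable]: "F k \<in> borel_measurable M" for k by (rule L2_measurable[OF F])
  \<comment> \<open>The summand 1 keeps \<open>s\<close> positive even if the space has measure 0,
    so that division by it is safe.\<close>
  define s where "s = sqrt (measure M (space M)) + 1"
  have s: "0 < s" by (simp add: s_def add_nonneg_pos)
  obtain r where r: "strict_mono r" "AE x in M. Cauchy (\<lambda>i. F (r i) x)"
  proof (rule cauchy_L1_AE_cauchy_subseq[of M F])
    show "\<And>n. integrable M (F n)" by (rule L2_integrable[OF F])
    fix e :: real assume "0 < e"
    then obtain K where K: "\<forall>j\<ge>K. \<forall>k\<ge>K. l2norm M (\<lambda>x. F j x - F k x) < e / s"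
      using C[of "e / s"] s by auto
    have "(\<integral>x. norm (F i x - F j x) \<partial>M) < e" if "K \<le> i" "K \<le> j" for i j
    proof -
      have "(\<integral>x. norm (F i x - F j x) \<partial>M) \<le> sqrt (measure M (space M)) * l2norm M (\<lambda>x. F i x - F j x)"
        using L1_le_l2norm[OF L2_diff[OF F F]] by simp
      also have "\<dots> \<le> s * l2norm M (\<lambda>x. F i x - F j x)"
        by (intro mult_right_mono) (auto simp: s_def)
      also have "\<dots> < s * (e / s)"
        using K that s by (intro mult_strict_left_mono) auto
      finally show ?thesis using s by simp
    qed
    then show "\<exists>N. \<forall>i\<ge>N. \<forall>j\<ge>N. (\<integral>x. norm (F i x - F j x) \<partial>M) < e" by blast
  qed blast
  define f where "f = (\<lambda>x. lim (\<lambda>k. F (r k) x))"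
  have f_meas [measurable]: "f \<in> borel_measurable M" unfolding f_def by measurable
  have lim: "AE x in M. (\<lambda>k. F (r k) x) \<longlonglongrightarrow> f x"
    using r(2) by eventually_elim (auto simp: f_def Cauchy_convergent_iff convergent_LIMSEQ_iff)
  \<comment> \<open>Fatou's lemma along the subsequence turns the Cauchy bound into a bound for the
    distance to \<open>f\<close>.\<close>
  have small: "(\<lambda>x. F j x - f x) \<in> L2 M \<and> l2norm M (\<lambda>x. F j x - f x) \<le> e"
    if K: "\<forall>j\<ge>K. \<forall>k\<ge>K. l2norm M (\<lambda>x. F j x - F k x) < e" and e: "0 < e" and j: "K \<le> j" for K e j
  proof -
    have "(\<integral>\<^sup>+x. ennreal ((F j x - f x)\<^sup>2) \<partial>M) = (\<integral>\<^sup>+x. liminf (\<lambda>k. ennreal ((F j x - F (r k) x)\<^sup>2)) \<partial>M)"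
    proof (rule nn_integral_cong_AE, use lim in eventually_elim)
      fix x assume "(\<lambda>k. F (r k) x) \<longlonglongrightarrow> f x"
      then have "(\<lambda>k. ennreal ((F j x - F (r k) x)\<^sup>2)) \<longlonglongrightarrow> ennreal ((F j x - f x)\<^sup>2)"
        by (intro tendsto_intros)
      then show "ennreal ((F j x - f x)\<^sup>2) = liminf (\<lambda>k. ennreal ((F j x - F (r k) x)\<^sup>2))"
        by (intro lim_imp_Liminf[symmetric]) auto
    qed
    also have "\<dots> \<le> liminf (\<lambda>k. \<integral>\<^sup>+x. ennreal ((F j x - F (r k) x)\<^sup>2) \<partial>M)"
      by (rule nn_integral_liminf) measurable
    also have "\<dots> \<le> liminf (\<lambda>k::nat. ennreal (e\<^sup>2))"
    proof (rule Liminf_mono, rule eventually_sequentiallyI[of K])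
      fix k assume "K \<le> k"
      then have "K \<le> r k" using seq_suble[OF r(1), of k] by simp
      then have "(l2norm M (\<lambda>x. F j x - F (r k) x))\<^sup>2 \<le> e\<^sup>2"
        using K j by (intro power_mono) (auto simp: less_imp_le)
      then show "(\<integral>\<^sup>+x. ennreal ((F j x - F (r k) x)\<^sup>2) \<partial>M) \<le> ennreal (e\<^sup>2)"
        using nn_integral_eq_integral[OF L2_integrable_square[OF L2_diff[OF F[of j] F[of "r k"]]]]
        by (simp add: l2norm_square ennreal_leI)
    qed
    finally have *: "(\<integral>\<^sup>+x. ennreal ((F j x - f x)\<^sup>2) \<partial>M) \<le> ennreal (e\<^sup>2)"
      by (simp add: Liminf_const)
    have int: "integrable M (\<lambda>x. (F j x - f x)\<^sup>2)"
    proof (rule integrableI_bounded)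
      show "(\<integral>\<^sup>+x. ennreal (norm ((F j x - f x)\<^sup>2)) \<partial>M) < \<infinity>"
        using order_le_less_trans[OF *] by simp
    qed measurable
    have "ennreal (\<integral>x. (F j x - f x)\<^sup>2 \<partial>M) \<le> ennreal (e\<^sup>2)"
      using * nn_integral_eq_integral[OF int] by simp
    then have "(l2norm M (\<lambda>x. F j x - f x))\<^sup>2 \<le> e\<^sup>2"
      by (simp add: l2norm_square)
    then have "l2norm M (\<lambda>x. F j x - f x) \<le> e"
      by (rule power2_le_imp_le) (use e in simp)
    moreover have "(\<lambda>x. F j x - f x) \<in> L2 M" by (rule L2_I[OF _ int]) measurable
    ultimately show ?thesis by simp
  qed
  have fL2: "f \<in> L2 M"
  proof -
    obtain K where "\<forall>j\<ge>K. \<forall>k\<ge>K. l2norm M (\<lambda>x. F j x - F k x) < 1" using C[of 1] by auto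
    from small[OF this, of K] have "(\<lambda>x. F K x - f x) \<in> L2 M" by simp
    from L2_diff[OF F[of K] this] show ?thesis by simp
  qed
  have "(\<lambda>k. l2norm M (\<lambda>x. F k x - f x)) \<longlonglongrightarrow> 0"
  proof (rule LIMSEQ_I)
    fix e :: real assume "0 < e"
    then obtain K where "\<forall>j\<ge>K. \<forall>k\<ge>K. l2norm M (\<lambda>x. F j x - F k x) < e / 2" using C[of "e/2"] by auto
    note sm = small[OF this]
    have "norm (l2norm M (\<lambda>x. F k x - f x) - 0) < e" if "K \<le> k" for k
      using sm[OF _ that] \<open>0 < e\<close> by simp
    then show "\<exists>no. \<forall>n\<ge>no. norm (l2norm M (\<lambda>x. F n x - f x) - 0) < e" by blast
  qed
  then have "L2_tends M F f" using F fL2 by (simp add: L2_tends_def)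
  moreover have "AE x in M. convergent (\<lambda>k. F (r k) x)"
    using lim by eventually_elim (auto simp: convergent_def)
  ultimately show ?thesis using r(1) unfolding f_def by blast
qed

lemma L2_tends_Cauchy:
  assumes "L2_tends N F f" "0 < e"
  shows "\<exists>K. \<forall>j\<ge>K. \<forall>k\<ge>K. l2norm N (\<lambda>x. F j x - F k x) < e"
proof -
  obtain K where K: "\<And>k. K \<le> k \<Longrightarrow> l2norm N (\<lambda>x. F k x - f x) < e / 2"
    using assms LIMSEQ_D[of "\<lambda>k. l2norm N (\<lambda>x. F k x - f x)" 0 "e/2"] by (auto simp: L2_tends_def)
  have "l2norm N (\<lambda>x. F j x - F k x) < e" if "K \<le> j" "K \<le> k" for j k
    using l2norm_triangle_via[of "F j" N f "F k"] K[OF that(1)] K[OF that(2)] assms(1)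
      l2norm_minus_commute[of N "F k" f] by (auto simp: L2_tends_def)
  then show ?thesis by blast
qed

text \<open>Orthogonal projection of \<open>f\<close> onto the closure of the subspace \<open>K\<close>.\<close>

lemma (in finite_measure) L2_projection:
  assumes K: "K \<subseteq> L2 M" "K \<noteq> {}"
    and lin: "\<And>g h c. g \<in> K \<Longrightarrow> h \<in> K \<Longrightarrow> (\<lambda>x. g x + c * h x) \<in> K"
    and f: "f \<in> L2 M"
  shows "\<exists>k p. (\<forall>j. k j \<in> K) \<and> L2_tends M k p \<and> (\<forall>g\<in>K. (\<integral>x. (f x - p x) * g x \<partial>M) = 0)"
proof -
  define D where "D = Inf ((\<lambda>g. l2norm M (\<lambda>x. f x - g x)) ` K)"
  have bdd: "bdd_below ((\<lambda>g. l2norm M (\<lambda>x. f x - g x)) ` K)"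
    by (rule bdd_belowI[of _ 0]) auto
  have Dle: "D \<le> l2norm M (\<lambda>x. f x - g x)" if "g \<in> K" for g
    unfolding D_def using that bdd by (intro cInf_lower) auto
  have D0: "0 \<le> D" unfolding D_def using K(2) by (intro cInf_greatest) auto
  have "\<exists>g\<in>K. l2norm M (\<lambda>x. f x - g x) < D + 1 / Suc j" for j
    using cInf_lessD[of "(\<lambda>g. l2norm M (\<lambda>x. f x - g x)) ` K" "D + 1 / Suc j"] K(2)
    unfolding D_def by auto
  then obtain k where k: "\<And>j. k j \<in> K" "\<And>j. l2norm M (\<lambda>x. f x - k j x) < D + 1 / Suc j"
    by metis
  have kL: "k j \<in> L2 M" for j using k(1) K(1) by auto
  \<comment> \<open>Parallelogram law with the midpoint of \<open>k i\<close> and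
    \<open>k j\<close>, whose distance from \<open>f\<close> is at least \<open>D\<close>. It makes
    the minimizing sequence Cauchy although \<open>K\<close> need not be closed.\<close>
  have par: "(l2norm M (\<lambda>x. k i x - k j x))\<^sup>2 + 4 * D\<^sup>2
      \<le> 2 * (l2norm M (\<lambda>x. f x - k i x))\<^sup>2 + 2 * (l2norm M (\<lambda>x. f x - k j x))\<^sup>2" for i j
  proof -
    \<comment> \<open>This function is the midpoint \<open>(k i + k j) / 2\<close>, in the shape
      that \<open>lin\<close> produces.\<close>
    have m: "(\<lambda>x. (k i x + 1 * k j x) + (-1/2) * (k i x + 1 * k j x)) \<in> K"
      by (intro lin k)
    have "D\<^sup>2 \<le> (l2norm M (\<lambda>x. f x - (k i x + k j x) / 2))\<^sup>2"
      using Dle[OF m] D0 by (intro power_mono) (auto simp: field_simps)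
    then have "(l2norm M (\<lambda>x. k i x - k j x))\<^sup>2 + 4 * D\<^sup>2
       \<le> (\<integral>x. (k i x - k j x)\<^sup>2 \<partial>M) + 4 * (\<integral>x. (f x - (k i x + k j x) / 2)\<^sup>2 \<partial>M)"
      by (simp add: l2norm_square)
    also have "\<dots> = (\<integral>x. (k i x - k j x)\<^sup>2 + 4 * (f x - (k i x + k j x) / 2)\<^sup>2 \<partial>M)"
    proof -
      have "(\<lambda>x. f x - (1/2) * (k i x + k j x)) \<in> L2 M"
        by (intro L2_diff L2_cmult L2_add f kL)
      then have "integrable M (\<lambda>x. (f x - (k i x + k j x) / 2)\<^sup>2)"
        using L2_integrable_square by fastforce
      then show ?thesis using L2_integrable_square[OF L2_diff[OF kL[of i] kL[of j]]] by simp
    qed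
    also have "\<dots> = (\<integral>x. 2 * (f x - k i x)\<^sup>2 + 2 * (f x - k j x)\<^sup>2 \<partial>M)"
      by (intro Bochner_Integration.integral_cong) (auto simp: power2_eq_square field_simps)
    also have "\<dots> = 2 * (l2norm M (\<lambda>x. f x - k i x))\<^sup>2 + 2 * (l2norm M (\<lambda>x. f x - k j x))\<^sup>2"
      using L2_integrable_square[OF L2_diff[OF f kL]] by (simp add: l2norm_square)
    finally show ?thesis .
  qed
  have bnd: "(l2norm M (\<lambda>x. f x - k j x))\<^sup>2 \<le> D\<^sup>2 + (2 * D + 1) * (1 / Suc j)" for j
  proof -
    have "(l2norm M (\<lambda>x. f x - k j x))\<^sup>2 \<le> (D + 1 / Suc j)\<^sup>2"
      using k(2)[of j] by (intro power_mono) auto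
    also have "\<dots> = D\<^sup>2 + (2 * D + 1 / Suc j) * (1 / Suc j)"
      by (simp add: power2_eq_square algebra_simps)
    also have "\<dots> \<le> D\<^sup>2 + (2 * D + 1) * (1 / Suc j)"
      by (intro add_left_mono mult_right_mono) auto
    finally show ?thesis .
  qed
  have Cauchy: "\<exists>J. \<forall>i\<ge>J. \<forall>j\<ge>J. l2norm M (\<lambda>x. k i x - k j x) < e" if e: "0 < e" for e
  proof -
    obtain J where J: "4 * (2 * D + 1) / e\<^sup>2 < real (Suc J)"
    proof -
      obtain m where "4 * (2 * D + 1) / e\<^sup>2 < real m" using reals_Archimedean2 by blast
      then show ?thesis using that[of m] by simp
    qed
    have "l2norm M (\<lambda>x. k i x - k j x) < e" if ij: "J \<le> i" "J \<le> j" for i j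
    proof -
      have "1 / real (Suc i) \<le> 1 / Suc J" "1 / real (Suc j) \<le> 1 / Suc J"
        using ij by (auto intro!: divide_left_mono)
      then have "(2 * D + 1) * (1 / Suc i) \<le> (2 * D + 1) * (1 / Suc J)"
         "(2 * D + 1) * (1 / Suc j) \<le> (2 * D + 1) * (1 / Suc J)"
        using D0 by (intro mult_left_mono; linarith)+
      then have "(l2norm M (\<lambda>x. k i x - k j x))\<^sup>2 \<le> 4 * ((2 * D + 1) * (1 / Suc J))"
        using par[of i j] bnd[of i] bnd[of j] by argo
      also have "\<dots> < e\<^sup>2" using J e by (simp add: field_simps del: of_nat_Suc)
      finally show ?thesis using e by (simp add: power2_less_imp_less)
    qed
    then show ?thesis by blast
  qed
  obtain p where p: "L2_tends M k p"
    using L2_complete_pointwise[OF kL Cauchy] by blast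
  have pL: "p \<in> L2 M" using p by (simp add: L2_tends_def)
  have fp: "l2norm M (\<lambda>x. f x - p x) \<le> D"
  proof (rule LIMSEQ_le[OF L2_tends_norm[OF L2_tends_diff[OF L2_tends_const[OF f] p]]])
    show "(\<lambda>j. D + 1 / Suc j) \<longlonglongrightarrow> D"
      using tendsto_add[OF tendsto_const LIMSEQ_inverse_real_of_nat, of D] by (simp add: inverse_eq_divide)
    show "\<exists>N. \<forall>n\<ge>N. l2norm M (\<lambda>x. f x - k n x) \<le> D + 1 / real (Suc n)"
      using k(2) less_imp_le by blast
  qed
  have "(\<integral>x. (f x - p x) * g x \<partial>M) = 0" if g: "g \<in> K" for g
  proof -
    have gL: "g \<in> L2 M" using g K by auto
    have fpL: "(\<lambda>x. f x - p x) \<in> L2 M" by (rule L2_diff[OF f pL])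
    define b where "b = (\<integral>x. (f x - p x) * g x \<partial>M)"
    define c where "c = (\<integral>x. (g x)\<^sup>2 \<partial>M)"
    have c0: "0 \<le> c" unfolding c_def by (intro integral_nonneg_AE) simp
    \<comment> \<open>Moving away from \<open>p\<close> along \<open>g\<close> cannot bring the
      distance below \<open>D\<close>, while \<open>p\<close> itself is at distance at most
      \<open>D\<close>. The remaining inequality holds for all \<open>t\<close>, so its linear
      coefficient \<open>b\<close> must vanish.\<close>
    have q: "2 * t * b \<le> t\<^sup>2 * c" for t
    proof -
      have lim: "(\<lambda>j. l2norm M (\<lambda>x. (f x - k j x) - t * g x)) \<longlonglongrightarrow> l2norm M (\<lambda>x. (f x - p x) - t * g x)"
        by (intro L2_tends_norm L2_tends_diff L2_tends_const L2_cmult gL f p)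
      have "D \<le> l2norm M (\<lambda>x. (f x - p x) - t * g x)"
      proof (rule LIMSEQ_le_const[OF lim])
        have "D \<le> l2norm M (\<lambda>x. (f x - k n x) - t * g x)" for n
          using Dle[OF lin[OF k(1)[of n] g, of t]] by (simp add: algebra_simps)
        then show "\<exists>N. \<forall>n\<ge>N. D \<le> l2norm M (\<lambda>x. (f x - k n x) - t * g x)" by blast
      qed
      then have "D\<^sup>2 \<le> (\<integral>x. ((f x - p x) - t * g x)\<^sup>2 \<partial>M)"
        using D0 by (simp flip: l2norm_square)
      also have "\<dots> = (\<integral>x. (f x - p x)\<^sup>2 - 2 * t * ((f x - p x) * g x) + t\<^sup>2 * (g x)\<^sup>2 \<partial>M)"
        by (intro Bochner_Integration.integral_cong) (auto simp: power2_eq_square algebra_simps)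
      also have "\<dots> = (l2norm M (\<lambda>x. f x - p x))\<^sup>2 - 2 * t * b + t\<^sup>2 * c"
        using L2_integrable_mult[OF fpL gL] L2_integrable_square[OF fpL] L2_integrable_square[OF gL]
        by (simp add: b_def c_def l2norm_square)
      also have "(l2norm M (\<lambda>x. f x - p x))\<^sup>2 \<le> D\<^sup>2" using fp by (intro power_mono) auto
      finally show ?thesis by simp
    qed
    have "b = 0"
    proof (cases "c = 0")
      case True
      then have "b * b \<le> 0" using q[of b] by simp
      then show ?thesis by (auto simp: mult_le_0_iff)
    next
      case False
      then have "2 * b\<^sup>2 \<le> b\<^sup>2" using q[of "b / c"] c0 by (simp add: field_simps power2_eq_square)
      then show ?thesis by simp
    qed
    then show ?thesis by (simp add: b_def)
  qed
  then show ?thesis using k(1) p by blast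
qed

section \<open>The Brownian filtration and time integrals\<close>

locale brownian_setting = prob_space M for M :: "'a measure" +
  fixes T :: real and W :: "'a process"
  assumes T_pos: "0 < T" and BM: "brownian_motion M T W"
begin

abbreviation F :: "real \<Rightarrow> 'a measure" where "F \<equiv> brownian_filtration M W"
abbreviation R :: "real measure" where "R \<equiv> restrict_space lborel {0..T}"
abbreviation P :: "(real \<times> 'a) measure" where "P \<equiv> time_scenario M T"

lemma space_R: "space R = {0..T}" by (simp add: space_restrict_space)

lemma finite_R: "finite_measure R"
  by (rule finite_measureI) (simp add: emeasure_restrict_space space_R emeasure_lborel_Icc_eq)

lemma space_P: "space P = {0..T} \<times> space M"
  by (simp add: time_scenario_def space_pair_measure space_R)

end

sublocale brownian_setting \<subseteq> R: finite_measure "restrict_space lborel {0..T}"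
  by (rule finite_R)

sublocale brownian_setting \<subseteq> RM: pair_sigma_finite "restrict_space lborel {0..T}" M ..

lemma (in brownian_setting) finite_P: "finite_measure P"
  unfolding time_scenario_def by (rule finite_measure_pair_measure) unfold_locales

sublocale brownian_setting \<subseteq> P: finite_measure "time_scenario M T"
  by (rule finite_P)

context brownian_setting
begin

lemma space_F [simp]: "space (F t) = space M"
  by (simp add: brownian_filtration_def space_measure_of_conv)

lemma generators_Pow: "past_events M W t \<union> null_sets M \<subseteq> Pow (space M)"
  using sets.space_closed by (auto simp: past_events_def null_sets_def)

lemma sets_F: "sets (F t) = sigma_sets (space M) (past_events M W t \<union> null_sets M)"
  unfolding brownian_filtration_def by (rule sets_measure_of[OF generators_Pow])

lemma W_measurable: "t \<in> {0..T} \<Longrightarrow> W t \<in> borel_measurable M"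
  using BM by (auto simp: brownian_motion_def)

lemma past_events_sets: "t \<le> T \<Longrightarrow> past_events M W t \<subseteq> sets M"
  using W_measurable by (auto simp: past_events_def intro!: measurable_sets)

lemma sets_F_subset: "t \<le> T \<Longrightarrow> sets (F t) \<subseteq> sets M"
  unfolding sets_F using past_events_sets by (intro sets.sigma_sets_subset) auto

lemma sets_F_mono: "s \<le> t \<Longrightarrow> sets (F s) \<subseteq> sets (F t)"
  unfolding sets_F
proof (rule sigma_sets_subseteq)
  assume "s \<le> t"
  then have "{0..s} \<subseteq> {0..t}" by auto
  then show "past_events M W s \<union> null_sets M \<subseteq> past_events M W t \<union> null_sets M"
    unfolding past_events_def by blast
qed

lemma measurable_F_mono: "f \<in> borel_measurable (F s) \<Longrightarrow> s \<le> t \<Longrightarrow> f \<in> borel_measurable (F t)"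
  using sets_F_mono by (auto simp: measurable_def)

lemma measurable_F_M: "f \<in> borel_measurable (F s) \<Longrightarrow> s \<le> T \<Longrightarrow> f \<in> borel_measurable M"
  using sets_F_subset by (auto simp: measurable_def)

lemma W_adapted: "0 \<le> s \<Longrightarrow> s \<le> t \<Longrightarrow> W s \<in> borel_measurable (F t)"
proof (rule measurableI)
  fix B :: "real set" assume "0 \<le> s" "s \<le> t" "B \<in> sets borel"
  then show "W s -` B \<inter> space (F t) \<in> sets (F t)"
    unfolding sets_F by (intro sigma_sets.Basic) (auto simp: past_events_def)
qed simp

lemma null_sets_F: "N \<in> null_sets M \<Longrightarrow> N \<in> sets (F t)"
  unfolding sets_F by (intro sigma_sets.Basic) auto

text \<open>This is where the augmentation pays off: the exceptional set lies in a null set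
  \<open>N\<close>, which belongs to \<open>F t\<close>. Measurability of \<open>f\<close> for
  \<open>M\<close> makes the part of its preimage inside \<open>N\<close> a null set as
  well.\<close>

lemma measurable_F_cong_AE:
  fixes f g :: "'a \<Rightarrow> real"
  assumes g: "g \<in> borel_measurable (F t)" and f: "f \<in> borel_measurable M"
    and eq: "AE \<omega> in M. f \<omega> = g \<omega>"
  shows "f \<in> borel_measurable (F t)"
proof (rule measurableI)
  fix B :: "real set" assume B: "B \<in> sets borel"
  obtain N where N: "N \<in> null_sets M" "{\<omega>\<in>space M. f \<omega> \<noteq> g \<omega>} \<subseteq> N"
    using eq by (auto simp: eventually_ae_filter)
  have Nf: "N \<in> sets (F t)" by (rule null_sets_F[OF N(1)])
  have "f -` B \<inter> space M \<inter> N \<in> null_sets M"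
    using measurable_sets[OF f B] N(1) by (intro null_set_Int1) auto
  then have fN: "f -` B \<inter> space M \<inter> N \<in> sets (F t)" by (rule null_sets_F)
  have gB: "g -` B \<inter> space (F t) \<in> sets (F t)" by (rule measurable_sets[OF g B])
  have "f -` B \<inter> space (F t) = (g -` B \<inter> space (F t) - N) \<union> (f -` B \<inter> space M \<inter> N)"
    using N(2) by auto
  then show "f -` B \<inter> space (F t) \<in> sets (F t)" using gB Nf fN by (metis sets.Diff sets.Un)
qed simp

text \<open>The increments are assumed independent of the raw past only. Up to null sets the
  augmentation adds no events, and with this \<open>increment_indep\<close> carries independence
  over to \<open>F s\<close>.\<close>

lemma sets_F_AE_past:
  assumes "t \<le> T" "A \<in> sets (F t)"
  shows "\<exists>B \<in> sigma_sets (space M) (past_events M W t). AE \<omega> in M. \<omega> \<in> A \<longleftrightarrow> \<omega> \<in> B"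
  using assms(2) unfolding sets_F
proof induction
  case (Basic a)
  then show ?case
  proof
    assume "a \<in> null_sets M"
    then have "AE \<omega> in M. \<omega> \<in> a \<longleftrightarrow> \<omega> \<in> {}" by (simp add: AE_not_in)
    then show ?thesis using sigma_sets.Empty by blast
  qed auto
next
  case Empty
  then show ?case using sigma_sets.Empty by force
next
  case (Compl a)
  then obtain B where B: "B \<in> sigma_sets (space M) (past_events M W t)" "AE \<omega> in M. \<omega> \<in> a \<longleftrightarrow> \<omega> \<in> B"
    by blast
  from B(2) have "AE \<omega> in M. \<omega> \<in> space M - a \<longleftrightarrow> \<omega> \<in> space M - B" by eventually_elim auto
  then show ?case using sigma_sets.Compl[OF B(1)] by blast
next
  case (Union a)
  then obtain B where B: "\<And>i::nat. B i \<in> sigma_sets (space M) (past_events M W t)"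
      "\<And>i. AE \<omega> in M. \<omega> \<in> a i \<longleftrightarrow> \<omega> \<in> B i"
    by metis
  have "AE \<omega> in M. \<forall>i. \<omega> \<in> a i \<longleftrightarrow> \<omega> \<in> B i" using B(2) by (simp add: AE_all_countable)
  then have "AE \<omega> in M. \<omega> \<in> (\<Union>i. a i) \<longleftrightarrow> \<omega> \<in> (\<Union>i. B i)" by eventually_elim auto
  then show ?case using sigma_sets.Union[of B, OF B(1)] by blast
qed

section \<open>Independence and moments of Brownian increments\<close>

lemma increment_distributed:
  "0 \<le> s \<Longrightarrow> s < t \<Longrightarrow> t \<le> T \<Longrightarrow>
    distributed M lborel (\<lambda>\<omega>. W t \<omega> - W s \<omega>) (normal_density 0 (sqrt (t - s)))"
  using BM by (simp add: brownian_motion_def)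

lemma increment_indep:
  fixes f :: "real \<Rightarrow> real" and g :: "'a \<Rightarrow> real"
  assumes st: "0 \<le> s" "s < t" "t \<le> T" and g: "g \<in> borel_measurable (F s)"
    and f: "f \<in> borel_measurable borel"
  shows "indep_var borel g borel (\<lambda>\<omega>. f (W t \<omega> - W s \<omega>))"
proof -
  let ?D = "\<lambda>\<omega>. W t \<omega> - W s \<omega>"
  have D[measurable]: "?D \<in> borel_measurable M" using W_measurable st by auto
  have ind: "indep_set (sigma_sets (space M) (past_events M W s))
      (sets (vimage_algebra (space M) ?D borel))"
    using BM st by (simp add: brownian_motion_def)
  have gM: "g \<in> borel_measurable M" using measurable_F_M[OF g] st by simp
  have "indep_var borel g borel ?D"
    unfolding indep_var_eq
  proof (intro conjI indep_setI)
    have s1: "sigma_sets (space M) {g -` A \<inter> space M |A. A \<in> sets borel} \<subseteq> sets (F s)"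
      using measurable_sets[OF g] sets.sigma_sets_subset[of "{g -` A \<inter> space M |A. A \<in> sets borel}" "F s"]
      by auto
    show "sigma_sets (space M) {g -` A \<inter> space M |A. A \<in> sets borel} \<subseteq> events"
      using s1 sets_F_subset[of s] st by auto
    show "sigma_sets (space M) {?D -` A \<inter> space M |A. A \<in> sets borel} \<subseteq> events"
      using measurable_sets[OF D] by (intro sets.sigma_sets_subset) auto
    fix a b assume a: "a \<in> sigma_sets (space M) {g -` A \<inter> space M |A. A \<in> sets borel}"
      and b: "b \<in> sigma_sets (space M) {?D -` A \<inter> space M |A. A \<in> sets borel}"
    have b': "b \<in> sets (vimage_algebra (space M) ?D borel)"
      using b by (simp add: sets_vimage_algebra)
    have bM: "b \<in> events"
    proof -
      have "{?D -` A \<inter> space M |A. A \<in> sets borel} \<subseteq> events" using measurable_sets[OF D] by auto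
      from sets.sigma_sets_subset[OF this] b show ?thesis by blast
    qed
    have aM: "a \<in> events" using a s1 sets_F_subset[of s] st by auto
    \<comment> \<open>The event is exchanged for one of the raw past, to which the assumed
      independence applies; no probability changes.\<close>
    obtain a' where a': "a' \<in> sigma_sets (space M) (past_events M W s)" "AE \<omega> in M. \<omega> \<in> a \<longleftrightarrow> \<omega> \<in> a'"
      using sets_F_AE_past[of s a] a s1 st by auto
    have a'M: "a' \<in> events" using a'(1) past_events_sets[of s] sets.sigma_sets_subset st by auto
    have "prob (a \<inter> b) = prob (a' \<inter> b)"
      using a'(2) aM a'M bM by (intro finite_measure_eq_AE) auto
    also have "\<dots> = prob a' * prob b" by (rule indep_setD[OF ind a'(1) b'])
    also have "prob a' = prob a" using a'(2) aM a'M by (intro finite_measure_eq_AE) auto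
    finally show "prob (a \<inter> b) = prob a * prob b" .
  qed (use gM in auto)
  from indep_var_compose[OF this, of "\<lambda>x. x" borel f borel] f show ?thesis
    by (simp add: o_def)
qed

lemma increment_expectation:
  fixes f :: "real \<Rightarrow> real" and g :: "'a \<Rightarrow> real"
  assumes st: "0 \<le> s" "s < t" "t \<le> T" and g: "g \<in> borel_measurable (F s)" "integrable M g"
    and f: "f \<in> borel_measurable borel" "integrable M (\<lambda>\<omega>. f (W t \<omega> - W s \<omega>))"
  shows "integrable M (\<lambda>\<omega>. g \<omega> * f (W t \<omega> - W s \<omega>))"
    and "expectation (\<lambda>\<omega>. g \<omega> * f (W t \<omega> - W s \<omega>)) =
      expectation g * expectation (\<lambda>\<omega>. f (W t \<omega> - W s \<omega>))"
  using indep_var_integrable[OF increment_indep[OF st g(1) f(1)] g(2) f(2)]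
    indep_var_lebesgue_integral[OF increment_indep[OF st g(1) f(1)] g(2) f(2)] by auto

text \<open>The moments of the sign and of the absolute value serve the discrete change of measure:
  the first makes its factors average to 1, the second is the source of their normalizing
  constant.\<close>

lemma increment_moments:
  assumes st: "0 \<le> s" "s < t" "t \<le> T"
  shows "integrable M (\<lambda>\<omega>. W t \<omega> - W s \<omega>)" "expectation (\<lambda>\<omega>. W t \<omega> - W s \<omega>) = 0"
    and "integrable M (\<lambda>\<omega>. (W t \<omega> - W s \<omega>)\<^sup>2)" "expectation (\<lambda>\<omega>. (W t \<omega> - W s \<omega>)\<^sup>2) = t - s"
    and "integrable M (\<lambda>\<omega>. \<bar>W t \<omega> - W s \<omega>\<bar>)"
    and "expectation (\<lambda>\<omega>. \<bar>W t \<omega> - W s \<omega>\<bar>) = sqrt (t - s) * sqrt (2 / pi)"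
    and "integrable M (\<lambda>\<omega>. sgn (W t \<omega> - W s \<omega>))" "expectation (\<lambda>\<omega>. sgn (W t \<omega> - W s \<omega>)) = 0"
proof -
  define \<sigma> where "\<sigma> = sqrt (t - s)"
  have \<sigma>: "0 < \<sigma>" using st by (simp add: \<sigma>_def)
  have \<sigma>2: "\<sigma>\<^sup>2 = t - s" using st by (simp add: \<sigma>_def)
  note D = increment_distributed[OF st, folded \<sigma>_def]
  have tr: "integrable M (\<lambda>\<omega>. f (W t \<omega> - W s \<omega>))" "expectation (\<lambda>\<omega>. f (W t \<omega> - W s \<omega>)) = e"
    if f: "f \<in> borel_measurable borel"
      and h: "has_bochner_integral lborel (\<lambda>x. normal_density 0 \<sigma> x * f x) e" for f e
  proof -
    have f': "f \<in> borel_measurable lborel" using f by simp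
    show "integrable M (\<lambda>\<omega>. f (W t \<omega> - W s \<omega>))"
      using distributed_integrable[OF D f'] integrable.intros[OF h] by simp
    show "expectation (\<lambda>\<omega>. f (W t \<omega> - W s \<omega>)) = e"
      using distributed_integral[OF D f'] has_bochner_integral_integral_eq[OF h] by simp
  qed
  have "has_bochner_integral lborel (\<lambda>x. normal_density 0 \<sigma> x * x) 0"
    using normal_moment_odd[OF \<sigma>, of 0 0] by simp
  from tr[OF _ this] show "integrable M (\<lambda>\<omega>. W t \<omega> - W s \<omega>)" "expectation (\<lambda>\<omega>. W t \<omega> - W s \<omega>) = 0"
    by auto
  have "has_bochner_integral lborel (\<lambda>x. normal_density 0 \<sigma> x * x\<^sup>2) (t - s)"
  proof -
    have "fact (2 * 1) / ((2 / \<sigma>\<^sup>2) ^ 1 * fact 1) = t - s"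
      using \<sigma> unfolding \<sigma>2 by (simp add: fact_numeral)
    then show ?thesis using normal_moment_even[OF \<sigma>, of 0 1] by (simp only: mult_1_right diff_zero)
  qed
  from tr[OF _ this] show "integrable M (\<lambda>\<omega>. (W t \<omega> - W s \<omega>)\<^sup>2)"
    "expectation (\<lambda>\<omega>. (W t \<omega> - W s \<omega>)\<^sup>2) = t - s" by auto
  have "has_bochner_integral lborel (\<lambda>x. normal_density 0 \<sigma> x * \<bar>x\<bar>) (\<sigma> * sqrt (2 / pi))"
    using normal_moment_abs_odd[OF \<sigma>, of 0 0] by simp
  from tr[OF _ this] show "integrable M (\<lambda>\<omega>. \<bar>W t \<omega> - W s \<omega>\<bar>)"
    "expectation (\<lambda>\<omega>. \<bar>W t \<omega> - W s \<omega>\<bar>) = sqrt (t - s) * sqrt (2 / pi)" by (auto simp: \<sigma>_def)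
  have sgn_meas: "(sgn :: real \<Rightarrow> real) \<in> borel_measurable borel"
    by (rule borel_measurable_sgn)
  have D_meas: "(\<lambda>\<omega>. W t \<omega> - W s \<omega>) \<in> borel_measurable M" using W_measurable st by auto
  show "integrable M (\<lambda>\<omega>. sgn (W t \<omega> - W s \<omega>))"
    using measurable_compose[OF D_meas sgn_meas] by (intro integrable_const_bound[of _ 1]) (auto simp: sgn_if)
  \<comment> \<open>Reflection at 0: the density is even and \<open>sgn\<close> is odd, so the
    integral equals its own negative.\<close>
  have "(\<integral>x. normal_density 0 \<sigma> x * sgn x \<partial>lborel) = (\<integral>x. normal_density 0 \<sigma> (- x) * sgn (- x) \<partial>lborel)"
    using lborel_integral_real_affine[of "-1" "\<lambda>x. normal_density 0 \<sigma> x * sgn x" 0] by simp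
  also have "\<dots> = - (\<integral>x. normal_density 0 \<sigma> x * sgn x \<partial>lborel)"
    by (simp add: normal_density_def sgn_minus)
  finally have "(\<integral>x. normal_density 0 \<sigma> x * sgn x \<partial>lborel) = 0" by simp
  then show "expectation (\<lambda>\<omega>. sgn (W t \<omega> - W s \<omega>)) = 0"
    using distributed_integral[OF D, of sgn] sgn_meas by simp
qed

text \<open>Independence makes the product square-integrable even for unbounded \<open>g\<close>,
  since the squares of \<open>g\<close> and of the increment are integrable separately. The case
  \<open>s = t\<close> is included so that degenerate intervals need no separate treatment
  later.\<close>

lemma increment_mult_L2:
  assumes st: "0 \<le> s" "s \<le> t" "t \<le> T" and g: "g \<in> borel_measurable (F s)" "g \<in> L2 M"
  shows "(\<lambda>\<omega>. g \<omega> * (W t \<omega> - W s \<omega>)) \<in> L2 M"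
    and "expectation (\<lambda>\<omega>. g \<omega> * (W t \<omega> - W s \<omega>)) = 0"
    and "expectation (\<lambda>\<omega>. (g \<omega> * (W t \<omega> - W s \<omega>))\<^sup>2) = (t - s) * expectation (\<lambda>\<omega>. (g \<omega>)\<^sup>2)"
proof -
  have "(\<lambda>\<omega>. g \<omega> * (W t \<omega> - W s \<omega>)) \<in> L2 M \<and> expectation (\<lambda>\<omega>. g \<omega> * (W t \<omega> - W s \<omega>)) = 0 \<and>
    expectation (\<lambda>\<omega>. (g \<omega> * (W t \<omega> - W s \<omega>))\<^sup>2) = (t - s) * expectation (\<lambda>\<omega>. (g \<omega>)\<^sup>2)"
  proof (cases "s = t")
    case True
    then show ?thesis by (simp add: L2_zero)
  next
    case False
    then have st': "0 \<le> s" "s < t" "t \<le> T" using st by auto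
    note m = increment_moments[OF st']
    have g2: "(\<lambda>\<omega>. (g \<omega>)\<^sup>2) \<in> borel_measurable (F s)" using g(1) by measurable
    note e1 = increment_expectation[OF st' g(1) L2_integrable[OF g(2)], of "\<lambda>x. x", simplified, OF m(1)]
    note e2 = increment_expectation[OF st' g2 L2_integrable_square[OF g(2)], of "\<lambda>x. x\<^sup>2", simplified, OF m(3)]
    have "(\<lambda>\<omega>. g \<omega> * (W t \<omega> - W s \<omega>)) \<in> L2 M"
      using e2(1) e1(1) by (intro L2_I) (auto simp: power_mult_distrib)
    then show ?thesis using e1(2) e2(2) m by (simp add: power_mult_distrib)
  qed
  then show "(\<lambda>\<omega>. g \<omega> * (W t \<omega> - W s \<omega>)) \<in> L2 M"
    "expectation (\<lambda>\<omega>. g \<omega> * (W t \<omega> - W s \<omega>)) = 0"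
    "expectation (\<lambda>\<omega>. (g \<omega> * (W t \<omega> - W s \<omega>))\<^sup>2) = (t - s) * expectation (\<lambda>\<omega>. (g \<omega>)\<^sup>2)" by auto
qed

subsection \<open>Processes as functions on the product space\<close>

lemma fst_P: "fst \<in> borel_measurable P"
proof -
  have "(\<lambda>x. x) \<in> measurable R borel" by (rule measurable_restrict_space1) simp
  then show ?thesis unfolding time_scenario_def
    using measurable_compose[OF measurable_fst] by fastforce
qed

lemma snd_P: "snd \<in> measurable P M"
  unfolding time_scenario_def by simp

lemma section_measurable:
  assumes "f \<in> borel_measurable P"
  shows "t \<in> {0..T} \<Longrightarrow> (\<lambda>\<omega>. f (t, \<omega>)) \<in> borel_measurable M"
    and "\<omega> \<in> space M \<Longrightarrow> (\<lambda>t. f (t, \<omega>)) \<in> borel_measurable R"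
  using measurable_compose[OF measurable_Pair1' assms[unfolded time_scenario_def]]
    measurable_compose[OF measurable_Pair2' assms[unfolded time_scenario_def]]
  by (auto simp: space_R)

text \<open>Time is the first factor of \<open>P\<close>, whereas a pathwise argument fixes the
  scenario first; the factors are swapped before sections are taken.\<close>

lemma AE_P_iff:
  assumes "AE (t, \<omega>) in P. Q t \<omega>"
  shows "AE \<omega> in M. AE t in R. Q t \<omega>"
proof -
  interpret MR: pair_sigma_finite M R ..
  have "AE x in distr (M \<Otimes>\<^sub>M R) (R \<Otimes>\<^sub>M M) (\<lambda>(x, y). (y, x)). case x of (t, \<omega>) \<Rightarrow> Q t \<omega>"
    using assms unfolding time_scenario_def RM.distr_pair_swap[symmetric] .
  then have "AE x in M \<Otimes>\<^sub>M R. case (case x of (x, y) \<Rightarrow> (y, x)) of (t, \<omega>) \<Rightarrow> Q t \<omega>"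
    by (rule AE_distrD[rotated]) (rule measurable_pair_swap')
  from MR.AE_pair[OF this] show ?thesis by simp
qed

lemma indicator_P: "A \<in> sets borel \<Longrightarrow> (\<lambda>z. indicator A (fst z) :: real) \<in> borel_measurable P"
  by (rule measurable_compose[OF fst_P]) simp

lemma lift_M_P: "g \<in> borel_measurable M \<Longrightarrow> (\<lambda>z. g (snd z)) \<in> borel_measurable P"
  by (rule measurable_compose[OF snd_P])

lemma integrable_lift_P:
  fixes g :: "'a \<Rightarrow> real"
  assumes "integrable M g"
  shows "integrable P (\<lambda>z. g (snd z))"
proof (rule integrableI_bounded)
  show "(\<lambda>z. g (snd z)) \<in> borel_measurable P" using assms by (intro lift_M_P) auto
  have "(\<integral>\<^sup>+z. ennreal (norm (g (snd z))) \<partial>P) = (\<integral>\<^sup>+t. \<integral>\<^sup>+\<omega>. ennreal (norm (g \<omega>)) \<partial>M \<partial>R)"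
    unfolding time_scenario_def using assms by (subst nn_integral_fst[symmetric]) auto
  also have "\<dots> = (\<integral>\<^sup>+\<omega>. ennreal (norm (g \<omega>)) \<partial>M) * emeasure R (space R)" by simp
  also have "\<dots> < \<infinity>"
    unfolding infinity_ennreal_def
  proof (rule ennreal_mult_less_top[THEN iffD2], intro disjI2 conjI)
    show "(\<integral>\<^sup>+\<omega>. ennreal (norm (g \<omega>)) \<partial>M) < top" using assms by (simp add: integrable_iff_bounded)
    show "emeasure R (space R) < top" using R.emeasure_finite[of "space R"] by (metis top.not_eq_extremum)
  qed
  finally show "(\<integral>\<^sup>+z. ennreal (norm (g (snd z))) \<partial>P) < \<infinity>" .
qed

lemma L2_lift_P: "g \<in> L2 M \<Longrightarrow> (\<lambda>z. g (snd z)) \<in> L2 P"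
  using integrable_lift_P[of "\<lambda>\<omega>. (g \<omega>)\<^sup>2"] by (auto simp: L2_def intro: lift_M_P)

lemma integrable_indicator_mult_P:
  fixes f :: "real \<times> 'a \<Rightarrow> real"
  assumes "integrable P f" "A \<in> sets borel"
  shows "integrable P (\<lambda>z. indicator A (fst z) * f z)"
  using assms(1) indicator_P[OF assms(2)]
  by (rule_tac Bochner_Integration.integrable_bound[of _ f]) (auto simp: indicator_def)

lemma integral_R: "(\<integral>t. f t \<partial>R) = (\<integral>t. indicator {0..T} t * f t \<partial>lborel)"
  for f :: "real \<Rightarrow> real"
  using integral_restrict_space[of "{0..T}" lborel f] by simp

lemma integral_indicator_R: "(\<integral>t. indicator A t \<partial>R) = measure lborel (A \<inter> {0..T})"
proof -
  have "(\<integral>t. indicator A t \<partial>R) = (\<integral>t. (indicator (A \<inter> {0..T}) t :: real) \<partial>lborel)"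
    unfolding integral_R by (rule Bochner_Integration.integral_cong) (auto simp: indicator_def)
  then show ?thesis by simp
qed

lemma integral_product_P:
  assumes "integrable M g" "A \<in> sets borel"
  shows "(\<integral>z. indicator A (fst z) * g (snd z) \<partial>P) = measure lborel (A \<inter> {0..T}) * expectation g"
proof -
  have "(\<integral>z. indicator A (fst z) * g (snd z) \<partial>P) = (\<integral>t. \<integral>\<omega>. indicator A t * g \<omega> \<partial>M \<partial>R)"
    using RM.integral_fst'[OF integrable_indicator_mult_P[OF integrable_lift_P[OF assms(1)] assms(2),
        unfolded time_scenario_def]] by (simp add: time_scenario_def)
  also have "\<dots> = (\<integral>t. indicator A t \<partial>R) * expectation g" by simp
  also have "(\<integral>t. indicator A t \<partial>R) = measure lborel (A \<inter> {0..T})"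
    using integral_indicator_R[of A] by simp
  finally show ?thesis .
qed

lemma energy_eq:
  assumes "case_prod v \<in> borel_measurable P"
  shows "energy M T v = (\<integral>\<^sup>+z. ennreal ((case_prod v z)\<^sup>2) \<partial>P)"
proof -
  have "energy M T v = (\<integral>\<^sup>+\<omega>. (\<integral>\<^sup>+t. ennreal ((v t \<omega>)\<^sup>2) \<partial>R) \<partial>M)"
    unfolding energy_def by (subst nn_integral_restrict_space) auto
  also have "\<dots> = (\<integral>\<^sup>+z. ennreal ((case_prod v z)\<^sup>2) \<partial>P)"
    using assms unfolding time_scenario_def
    by (subst RM.nn_integral_snd[symmetric]) auto
  finally show ?thesis .
qed

text \<open>By Tonelli the iterated integral in \<open>energy\<close> is the integral over
  \<open>P\<close>, so finite energy turns into membership in one Hilbert space of functions on time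
  and scenario.\<close>

lemma L2_adapted_iff: "v \<in> L2_adapted M T W \<longleftrightarrow> adapted M T W v \<and> case_prod v \<in> L2 P"
proof -
  have "energy M T v < \<infinity> \<longleftrightarrow> case_prod v \<in> L2 P" if "case_prod v \<in> borel_measurable P"
    using that energy_eq[OF that] by (auto simp: L2_def integrable_iff_bounded)
  then show ?thesis by (auto simp: L2_adapted_def adapted_def)
qed

lemma energy_eq_l2norm:
  assumes "case_prod v \<in> L2 P"
  shows "energy M T v = ennreal ((l2norm P (case_prod v))\<^sup>2)"
  using energy_eq[OF L2_measurable[OF assms]] nn_integral_eq_integral[OF L2_integrable_square[OF assms]]
  by (simp add: l2norm_square)

subsection \<open>Integrals over time\<close>

text \<open>Cauchy-Schwarz in time for almost every scenario, then integration over scenarios. Both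
  the length of \<open>A\<close> and the norm localized to \<open>A\<close> are kept: the former
  makes drift over short intervals small, the latter can be summed over disjoint intervals.\<close>

lemma time_integral_L2:
  assumes w: "w \<in> L2 P" and A: "A \<in> sets borel"
  shows "(\<lambda>\<omega>. \<integral>t. indicator A t * w (t, \<omega>) \<partial>R) \<in> L2 M"
    and "l2norm M (\<lambda>\<omega>. \<integral>t. indicator A t * w (t, \<omega>) \<partial>R) \<le>
      sqrt (measure lborel (A \<inter> {0..T})) * l2norm P (\<lambda>z. indicator A (fst z) * w z)"
    and "AE \<omega> in M. integrable R (\<lambda>t. w (t, \<omega>)) \<and> (\<lambda>t. w (t, \<omega>)) \<in> L2 R"
proof -
  let ?I = "\<lambda>\<omega>. \<integral>t. indicator A t * w (t, \<omega>) \<partial>R"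
  have wm [measurable]: "w \<in> borel_measurable (R \<Otimes>\<^sub>M M)"
    using L2_measurable[OF w] by (simp add: time_scenario_def)
  have AR: "(\<lambda>t. indicator A t :: real) \<in> borel_measurable R"
    using A by (intro measurable_restrict_space1) simp
  have wA: "(\<lambda>z. indicator A (fst z) * w z) \<in> L2 P"
    using indicator_P[OF A] by (intro L2_bounded_mult[OF w, of _ 1]) (auto simp: indicator_def)
  have sq: "integrable (R \<Otimes>\<^sub>M M) (\<lambda>z. (indicator A (fst z) * w z)\<^sup>2)"
    using L2_integrable_square[OF wA] by (simp add: time_scenario_def)
  have sq': "integrable (R \<Otimes>\<^sub>M M) (\<lambda>z. (w z)\<^sup>2)"
    using L2_integrable_square[OF w] by (simp add: time_scenario_def)
  have s: "AE \<omega> in M. (\<lambda>t. w (t, \<omega>)) \<in> L2 R"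
  proof -
    have "AE \<omega> in M. integrable R (\<lambda>t. (w (t, \<omega>))\<^sup>2)"
      using RM.AE_integrable_snd[of "\<lambda>t \<omega>. (w (t, \<omega>))\<^sup>2"] sq' by (simp add: split_beta')
    moreover have "\<And>\<omega>. \<omega> \<in> space M \<Longrightarrow> (\<lambda>t. w (t, \<omega>)) \<in> borel_measurable R"
      by (rule section_measurable(2)[OF L2_measurable[OF w]])
    ultimately show ?thesis by (auto simp: L2_def)
  qed
  then show "AE \<omega> in M. integrable R (\<lambda>t. w (t, \<omega>)) \<and> (\<lambda>t. w (t, \<omega>)) \<in> L2 R"
    by eventually_elim (auto intro: R.L2_integrable)
  have mI: "?I \<in> borel_measurable M"
  proof (rule R.borel_measurable_lebesgue_integral)
    have "(\<lambda>z. indicator A (fst z) * w z) \<circ> (\<lambda>(x, y). (y, x)) \<in> borel_measurable (M \<Otimes>\<^sub>M R)"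
      using L2_measurable[OF wA] unfolding time_scenario_def
      by (intro measurable_comp[OF measurable_pair_swap'])
    then show "(\<lambda>(\<omega>, t). indicator A t * w (t, \<omega>)) \<in> borel_measurable (M \<Otimes>\<^sub>M R)"
      by (simp add: o_def split_beta')
  qed
  have mA: "(\<integral>t. (indicator A t :: real)\<^sup>2 \<partial>R) = measure lborel (A \<inter> {0..T})"
  proof -
    have "(\<lambda>t. (indicator A t :: real)\<^sup>2) = indicator A" by (auto simp: indicator_def)
    then show ?thesis using integral_indicator_R[of A] by simp
  qed
  have bd: "AE \<omega> in M. (?I \<omega>)\<^sup>2 \<le> measure lborel (A \<inter> {0..T}) * (\<integral>t. (indicator A t * w (t, \<omega>))\<^sup>2 \<partial>R)"
    using s
  proof eventually_elim
    case (elim \<omega>)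
    have A2: "(\<lambda>t. indicator A t :: real) \<in> L2 R"
      by (rule R.L2_bounded[OF AR, of 1]) (auto simp: indicator_def)
    have Aw: "(\<lambda>t. indicator A t * w (t, \<omega>)) \<in> L2 R"
      by (rule L2_bounded_mult[OF elim AR, of 1]) (auto simp: indicator_def)
    \<comment> \<open>An indicator is idempotent, so each factor of Cauchy-Schwarz can receive a
      copy of it.\<close>
    have "?I \<omega> = (\<integral>t. indicator A t * (indicator A t * w (t, \<omega>)) \<partial>R)"
      by (intro Bochner_Integration.integral_cong) (auto simp: indicator_def)
    then have "\<bar>?I \<omega>\<bar> \<le> l2norm R (indicator A) * l2norm R (\<lambda>t. indicator A t * w (t, \<omega>))"
      using L2_Cauchy_Schwarz[OF A2 Aw] by simp
    then have "\<bar>?I \<omega>\<bar>\<^sup>2 \<le> (l2norm R (indicator A) * l2norm R (\<lambda>t. indicator A t * w (t, \<omega>)))\<^sup>2"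
      by (intro power_mono) auto
    then show ?case by (simp add: power_mult_distrib l2norm_square mA)
  qed
  have intR: "integrable M (\<lambda>\<omega>. \<integral>t. (indicator A t * w (t, \<omega>))\<^sup>2 \<partial>R)"
    using RM.integrable_snd[of "\<lambda>t \<omega>. (indicator A t * w (t, \<omega>))\<^sup>2"] sq by (simp add: split_beta')
  have int: "integrable M (\<lambda>\<omega>. (?I \<omega>)\<^sup>2)"
  proof (rule Bochner_Integration.integrable_bound[OF integrable_mult_right[OF intR]])
    show "AE \<omega> in M. norm ((?I \<omega>)\<^sup>2) \<le> norm (measure lborel (A \<inter> {0..T}) * (\<integral>t. (indicator A t * w (t, \<omega>))\<^sup>2 \<partial>R))"
      using bd by eventually_elim (smt (verit) real_norm_def zero_le_power2 norm_ge_zero)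
    show "(\<lambda>\<omega>. (?I \<omega>)\<^sup>2) \<in> borel_measurable M" using mI by measurable
  qed
  show "?I \<in> L2 M" using mI int by (rule L2_I)
  have "(\<integral>\<omega>. (?I \<omega>)\<^sup>2 \<partial>M) \<le> (\<integral>\<omega>. measure lborel (A \<inter> {0..T}) * (\<integral>t. (indicator A t * w (t, \<omega>))\<^sup>2 \<partial>R) \<partial>M)"
    using bd int intR by (intro integral_mono_AE) auto
  also have "\<dots> = measure lborel (A \<inter> {0..T}) * (\<integral>z. (indicator A (fst z) * w z)\<^sup>2 \<partial>P)"
    using RM.integral_snd[of "\<lambda>t \<omega>. (indicator A t * w (t, \<omega>))\<^sup>2"] sq
    by (simp add: split_beta' time_scenario_def)
  finally have "sqrt (\<integral>\<omega>. (?I \<omega>)\<^sup>2 \<partial>M) \<le> sqrt (measure lborel (A \<inter> {0..T}) * (\<integral>z. (indicator A (fst z) * w z)\<^sup>2 \<partial>P))"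
    by (rule real_sqrt_le_mono)
  then show "l2norm M ?I \<le> sqrt (measure lborel (A \<inter> {0..T})) * l2norm P (\<lambda>z. indicator A (fst z) * w z)"
    by (simp add: l2norm_def real_sqrt_mult)
qed

lemma time_integral_inner:
  assumes w: "w \<in> L2 P" and A: "A \<in> sets borel" and Z: "Z \<in> L2 M"
  shows "expectation (\<lambda>\<omega>. (\<integral>t. indicator A t * w (t, \<omega>) \<partial>R) * Z \<omega>)
      = (\<integral>z. indicator A (fst z) * (w z * Z (snd z)) \<partial>P)" (is ?th1)
    and "(\<integral>z. indicator A (fst z) * (w z * Z (snd z)) \<partial>P)
      = (\<integral>t. indicator A t * expectation (\<lambda>\<omega>. w (t, \<omega>) * Z \<omega>) \<partial>R)" (is ?th2)
proof -
  have "integrable P (\<lambda>z. w z * Z (snd z))"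
    by (rule L2_integrable_mult[OF w L2_lift_P[OF Z]])
  from integrable_indicator_mult_P[OF this A]
  have i: "integrable (R \<Otimes>\<^sub>M M) (\<lambda>(t, \<omega>). indicator A t * (w (t, \<omega>) * Z \<omega>))"
    by (simp add: time_scenario_def split_beta')
  show ?th1 using RM.integral_snd[OF i] by (simp add: time_scenario_def split_beta' mult.assoc[symmetric])
  show ?th2 using RM.integral_fst[OF i] by (simp add: time_scenario_def split_beta')
qed

definition TI :: "'a process \<Rightarrow> 'a process" where
  "TI v t \<omega> = (\<integral>s. indicator {..t} s * v s \<omega> \<partial>R)"

lemma TI_L2: "case_prod v \<in> L2 P \<Longrightarrow> TI v t \<in> L2 M"
  unfolding TI_def[abs_def] using time_integral_L2(1)[of "case_prod v" "{..t}"] by simp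

text \<open>Along a subsequence the convergence is almost sure, and \<open>F t\<close> is
  insensitive to null sets.\<close>

lemma L2_tends_measurable_F:
  assumes "L2_tends M X Y" "\<And>k. X k \<in> borel_measurable (F t)"
  shows "Y \<in> borel_measurable (F t)"
proof -
  obtain r where r: "AE \<omega> in M. (\<lambda>k. X (r k) \<omega>) \<longlonglongrightarrow> Y \<omega>"
    using L2_tends_AE_subseq[OF assms(1)] by blast
  show ?thesis
  proof (rule measurable_F_cong_AE)
    show "(\<lambda>\<omega>. lim (\<lambda>k. X (r k) \<omega>)) \<in> borel_measurable (F t)"
      using assms(2) by measurable
    show "Y \<in> borel_measurable M" using assms(1) L2_measurable by (auto simp: L2_tends_def)
    show "AE \<omega> in M. Y \<omega> = lim (\<lambda>k. X (r k) \<omega>)"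
      using r by eventually_elim (simp add: limI)
  qed
qed

text \<open>The time integral is only seen to be jointly measurable, not progressively measurable.
  Its component orthogonal to \<open>F t\<close> vanishes since it is orthogonal to each \<open>v s\<close>.\<close>

lemma TI_adapted:
  assumes v: "v \<in> L2_adapted M T W" and t: "t \<in> {0..T}"
  shows "TI v t \<in> borel_measurable (F t)"
proof -
  have vL: "case_prod v \<in> L2 P" and ad: "adapted M T W v" using v by (auto simp: L2_adapted_iff)
  let ?K = "L2 M \<inter> borel_measurable (F t)"
  have X: "TI v t \<in> L2 M" by (rule TI_L2[OF vL])
  have "\<exists>k p. (\<forall>j. k j \<in> ?K) \<and> L2_tends M k p \<and> (\<forall>g\<in>?K. (\<integral>x. (TI v t x - p x) * g x \<partial>M) = 0)"
    by (rule L2_projection[OF _ _ _ X]) (auto intro: L2_add L2_cmult L2_zero)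
  then obtain k p where k: "\<And>j. k j \<in> ?K" "L2_tends M k p"
    and orth: "\<And>g. g \<in> ?K \<Longrightarrow> (\<integral>x. (TI v t x - p x) * g x \<partial>M) = 0" by blast
  \<comment> \<open>\<open>?K\<close> is closed under mean-square limits, so the projection
    \<open>p\<close> is again measurable for \<open>F t\<close>.\<close>
  have pK: "p \<in> ?K" using L2_tends_measurable_F[OF k(2), of t] k by (auto simp: L2_tends_def)
  define Z where "Z = (\<lambda>\<omega>. TI v t \<omega> - p \<omega>)"
  have Z: "Z \<in> L2 M" unfolding Z_def using pK X by (auto intro: L2_diff)
  have "expectation (\<lambda>\<omega>. TI v t \<omega> * Z \<omega>) = (\<integral>s. indicator {..t} s * expectation (\<lambda>\<omega>. v s \<omega> * Z \<omega>) \<partial>R)"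
    unfolding TI_def using time_integral_inner[OF vL _ Z, of "{..t}"] by simp
  also have "\<dots> = (\<integral>s. 0 \<partial>R)"
  proof (rule integral_cong_AE)
    have "AE s in R. (\<lambda>\<omega>. v s \<omega>) \<in> L2 M"
    proof -
      have "AE s in R. integrable M (\<lambda>\<omega>. (v s \<omega>)\<^sup>2)"
        using RM.AE_integrable_fst[of "\<lambda>s \<omega>. (v s \<omega>)\<^sup>2"] L2_integrable_square[OF vL]
        by (simp add: time_scenario_def split_beta')
      then show ?thesis
        by (rule AE_mp) (use section_measurable(1)[OF L2_measurable[OF vL]] in
            \<open>auto simp: L2_def space_R intro!: AE_I2\<close>)
    qed
    then show "AE s in R. indicator {..t} s * expectation (\<lambda>\<omega>. v s \<omega> * Z \<omega>) = 0"
    proof (rule AE_mp, intro AE_I2 impI)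
      fix s assume s: "s \<in> space R" "(\<lambda>\<omega>. v s \<omega>) \<in> L2 M"
      show "indicator {..t} s * expectation (\<lambda>\<omega>. v s \<omega> * Z \<omega>) = 0"
      proof (cases "s \<le> t")
        case True
        \<comment> \<open>A section at a time \<open>s \<le> t\<close> is itself an element of
          \<open>?K\<close>, so the residual \<open>Z\<close> is orthogonal to it. Integrating over
          \<open>s\<close> makes \<open>Z\<close> orthogonal to \<open>TI v t\<close>, and hence to
          itself.\<close>
        have "v s \<in> ?K" using s ad True measurable_F_mono[of "v s" s t] by (auto simp: adapted_def space_R)
        from orth[OF this] show ?thesis by (simp add: Z_def mult.commute)
      qed simp
    qed
    have "(\<lambda>s. \<integral>\<omega>. (\<lambda>(s, \<omega>). indicator {..t} s * (v s \<omega> * Z \<omega>)) (s, \<omega>) \<partial>M) \<in> borel_measurable R"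
    proof (rule borel_measurable_integrable, rule RM.integrable_fst')
      show "integrable (R \<Otimes>\<^sub>M M) (\<lambda>(s, \<omega>). indicator {..t} s * (v s \<omega> * Z \<omega>))"
        using integrable_indicator_mult_P[OF L2_integrable_mult[OF vL L2_lift_P[OF Z]], of "{..t}"]
        by (simp add: time_scenario_def split_beta')
    qed
    then show "(\<lambda>s. indicator {..t} s * expectation (\<lambda>\<omega>. v s \<omega> * Z \<omega>)) \<in> borel_measurable R"
      by simp
  qed simp
  finally have 1: "expectation (\<lambda>\<omega>. TI v t \<omega> * Z \<omega>) = 0" by simp
  have 2: "expectation (\<lambda>\<omega>. p \<omega> * Z \<omega>) = 0" using orth[OF pK] by (simp add: Z_def mult.commute)
  have "(l2norm M Z)\<^sup>2 = expectation (\<lambda>\<omega>. TI v t \<omega> * Z \<omega> - p \<omega> * Z \<omega>)"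
    unfolding l2norm_square
    by (intro Bochner_Integration.integral_cong) (auto simp: Z_def power2_eq_square algebra_simps)
  also have "\<dots> = 0" using 1 2 pK Z X by (simp add: L2_integrable_mult)
  finally have "AE \<omega> in M. Z \<omega> = 0" using l2norm_eq_0_AE[OF Z] by simp
  then have "AE \<omega> in M. TI v t \<omega> = p \<omega>" by (simp add: Z_def)
  with pK L2_measurable[OF X] show ?thesis by (auto intro: measurable_F_cong_AE)
qed

end

section \<open>Integrals of step processes\<close>

text \<open>A block \<open>(a, b, h)\<close> stands for the process \<open>h 1\<^bsub>(a,b]\<^esub>\<close>. Sums of arbitrary, possibly overlapping
  blocks form a vector space without any refinement of partitions.\<close>

context brownian_setting
begin

definition valid_block :: "real \<times> real \<times> ('a \<Rightarrow> real) \<Rightarrow> bool" where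
  "valid_block = (\<lambda>(a, b, h). 0 \<le> a \<and> a \<le> b \<and> b \<le> T \<and> h \<in> borel_measurable (F a) \<and>
    (\<exists>C. \<forall>\<omega>\<in>space M. \<bar>h \<omega>\<bar> \<le> C))"

definition valid :: "(real \<times> real \<times> ('a \<Rightarrow> real)) list \<Rightarrow> bool" where
  "valid L \<longleftrightarrow> (\<forall>B\<in>set L. valid_block B)"

definition bp :: "(real \<times> real \<times> ('a \<Rightarrow> real)) list \<Rightarrow> 'a process" where
  "bp L t \<omega> = (\<Sum>(a, b, h)\<leftarrow>L. h \<omega> * indicator {a<..b} t)"

definition wi :: "(real \<times> real \<times> ('a \<Rightarrow> real)) list \<Rightarrow> 'a process" where
  "wi L t \<omega> = (\<Sum>(a, b, h)\<leftarrow>L. h \<omega> * (W (min t b) \<omega> - W (min t a) \<omega>))"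

lemma valid_simps [simp]:
  "valid []" "valid (B # L) \<longleftrightarrow> valid_block B \<and> valid L" "valid (L @ L') \<longleftrightarrow> valid L \<and> valid L'"
  by (auto simp: valid_def)

lemma bp_simps [simp]:
  "bp [] t \<omega> = 0" "bp ((a, b, h) # L) t \<omega> = h \<omega> * indicator {a<..b} t + bp L t \<omega>"
  "bp (L @ L') t \<omega> = bp L t \<omega> + bp L' t \<omega>"
  by (auto simp: bp_def)

lemma wi_simps [simp]:
  "wi [] t \<omega> = 0"
  "wi ((a, b, h) # L) t \<omega> = h \<omega> * (W (min t b) \<omega> - W (min t a) \<omega>) + wi L t \<omega>"
  "wi (L @ L') t \<omega> = wi L t \<omega> + wi L' t \<omega>"
  by (auto simp: wi_def)

lemma bounded_F_L2:
  fixes g :: "'a \<Rightarrow> real"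
  assumes "g \<in> borel_measurable (F s)" "s \<le> T" "\<forall>\<omega>\<in>space M. \<bar>g \<omega>\<bar> \<le> C"
  shows "g \<in> L2 M"
  using assms measurable_F_M[OF assms(1,2)] by (intro L2_bounded[of _ C]) (auto intro: AE_I2)

lemma increment_L2: "0 \<le> s \<Longrightarrow> s \<le> t \<Longrightarrow> t \<le> T \<Longrightarrow> (\<lambda>\<omega>. W t \<omega> - W s \<omega>) \<in> L2 M"
  using increment_mult_L2(1)[of s t "\<lambda>_. 1"] by (simp add: L2_const)

lemma increment_square_expectation:
  fixes g :: "'a \<Rightarrow> real"
  assumes st: "0 \<le> s" "s \<le> t" "t \<le> T" and g: "g \<in> borel_measurable (F s)" "g \<in> L2 M"
  shows "expectation (\<lambda>\<omega>. g \<omega> * (W t \<omega> - W s \<omega>)\<^sup>2) = (t - s) * expectation g"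
proof (cases "s = t")
  case False
  then have st': "0 \<le> s" "s < t" "t \<le> T" using st by auto
  from increment_expectation(2)[OF st' g(1) L2_integrable[OF g(2)], of "\<lambda>x. x\<^sup>2"] increment_moments[OF st']
  show ?thesis by simp
qed simp

text \<open>\<open>W c - W a\<close> is split at \<open>b\<close>. The part after \<open>b\<close>
  has mean 0 against everything known at \<open>b\<close>, which leaves the square of the common
  increment.\<close>

lemma increment_product_expectation:
  fixes g :: "'a \<Rightarrow> real"
  assumes st: "0 \<le> a" "a \<le> b" "b \<le> c" "c \<le> T" and g: "g \<in> borel_measurable (F a)"
    and C: "\<forall>\<omega>\<in>space M. \<bar>g \<omega>\<bar> \<le> C"
  shows "expectation (\<lambda>\<omega>. g \<omega> * ((W b \<omega> - W a \<omega>) * (W c \<omega> - W a \<omega>))) = (b - a) * expectation g"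
proof -
  have gL: "g \<in> L2 M" using bounded_F_L2[OF g _ C] st by simp
  have gM: "g \<in> borel_measurable M" by (rule L2_measurable[OF gL])
  have gb: "g \<in> borel_measurable (F b)" using measurable_F_mono[OF g st(2)] .
  have gW: "(\<lambda>\<omega>. g \<omega> * (W b \<omega> - W a \<omega>)) \<in> L2 M"
    using increment_L2[of a b] C st by (intro L2_bounded_mult[OF _ gM, of _ C]) auto
  have gWF: "(\<lambda>\<omega>. g \<omega> * (W b \<omega> - W a \<omega>)) \<in> borel_measurable (F b)"
    using gb W_adapted[of b b] W_adapted[of a b] st by auto
  have i1: "integrable M (\<lambda>\<omega>. g \<omega> * (W b \<omega> - W a \<omega>) * (W b \<omega> - W a \<omega>))"
    and i2: "integrable M (\<lambda>\<omega>. g \<omega> * (W b \<omega> - W a \<omega>) * (W c \<omega> - W b \<omega>))"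
    using L2_integrable_mult[OF gW] increment_L2 st by auto
  have "expectation (\<lambda>\<omega>. g \<omega> * ((W b \<omega> - W a \<omega>) * (W c \<omega> - W a \<omega>)))
    = expectation (\<lambda>\<omega>. g \<omega> * (W b \<omega> - W a \<omega>) * (W b \<omega> - W a \<omega>)
      + g \<omega> * (W b \<omega> - W a \<omega>) * (W c \<omega> - W b \<omega>))"
    by (intro Bochner_Integration.integral_cong) (auto simp: algebra_simps)
  also have "\<dots> = expectation (\<lambda>\<omega>. g \<omega> * (W b \<omega> - W a \<omega>)\<^sup>2)"
    using i1 i2 increment_mult_L2(2)[OF _ _ _ gWF gW, of c] st by (simp add: power2_eq_square mult.assoc)
  also have "\<dots> = (b - a) * expectation g"
    using st by (intro increment_square_expectation g gL) auto
  finally show ?thesis .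
qed

text \<open>The first block is cut at time \<open>a'\<close>, where the second begins. What precedes
  the cut is known at \<open>a'\<close> and hence orthogonal to the second block; what follows
  starts together with it. The expression with \<open>max 0\<close> is the length of the
  overlap.\<close>

lemma block_inner_ordered:
  assumes B: "valid_block (a, b, h)" "valid_block (a', b', h')" and aa: "a \<le> a'"
  shows "expectation (\<lambda>\<omega>. (h \<omega> * (W b \<omega> - W a \<omega>)) * (h' \<omega> * (W b' \<omega> - W a' \<omega>)))
    = max 0 (min b b' - max a a') * expectation (\<lambda>\<omega>. h \<omega> * h' \<omega>)"
proof -
  obtain C C' where C: "\<forall>\<omega>\<in>space M. \<bar>h \<omega>\<bar> \<le> C" "\<forall>\<omega>\<in>space M. \<bar>h' \<omega>\<bar> \<le> C'"
    using B by (auto simp: valid_block_def)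
  have o: "0 \<le> a" "a \<le> b" "b \<le> T" "0 \<le> a'" "a' \<le> b'" "b' \<le> T"
    and h: "h \<in> borel_measurable (F a)" "h' \<in> borel_measurable (F a')"
    using B by (auto simp: valid_block_def)
  have ha: "h \<in> borel_measurable (F a')" by (rule measurable_F_mono[OF h(1) aa])
  define g where "g = (\<lambda>\<omega>. h \<omega> * h' \<omega>)"
  have gF: "g \<in> borel_measurable (F a')" unfolding g_def using ha h(2) by measurable
  have gC: "\<forall>\<omega>\<in>space M. \<bar>g \<omega>\<bar> \<le> C * C'"
    using C by (auto simp: g_def abs_mult intro!: mult_mono)
  have gM: "g \<in> borel_measurable M" using measurable_F_M[OF gF] o by simp
  define c where "c = min b a'"
  have c: "a \<le> c" "c \<le> a'" "c \<le> b" "c \<le> T" "0 \<le> c" using o aa by (auto simp: c_def)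
  have gc: "(\<lambda>\<omega>. g \<omega> * (W c \<omega> - W a \<omega>)) \<in> L2 M"
    using increment_L2[of a c] gC c o by (intro L2_bounded_mult[OF _ gM, of _ "C * C'"]) auto
  have gcF: "(\<lambda>\<omega>. g \<omega> * (W c \<omega> - W a \<omega>)) \<in> borel_measurable (F a')"
    using gF W_adapted[of c a'] W_adapted[of a a'] c o by auto
  have zero: "expectation (\<lambda>\<omega>. g \<omega> * (W c \<omega> - W a \<omega>) * (W b' \<omega> - W a' \<omega>)) = 0"
    by (rule increment_mult_L2(2)[OF _ _ _ gcF gc]) (use o in auto)
  have i1: "integrable M (\<lambda>\<omega>. g \<omega> * (W c \<omega> - W a \<omega>) * (W b' \<omega> - W a' \<omega>))"
    using L2_integrable_mult[OF gc] increment_L2 o by auto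
  show ?thesis
  proof (cases "b \<le> a'")
    case True
    then have "c = b" by (simp add: c_def)
    then show ?thesis using zero True o by (simp add: g_def mult_ac)
  next
    case False
    then have ca: "c = a'" by (simp add: c_def)
    have gb: "(\<lambda>\<omega>. g \<omega> * (W b \<omega> - W a' \<omega>)) \<in> L2 M"
      using increment_L2[of a' b] gC False o by (intro L2_bounded_mult[OF _ gM, of _ "C * C'"]) auto
    have i2: "integrable M (\<lambda>\<omega>. g \<omega> * ((W b \<omega> - W a' \<omega>) * (W b' \<omega> - W a' \<omega>)))"
      using L2_integrable_mult[OF gb increment_L2[of a' b']] o by (simp add: mult.assoc)
    have "expectation (\<lambda>\<omega>. (h \<omega> * (W b \<omega> - W a \<omega>)) * (h' \<omega> * (W b' \<omega> - W a' \<omega>)))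
      = expectation (\<lambda>\<omega>. g \<omega> * (W c \<omega> - W a \<omega>) * (W b' \<omega> - W a' \<omega>)
          + g \<omega> * ((W b \<omega> - W a' \<omega>) * (W b' \<omega> - W a' \<omega>)))"
      unfolding ca by (intro Bochner_Integration.integral_cong) (auto simp: g_def algebra_simps)
    also have "\<dots> = expectation (\<lambda>\<omega>. g \<omega> * ((W b \<omega> - W a' \<omega>) * (W b' \<omega> - W a' \<omega>)))"
      using i1 i2 zero by simp
    also have "\<dots> = (min b b' - a') * expectation g"
    proof (cases "b \<le> b'")
      case True
      then show ?thesis using increment_product_expectation[OF _ _ True _ gF gC] o False by simp
    next
      case F: False
      then show ?thesis using increment_product_expectation[of a' b' b, OF _ _ _ _ gF gC] o False
        by (simp add: mult.commute)
    qed
    finally show ?thesis using aa False o by (simp add: g_def)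
  qed
qed

lemma block_inner:
  assumes B: "valid_block (a, b, h)" "valid_block (a', b', h')"
  shows "expectation (\<lambda>\<omega>. (h \<omega> * (W b \<omega> - W a \<omega>)) * (h' \<omega> * (W b' \<omega> - W a' \<omega>)))
    = max 0 (min b b' - max a a') * expectation (\<lambda>\<omega>. h \<omega> * h' \<omega>)"
proof (cases "a \<le> a'")
  case True
  then show ?thesis by (rule block_inner_ordered[OF B])
next
  case False
  then have "a' \<le> a" by simp
  from block_inner_ordered[OF B(2,1) this] show ?thesis
    by (simp add: mult.commute min.commute max.commute)
qed

text \<open>Stopping at \<open>t\<close> shortens a block that has begun. A block that has not begun
  must vanish altogether and cannot be shortened to a valid one, because its coefficient is known
  only at time \<open>a\<close>.\<close>

lemma block_stop:
  assumes B: "valid_block (a, b, h)" and t: "t \<in> {0..T}"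
  shows "t \<le> a \<Longrightarrow> h \<omega> * (W (min t b) \<omega> - W (min t a) \<omega>) = 0"
    and "a < t \<Longrightarrow> valid_block (a, min t b, h)" and "a < t \<Longrightarrow> min t a = a"
  using assms by (auto simp: valid_block_def)

lemma measure_block_inter:
  assumes "valid_block (a, b, h)" "valid_block (a', b', h')" "t \<in> {0..T}"
  shows "measure lborel ({a<..b} \<inter> {a'<..b'} \<inter> {..t} \<inter> {0..T}) = max 0 (min (min b b') t - max a a')"
proof -
  have "{a<..b} \<inter> {a'<..b'} \<inter> {..t} \<inter> {0..T} = {max a a'<..min (min b b') t}"
    using assms by (auto simp: valid_block_def)
  moreover have "measure lborel {l<..u} = max 0 (u - l)" for l u :: real
    by (cases "l \<le> u") auto
  ultimately show ?thesis by simp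
qed

lemma block_wi_measurable:
  assumes B: "valid_block (a, b, h)" and t: "t \<in> {0..T}"
  shows "(\<lambda>\<omega>. h \<omega> * (W (min t b) \<omega> - W (min t a) \<omega>)) \<in> borel_measurable (F t)"
proof (cases "t \<le> a")
  case True
  show ?thesis unfolding block_stop(1)[OF B t True] by simp
next
  case False
  have o: "0 \<le> a" "a \<le> b" "b \<le> T" and h: "h \<in> borel_measurable (F a)"
    using B by (auto simp: valid_block_def)
  have "h \<in> borel_measurable (F t)" using measurable_F_mono[OF h] False by simp
  then show ?thesis using W_adapted[of "min t b" t] W_adapted[of "min t a" t] o t by auto
qed

lemma block_wi_L2:
  assumes B: "valid_block (a, b, h)" and t: "t \<in> {0..T}"
  shows "(\<lambda>\<omega>. h \<omega> * (W (min t b) \<omega> - W (min t a) \<omega>)) \<in> L2 M"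
proof -
  have o: "0 \<le> a" "a \<le> b" "b \<le> T" and h: "h \<in> borel_measurable (F a)"
    using B by (auto simp: valid_block_def)
  obtain C where C: "\<forall>\<omega>\<in>space M. \<bar>h \<omega>\<bar> \<le> C" using B by (auto simp: valid_block_def)
  have "h \<in> borel_measurable M" using measurable_F_M[OF h] o by simp
  then show ?thesis using C o t by (intro L2_bounded_mult[of _ _ _ C] increment_L2) auto
qed

lemma block_bp_L2:
  assumes B: "valid_block (a, b, h)"
  shows "(\<lambda>z. h (snd z) * indicator {a<..b} (fst z)) \<in> L2 P"
proof -
  have o: "0 \<le> a" "a \<le> b" "b \<le> T" and h: "h \<in> borel_measurable (F a)"
    using B by (auto simp: valid_block_def)
  obtain C where C: "\<forall>\<omega>\<in>space M. \<bar>h \<omega>\<bar> \<le> C" using B by (auto simp: valid_block_def)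
  have hM: "h \<in> borel_measurable M" using measurable_F_M[OF h] o by simp
  have "\<bar>h (snd z) * indicator {a<..b} (fst z)\<bar> \<le> C" if "z \<in> space P" for z
  proof -
    have "\<bar>h (snd z)\<bar> \<le> C" using C that by (auto simp: space_P)
    then show ?thesis using abs_ge_zero[of "h (snd z)"] by (auto simp: indicator_def simp del: abs_ge_zero)
  qed
  then show ?thesis
    using lift_M_P[OF hM] indicator_P[of "{a<..b}"] by (intro P.L2_bounded[of _ C] AE_I2) auto
qed

lemma wi_measurable: "valid L \<Longrightarrow> t \<in> {0..T} \<Longrightarrow> wi L t \<in> borel_measurable (F t)"
proof (induction L)
  case (Cons B L)
  obtain a b h where B: "B = (a, b, h)" by (cases B)
  show ?case using Cons block_wi_measurable[of a b h t] unfolding B by (simp add: wi_simps[abs_def])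
qed (simp add: wi_simps[abs_def])

lemma wi_L2: "valid L \<Longrightarrow> t \<in> {0..T} \<Longrightarrow> wi L t \<in> L2 M"
proof (induction L)
  case (Cons B L)
  obtain a b h where B: "B = (a, b, h)" by (cases B)
  show ?case using Cons L2_add[OF block_wi_L2[of a b h t]] unfolding B by (simp add: wi_simps[abs_def])
qed (simp add: wi_simps[abs_def] L2_zero)

lemma case_prod_bp_Cons: "case_prod (bp ((a, b, h) # L)) =
    (\<lambda>z. h (snd z) * indicator {a<..b} (fst z) + case_prod (bp L) z)"
  by (auto simp: split_beta')

lemma case_prod_bp_Nil: "case_prod (bp []) = (\<lambda>z. 0)"
  by (auto simp: split_beta')

lemma bp_L2: "valid L \<Longrightarrow> case_prod (bp L) \<in> L2 P"
proof (induction L)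
  case (Cons B L)
  obtain a b h where B: "B = (a, b, h)" by (cases B)
  show ?case using Cons L2_add[OF block_bp_L2[of a b h]] unfolding B case_prod_bp_Cons by simp
qed (simp add: L2_zero case_prod_bp_Nil)

lemma bp_adapted: "valid L \<Longrightarrow> adapted M T W (bp L)"
proof -
  assume L: "valid L"
  have "bp L t \<in> borel_measurable (F t)" if t: "t \<in> {0..T}" for t
    using L
  proof (induction L)
    case (Cons B L)
    obtain a b h where B: "B = (a, b, h)" by (cases B)
    have "(\<lambda>\<omega>. h \<omega> * indicator {a<..b} t) \<in> borel_measurable (F t)"
    proof (cases "t \<le> a")
      case False
      then have "h \<in> borel_measurable (F t)"
      proof -
        have "h \<in> borel_measurable (F a)" using Cons(2) by (simp add: B valid_block_def)
        then show ?thesis by (rule measurable_F_mono) (use False in simp)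
      qed
      then show ?thesis by measurable
    qed simp
    moreover have "bp L t \<in> borel_measurable (F t)" using Cons by simp
    ultimately have "(\<lambda>\<omega>. h \<omega> * indicator {a<..b} t + bp L t \<omega>) \<in> borel_measurable (F t)"
      by (rule borel_measurable_add)
    then show ?case unfolding B bp_simps(2)[abs_def] .
  qed (simp add: bp_simps[abs_def])
  then show ?thesis using L2_measurable[OF bp_L2[OF L]] by (simp add: adapted_def)
qed

lemma bp_L2_adapted: "valid L \<Longrightarrow> bp L \<in> L2_adapted M T W"
  by (simp add: L2_adapted_iff bp_L2 bp_adapted)

lemma block_isometry:
  assumes B: "valid_block (a, b, h)" "valid_block (a', b', h')" and t: "t \<in> {0..T}"
  shows "expectation (\<lambda>\<omega>. (h \<omega> * (W (min t b) \<omega> - W (min t a) \<omega>)) * (h' \<omega> * (W (min t b') \<omega> - W (min t a') \<omega>)))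
    = (\<integral>z. indicator {..t} (fst z) * ((h (snd z) * indicator {a<..b} (fst z)) * (h' (snd z) * indicator {a'<..b'} (fst z))) \<partial>P)"
    (is "?l = ?r")
proof -
  have hL: "h \<in> L2 M" "h' \<in> L2 M"
    using B bounded_F_L2[of h a] bounded_F_L2[of h' a'] by (auto simp: valid_block_def)
  have "?r = (\<integral>z. indicator ({a<..b} \<inter> {a'<..b'} \<inter> {..t}) (fst z) * (h (snd z) * h' (snd z)) \<partial>P)"
    unfolding indicator_inter_arith by (simp only: mult_ac)
  also have "\<dots> = measure lborel ({a<..b} \<inter> {a'<..b'} \<inter> {..t} \<inter> {0..T}) * expectation (\<lambda>\<omega>. h \<omega> * h' \<omega>)"
    by (rule integral_product_P[OF L2_integrable_mult[OF hL]]) simp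
  also have "\<dots> = max 0 (min (min b b') t - max a a') * expectation (\<lambda>\<omega>. h \<omega> * h' \<omega>)"
    unfolding measure_block_inter[OF B t] ..
  finally have r: "?r = max 0 (min (min b b') t - max a a') * expectation (\<lambda>\<omega>. h \<omega> * h' \<omega>)" .
  consider "t \<le> a" | "t \<le> a'" | "a < t" "a' < t" by linarith
  then show ?thesis
  proof cases
    case 1
    then have "max 0 (min (min b b') t - max a a') = 0" by linarith
    then show ?thesis unfolding r block_stop(1)[OF B(1) t 1] by simp
  next
    case 2
    then have "max 0 (min (min b b') t - max a a') = 0" by linarith
    then show ?thesis unfolding r block_stop(1)[OF B(2) t 2] by simp
  next
    case 3
    have "?l = max 0 (min (min t b) (min t b') - max a a') * expectation (\<lambda>\<omega>. h \<omega> * h' \<omega>)"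
      unfolding block_stop(3)[OF B(1) t 3(1)] block_stop(3)[OF B(2) t 3(2)]
      by (rule block_inner[OF block_stop(2)[OF B(1) t 3(1)] block_stop(2)[OF B(2) t 3(2)]])
    also have "min (min t b) (min t b') = min (min b b') t" by auto
    finally show ?thesis unfolding r .
  qed
qed

lemma L2_indicator_P: "f \<in> L2 P \<Longrightarrow> A \<in> sets borel \<Longrightarrow> (\<lambda>z. indicator A (fst z) * f z) \<in> L2 P"
  using indicator_P[of A] by (intro L2_bounded_mult[of _ _ _ 1]) (auto simp: indicator_def)

text \<open>Both sides are bilinear, so an outer induction on \<open>L\<close> and an inner one on
  \<open>L'\<close> reduce the identity to two single blocks. Overlaps are harmless since
  \<open>block_isometry\<close> covers every relative position.\<close>

lemma wi_isometry:
  assumes "valid L" "valid L'" and t: "t \<in> {0..T}"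
  shows "expectation (\<lambda>\<omega>. wi L t \<omega> * wi L' t \<omega>)
    = (\<integral>z. indicator {..t} (fst z) * (case_prod (bp L) z * case_prod (bp L') z) \<partial>P)"
  using assms(1)
proof (induction L)
  case (Cons B L)
  obtain a b h where B: "B = (a, b, h)" by (cases B)
  have vB: "valid_block (a, b, h)" and vL: "valid L" using Cons.prems by (auto simp: B)
  let ?b = "\<lambda>\<omega>. h \<omega> * (W (min t b) \<omega> - W (min t a) \<omega>)"
  let ?p = "\<lambda>z. h (snd z) * indicator {a<..b} (fst z)"
  have single: "expectation (\<lambda>\<omega>. ?b \<omega> * wi L' t \<omega>)
    = (\<integral>z. indicator {..t} (fst z) * (?p z * case_prod (bp L') z) \<partial>P)"
    using assms(2)
  proof (induction L')
    case (Cons B' L')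
    obtain a' b' h' where B': "B' = (a', b', h')" by (cases B')
    have vB': "valid_block (a', b', h')" and vL': "valid L'" using Cons.prems by (auto simp: B')
    let ?b' = "\<lambda>\<omega>. h' \<omega> * (W (min t b') \<omega> - W (min t a') \<omega>)"
    let ?p' = "\<lambda>z. h' (snd z) * indicator {a'<..b'} (fst z)"
    have "expectation (\<lambda>\<omega>. ?b \<omega> * wi (B' # L') t \<omega>)
      = expectation (\<lambda>\<omega>. ?b \<omega> * ?b' \<omega> + ?b \<omega> * wi L' t \<omega>)"
      by (simp add: B' distrib_left)
    also have "\<dots> = expectation (\<lambda>\<omega>. ?b \<omega> * ?b' \<omega>) + expectation (\<lambda>\<omega>. ?b \<omega> * wi L' t \<omega>)"
      by (intro Bochner_Integration.integral_add L2_integrable_mult block_wi_L2 wi_L2 vB vB' vL' t)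
    also have "\<dots> = (\<integral>z. indicator {..t} (fst z) * (?p z * ?p' z) \<partial>P)
       + (\<integral>z. indicator {..t} (fst z) * (?p z * case_prod (bp L') z) \<partial>P)"
      using block_isometry[OF vB vB' t] Cons.IH[OF vL'] by simp
    also have "\<dots> = (\<integral>z. indicator {..t} (fst z) * (?p z * ?p' z)
       + indicator {..t} (fst z) * (?p z * case_prod (bp L') z) \<partial>P)"
      by (intro Bochner_Integration.integral_add[symmetric] integrable_indicator_mult_P
          L2_integrable_mult block_bp_L2 bp_L2 vB vB' vL') auto
    also have "\<dots> = (\<integral>z. indicator {..t} (fst z) * (?p z * case_prod (bp (B' # L')) z) \<partial>P)"
      unfolding B' case_prod_bp_Cons by (simp add: distrib_left)
    finally show ?case .
  qed (simp add: case_prod_bp_Nil)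
  have "expectation (\<lambda>\<omega>. wi (B # L) t \<omega> * wi L' t \<omega>)
    = expectation (\<lambda>\<omega>. ?b \<omega> * wi L' t \<omega> + wi L t \<omega> * wi L' t \<omega>)"
    by (simp add: B distrib_right)
  also have "\<dots> = expectation (\<lambda>\<omega>. ?b \<omega> * wi L' t \<omega>) + expectation (\<lambda>\<omega>. wi L t \<omega> * wi L' t \<omega>)"
    by (intro Bochner_Integration.integral_add L2_integrable_mult block_wi_L2 wi_L2 vB vL t assms)
  also have "\<dots> = (\<integral>z. indicator {..t} (fst z) * (?p z * case_prod (bp L') z) \<partial>P)
     + (\<integral>z. indicator {..t} (fst z) * (case_prod (bp L) z * case_prod (bp L') z) \<partial>P)"
    using single Cons.IH[OF vL] by simp
  also have "\<dots> = (\<integral>z. indicator {..t} (fst z) * (?p z * case_prod (bp L') z)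
     + indicator {..t} (fst z) * (case_prod (bp L) z * case_prod (bp L') z) \<partial>P)"
    by (intro Bochner_Integration.integral_add[symmetric] integrable_indicator_mult_P
        L2_integrable_mult block_bp_L2 bp_L2 vB vL assms) auto
  also have "\<dots> = (\<integral>z. indicator {..t} (fst z) * (case_prod (bp (B # L)) z * case_prod (bp L') z) \<partial>P)"
    unfolding B case_prod_bp_Cons by (simp add: distrib_left distrib_right)
  finally show ?case .
qed (simp add: case_prod_bp_Nil)

lemma l2norm_wi:
  assumes "valid L" "t \<in> {0..T}"
  shows "l2norm M (wi L t) = l2norm P (\<lambda>z. indicator {..t} (fst z) * case_prod (bp L) z)"
proof -
  have "(l2norm M (wi L t))\<^sup>2 = (\<integral>z. indicator {..t} (fst z) * (case_prod (bp L) z * case_prod (bp L) z) \<partial>P)"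
    using wi_isometry[OF assms(1,1,2)] unfolding l2norm_square unfolding power2_eq_square .
  also have "\<dots> = (l2norm P (\<lambda>z. indicator {..t} (fst z) * case_prod (bp L) z))\<^sup>2"
    unfolding l2norm_square
    by (intro Bochner_Integration.integral_cong) (auto simp: indicator_def power2_eq_square)
  finally show ?thesis by simp
qed

lemma l2norm_indicator_P_le:
  assumes "f \<in> L2 P" "A \<in> sets borel"
  shows "l2norm P (\<lambda>z. indicator A (fst z) * f z) \<le> l2norm P f"
  by (rule l2norm_mono[OF assms(1) L2_measurable[OF L2_indicator_P[OF assms]]])
    (auto simp: indicator_def)

lemma l2norm_wi_le: "valid L \<Longrightarrow> t \<in> {0..T} \<Longrightarrow> l2norm M (wi L t) \<le> l2norm P (case_prod (bp L))"
  unfolding l2norm_wi by (rule l2norm_indicator_P_le) (auto intro: bp_L2)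

lemma wi_martingale:
  assumes "valid L" and st: "0 \<le> s" "s \<le> t" "t \<le> T" and g: "g \<in> borel_measurable (F s)" "g \<in> L2 M"
  shows "expectation (\<lambda>\<omega>. (wi L t \<omega> - wi L s \<omega>) * g \<omega>) = 0"
  using assms(1)
proof (induction L)
  case (Cons B L)
  obtain a b h where B: "B = (a, b, h)" by (cases B)
  have vB: "valid_block (a, b, h)" and vL: "valid L" using Cons.prems by (auto simp: B)
  have o: "0 \<le> a" "a \<le> b" "b \<le> T" and h: "h \<in> borel_measurable (F a)"
    using vB by (auto simp: valid_block_def)
  obtain C where C: "\<forall>\<omega>\<in>space M. \<bar>h \<omega>\<bar> \<le> C" using vB by (auto simp: valid_block_def)
  have hM: "h \<in> borel_measurable M" using measurable_F_M[OF h] o by simp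
  let ?b = "\<lambda>t \<omega>. h \<omega> * (W (min t b) \<omega> - W (min t a) \<omega>)"
  have tT: "t \<in> {0..T}" "s \<in> {0..T}" using st by auto
  \<comment> \<open>Only the part of the block after both \<open>a\<close> and \<open>s\<close>
    contributes to the increment from \<open>s\<close> to \<open>t\<close>, and from there on
    \<open>h * g\<close> is known.\<close>
  define e where "e = max a s"
  have hg: "(\<lambda>\<omega>. h \<omega> * g \<omega>) \<in> L2 M" using C by (intro L2_bounded_mult[OF g(2) hM]) auto
  have hgF: "(\<lambda>\<omega>. h \<omega> * g \<omega>) \<in> borel_measurable (F e)"
    using measurable_F_mono[OF h, of e] measurable_F_mono[OF g(1), of e] by (auto simp: e_def)
  have eq: "(?b t \<omega> - ?b s \<omega>) * g \<omega> = (h \<omega> * g \<omega>) * (W (max e (min t b)) \<omega> - W e \<omega>)" for \<omega>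
  proof (cases "t \<le> a")
    case True
    then show ?thesis using st o by (cases "s = a") (auto simp: e_def min_def max_def)
  next
    case F: False
    show ?thesis
    proof (cases "s \<le> a")
      case True
      then show ?thesis using F o by (simp add: e_def min_def max_def algebra_simps)
    next
      case F2: False
      then show ?thesis
        using F o st by (cases "s \<le> b") (auto simp: e_def min_def max_def algebra_simps)
    qed
  qed
  have z: "expectation (\<lambda>\<omega>. (?b t \<omega> - ?b s \<omega>) * g \<omega>) = 0"
    unfolding eq by (rule increment_mult_L2(2)[OF _ _ _ hgF hg]) (use o st in \<open>auto simp: e_def\<close>)
  have "expectation (\<lambda>\<omega>. (wi (B # L) t \<omega> - wi (B # L) s \<omega>) * g \<omega>)
    = expectation (\<lambda>\<omega>. (?b t \<omega> - ?b s \<omega>) * g \<omega> + (wi L t \<omega> - wi L s \<omega>) * g \<omega>)"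
    by (intro Bochner_Integration.integral_cong) (auto simp: B algebra_simps)
  also have "\<dots> = expectation (\<lambda>\<omega>. (?b t \<omega> - ?b s \<omega>) * g \<omega>) + expectation (\<lambda>\<omega>. (wi L t \<omega> - wi L s \<omega>) * g \<omega>)"
    by (intro Bochner_Integration.integral_add L2_integrable_mult L2_diff block_wi_L2 wi_L2 vB vL g tT)
  finally show ?case using z Cons.IH[OF vL] by simp
qed simp

subsection \<open>Operations on block lists\<close>

definition scale_blocks :: "real \<Rightarrow> (real \<times> real \<times> ('a \<Rightarrow> real)) list \<Rightarrow> (real \<times> real \<times> ('a \<Rightarrow> real)) list" where
  "scale_blocks c L = map (\<lambda>(a, b, h). (a, b, \<lambda>\<omega>. c * h \<omega>)) L"

lemma scale_blocks:
  shows "bp (scale_blocks c L) t \<omega> = c * bp L t \<omega>" "wi (scale_blocks c L) t \<omega> = c * wi L t \<omega>"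
  by (induction L) (auto simp: scale_blocks_def algebra_simps)

lemma valid_scale_blocks:
  assumes "valid L" shows "valid (scale_blocks c L)"
proof -
  have "valid_block (a, b, \<lambda>\<omega>. c * h \<omega>)" if B: "valid_block (a, b, h)" for a b h
  proof -
    obtain C where C: "\<forall>\<omega>\<in>space M. \<bar>h \<omega>\<bar> \<le> C" using B unfolding valid_block_def by blast
    have "\<forall>\<omega>\<in>space M. \<bar>c * h \<omega>\<bar> \<le> \<bar>c\<bar> * C" using C by (auto simp: abs_mult intro: mult_left_mono)
    then show ?thesis using B by (auto simp: valid_block_def)
  qed
  then show ?thesis using assms by (auto simp: valid_def scale_blocks_def)
qed

text \<open>Blocks for the process multiplied by \<open>g\<close> on \<open>(a, b]\<close>. The
  outer \<open>max\<close> turns an empty intersection with \<open>(c, d]\<close> into a degenerate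
  block, so the endpoints stay ordered.\<close>

definition localize_blocks :: "real \<Rightarrow> real \<Rightarrow> ('a \<Rightarrow> real) \<Rightarrow> (real \<times> real \<times> ('a \<Rightarrow> real)) list \<Rightarrow>
    (real \<times> real \<times> ('a \<Rightarrow> real)) list" where
  "localize_blocks a b g L =
    map (\<lambda>(c, d, h). (max a c, max (max a c) (min b d), \<lambda>\<omega>. g \<omega> * h \<omega>)) L"

lemma bp_localize_blocks:
  "bp (localize_blocks a b g L) t \<omega> = g \<omega> * indicator {a<..b} t * bp L t \<omega>"
  by (induction L) (auto simp: localize_blocks_def algebra_simps indicator_def)

lemma wi_localize_blocks:
  assumes "valid L" "a \<le> b"
  shows "wi (localize_blocks a b g L) t \<omega> = g \<omega> * (wi L (min t b) \<omega> - wi L (min t a) \<omega>)"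
  using assms(1)
proof (induction L)
  case (Cons B L)
  obtain c d h where B: "B = (c, d, h)" by (cases B)
  have cd: "c \<le> d" using Cons.prems by (auto simp: B valid_block_def)
  have "W (min t (max (max a c) (min b d))) \<omega> - W (min t (max a c)) \<omega>
     = W (min (min t b) d) \<omega> - W (min (min t b) c) \<omega> - (W (min (min t a) d) \<omega> - W (min (min t a) c) \<omega>)"
    using cd assms(2) by (smt (verit) max_def min_def)
  then have "g \<omega> * h \<omega> * (W (min t (max (max a c) (min b d))) \<omega> - W (min t (max a c)) \<omega>)
     = g \<omega> * h \<omega> * (W (min (min t b) d) \<omega> - W (min (min t b) c) \<omega>
        - (W (min (min t a) d) \<omega> - W (min (min t a) c) \<omega>))"
    by simp
  moreover have "wi (localize_blocks a b g L) t \<omega> = g \<omega> * (wi L (min t b) \<omega> - wi L (min t a) \<omega>)"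
    using Cons by simp
  moreover have "localize_blocks a b g (B # L) = (max a c, max (max a c) (min b d), \<lambda>\<omega>. g \<omega> * h \<omega>) # localize_blocks a b g L"
    by (simp add: localize_blocks_def B)
  ultimately show ?case unfolding B by (simp only: wi_simps) (simp only: algebra_simps)
qed (simp add: localize_blocks_def)

lemma valid_localize_blocks:
  assumes "valid L" "0 \<le> a" "a \<le> b" "b \<le> T" "g \<in> borel_measurable (F a)" "\<forall>\<omega>\<in>space M. \<bar>g \<omega>\<bar> \<le> C"
  shows "valid (localize_blocks a b g L)"
proof -
  have "valid_block (max a c, max (max a c) (min b d), \<lambda>\<omega>. g \<omega> * h \<omega>)" if B: "valid_block (c, d, h)" for c d h
  proof -
    obtain D where D: "\<forall>\<omega>\<in>space M. \<bar>h \<omega>\<bar> \<le> D" using B by (auto simp: valid_block_def)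
    have "\<forall>\<omega>\<in>space M. \<bar>g \<omega> * h \<omega>\<bar> \<le> C * D"
    proof
      fix \<omega> assume "\<omega> \<in> space M"
      then have "\<bar>g \<omega>\<bar> \<le> C" "\<bar>h \<omega>\<bar> \<le> D" using D assms(6) by auto
      then show "\<bar>g \<omega> * h \<omega>\<bar> \<le> C * D" unfolding abs_mult by (intro mult_mono) linarith+
    qed
    moreover have "(\<lambda>\<omega>. g \<omega> * h \<omega>) \<in> borel_measurable (F (max a c))"
    proof -
      have h: "h \<in> borel_measurable (F c)" using B by (simp add: valid_block_def)
      show ?thesis
        by (intro borel_measurable_times measurable_F_mono[OF assms(5)] measurable_F_mono[OF h]) simp_all
    qed
    moreover have "0 \<le> c" "c \<le> d" "d \<le> T" using B by (simp_all add: valid_block_def)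
    ultimately show ?thesis using assms(2-4) unfolding valid_block_def
      by (intro case_prodI conjI exI[of _ "C * D"]) auto
  qed
  then show ?thesis using assms(1) by (auto simp: valid_def localize_blocks_def)
qed

definition partition_blocks :: "nat \<Rightarrow> (nat \<Rightarrow> real) \<Rightarrow> (nat \<Rightarrow> 'a \<Rightarrow> real) \<Rightarrow> (real \<times> real \<times> ('a \<Rightarrow> real)) list" where
  "partition_blocks m \<tau> h = map (\<lambda>j. (\<tau> j, \<tau> (Suc j), h j)) [0..<m]"

lemma partition_blocks:
  "bp (partition_blocks m \<tau> h) t \<omega> = elementary_process m \<tau> h t \<omega>"
  "wi (partition_blocks m \<tau> h) t \<omega> = elementary_integral W m \<tau> h t \<omega>"
  by (simp_all add: partition_blocks_def bp_def wi_def elementary_process_def elementary_integral_def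
      o_def interv_sum_list_conv_sum_set_nat atLeast0LessThan)

lemma valid_partition_blocks: "elementary M T W m \<tau> h \<Longrightarrow> valid (partition_blocks m \<tau> h)"
  by (auto simp: elementary_def valid_def partition_blocks_def valid_block_def Suc_le_eq)

end

section \<open>Density of dyadic step processes\<close>

lemma integrable_indicator_lborel:
  fixes f :: "real \<Rightarrow> real"
  assumes "integrable lborel f" "A \<in> sets borel"
  shows "integrable lborel (\<lambda>s. indicator A s * f s)"
  using integrable_mult_indicator[of A lborel f] assms by simp

text \<open>The positive and the negative part of \<open>g\<close> are densities of finite measures
  that agree on right half-lines, which generate the Borel sets; the measures coincide, and
  densities are unique almost everywhere.\<close>

lemma AE_zero_if_integrals_zero:
  fixes g :: "real \<Rightarrow> real"
  assumes g: "integrable lborel g" and z: "\<And>t. (\<integral>s. indicator {t<..} s * g s \<partial>lborel) = 0"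
  shows "AE s in lborel. g s = 0"
proof -
  have [measurable]: "g \<in> borel_measurable borel" using g by auto
  define p n where "p = (\<lambda>s. max 0 (g s))" and "n = (\<lambda>s. max 0 (- g s))"
  have pn_meas [measurable]: "p \<in> borel_measurable borel" "n \<in> borel_measurable borel"
    unfolding p_def n_def by measurable
  have pi: "integrable lborel p" and ni: "integrable lborel n"
    unfolding p_def n_def using g by auto
  have emeas: "emeasure (density lborel (\<lambda>s. ennreal (f s))) {t<..}
      = ennreal (\<integral>s. indicator {t<..} s * f s \<partial>lborel)"
    if f: "integrable lborel f" "\<And>s. 0 \<le> f s" "f \<in> borel_measurable borel" for f :: "real \<Rightarrow> real" and t
  proof -
    have fm: "(\<lambda>s. ennreal (f s)) \<in> borel_measurable lborel" using f(3) by measurable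
    have fi: "integrable lborel (\<lambda>s. indicator {t<..} s * f s)"
      by (rule integrable_indicator_lborel[OF f(1)]) simp
    have "emeasure (density lborel (\<lambda>s. ennreal (f s))) {t<..}
      = (\<integral>\<^sup>+s. ennreal (f s) * indicator {t<..} s \<partial>lborel)"
      by (rule emeasure_density[OF fm]) simp
    also have "\<dots> = (\<integral>\<^sup>+s. ennreal (indicator {t<..} s * f s) \<partial>lborel)"
      by (intro nn_integral_cong) (auto simp: indicator_def)
    also have "\<dots> = ennreal (\<integral>s. indicator {t<..} s * f s \<partial>lborel)"
      by (rule nn_integral_eq_integral[OF fi]) (auto simp: f(2))
    finally show ?thesis .
  qed
  have pe: "emeasure (density lborel (\<lambda>s. ennreal (p s))) {t<..} = ennreal (\<integral>s. indicator {t<..} s * p s \<partial>lborel)"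
    and ne: "emeasure (density lborel (\<lambda>s. ennreal (n s))) {t<..} = ennreal (\<integral>s. indicator {t<..} s * n s \<partial>lborel)" for t
    using emeas[OF pi _ pn_meas(1)] emeas[OF ni _ pn_meas(2)] by (auto simp: p_def n_def)
  have eq: "(\<integral>s. indicator {t<..} s * p s \<partial>lborel) = (\<integral>s. indicator {t<..} s * n s \<partial>lborel)" for t
  proof -
    have i: "integrable lborel (\<lambda>s. indicator {t<..} s * p s)" "integrable lborel (\<lambda>s. indicator {t<..} s * n s)"
      by (rule integrable_indicator_lborel[OF pi] integrable_indicator_lborel[OF ni], simp)+
    have "0 = (\<integral>s. indicator {t<..} s * p s - indicator {t<..} s * n s \<partial>lborel)"
      unfolding z[of t, symmetric]
      by (intro Bochner_Integration.integral_cong) (auto simp: p_def n_def max_def)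
    then show ?thesis using i by simp
  qed
  have "density lborel (\<lambda>s. ennreal (p s)) = density lborel (\<lambda>s. ennreal (n s))"
  proof (rule measure_eqI_lessThan)
    show "emeasure (density lborel (\<lambda>s. ennreal (p s))) {t<..} < \<infinity>" for t
      unfolding pe by simp
    show "emeasure (density lborel (\<lambda>s. ennreal (p s))) {t<..} = emeasure (density lborel (\<lambda>s. ennreal (n s))) {t<..}" for t
      unfolding pe ne eq ..
  qed auto
  then have "AE s in lborel. ennreal (p s) = ennreal (n s)"
    by (subst (asm) sigma_finite_measure.density_unique_iff[OF sigma_finite_lborel]) auto
  then show ?thesis
    by eventually_elim (auto simp: p_def n_def max_def split: if_splits)
qed

context brownian_setting
begin

section \<open>Dyadic grids and step processes along them\<close>

definition grid :: "nat \<Rightarrow> nat \<Rightarrow> real" where "grid k j = T * real j / 2 ^ k"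

abbreviation elem :: "nat \<Rightarrow> (nat \<Rightarrow> 'a \<Rightarrow> real) \<Rightarrow> bool" where
  "elem k h \<equiv> elementary M T W (2 ^ k) (grid k) h"

abbreviation ep :: "nat \<Rightarrow> (nat \<Rightarrow> 'a \<Rightarrow> real) \<Rightarrow> 'a process" where
  "ep k h \<equiv> elementary_process (2 ^ k) (grid k) h"

lemma grid_mono: "i \<le> j \<Longrightarrow> grid k i \<le> grid k j"
  using T_pos by (simp add: grid_def divide_right_mono mult_left_mono)

lemma grid_0 [simp]: "grid k 0 = 0" by (simp add: grid_def)
lemma grid_top [simp]: "grid k (2 ^ k) = T" by (simp add: grid_def)

lemma grid_in: "j \<le> 2 ^ k \<Longrightarrow> grid k j \<in> {0..T}"
  using grid_mono[of 0 j k] grid_mono[of j "2 ^ k" k] by simp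

lemma grid_step: "grid k (Suc j) - grid k j = T / 2 ^ k"
  by (simp add: grid_def field_simps)

lemma grid_refine: "grid (Suc k) (2 * j) = grid k j"
  by (simp add: grid_def)

text \<open>For \<open>t\<close> in \<open>[0, T]\<close> this is the least index whose grid point
  is not before \<open>t\<close>. Rounding up matches the cells of step processes, which are open on
  the left and closed on the right.\<close>

definition gidx :: "nat \<Rightarrow> real \<Rightarrow> nat" where "gidx k t = nat \<lceil>t * 2 ^ k / T\<rceil>"

lemma gidx_le: "t \<in> {0..T} \<Longrightarrow> gidx k t \<le> 2 ^ k"
proof -
  assume t: "t \<in> {0..T}"
  have "t * 2 ^ k / T \<le> of_int (2 ^ k)" using t T_pos by (simp add: field_simps)
  then have "\<lceil>t * 2 ^ k / T\<rceil> \<le> 2 ^ k" by (simp only: ceiling_le_iff)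
  then show ?thesis by (simp add: gidx_def nat_le_iff)
qed

lemma grid_gidx:
  assumes t: "t \<in> {0..T}"
  shows "t \<le> grid k (gidx k t)" "grid k (gidx k t) \<le> t + T / 2 ^ k"
proof -
  have n0: "0 \<le> t * 2 ^ k / T" using t T_pos by simp
  have c: "t * 2 ^ k / T \<le> real (gidx k t)" unfolding gidx_def by (rule of_nat_ceiling)
  have c2: "real (gidx k t) \<le> t * 2 ^ k / T + 1"
    using n0 by (simp add: of_nat_nat gidx_def)
  show "t \<le> grid k (gidx k t)" using c T_pos by (simp add: grid_def field_simps)
  have "grid k (gidx k t) \<le> T * (t * 2 ^ k / T + 1) / 2 ^ k"
    unfolding grid_def using c2 T_pos by (intro divide_right_mono mult_left_mono) auto
  also have "\<dots> = t + T / 2 ^ k" using T_pos by (simp add: field_simps)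
  finally show "grid k (gidx k t) \<le> t + T / 2 ^ k" .
qed

lemma grid_gidx_tendsto:
  assumes t: "t \<in> {0..T}"
  shows "(\<lambda>k. grid k (gidx k t)) \<longlonglongrightarrow> t"
proof -
  have "(\<lambda>k. (1 / 2 :: real) ^ k) \<longlonglongrightarrow> 0" by (rule LIMSEQ_power_zero) (simp add: real_norm_def)
  then have "(\<lambda>k. t + T * (1 / 2) ^ k) \<longlonglongrightarrow> t + T * 0" by (intro tendsto_add tendsto_mult tendsto_const)
  then have lim: "(\<lambda>k. t + T * (1 / 2) ^ k) \<longlonglongrightarrow> t" by simp
  show ?thesis
    by (rule tendsto_sandwich[OF _ _ tendsto_const lim]) (use grid_gidx[OF t] in \<open>auto simp: power_divide\<close>)
qed

lemma elem_iff: "elem k h \<longleftrightarrow>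
  (\<forall>j<2^k. h j \<in> borel_measurable (F (grid k j)) \<and> (\<exists>C. \<forall>\<omega>\<in>space M. \<bar>h j \<omega>\<bar> \<le> C))"
  using grid_in grid_mono by (auto simp: elementary_def)

lemma sum_double: "(\<Sum>i<2 * n. f i) = (\<Sum>j<n. f (2 * j) + f (Suc (2 * j)))"
  for f :: "nat \<Rightarrow> real"
  by (induction n) (auto simp: algebra_simps)

text \<open>Halving the cells repeats every coefficient: \<open>j div 2\<close> is the coarse cell
  that contains the fine cell \<open>j\<close>.\<close>

lemma ep_refine: "ep (Suc k) (\<lambda>j. h (j div 2)) = ep k h"
proof (intro ext)
  fix t \<omega>
  have "ep (Suc k) (\<lambda>j. h (j div 2)) t \<omega>
    = (\<Sum>j<2^k. h j \<omega> * indicator {grid (Suc k) (2 * j)<..grid (Suc k) (Suc (2 * j))} t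
      + h j \<omega> * indicator {grid (Suc k) (Suc (2 * j))<..grid (Suc k) (2 * Suc j)} t)"
    unfolding elementary_process_def power_Suc sum_double by simp
  also have "\<dots> = ep k h t \<omega>"
    unfolding elementary_process_def
  proof (rule sum.cong[OF refl])
    fix j
    have "grid (Suc k) (2 * j) \<le> grid (Suc k) (Suc (2 * j))" "grid (Suc k) (Suc (2 * j)) \<le> grid (Suc k) (2 * Suc j)"
      by (auto intro!: grid_mono)
    then show "h j \<omega> * indicator {grid (Suc k) (2 * j)<..grid (Suc k) (Suc (2 * j))} t
      + h j \<omega> * indicator {grid (Suc k) (Suc (2 * j))<..grid (Suc k) (2 * Suc j)} t
      = h j \<omega> * indicator {grid k j<..grid k (Suc j)} t"
      unfolding grid_refine by (auto simp: indicator_def)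
  qed
  finally show "ep (Suc k) (\<lambda>j. h (j div 2)) t \<omega> = ep k h t \<omega>" .
qed

lemma elem_refine: "elem k h \<Longrightarrow> elem (Suc k) (\<lambda>j. h (j div 2))"
proof -
  assume e: "elem k h"
  have "h (j div 2) \<in> borel_measurable (F (grid (Suc k) j)) \<and> (\<exists>C. \<forall>\<omega>\<in>space M. \<bar>h (j div 2) \<omega>\<bar> \<le> C)"
    if j: "j < 2 ^ Suc k" for j
  proof -
    have "j div 2 < 2 ^ k" using j by auto
    moreover have "grid k (j div 2) \<le> grid (Suc k) j"
      using grid_mono[of "2 * (j div 2)" j "Suc k"] by (simp add: grid_refine)
    ultimately show ?thesis using e measurable_F_mono unfolding elem_iff by blast
  qed
  then show ?thesis unfolding elem_iff by blast
qed

lemma elem_refine_le: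
  assumes "elem k h" "k \<le> m" "\<And>j. j < 2 ^ k \<Longrightarrow> Q (h j)"
  shows "\<exists>h'. elem m h' \<and> ep m h' = ep k h \<and> (\<forall>j<2^m. Q (h' j))"
  using assms(2)
proof (induction m rule: dec_induct)
  case base
  then show ?case using assms by blast
next
  case (step m)
  then obtain h' where h': "elem m h'" "ep m h' = ep k h" "\<And>j. j<2^m \<Longrightarrow> Q (h' j)" by blast
  have "\<forall>j<2^Suc m. Q (h' (j div 2))" using h'(3) by auto
  then show ?case using elem_refine[OF h'(1)] ep_refine[of m h'] h'(2) by metis
qed

lemma elem_linear:
  assumes "elem k h" "elem k h'"
  shows "elem k (\<lambda>j \<omega>. h j \<omega> + c * h' j \<omega>)"
    and "ep k (\<lambda>j \<omega>. h j \<omega> + c * h' j \<omega>) t \<omega> = ep k h t \<omega> + c * ep k h' t \<omega>"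
proof -
  have "(\<lambda>\<omega>. h j \<omega> + c * h' j \<omega>) \<in> borel_measurable (F (grid k j)) \<and> (\<exists>C. \<forall>\<omega>\<in>space M. \<bar>h j \<omega> + c * h' j \<omega>\<bar> \<le> C)"
    if j: "j < 2 ^ k" for j
  proof -
    have m: "h j \<in> borel_measurable (F (grid k j))" "h' j \<in> borel_measurable (F (grid k j))"
      using assms j by (auto simp: elem_iff)
    obtain C C' where C: "\<forall>\<omega>\<in>space M. \<bar>h j \<omega>\<bar> \<le> C" "\<forall>\<omega>\<in>space M. \<bar>h' j \<omega>\<bar> \<le> C'"
      using assms j unfolding elem_iff by blast
    have "\<bar>h j \<omega> + c * h' j \<omega>\<bar> \<le> C + \<bar>c\<bar> * C'" if "\<omega> \<in> space M" for \<omega>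
    proof -
      have "\<bar>c * h' j \<omega>\<bar> \<le> \<bar>c\<bar> * C'" using C that by (simp add: abs_mult mult_left_mono)
      then show ?thesis using C(1) that abs_triangle_ineq[of "h j \<omega>" "c * h' j \<omega>"] by fastforce
    qed
    then show ?thesis using m by auto
  qed
  then show "elem k (\<lambda>j \<omega>. h j \<omega> + c * h' j \<omega>)" unfolding elem_iff by blast
  show "ep k (\<lambda>j \<omega>. h j \<omega> + c * h' j \<omega>) t \<omega> = ep k h t \<omega> + c * ep k h' t \<omega>"
    unfolding elementary_process_def sum_distrib_left sum.distrib[symmetric]
    by (simp only: distrib_right mult.assoc)
qed

lemma bp_partition: "bp (partition_blocks m \<tau> h) = elementary_process m \<tau> h"
  "wi (partition_blocks m \<tau> h) = elementary_integral W m \<tau> h"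
  by (intro ext, simp add: partition_blocks)+

lemma ep_L2: "elem k h \<Longrightarrow> case_prod (ep k h) \<in> L2 P"
  using bp_L2[OF valid_partition_blocks] by (simp add: bp_partition)

lemma ep_L2_adapted: "elem k h \<Longrightarrow> ep k h \<in> L2_adapted M T W"
  using bp_L2_adapted[OF valid_partition_blocks] by (simp add: bp_partition)

definition clip :: "real \<Rightarrow> real \<Rightarrow> real" where "clip c x = max (- c) (min c x)"

lemma clip_measurable [measurable]: "clip c \<in> borel_measurable borel"
  unfolding clip_def by measurable

lemma clip_bound: "0 \<le> c \<Longrightarrow> \<bar>clip c x\<bar> \<le> c" "\<bar>clip c x\<bar> \<le> \<bar>x\<bar> \<or> c < 0" "\<bar>x\<bar> \<le> c \<Longrightarrow> clip c x = x"
  by (auto simp: clip_def)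

text \<open>Truncation moves a value no further from any target within the bound. The bound of
  \<open>\<rho>\<close> can thus be imposed on its step approximations without loss of
  accuracy.\<close>

lemma clip_contract: "0 \<le> c \<Longrightarrow> \<bar>y\<bar> \<le> c \<Longrightarrow> \<bar>clip c x - y\<bar> \<le> \<bar>x - y\<bar>"
  by (auto simp: clip_def)

text \<open>At each point the truncation is eventually exact, and the square of \<open>g\<close>
  dominates the squared error.\<close>

lemma L2_tends_clip:
  assumes g: "g \<in> L2 N"
  shows "L2_tends N (\<lambda>k x. clip (real k) (g x)) g"
proof -
  have gm [measurable]: "g \<in> borel_measurable N" by (rule L2_measurable[OF g])
  have L: "(\<lambda>x. clip (real k) (g x)) \<in> L2 N" for k
  proof (rule L2_dominated[OF g])
    show "(\<lambda>x. clip (real k) (g x)) \<in> borel_measurable N" by measurable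
    show "AE x in N. \<bar>clip (real k) (g x)\<bar> \<le> 1 * \<bar>g x\<bar>" using clip_bound(2)[of "real k"] by auto
  qed
  have "(\<lambda>k. \<integral>x. (clip (real k) (g x) - g x)\<^sup>2 \<partial>N) \<longlonglongrightarrow> (\<integral>x. 0 \<partial>N)"
  proof (rule integral_dominated_convergence[where w="\<lambda>x. (g x)\<^sup>2"])
    show "integrable N (\<lambda>x. (g x)\<^sup>2)" by (rule L2_integrable_square[OF g])
    show "AE x in N. (\<lambda>k. (clip (real k) (g x) - g x)\<^sup>2) \<longlonglongrightarrow> 0"
    proof (rule AE_I2)
      fix x
      obtain n :: nat where n: "\<bar>g x\<bar> \<le> real n" using real_arch_simple by blast
      have "(clip (real k) (g x) - g x)\<^sup>2 = 0" if "n \<le> k" for k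
        using n that clip_bound(3)[of "g x" "real k"] by auto
      then show "(\<lambda>k. (clip (real k) (g x) - g x)\<^sup>2) \<longlonglongrightarrow> 0"
        by (intro tendsto_eventually eventually_sequentiallyI[of n])
    qed
    show "AE x in N. norm ((clip (real k) (g x) - g x)\<^sup>2) \<le> (g x)\<^sup>2" for k
    proof (rule AE_I2)
      fix x
      have "\<bar>clip (real k) (g x) - g x\<bar> \<le> \<bar>g x\<bar>" by (auto simp: clip_def)
      then show "norm ((clip (real k) (g x) - g x)\<^sup>2) \<le> (g x)\<^sup>2" by (simp add: abs_le_square_iff)
    qed
  qed measurable
  then have "(\<lambda>k. l2norm N (\<lambda>x. clip (real k) (g x) - g x)) \<longlonglongrightarrow> 0"
    unfolding l2norm_def using tendsto_real_sqrt by fastforce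
  then show ?thesis using L g by (simp add: L2_tends_def)
qed

definition dyadic_steps :: "(real \<times> 'a \<Rightarrow> real) set" where
  "dyadic_steps = {case_prod (ep k h) |k h. elem k h}"

lemma dyadic_steps_linear:
  assumes "f \<in> dyadic_steps" "g \<in> dyadic_steps"
  shows "(\<lambda>z. f z + c * g z) \<in> dyadic_steps"
proof -
  obtain k h k' h' where f: "f = case_prod (ep k h)" "elem k h" and g: "g = case_prod (ep k' h')" "elem k' h'"
    using assms by (auto simp: dyadic_steps_def)
  define m where "m = max k k'"
  obtain h1 where h1: "elem m h1" "ep m h1 = ep k h" using elem_refine_le[OF f(2), of m "\<lambda>_. True"] by (auto simp: m_def)
  obtain h2 where h2: "elem m h2" "ep m h2 = ep k' h'" using elem_refine_le[OF g(2), of m "\<lambda>_. True"] by (auto simp: m_def)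
  have "(\<lambda>z. f z + c * g z) = case_prod (ep m (\<lambda>j \<omega>. h1 j \<omega> + c * h2 j \<omega>))"
    using f g h1 h2 elem_linear(2)[OF h1(1) h2(1)] by (auto simp: fun_eq_iff)
  then show ?thesis using elem_linear(1)[OF h1(1) h2(1)] unfolding dyadic_steps_def by blast
qed

text \<open>A square-integrable process orthogonal to all dyadic steps has time integrals that form both a
  martingale and a process of finite variation along the dyadic grids; hence they vanish.\<close>

lemma orthogonal_to_steps_zero:
  assumes u: "u \<in> L2 P" and orth: "\<And>f. f \<in> dyadic_steps \<Longrightarrow> (\<integral>z. u z * f z \<partial>P) = 0"
    and ad: "\<And>t. t \<in> {0..T} \<Longrightarrow> (\<lambda>\<omega>. \<integral>s. indicator {..t} s * u (s, \<omega>) \<partial>R) \<in> borel_measurable (F t)"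
  shows "l2norm P u = 0"
proof -
  define V where "V = (\<lambda>t \<omega>. \<integral>s. indicator {..t} s * u (s, \<omega>) \<partial>R)"
  have VL: "V t \<in> L2 M" for t unfolding V_def by (rule time_integral_L2(1)[OF u]) simp
  have VF: "V t \<in> borel_measurable (F t)" if "t \<in> {0..T}" for t unfolding V_def by (rule ad[OF that])
  have AEi: "AE \<omega> in M. integrable R (\<lambda>t. u (t, \<omega>))" using time_integral_L2(3)[OF u, of UNIV] by auto
  have diff: "AE \<omega> in M. V b \<omega> - V a \<omega> = (\<integral>s. indicator {a<..b} s * u (s, \<omega>) \<partial>R)" if ab: "a \<le> b" for a b
    using AEi
  proof eventually_elim
    case (elim \<omega>)
    have i: "integrable R (\<lambda>s. indicator A s * u (s, \<omega>))" if "A \<in> sets borel" for A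
    proof -
      have "A \<inter> space R \<in> sets R" using that by (auto simp: sets_restrict_space space_R)
      then have "integrable R (\<lambda>s. indicator (A \<inter> space R) s *\<^sub>R u (s, \<omega>))"
        by (rule integrable_mult_indicator[OF _ elim])
      then show ?thesis
        by (rule Bochner_Integration.integrable_cong[THEN iffD1, rotated -1]) (auto simp: indicator_def)
    qed
    show ?case unfolding V_def
      by (subst Bochner_Integration.integral_diff[symmetric, OF i i])
        (use ab in \<open>auto intro!: Bochner_Integration.integral_cong simp: indicator_def\<close>)
  qed
  have step_orth: "expectation (\<lambda>\<omega>. (V (grid k (Suc j)) \<omega> - V (grid k j) \<omega>) * g \<omega>) = 0"
    if j: "j < 2 ^ k" and g: "g \<in> borel_measurable (F (grid k j))" "\<forall>\<omega>\<in>space M. \<bar>g \<omega>\<bar> \<le> C" for k j g C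
  proof -
    let ?a = "grid k j" and ?b = "grid k (Suc j)"
    have gL: "g \<in> L2 M" using bounded_F_L2[OF g(1) _ g(2)] grid_in[of j k] j by simp
    have ab: "?a \<le> ?b" by (rule grid_mono) simp
    \<comment> \<open>The test function is a single cell carrying the coefficient \<open>g\<close>;
      orthogonality to it is the martingale property of \<open>V\<close> over that cell.\<close>
    define h where "h = (\<lambda>i. if i = j then g else (\<lambda>_. 0))"
    have h: "elem k h" using g unfolding elem_iff h_def by (auto intro: exI[of _ 0])
    have eph: "ep k h s \<omega> = indicator {?a<..?b} s * g \<omega>" for s \<omega>
    proof -
      have "ep k h s \<omega> = (\<Sum>i<2^k. if i = j then g \<omega> * indicator {?a<..?b} s else 0)"
        unfolding elementary_process_def h_def by (intro sum.cong) auto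
      also have "\<dots> = g \<omega> * indicator {?a<..?b} s" using j by simp
      finally show ?thesis by simp
    qed
    have "expectation (\<lambda>\<omega>. (V ?b \<omega> - V ?a \<omega>) * g \<omega>)
      = expectation (\<lambda>\<omega>. (\<integral>s. indicator {?a<..?b} s * u (s, \<omega>) \<partial>R) * g \<omega>)"
    proof (rule integral_cong_AE)
      show "AE \<omega> in M. (V ?b \<omega> - V ?a \<omega>) * g \<omega> = (\<integral>s. indicator {?a<..?b} s * u (s, \<omega>) \<partial>R) * g \<omega>"
        using diff[OF ab] by eventually_elim simp
      show "(\<lambda>\<omega>. (V ?b \<omega> - V ?a \<omega>) * g \<omega>) \<in> borel_measurable M"
        using L2_measurable[OF VL] L2_measurable[OF gL] by measurable
      show "(\<lambda>\<omega>. (\<integral>s. indicator {?a<..?b} s * u (s, \<omega>) \<partial>R) * g \<omega>) \<in> borel_measurable M"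
        using L2_measurable[OF time_integral_L2(1)[OF u, of "{?a<..?b}"]] L2_measurable[OF gL] by measurable
    qed
    also have "\<dots> = (\<integral>z. indicator {?a<..?b} (fst z) * (u z * g (snd z)) \<partial>P)"
      by (rule time_integral_inner(1)[OF u _ gL]) simp
    also have "\<dots> = (\<integral>z. u z * case_prod (ep k h) z \<partial>P)"
      by (intro Bochner_Integration.integral_cong) (auto simp: eph split_beta')
    also have "\<dots> = 0" using h by (intro orth) (auto simp: dyadic_steps_def)
    finally show ?thesis .
  qed
  \<comment> \<open>The value of \<open>V\<close> at the left grid point is not bounded, so it is
    truncated to an admissible coefficient, and the truncation is removed in the limit.\<close>
  have step_mart: "expectation (\<lambda>\<omega>. (V (grid k (Suc j)) \<omega> - V (grid k j) \<omega>) * V (grid k j) \<omega>) = 0"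
    if j: "j < 2 ^ k" for k j
  proof -
    let ?a = "grid k j" and ?b = "grid k (Suc j)"
    have aT: "?a \<in> {0..T}" using grid_in[of j k] j by simp
    have "(\<lambda>n. expectation (\<lambda>\<omega>. clip (real n) (V ?a \<omega>) * (V ?b \<omega> - V ?a \<omega>)))
       \<longlonglongrightarrow> expectation (\<lambda>\<omega>. V ?a \<omega> * (V ?b \<omega> - V ?a \<omega>))"
      by (rule L2_tends_inner_const[OF L2_tends_clip[OF VL] L2_diff[OF VL VL]])
    moreover have "expectation (\<lambda>\<omega>. clip (real n) (V ?a \<omega>) * (V ?b \<omega> - V ?a \<omega>)) = 0" for n
      using step_orth[OF j measurable_compose[OF VF[OF aT] clip_measurable], of n "real n"] clip_bound(1)[of "real n"]
      by (simp add: mult.commute)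
    ultimately show ?thesis by (simp add: LIMSEQ_const_iff mult.commute)
  qed
  \<comment> \<open>Orthogonal increments add up in mean square, and Cauchy-Schwarz bounds each by
    the mesh times its share of the energy of \<open>u\<close>. The total still carries the factor
    \<open>T / 2 ^ k\<close>.\<close>
  have bound: "(l2norm M (V (grid k j)))\<^sup>2 \<le> T / 2 ^ k * (\<integral>z. indicator {0<..grid k j} (fst z) * (u z)\<^sup>2 \<partial>P)"
    if "j \<le> 2 ^ k" for k j
    using that
  proof (induction j)
    case 0
    have "{..0} \<inter> {0..T} = {0}" using T_pos by auto
    then have "l2norm M (V 0) \<le> 0"
      using time_integral_L2(2)[OF u, of "{..0}"] by (simp add: V_def)
    then have "l2norm M (V 0) = 0" using l2norm_nonneg[of M "V 0"] by linarith
    then show ?case by simp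
  next
    case (Suc j)
    let ?a = "grid k j" and ?b = "grid k (Suc j)"
    have j: "j < 2 ^ k" using Suc.prems by simp
    have ab: "?a \<le> ?b" by (rule grid_mono) simp
    have aT: "0 \<le> ?a" "?b \<le> T" using grid_in[of j k] grid_in[of "Suc j" k] Suc.prems by auto
    have "{?a<..?b} \<inter> {0..T} = {?a<..?b}" using aT by auto
    then have me: "measure lborel ({?a<..?b} \<inter> {0..T}) = T / 2 ^ k" using grid_step[of k j] ab by simp
    have isq: "integrable P (\<lambda>z. (u z)\<^sup>2)" by (rule L2_integrable_square[OF u])
    let ?D = "\<lambda>\<omega>. V ?b \<omega> - V ?a \<omega>"
    have D: "?D \<in> L2 M" by (rule L2_diff[OF VL VL])
    have "l2norm M ?D = l2norm M (\<lambda>\<omega>. \<integral>s. indicator {?a<..?b} s * u (s, \<omega>) \<partial>R)"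
      by (rule l2norm_cong_AE[OF L2_measurable[OF D] L2_measurable[OF time_integral_L2(1)[OF u]] diff[OF ab]]) simp
    also have "\<dots> \<le> sqrt (T / 2 ^ k) * l2norm P (\<lambda>z. indicator {?a<..?b} (fst z) * u z)"
      using time_integral_L2(2)[OF u, of "{?a<..?b}"] unfolding me by simp
    finally have "(l2norm M ?D)\<^sup>2 \<le> (sqrt (T / 2 ^ k) * l2norm P (\<lambda>z. indicator {?a<..?b} (fst z) * u z))\<^sup>2"
      by (rule power_mono) simp
    also have "\<dots> = T / 2 ^ k * (\<integral>z. (indicator {?a<..?b} (fst z) * u z)\<^sup>2 \<partial>P)"
      using T_pos unfolding power_mult_distrib[of "sqrt _"] l2norm_square by simp
    also have "(\<integral>z. (indicator {?a<..?b} (fst z) * u z)\<^sup>2 \<partial>P) = (\<integral>z. indicator {?a<..?b} (fst z) * (u z)\<^sup>2 \<partial>P)"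
      by (intro Bochner_Integration.integral_cong) (auto simp: indicator_def)
    finally have Dsq: "(l2norm M ?D)\<^sup>2 \<le> T / 2 ^ k * (\<integral>z. indicator {?a<..?b} (fst z) * (u z)\<^sup>2 \<partial>P)" .
    have "(l2norm M (V ?b))\<^sup>2 = expectation (\<lambda>\<omega>. (V ?a \<omega>)\<^sup>2 + 2 * (?D \<omega> * V ?a \<omega>) + (?D \<omega>)\<^sup>2)"
      unfolding l2norm_square by (intro Bochner_Integration.integral_cong) (auto simp: power2_eq_square algebra_simps)
    also have "\<dots> = (l2norm M (V ?a))\<^sup>2 + 2 * expectation (\<lambda>\<omega>. ?D \<omega> * V ?a \<omega>) + (l2norm M ?D)\<^sup>2"
      using L2_integrable_square[OF VL[of ?a]] L2_integrable_square[OF D] L2_integrable_mult[OF D VL[of ?a]]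
      by (simp add: l2norm_square)
    also have "\<dots> = (l2norm M (V ?a))\<^sup>2 + (l2norm M ?D)\<^sup>2" using step_mart[OF j] by simp
    also have "\<dots> \<le> T / 2 ^ k * (\<integral>z. indicator {0<..?a} (fst z) * (u z)\<^sup>2 \<partial>P)
      + T / 2 ^ k * (\<integral>z. indicator {?a<..?b} (fst z) * (u z)\<^sup>2 \<partial>P)"
      using Suc.IH j Dsq by simp
    also have "\<dots> = T / 2 ^ k * (\<integral>z. indicator {0<..?a} (fst z) * (u z)\<^sup>2 + indicator {?a<..?b} (fst z) * (u z)\<^sup>2 \<partial>P)"
      using integrable_indicator_mult_P[OF isq] by (simp add: distrib_left)
    also have "(\<integral>z. indicator {0<..?a} (fst z) * (u z)\<^sup>2 + indicator {?a<..?b} (fst z) * (u z)\<^sup>2 \<partial>P)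
      = (\<integral>z. indicator {0<..?b} (fst z) * (u z)\<^sup>2 \<partial>P)"
      using ab aT by (intro Bochner_Integration.integral_cong) (auto simp: indicator_def)
    finally show ?case .
  qed
  have Vzero: "AE \<omega> in M. V (grid k j) \<omega> = 0" if j: "j \<le> 2 ^ k" for k j
  proof -
    have isq: "integrable P (\<lambda>z. (u z)\<^sup>2)" by (rule L2_integrable_square[OF u])
    \<comment> \<open>The same instant is a point of every finer grid, so the mesh in the bound may
      be sent to 0.\<close>
    have "(l2norm M (V (grid k j)))\<^sup>2 \<le> T / 2 ^ (k + n) * (l2norm P u)\<^sup>2" for n
    proof -
      have g: "grid (k + n) (2 ^ n * j) = grid k j" by (simp add: grid_def power_add)
      have "2 ^ n * j \<le> 2 ^ (k + n)" using j by (simp add: power_add)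
      from bound[OF this] have "(l2norm M (V (grid k j)))\<^sup>2
          \<le> T / 2 ^ (k + n) * (\<integral>z. indicator {0<..grid k j} (fst z) * (u z)\<^sup>2 \<partial>P)"
        by (simp only: g)
      also have "\<dots> \<le> T / 2 ^ (k + n) * (\<integral>z. (u z)\<^sup>2 \<partial>P)"
        using T_pos by (intro mult_left_mono integral_mono integrable_indicator_mult_P isq) (auto simp: indicator_def)
      finally show ?thesis by (simp add: l2norm_square)
    qed
    moreover have "(\<lambda>n. T / 2 ^ (k + n) * (l2norm P u)\<^sup>2) \<longlonglongrightarrow> 0"
    proof -
      have "(\<lambda>n. (1 / 2 :: real) ^ n) \<longlonglongrightarrow> 0" by (rule LIMSEQ_power_zero) (simp add: real_norm_def)
      then have "(\<lambda>n. (T / 2 ^ k * (l2norm P u)\<^sup>2) * (1 / 2) ^ n) \<longlonglongrightarrow> 0" by (rule tendsto_mult_right_zero)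
      then show ?thesis by (simp add: power_add power_divide mult.commute mult.left_commute)
    qed
    ultimately have "(l2norm M (V (grid k j)))\<^sup>2 \<le> 0" by (intro LIMSEQ_le_const) auto
    then have "l2norm M (V (grid k j)) = 0" by simp
    then show ?thesis by (rule l2norm_eq_0_AE[OF VL])
  qed
  have all0: "AE \<omega> in M. \<forall>k j. j \<le> 2 ^ k \<longrightarrow> V (grid k j) \<omega> = 0"
    using Vzero by (simp add: AE_all_countable)
  have "AE \<omega> in M. (\<integral>t. (u (t, \<omega>))\<^sup>2 \<partial>R) = 0"
    using all0 AEi
  proof eventually_elim
    case (elim \<omega>)
    define g where "g = (\<lambda>s. indicator {0..T} s * u (s, \<omega>))"
    have gi: "integrable lborel g"
      using elim(2) integrable_restrict_space[of "{0..T}" lborel "\<lambda>t. u (t, \<omega>)"] by (simp add: g_def)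
    have Vg: "V t \<omega> = (\<integral>s. indicator {..t} s * g s \<partial>lborel)" for t
      unfolding V_def integral_R by (intro Bochner_Integration.integral_cong) (auto simp: g_def)
    have gA: "integrable lborel (\<lambda>s. indicator A s * g s)" if "A \<in> sets borel" for A
      by (rule integrable_indicator_lborel[OF gi that])
    have z: "(\<integral>s. indicator {..t} s * g s \<partial>lborel) = 0" for t
    proof -
      consider "t < 0" | "0 \<le> t" "t \<le> T" | "T < t" by linarith
      then show ?thesis
      proof cases
        case 1
        then have "(\<lambda>s. indicator {..t} s * g s) = (\<lambda>s. 0)" by (auto simp: g_def indicator_def)
        then show ?thesis by simp
      next
        case 3
        have "(\<integral>s. indicator {..t} s * g s \<partial>lborel) = (\<integral>s. indicator {..T} s * g s \<partial>lborel)"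
          using 3 by (intro Bochner_Integration.integral_cong) (auto simp: g_def indicator_def)
        also have "\<dots> = V (grid 0 1) \<omega>" unfolding Vg by (simp add: grid_def)
        finally show ?thesis using elim(1) by simp
      next
        case 2
        \<comment> \<open>Grid points approach \<open>t\<close> from the right, so the indicators of
          \<open>{..d k}\<close> converge to that of \<open>{..t}\<close> at every point, including
          \<open>t\<close> itself.\<close>
        define d where "d = (\<lambda>k. grid k (gidx k t))"
        have d: "t \<le> d k" for k using 2 by (simp add: d_def grid_gidx)
        have \<open>d \<longlonglongrightarrow> t\<close> unfolding d_def using 2 by (intro grid_gidx_tendsto) simp
        have "(\<lambda>k. \<integral>s. indicator {..d k} s * g s \<partial>lborel) \<longlonglongrightarrow> (\<integral>s. indicator {..t} s * g s \<partial>lborel)"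
        proof (rule integral_dominated_convergence[where w="\<lambda>s. \<bar>g s\<bar>"])
          show "AE s in lborel. (\<lambda>k. indicator {..d k} s * g s) \<longlonglongrightarrow> indicator {..t} s * g s"
          proof (rule AE_I2)
            fix s
            show "(\<lambda>k. indicator {..d k} s * g s) \<longlonglongrightarrow> indicator {..t} s * g s"
            proof (cases "s \<le> t")
              case True
              then have "indicator {..d k} s = (1::real)" for k using d[of k] by (simp add: indicator_def)
              then show ?thesis using True by simp
            next
              case False
              then have "eventually (\<lambda>k. d k < s) sequentially"
                using order_tendstoD(2)[OF \<open>d \<longlonglongrightarrow> t\<close>, of s] by simp
              then have "eventually (\<lambda>k. indicator {..d k} s * g s = indicator {..t} s * g s) sequentially"
                by eventually_elim (use False in \<open>auto simp: indicator_def\<close>)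
              then show ?thesis by (rule tendsto_eventually)
            qed
          qed
          show "AE s in lborel. norm (indicator {..d k} s * g s) \<le> \<bar>g s\<bar>" for k
            by (auto simp: indicator_def)
        qed (use gi gA in auto)
        moreover have "(\<integral>s. indicator {..d k} s * g s \<partial>lborel) = 0" for k
          using elim(1) gidx_le[of t k] 2 by (simp add: Vg[symmetric] d_def)
        ultimately show ?thesis by (simp add: LIMSEQ_const_iff)
      qed
    qed
    have tot: "(\<integral>s. g s \<partial>lborel) = 0"
    proof -
      have "(\<integral>s. g s \<partial>lborel) = (\<integral>s. indicator {..T} s * g s \<partial>lborel)"
        by (intro Bochner_Integration.integral_cong) (auto simp: g_def indicator_def)
      then show ?thesis using z by simp
    qed
    have "(\<integral>s. indicator {t<..} s * g s \<partial>lborel) = 0" for t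
    proof -
      have "(\<integral>s. indicator {t<..} s * g s \<partial>lborel) = (\<integral>s. g s - indicator {..t} s * g s \<partial>lborel)"
        by (intro Bochner_Integration.integral_cong) (auto simp: indicator_def)
      also have "\<dots> = 0" using gi gA z tot by simp
      finally show ?thesis .
    qed
    from AE_zero_if_integrals_zero[OF gi this] have "AE s in lborel. g s = 0" .
    then have "(\<integral>s. (g s)\<^sup>2 \<partial>lborel) = 0"
      by (intro integral_eq_zero_AE) (auto elim: eventually_mono)
    moreover have "(\<integral>t. (u (t, \<omega>))\<^sup>2 \<partial>R) = (\<integral>s. (g s)\<^sup>2 \<partial>lborel)"
      unfolding integral_R by (intro Bochner_Integration.integral_cong) (auto simp: g_def indicator_def)
    ultimately show ?case by simp
  qed
  then have "(\<integral>\<omega>. (\<integral>t. (u (t, \<omega>))\<^sup>2 \<partial>R) \<partial>M) = 0"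
    by (intro integral_eq_zero_AE)
  moreover have "(\<integral>\<omega>. (\<integral>t. (u (t, \<omega>))\<^sup>2 \<partial>R) \<partial>M) = (\<integral>z. (u z)\<^sup>2 \<partial>P)"
    using RM.integral_snd[of "\<lambda>t \<omega>. (u (t, \<omega>))\<^sup>2"] L2_integrable_square[OF u]
    by (simp add: time_scenario_def split_beta')
  ultimately show ?thesis by (simp add: l2norm_def)
qed

lemma L2_adapted_diff:
  assumes "u \<in> L2_adapted M T W" "v \<in> L2_adapted M T W"
  shows "(\<lambda>t \<omega>. u t \<omega> + c * v t \<omega>) \<in> L2_adapted M T W"
proof -
  have e: "case_prod (\<lambda>t \<omega>. u t \<omega> + c * v t \<omega>) = (\<lambda>z. case_prod u z + c * case_prod v z)" by auto
  have "case_prod (\<lambda>t \<omega>. u t \<omega> + c * v t \<omega>) \<in> L2 P"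
    unfolding e using assms by (intro L2_add L2_cmult) (auto simp: L2_adapted_iff)
  moreover have "(\<lambda>\<omega>. u t \<omega> + c * v t \<omega>) \<in> borel_measurable (F t)" if "t \<in> {0..T}" for t
  proof -
    have "u t \<in> borel_measurable (F t)" "v t \<in> borel_measurable (F t)"
      using assms that by (auto simp: L2_adapted_iff adapted_def)
    then show ?thesis by measurable
  qed
  ultimately show ?thesis by (auto simp: L2_adapted_iff adapted_def dest: L2_measurable)
qed

text \<open>The residual of \<open>v\<close> after projection onto the closure of the dyadic steps
  is orthogonal to all steps. The projection \<open>p\<close> is a mean-square limit on the product
  space, which says nothing about its individual time slices; the time integrals of
  \<open>v - p\<close>, however, are limits of adapted ones, and that is all
  \<open>orthogonal_to_steps_zero\<close> asks for.\<close>

lemma step_density: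
  assumes v: "v \<in> L2_adapted M T W" and e: "0 < e"
  shows "\<exists>k h. elem k h \<and> l2norm P (\<lambda>z. case_prod (ep k h) z - case_prod v z) < e"
proof -
  have vL: "case_prod v \<in> L2 P" using v by (simp add: L2_adapted_iff)
  have e0: "elem 0 (\<lambda>_ _. 0)" unfolding elem_iff by auto
  have "\<exists>f p. (\<forall>j. f j \<in> dyadic_steps) \<and> L2_tends P f p
      \<and> (\<forall>g\<in>dyadic_steps. (\<integral>z. (case_prod v z - p z) * g z \<partial>P) = 0)"
  proof (rule P.L2_projection[OF _ _ _ vL])
    show "dyadic_steps \<subseteq> L2 P" by (auto simp: dyadic_steps_def intro: ep_L2)
    show "dyadic_steps \<noteq> {}" using e0 unfolding dyadic_steps_def by blast
  qed (rule dyadic_steps_linear)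
  then obtain f p where f: "\<And>j. f j \<in> dyadic_steps" "L2_tends P f p"
    and orth: "\<And>g. g \<in> dyadic_steps \<Longrightarrow> (\<integral>z. (case_prod v z - p z) * g z \<partial>P) = 0" by blast
  have pL: "p \<in> L2 P" using f(2) by (simp add: L2_tends_def)
  define u where "u = (\<lambda>z. case_prod v z - p z)"
  have u: "u \<in> L2 P" unfolding u_def by (rule L2_diff[OF vL pL])
  have "l2norm P u = 0"
  proof (rule orthogonal_to_steps_zero[OF u])
    show "(\<integral>z. u z * g z \<partial>P) = 0" if "g \<in> dyadic_steps" for g
      unfolding u_def by (rule orth[OF that])
    fix t assume t: "t \<in> {0..T}"
    let ?X = "\<lambda>j \<omega>. \<integral>s. indicator {..t} s * (case_prod v (s, \<omega>) - f j (s, \<omega>)) \<partial>R"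
    let ?Y = "\<lambda>\<omega>. \<integral>s. indicator {..t} s * u (s, \<omega>) \<partial>R"
    have fL: "f j \<in> L2 P" for j using f(1)[of j] by (auto simp: dyadic_steps_def intro: ep_L2)
    have vf: "(\<lambda>z. case_prod v z - f j z) \<in> L2 P" for j by (rule L2_diff[OF vL fL])
    have pf: "(\<lambda>z. p z - f j z) \<in> L2 P" for j by (rule L2_diff[OF pL fL])
    show "?Y \<in> borel_measurable (F t)"
    proof (rule L2_tends_measurable_F)
      show "?X j \<in> borel_measurable (F t)" for j
      proof -
        obtain k h where kh: "f j = case_prod (ep k h)" "elem k h" using f(1)[of j] by (auto simp: dyadic_steps_def)
        from TI_adapted[OF L2_adapted_diff[OF v ep_L2_adapted[OF kh(2)], of "-1"] t]
        show ?thesis by (simp add: TI_def[abs_def] kh(1))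
      qed
      show "L2_tends M ?X ?Y"
      proof (rule L2_tends_I)
        show "?X j \<in> L2 M" for j using time_integral_L2(1)[OF vf, of "{..t}"] by simp
        show "?Y \<in> L2 M" using time_integral_L2(1)[OF u, of "{..t}"] by simp
        show "(\<lambda>j. sqrt (measure lborel ({..t} \<inter> {0..T})) * l2norm P (\<lambda>z. f j z - p z)) \<longlonglongrightarrow> 0"
          using f(2) by (auto simp: L2_tends_def intro: tendsto_mult_right_zero)
        fix j
        have "AE \<omega> in M. ?X j \<omega> - ?Y \<omega> = (\<integral>s. indicator {..t} s * (p (s, \<omega>) - f j (s, \<omega>)) \<partial>R)"
        proof -
          have 1: "AE \<omega> in M. (\<lambda>s. case_prod v (s, \<omega>) - f j (s, \<omega>)) \<in> L2 R"
            using time_integral_L2(3)[OF vf, of UNIV j] by auto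
          have 2: "AE \<omega> in M. (\<lambda>s. u (s, \<omega>)) \<in> L2 R"
            using time_integral_L2(3)[OF u, of UNIV] by auto
          have ind: "(\<lambda>s. indicator {..t} s) \<in> L2 R"
          proof (rule R.L2_bounded[of _ 1])
            show "(\<lambda>s. indicator {..t} s :: real) \<in> borel_measurable R"
              by (rule measurable_restrict_space1) simp
          qed (auto simp: indicator_def)
          show ?thesis using 1 2
          proof eventually_elim
            case (elim \<omega>)
            show ?case
              by (subst Bochner_Integration.integral_diff[symmetric, OF L2_integrable_mult[OF ind elim(1)]
                    L2_integrable_mult[OF ind elim(2)]])
                (auto intro!: Bochner_Integration.integral_cong simp: u_def algebra_simps)
          qed
        qed
        then have "l2norm M (\<lambda>\<omega>. ?X j \<omega> - ?Y \<omega>) = l2norm M (\<lambda>\<omega>. \<integral>s. indicator {..t} s * (p (s, \<omega>) - f j (s, \<omega>)) \<partial>R)"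
          using time_integral_L2(1)[OF vf, of "{..t}" j] time_integral_L2(1)[OF u, of "{..t}"]
            time_integral_L2(1)[OF pf, of "{..t}" j]
          by (intro l2norm_cong_AE) (auto dest!: L2_measurable)
        also have "\<dots> \<le> sqrt (measure lborel ({..t} \<inter> {0..T})) * l2norm P (\<lambda>z. indicator {..t} (fst z) * (p z - f j z))"
          using time_integral_L2(2)[OF pf, of "{..t}" j] by simp
        also have "\<dots> \<le> sqrt (measure lborel ({..t} \<inter> {0..T})) * l2norm P (\<lambda>z. f j z - p z)"
          using l2norm_indicator_P_le[OF pf[of j], of "{..t}"] l2norm_minus_commute[of P p "f j"]
          by (intro mult_left_mono) auto
        finally show "l2norm M (\<lambda>\<omega>. ?X j \<omega> - ?Y \<omega>)
            \<le> sqrt (measure lborel ({..t} \<inter> {0..T})) * l2norm P (\<lambda>z. f j z - p z)" .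
      qed
    qed
  qed
  moreover have "(\<lambda>j. l2norm P (\<lambda>z. f j z - case_prod v z)) \<longlonglongrightarrow> l2norm P (\<lambda>z. p z - case_prod v z)"
    by (intro L2_tends_norm L2_tends_diff f L2_tends_const vL)
  ultimately have "(\<lambda>j. l2norm P (\<lambda>z. f j z - case_prod v z)) \<longlonglongrightarrow> 0"
    using l2norm_minus_commute[of P p "case_prod v"] by (simp add: u_def)
  then have "eventually (\<lambda>j. l2norm P (\<lambda>z. f j z - case_prod v z) < e) sequentially"
    using e by (simp add: order_tendstoD(2))
  then obtain j where "l2norm P (\<lambda>z. f j z - case_prod v z) < e"
    using eventually_happens' sequentially_bot by blast
  moreover obtain k h where "f j = case_prod (ep k h)" "elem k h"
    using f(1)[of j] by (auto simp: dyadic_steps_def)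
  ultimately show ?thesis by metis
qed

end

section \<open>The Ito integral\<close>

context brownian_setting
begin

text \<open>A version of the integral that is only determined up to modification and that allows arbitrary
  block sums as approximations.\<close>

definition ito :: "'a process \<Rightarrow> 'a process \<Rightarrow> bool" where
  "ito v I \<longleftrightarrow> v \<in> L2_adapted M T W \<and>
    (\<exists>L. (\<forall>k. valid (L k)) \<and> L2_tends P (\<lambda>k. case_prod (bp (L k))) (case_prod v) \<and>
      (\<forall>t\<in>{0..T}. L2_tends M (\<lambda>k. wi (L k) t) (I t)))"

lemma itoE:
  assumes "ito v I"
  obtains L where "\<And>k. valid (L k)" "L2_tends P (\<lambda>k. case_prod (bp (L k))) (case_prod v)"
    "\<And>t. t \<in> {0..T} \<Longrightarrow> L2_tends M (\<lambda>k. wi (L k) t) (I t)"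
  using assms unfolding ito_def by (elim conjE exE) (rule that, erule spec, assumption, erule (1) bspec)

lemma itoI:
  assumes "v \<in> L2_adapted M T W" "\<And>k. valid (L k)"
    "L2_tends P (\<lambda>k. case_prod (bp (L k))) (case_prod v)"
    "\<And>t. t \<in> {0..T} \<Longrightarrow> L2_tends M (\<lambda>k. wi (L k) t) (I t)"
  shows "ito v I"
  unfolding ito_def using assms by (intro conjI exI[of _ L]) simp_all

lemma ito_integrand: "ito v I \<Longrightarrow> v \<in> L2_adapted M T W"
  by (simp add: ito_def)

lemma ito_integrand_L2: "ito v I \<Longrightarrow> case_prod v \<in> L2 P"
  by (simp add: ito_def L2_adapted_iff)

lemma ito_L2: "ito v I \<Longrightarrow> t \<in> {0..T} \<Longrightarrow> I t \<in> L2 M"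
  by (auto simp: ito_def L2_tends_def)

lemma ito_measurable:
  assumes "ito v I" "t \<in> {0..T}" shows "I t \<in> borel_measurable (F t)"
proof -
  obtain L where L: "\<And>k. valid (L k)" "\<And>t. t \<in> {0..T} \<Longrightarrow> L2_tends M (\<lambda>k. wi (L k) t) (I t)"
    using itoE[OF assms(1)] by metis
  show ?thesis by (rule L2_tends_measurable_F[OF L(2)[OF assms(2)] wi_measurable[OF L(1) assms(2)]])
qed

lemma ito_inner:
  assumes "ito v I" "ito w J" and t: "t \<in> {0..T}"
  shows "expectation (\<lambda>\<omega>. I t \<omega> * J t \<omega>) = (\<integral>z. indicator {..t} (fst z) * (case_prod v z * case_prod w z) \<partial>P)"
proof -
  obtain L where L: "\<And>k. valid (L k)" "L2_tends P (\<lambda>k. case_prod (bp (L k))) (case_prod v)"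
    "\<And>t. t \<in> {0..T} \<Longrightarrow> L2_tends M (\<lambda>k. wi (L k) t) (I t)" using itoE[OF assms(1)] by metis
  obtain K where K: "\<And>k. valid (K k)" "L2_tends P (\<lambda>k. case_prod (bp (K k))) (case_prod w)"
    "\<And>t. t \<in> {0..T} \<Longrightarrow> L2_tends M (\<lambda>k. wi (K k) t) (J t)" using itoE[OF assms(2)] by metis
  have 1: "(\<lambda>k. expectation (\<lambda>\<omega>. wi (L k) t \<omega> * wi (K k) t \<omega>)) \<longlonglongrightarrow> expectation (\<lambda>\<omega>. I t \<omega> * J t \<omega>)"
    by (rule L2_tends_inner[OF L(3)[OF t] K(3)[OF t]])
  have "L2_tends P (\<lambda>k z. indicator {..t} (fst z) * case_prod (bp (L k)) z) (\<lambda>z. indicator {..t} (fst z) * case_prod v z)"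
    by (rule L2_tends_bounded_mult[OF L(2) indicator_P, of _ 1]) (auto simp: indicator_def)
  from L2_tends_inner[OF this K(2)]
  have "(\<lambda>k. \<integral>z. indicator {..t} (fst z) * (case_prod (bp (L k)) z * case_prod (bp (K k)) z) \<partial>P)
    \<longlonglongrightarrow> (\<integral>z. indicator {..t} (fst z) * (case_prod v z * case_prod w z) \<partial>P)"
    by (simp only: mult.assoc)
  with 1 show ?thesis unfolding wi_isometry[OF L(1) K(1) t] by (rule LIMSEQ_unique)
qed

lemma ito_norm:
  assumes "ito v I" and t: "t \<in> {0..T}"
  shows "l2norm M (I t) = l2norm P (\<lambda>z. indicator {..t} (fst z) * case_prod v z)"
proof -
  have "(l2norm M (I t))\<^sup>2 = (\<integral>z. indicator {..t} (fst z) * (case_prod v z * case_prod v z) \<partial>P)"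
    using ito_inner[OF assms(1,1) t] unfolding l2norm_square unfolding power2_eq_square .
  also have "\<dots> = (l2norm P (\<lambda>z. indicator {..t} (fst z) * case_prod v z))\<^sup>2"
    unfolding l2norm_square
    by (intro Bochner_Integration.integral_cong) (auto simp: indicator_def power2_eq_square)
  finally show ?thesis by simp
qed

lemma ito_linear:
  assumes "ito v I" "ito w J"
  shows "ito (\<lambda>t \<omega>. v t \<omega> + c * w t \<omega>) (\<lambda>t \<omega>. I t \<omega> + c * J t \<omega>)"
proof -
  obtain L where L: "\<And>k. valid (L k)" "L2_tends P (\<lambda>k. case_prod (bp (L k))) (case_prod v)"
    "\<And>t. t \<in> {0..T} \<Longrightarrow> L2_tends M (\<lambda>k. wi (L k) t) (I t)" using itoE[OF assms(1)] by metis
  obtain K where K: "\<And>k. valid (K k)" "L2_tends P (\<lambda>k. case_prod (bp (K k))) (case_prod w)"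
    "\<And>t. t \<in> {0..T} \<Longrightarrow> L2_tends M (\<lambda>k. wi (K k) t) (J t)" using itoE[OF assms(2)] by metis
  have b: "case_prod (bp (L k @ scale_blocks c (K k))) = (\<lambda>z. case_prod (bp (L k)) z + c * case_prod (bp (K k)) z)" for k
    by (auto simp: scale_blocks)
  have w: "wi (L k @ scale_blocks c (K k)) t = (\<lambda>\<omega>. wi (L k) t \<omega> + c * wi (K k) t \<omega>)" for k t
    by (auto simp: scale_blocks)
  have e: "case_prod (\<lambda>t \<omega>. v t \<omega> + c * w t \<omega>) = (\<lambda>z. case_prod v z + c * case_prod w z)" by auto
  have "valid (L k @ scale_blocks c (K k))" for k using L(1) K(1) by (simp add: valid_scale_blocks)
  moreover have "L2_tends P (\<lambda>k. case_prod (bp (L k @ scale_blocks c (K k)))) (case_prod (\<lambda>t \<omega>. v t \<omega> + c * w t \<omega>))"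
    unfolding b e by (intro L2_tends_add L2_tends_cmult L K)
  moreover have "L2_tends M (\<lambda>k. wi (L k @ scale_blocks c (K k)) t) (\<lambda>\<omega>. I t \<omega> + c * J t \<omega>)"
    if "t \<in> {0..T}" for t
    unfolding w by (intro L2_tends_add L2_tends_cmult L K that)
  moreover have "(\<lambda>t \<omega>. v t \<omega> + c * w t \<omega>) \<in> L2_adapted M T W"
    by (rule L2_adapted_diff[OF assms[THEN ito_integrand]])
  ultimately show ?thesis by (intro itoI)
qed

lemma ito_diff_norm_le:
  assumes "ito v I" "ito w J" "t \<in> {0..T}"
  shows "l2norm M (\<lambda>\<omega>. I t \<omega> - J t \<omega>) \<le> l2norm P (\<lambda>z. case_prod v z - case_prod w z)"
proof -
  have L: "(\<lambda>z. case_prod v z - case_prod w z) \<in> L2 P"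
    using assms by (intro L2_diff ito_integrand_L2)
  have e: "case_prod (\<lambda>t \<omega>. v t \<omega> + (-1) * w t \<omega>) = (\<lambda>z. case_prod v z - case_prod w z)" by auto
  have "l2norm M (\<lambda>\<omega>. I t \<omega> - J t \<omega>) = l2norm P (\<lambda>z. indicator {..t} (fst z) * (case_prod v z - case_prod w z))"
    using ito_norm[OF ito_linear[OF assms(1,2), of "-1"] assms(3)] unfolding e by simp
  also have "\<dots> \<le> l2norm P (\<lambda>z. case_prod v z - case_prod w z)"
    by (rule l2norm_indicator_P_le[OF L]) simp
  finally show ?thesis .
qed

lemma ito_unique:
  assumes "ito v I" "ito w J" "AE z in P. case_prod v z = case_prod w z" "t \<in> {0..T}"
  shows "AE \<omega> in M. I t \<omega> = J t \<omega>"
proof -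
  have "l2norm P (\<lambda>z. case_prod v z - case_prod w z) = l2norm P (\<lambda>z. 0)"
  proof (rule l2norm_cong_AE)
    show "(\<lambda>z. case_prod v z - case_prod w z) \<in> borel_measurable P"
      by (intro L2_measurable[OF L2_diff] ito_integrand_L2[OF assms(1)] ito_integrand_L2[OF assms(2)])
    show "AE z in P. case_prod v z - case_prod w z = 0" using assms(3) by eventually_elim simp
  qed simp
  then have "l2norm M (\<lambda>\<omega>. I t \<omega> - J t \<omega>) = 0"
  proof -
    have "l2norm P (\<lambda>z. 0) = 0" by (simp add: l2norm_def)
    then show ?thesis
      using ito_diff_norm_le[OF assms(1,2,4)] l2norm_nonneg[of M "\<lambda>\<omega>. I t \<omega> - J t \<omega>"] \<open>l2norm P _ = l2norm P (\<lambda>z. 0)\<close>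
      by linarith
  qed
  moreover have "(\<lambda>\<omega>. I t \<omega> - J t \<omega>) \<in> L2 M" using assms by (intro L2_diff ito_L2)
  ultimately have "AE \<omega> in M. I t \<omega> - J t \<omega> = 0" by (intro l2norm_eq_0_AE)
  then show ?thesis by simp
qed

lemma ito_martingale:
  assumes "ito v I" and st: "0 \<le> s" "s \<le> t" "t \<le> T" and g: "g \<in> borel_measurable (F s)" "g \<in> L2 M"
  shows "expectation (\<lambda>\<omega>. (I t \<omega> - I s \<omega>) * g \<omega>) = 0"
proof -
  obtain L where L: "\<And>k. valid (L k)" "\<And>t. t \<in> {0..T} \<Longrightarrow> L2_tends M (\<lambda>k. wi (L k) t) (I t)"
    using itoE[OF assms(1)] by metis
  have "(\<lambda>k. expectation (\<lambda>\<omega>. (wi (L k) t \<omega> - wi (L k) s \<omega>) * g \<omega>)) \<longlonglongrightarrow> expectation (\<lambda>\<omega>. (I t \<omega> - I s \<omega>) * g \<omega>)"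
    using st by (intro L2_tends_inner_const L2_tends_diff L g) auto
  then show ?thesis unfolding wi_martingale[OF L(1) st g] by (simp add: LIMSEQ_const_iff)
qed

text \<open>A bounded factor known at \<open>a\<close> may be pulled out of the integral over
  \<open>(a, b]\<close>. This is plain for block sums, and multiplication by a bounded function
  preserves mean-square limits.\<close>

lemma ito_localize:
  assumes "ito v I" and ab: "0 \<le> a" "a \<le> b" "b \<le> T"
    and g: "g \<in> borel_measurable (F a)" "\<forall>\<omega>\<in>space M. \<bar>g \<omega>\<bar> \<le> C"
  shows "ito (\<lambda>t \<omega>. g \<omega> * indicator {a<..b} t * v t \<omega>) (\<lambda>t \<omega>. g \<omega> * (I (min t b) \<omega> - I (min t a) \<omega>))"
proof -
  obtain L where L: "\<And>k. valid (L k)" "L2_tends P (\<lambda>k. case_prod (bp (L k))) (case_prod v)"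
    "\<And>t. t \<in> {0..T} \<Longrightarrow> L2_tends M (\<lambda>k. wi (L k) t) (I t)" using itoE[OF assms(1)] by metis
  have gM: "g \<in> borel_measurable M" using measurable_F_M[OF g(1)] ab by simp
  define G where "G = (\<lambda>z. g (snd z) * indicator {a<..b} (fst z) :: real)"
  have Gm: "G \<in> borel_measurable P" unfolding G_def
    by (intro borel_measurable_times lift_M_P gM indicator_P) simp
  have GC: "\<bar>G z\<bar> \<le> \<bar>C\<bar>" if "z \<in> space P" for z
    using g(2) that by (fastforce simp: G_def space_P indicator_def)
  have b: "case_prod (bp (localize_blocks a b g (L k))) = (\<lambda>z. G z * case_prod (bp (L k)) z)" for k
    by (auto simp: bp_localize_blocks G_def)
  have e: "case_prod (\<lambda>t \<omega>. g \<omega> * indicator {a<..b} t * v t \<omega>) = (\<lambda>z. G z * case_prod v z)"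
    by (auto simp: G_def)
  have w: "wi (localize_blocks a b g (L k)) t = (\<lambda>\<omega>. g \<omega> * (wi (L k) (min t b) \<omega> - wi (L k) (min t a) \<omega>))" for k t
    by (auto simp: wi_localize_blocks[OF L(1) ab(2)])
  have "valid (localize_blocks a b g (L k))" for k
    by (rule valid_localize_blocks[OF L(1) ab g])
  moreover have t1: "L2_tends P (\<lambda>k. case_prod (bp (localize_blocks a b g (L k)))) (case_prod (\<lambda>t \<omega>. g \<omega> * indicator {a<..b} t * v t \<omega>))"
    unfolding b e by (rule L2_tends_bounded_mult[OF L(2) Gm GC])
  moreover have "L2_tends M (\<lambda>k. wi (localize_blocks a b g (L k)) t) (\<lambda>\<omega>. g \<omega> * (I (min t b) \<omega> - I (min t a) \<omega>))"
    if t: "t \<in> {0..T}" for t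
  proof -
    from t have "L2_tends M (\<lambda>k \<omega>. wi (L k) (min t b) \<omega> - wi (L k) (min t a) \<omega>) (\<lambda>\<omega>. I (min t b) \<omega> - I (min t a) \<omega>)"
      using ab by (intro L2_tends_diff L(3)) auto
    then show "L2_tends M (\<lambda>k. wi (localize_blocks a b g (L k)) t) (\<lambda>\<omega>. g \<omega> * (I (min t b) \<omega> - I (min t a) \<omega>))"
      unfolding w using g(2) by (intro L2_tends_bounded_mult[OF _ gM, of _ _ C]) auto
  qed
  moreover have "(\<lambda>t \<omega>. g \<omega> * indicator {a<..b} t * v t \<omega>) \<in> L2_adapted M T W"
  proof -
    have vF: "v t \<in> borel_measurable (F t)" if "t \<in> {0..T}" for t
      using ito_integrand[OF assms(1)] that by (auto simp: L2_adapted_iff adapted_def)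
    have "(\<lambda>\<omega>. g \<omega> * indicator {a<..b} t * v t \<omega>) \<in> borel_measurable (F t)" if t: "t \<in> {0..T}" for t
    proof (cases "t \<le> a")
      case False
      then have "g \<in> borel_measurable (F t)" using measurable_F_mono[OF g(1)] by simp
      then show ?thesis using vF[OF t] by measurable
    qed simp
    moreover have "case_prod (\<lambda>t \<omega>. g \<omega> * indicator {a<..b} t * v t \<omega>) \<in> L2 P"
      using t1 by (simp add: L2_tends_def)
    ultimately show ?thesis by (auto simp: L2_adapted_iff adapted_def dest: L2_measurable)
  qed
  ultimately show ?thesis by (intro itoI)
qed

lemma ennreal_square_tendsto_0_iff:
  assumes "\<And>k. 0 \<le> x k"
  shows "(\<lambda>k. ennreal ((x k)\<^sup>2)) \<longlonglongrightarrow> 0 \<longleftrightarrow> x \<longlonglongrightarrow> (0::real)"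
proof
  assume "(\<lambda>k. ennreal ((x k)\<^sup>2)) \<longlonglongrightarrow> 0"
  then have "(\<lambda>k. ennreal ((x k)\<^sup>2)) \<longlonglongrightarrow> ennreal 0" by simp
  then have "(\<lambda>k. (x k)\<^sup>2) \<longlonglongrightarrow> 0" by (subst (asm) tendsto_ennreal_iff) auto
  then have "(\<lambda>k. sqrt ((x k)\<^sup>2)) \<longlonglongrightarrow> sqrt 0" by (rule tendsto_real_sqrt)
  then show "x \<longlonglongrightarrow> 0" using assms by simp
next
  assume "x \<longlonglongrightarrow> 0"
  then have "(\<lambda>k. (x k)\<^sup>2) \<longlonglongrightarrow> 0\<^sup>2" by (rule tendsto_power)
  then have "(\<lambda>k. ennreal ((x k)\<^sup>2)) \<longlonglongrightarrow> ennreal (0\<^sup>2)" by (rule tendsto_ennrealI)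
  then show "(\<lambda>k. ennreal ((x k)\<^sup>2)) \<longlonglongrightarrow> 0" by simp
qed

lemma nn_integral_square_l2norm:
  "f \<in> L2 N \<Longrightarrow> (\<integral>\<^sup>+x. ennreal ((f x)\<^sup>2) \<partial>N) = ennreal ((l2norm N f)\<^sup>2)"
  using nn_integral_eq_integral[OF L2_integrable_square] by (simp add: l2norm_square)

lemma is_ito_integral_imp_ito:
  assumes "is_ito_integral M T W v I"
  shows "ito v I"
proof -
  from assms obtain m \<tau> h where v: "v \<in> L2_adapted M T W"
    and IF: "\<And>t. t \<in> {0..T} \<Longrightarrow> I t \<in> borel_measurable (F t)"
    and el: "\<And>k::nat. elementary M T W (m k) (\<tau> k) (h k)"
    and en: "(\<lambda>k. energy M T (\<lambda>t \<omega>. elementary_process (m k) (\<tau> k) (h k) t \<omega> - v t \<omega>)) \<longlonglongrightarrow> 0"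
    and li: "\<And>t. t \<in> {0..T} \<Longrightarrow> (\<lambda>k. \<integral>\<^sup>+\<omega>. ennreal ((elementary_integral W (m k) (\<tau> k) (h k) t \<omega> - I t \<omega>)\<^sup>2) \<partial>M) \<longlonglongrightarrow> 0"
    unfolding is_ito_integral_def by blast
  define L where "L = (\<lambda>k. partition_blocks (m k) (\<tau> k) (h k))"
  have vL: "valid (L k)" for k unfolding L_def by (rule valid_partition_blocks[OF el])
  have bpL: "elementary_process (m k) (\<tau> k) (h k) = bp (L k)"
    and wiL: "elementary_integral W (m k) (\<tau> k) (h k) = wi (L k)" for k
    by (simp_all add: L_def bp_partition)
  have vP: "case_prod v \<in> L2 P" using v by (simp add: L2_adapted_iff)
  have dP: "case_prod (\<lambda>t \<omega>. bp (L k) t \<omega> - v t \<omega>) = (\<lambda>z. case_prod (bp (L k)) z - case_prod v z)" for k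
    by auto
  have dL: "(\<lambda>z. case_prod (bp (L k)) z - case_prod v z) \<in> L2 P" for k
    by (rule L2_diff[OF bp_L2[OF vL] vP])
  have "(\<lambda>k. ennreal ((l2norm P (\<lambda>z. case_prod (bp (L k)) z - case_prod v z))\<^sup>2)) \<longlonglongrightarrow> 0"
    using en energy_eq_l2norm[of "\<lambda>t \<omega>. bp (L _) t \<omega> - v t \<omega>", unfolded dP, OF dL] unfolding bpL by simp
  then have 1: "L2_tends P (\<lambda>k. case_prod (bp (L k))) (case_prod v)"
    by (subst (asm) ennreal_square_tendsto_0_iff) (auto simp: L2_tends_def bp_L2[OF vL] vP)
  have 2: "L2_tends M (\<lambda>k. wi (L k) t) (I t)" if t: "t \<in> {0..T}" for t
  proof -
    have lim: "(\<lambda>k. \<integral>\<^sup>+\<omega>. ennreal ((wi (L k) t \<omega> - I t \<omega>)\<^sup>2) \<partial>M) \<longlonglongrightarrow> 0"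
      using li[OF t] unfolding wiL .
    then have "eventually (\<lambda>k. (\<integral>\<^sup>+\<omega>. ennreal ((wi (L k) t \<omega> - I t \<omega>)\<^sup>2) \<partial>M) < 1) sequentially"
      by (rule order_tendstoD(2)) simp
    \<comment> \<open>A single approximant at finite distance already places \<open>I t\<close> in
      \<open>L2\<close>.\<close>
    then obtain k where k: "(\<integral>\<^sup>+\<omega>. ennreal ((wi (L k) t \<omega> - I t \<omega>)\<^sup>2) \<partial>M) < 1"
      using eventually_happens' sequentially_bot by blast
    have IM: "I t \<in> borel_measurable M" using measurable_F_M[OF IF[OF t]] t by simp
    have wL: "wi (L k) t \<in> L2 M" for k by (rule wi_L2[OF vL t])
    have "(\<lambda>\<omega>. wi (L k) t \<omega> - I t \<omega>) \<in> L2 M"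
    proof (rule L2_I)
      show m: "(\<lambda>\<omega>. wi (L k) t \<omega> - I t \<omega>) \<in> borel_measurable M"
        using IM L2_measurable[OF wL] by measurable
      show "integrable M (\<lambda>\<omega>. (wi (L k) t \<omega> - I t \<omega>)\<^sup>2)"
      proof (rule integrableI_bounded)
        show "(\<integral>\<^sup>+\<omega>. ennreal (norm ((wi (L k) t \<omega> - I t \<omega>)\<^sup>2)) \<partial>M) < \<infinity>"
          using order.strict_trans[OF k, of \<infinity>] by simp
      qed (use m in measurable)
    qed
    from L2_diff[OF wL[of k] this] have IL: "I t \<in> L2 M" by simp
    have "(\<lambda>k. ennreal ((l2norm M (\<lambda>\<omega>. wi (L k) t \<omega> - I t \<omega>))\<^sup>2)) \<longlonglongrightarrow> 0"
      using lim nn_integral_square_l2norm[OF L2_diff[OF wL IL]] by simp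
    then show ?thesis
      by (subst (asm) ennreal_square_tendsto_0_iff) (auto simp: L2_tends_def wL IL)
  qed
  show ?thesis by (rule itoI[OF v vL 1 2])
qed

subsection \<open>Maximal inequality and continuous versions\<close>

text \<open>Doob's inequality, with the indicator kept on the right so that induction on
  \<open>m\<close> closes. The event \<open>A\<close> is known at the earlier time
  \<open>?s\<close>, so passing to \<open>?t\<close> can only raise the mean square on
  \<open>A\<close>; on the new event \<open>B\<close> the level is reached at \<open>?t\<close>
  itself.\<close>

lemma maximal_inequality_grid:
  assumes X: "\<And>t. t \<in> {0..T} \<Longrightarrow> X t \<in> L2 M" "\<And>t. t \<in> {0..T} \<Longrightarrow> X t \<in> borel_measurable (F t)"
    and mart: "\<And>s t g. 0 \<le> s \<Longrightarrow> s \<le> t \<Longrightarrow> t \<le> T \<Longrightarrow> g \<in> borel_measurable (F s) \<Longrightarrow> g \<in> L2 M \<Longrightarrow>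
      expectation (\<lambda>\<omega>. (X t \<omega> - X s \<omega>) * g \<omega>) = 0"
    and e: "0 < e" and m: "m \<le> 2 ^ k"
  shows "e\<^sup>2 * prob {\<omega>\<in>space M. \<exists>j\<le>m. e \<le> \<bar>X (grid k j) \<omega>\<bar>}
    \<le> expectation (\<lambda>\<omega>. indicator {\<omega>\<in>space M. \<exists>j\<le>m. e \<le> \<bar>X (grid k j) \<omega>\<bar>} \<omega> * (X (grid k m) \<omega>)\<^sup>2)"
  using m
proof (induction m)
  case 0
  let ?A = "{\<omega>\<in>space M. e \<le> \<bar>X 0 \<omega>\<bar>}"
  have X0: "X 0 \<in> L2 M" using X T_pos by simp
  have [measurable]: "X 0 \<in> borel_measurable M" by (rule L2_measurable[OF X0])
  have A: "?A \<in> events" by measurable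
  have "e\<^sup>2 * prob ?A = expectation (\<lambda>\<omega>. indicator ?A \<omega> * e\<^sup>2)" using A by simp
  also have "\<dots> \<le> expectation (\<lambda>\<omega>. indicator ?A \<omega> * (X 0 \<omega>)\<^sup>2)"
  proof (rule integral_mono)
    show "integrable M (\<lambda>\<omega>. indicator ?A \<omega> * (X 0 \<omega>)\<^sup>2)"
      using integrable_mult_indicator[OF A L2_integrable_square[OF X0]] by simp
    show "indicator ?A \<omega> * e\<^sup>2 \<le> indicator ?A \<omega> * (X 0 \<omega>)\<^sup>2" for \<omega>
      using e abs_le_square_iff[of e "X 0 \<omega>"] by (auto simp: indicator_def)
    show "integrable M (\<lambda>\<omega>. indicator ?A \<omega> * e\<^sup>2)"
      using integrable_mult_indicator[OF A, of "\<lambda>_. e\<^sup>2"] by simp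
  qed
  finally show ?case by simp
next
  case (Suc m)
  define A where "A = {\<omega>\<in>space M. \<exists>j\<le>m. e \<le> \<bar>X (grid k j) \<omega>\<bar>}"
  define A' where "A' = {\<omega>\<in>space M. \<exists>j\<le>Suc m. e \<le> \<bar>X (grid k j) \<omega>\<bar>}"
  let ?s = "grid k m" and ?t = "grid k (Suc m)"
  have st: "?s \<in> {0..T}" "?t \<in> {0..T}" "?s \<le> ?t"
    using Suc.prems by (intro grid_in grid_mono; simp)+
  have XF: "X (grid k j) \<in> borel_measurable (F ?s)" if "j \<le> m" for j
    using measurable_F_mono[OF X(2)[OF grid_in[of j k]] grid_mono[OF that]] that Suc.prems by simp
  have As: "A \<in> sets (F ?s)"
  proof -
    have "A = (\<Union>j\<in>{..m}. {\<omega>\<in>space (F ?s). e \<le> \<bar>X (grid k j) \<omega>\<bar>})" by (auto simp: A_def)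
    also have "\<dots> \<in> sets (F ?s)"
    proof (rule sets.finite_UN)
      fix j assume "j \<in> {..m}"
      then have [measurable]: "X (grid k j) \<in> borel_measurable (F ?s)" using XF by simp
      show "{\<omega>\<in>space (F ?s). e \<le> \<bar>X (grid k j) \<omega>\<bar>} \<in> sets (F ?s)" by measurable
    qed simp
    finally show ?thesis .
  qed
  have A: "A \<in> events" by (rule subsetD[OF sets_F_subset As]) (use st in simp)
  have XL: "X ?s \<in> L2 M" "X ?t \<in> L2 M" by (rule X(1)[OF st(1)], rule X(1)[OF st(2)])
  have [measurable]: "X ?t \<in> borel_measurable M" "X ?s \<in> borel_measurable M" by (rule L2_measurable[OF XL(2)], rule L2_measurable[OF XL(1)])
  define B where "B = {\<omega>\<in>space M. \<omega> \<notin> A \<and> e \<le> \<bar>X ?t \<omega>\<bar>}"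
  have B: "B \<in> events"
  proof -
    have eq: "B = {\<omega>\<in>space M. e \<le> \<bar>X ?t \<omega>\<bar>} - A" by (auto simp: B_def)
    have "{\<omega>\<in>space M. e \<le> \<bar>X ?t \<omega>\<bar>} \<in> events" by measurable
    from sets.Diff[OF this A] show ?thesis unfolding eq .
  qed
  have un: "A' = A \<union> B" by (auto simp: A'_def A_def B_def le_Suc_eq)
  have gL: "(\<lambda>\<omega>. indicator A \<omega> * X ?s \<omega>) \<in> L2 M"
    using A by (intro L2_bounded_mult[OF XL(1), of _ 1]) (auto simp: indicator_def)
  have gF: "(\<lambda>\<omega>. indicator A \<omega> * X ?s \<omega>) \<in> borel_measurable (F ?s)"
    using As X(2)[OF st(1)] by measurable
  have D: "(\<lambda>\<omega>. X ?t \<omega> - X ?s \<omega>) \<in> L2 M" by (rule L2_diff[OF XL(2,1)])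
  have iA: "integrable M (\<lambda>\<omega>. indicator A \<omega> * f \<omega>)" if "integrable M f" for f :: "'a \<Rightarrow> real"
    using integrable_mult_indicator[OF A that] by simp
  have iB: "integrable M (\<lambda>\<omega>. indicator B \<omega> * f \<omega>)" if "integrable M f" for f :: "'a \<Rightarrow> real"
    using integrable_mult_indicator[OF B that] by simp
  have "expectation (\<lambda>\<omega>. indicator A \<omega> * (X ?s \<omega>)\<^sup>2)
      \<le> expectation (\<lambda>\<omega>. indicator A \<omega> * (X ?s \<omega>)\<^sup>2) + expectation (\<lambda>\<omega>. indicator A \<omega> * (X ?t \<omega> - X ?s \<omega>)\<^sup>2)"
    by (simp add: integral_nonneg_AE)
  also have "\<dots> = expectation (\<lambda>\<omega>. indicator A \<omega> * (X ?s \<omega>)\<^sup>2) + expectation (\<lambda>\<omega>. indicator A \<omega> * (X ?t \<omega> - X ?s \<omega>)\<^sup>2)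
     + 2 * expectation (\<lambda>\<omega>. (X ?t \<omega> - X ?s \<omega>) * (indicator A \<omega> * X ?s \<omega>))"
    using mart[OF _ st(3) _ gF gL] st by simp
  also have "\<dots> = expectation (\<lambda>\<omega>. indicator A \<omega> * (X ?s \<omega>)\<^sup>2 + indicator A \<omega> * (X ?t \<omega> - X ?s \<omega>)\<^sup>2
     + 2 * ((X ?t \<omega> - X ?s \<omega>) * (indicator A \<omega> * X ?s \<omega>)))"
    using iA[OF L2_integrable_square[OF XL(1)]] iA[OF L2_integrable_square[OF D]] L2_integrable_mult[OF D gL]
    by simp
  also have "\<dots> = expectation (\<lambda>\<omega>. indicator A \<omega> * (X ?t \<omega>)\<^sup>2)"
    by (intro Bochner_Integration.integral_cong) (auto simp: power2_eq_square algebra_simps)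
  finally have 1: "e\<^sup>2 * prob A \<le> expectation (\<lambda>\<omega>. indicator A \<omega> * (X ?t \<omega>)\<^sup>2)"
    using Suc by (simp add: A_def)
  have "e\<^sup>2 * prob B = expectation (\<lambda>\<omega>. indicator B \<omega> * e\<^sup>2)" using B by simp
  also have "\<dots> \<le> expectation (\<lambda>\<omega>. indicator B \<omega> * (X ?t \<omega>)\<^sup>2)"
  proof (rule integral_mono)
    show "integrable M (\<lambda>\<omega>. indicator B \<omega> * (X ?t \<omega>)\<^sup>2)" by (rule iB[OF L2_integrable_square[OF XL(2)]])
    show "integrable M (\<lambda>\<omega>. indicator B \<omega> * e\<^sup>2)" by (rule iB) simp
    show "indicator B \<omega> * e\<^sup>2 \<le> indicator B \<omega> * (X ?t \<omega>)\<^sup>2" for \<omega>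
      using e abs_le_square_iff[of e "X ?t \<omega>"] by (auto simp: indicator_def B_def)
  qed
  finally have 2: "e\<^sup>2 * prob B \<le> expectation (\<lambda>\<omega>. indicator B \<omega> * (X ?t \<omega>)\<^sup>2)" .
  have "prob A' = prob A + prob B"
    unfolding un by (rule finite_measure_Union[OF A B]) (auto simp: B_def)
  then have "e\<^sup>2 * prob A' = e\<^sup>2 * prob A + e\<^sup>2 * prob B" by (simp add: distrib_left)
  also have "\<dots> \<le> expectation (\<lambda>\<omega>. indicator A \<omega> * (X ?t \<omega>)\<^sup>2) + expectation (\<lambda>\<omega>. indicator B \<omega> * (X ?t \<omega>)\<^sup>2)"
    using 1 2 by simp
  also have "\<dots> = expectation (\<lambda>\<omega>. indicator A \<omega> * (X ?t \<omega>)\<^sup>2 + indicator B \<omega> * (X ?t \<omega>)\<^sup>2)"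
    using iA[OF L2_integrable_square[OF XL(2)]] iB[OF L2_integrable_square[OF XL(2)]] by simp
  also have "\<dots> = expectation (\<lambda>\<omega>. indicator A' \<omega> * (X ?t \<omega>)\<^sup>2)"
    unfolding un by (intro Bochner_Integration.integral_cong) (auto simp: indicator_def B_def)
  finally show ?case unfolding A'_def .
qed

text \<open>The events increase along the grids, since each grid contains the coarser ones; the
  bound is free of \<open>k\<close> and passes to the union over all dyadic times.\<close>

lemma maximal_inequality:
  assumes X: "\<And>t. t \<in> {0..T} \<Longrightarrow> X t \<in> L2 M" "\<And>t. t \<in> {0..T} \<Longrightarrow> X t \<in> borel_measurable (F t)"
    and mart: "\<And>s t g. 0 \<le> s \<Longrightarrow> s \<le> t \<Longrightarrow> t \<le> T \<Longrightarrow> g \<in> borel_measurable (F s) \<Longrightarrow> g \<in> L2 M \<Longrightarrow>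
      expectation (\<lambda>\<omega>. (X t \<omega> - X s \<omega>) * g \<omega>) = 0"
    and e: "0 < e"
  shows "{\<omega>\<in>space M. \<exists>k. \<exists>j\<le>2^k. e \<le> \<bar>X (grid k j) \<omega>\<bar>} \<in> events"
    and "prob {\<omega>\<in>space M. \<exists>k. \<exists>j\<le>2^k. e \<le> \<bar>X (grid k j) \<omega>\<bar>} \<le> (l2norm M (X T))\<^sup>2 / e\<^sup>2"
proof -
  define A where "A = (\<lambda>k. {\<omega>\<in>space M. \<exists>j\<le>2^k. e \<le> \<bar>X (grid k j) \<omega>\<bar>})"
  have Am: "A k \<in> events" for k
  proof -
    have "A k = (\<Union>j\<in>{..2^k}. {\<omega>\<in>space M. e \<le> \<bar>X (grid k j) \<omega>\<bar>})" by (auto simp: A_def)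
    also have "\<dots> \<in> events"
    proof (rule sets.finite_UN)
      fix j assume "j \<in> {..2^k::nat}"
      then have [measurable]: "X (grid k j) \<in> borel_measurable M" using X(1)[OF grid_in] by (auto intro: L2_measurable)
      show "{\<omega>\<in>space M. e \<le> \<bar>X (grid k j) \<omega>\<bar>} \<in> events" by measurable
    qed simp
    finally show ?thesis .
  qed
  have un: "{\<omega>\<in>space M. \<exists>k. \<exists>j\<le>2^k. e \<le> \<bar>X (grid k j) \<omega>\<bar>} = (\<Union>k. A k)" by (auto simp: A_def)
  show "{\<omega>\<in>space M. \<exists>k. \<exists>j\<le>2^k. e \<le> \<bar>X (grid k j) \<omega>\<bar>} \<in> events" unfolding un using Am by auto
  have inc: "incseq A"
  proof (rule incseq_SucI, rule subsetI)
    fix k \<omega> assume "\<omega> \<in> A k"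
    then obtain j where "\<omega> \<in> space M" "j \<le> 2 ^ k" "e \<le> \<bar>X (grid k j) \<omega>\<bar>" by (auto simp: A_def)
    then have "\<omega> \<in> space M \<and> 2 * j \<le> 2 ^ Suc k \<and> e \<le> \<bar>X (grid (Suc k) (2 * j)) \<omega>\<bar>"
      by (simp add: grid_refine)
    then show "\<omega> \<in> A (Suc k)" unfolding A_def by blast
  qed
  have XT: "X T \<in> L2 M" using X T_pos by simp
  have bnd: "prob (A k) \<le> (l2norm M (X T))\<^sup>2 / e\<^sup>2" for k
  proof -
    have "e\<^sup>2 * prob (A k) \<le> expectation (\<lambda>\<omega>. indicator (A k) \<omega> * (X T \<omega>)\<^sup>2)"
      unfolding A_def
      using maximal_inequality_grid[of X e "2 ^ k" k, OF X mart e order_refl] by (simp only: grid_top)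
    also have "\<dots> \<le> expectation (\<lambda>\<omega>. (X T \<omega>)\<^sup>2)"
      using integrable_mult_indicator[OF Am[of k] L2_integrable_square[OF XT]] L2_integrable_square[OF XT]
      by (intro integral_mono) (auto simp: indicator_def)
    finally show ?thesis using e by (simp add: l2norm_square field_simps)
  qed
  have "(\<lambda>k. prob (A k)) \<longlonglongrightarrow> prob (\<Union>k. A k)"
    using Am inc by (intro finite_Lim_measure_incseq) auto
  then show "prob {\<omega>\<in>space M. \<exists>k. \<exists>j\<le>2^k. e \<le> \<bar>X (grid k j) \<omega>\<bar>} \<le> (l2norm M (X T))\<^sup>2 / e\<^sup>2"
    unfolding un using bnd by (intro LIMSEQ_le_const2) auto
qed

lemma grid_bound_extends:
  assumes c: "continuous_on {0..T} f" and b: "\<And>k j. j \<le> 2 ^ k \<Longrightarrow> \<bar>f (grid k j)\<bar> \<le> e" and t: "t \<in> {0..T}"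
  shows "\<bar>f t\<bar> \<le> (e::real)"
proof -
  have "(\<lambda>k. f (grid k (gidx k t))) \<longlonglongrightarrow> f t"
    using grid_in gidx_le[OF t]
    by (intro continuous_on_tendsto_compose[OF c grid_gidx_tendsto[OF t] t] always_eventually) blast
  then have "(\<lambda>k. \<bar>f (grid k (gidx k t))\<bar>) \<longlonglongrightarrow> \<bar>f t\<bar>" by (rule tendsto_rabs)
  then show ?thesis by (rule LIMSEQ_le_const2) (use b gidx_le[OF t] in blast)
qed

lemma wi_continuous:
  assumes "valid L" "continuous_on {0..T} (\<lambda>t. W t \<omega>)"
  shows "continuous_on {0..T} (\<lambda>t. wi L t \<omega>)"
  using assms(1)
proof (induction L)
  case (Cons B L)
  obtain a b h where B: "B = (a, b, h)" by (cases B)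
  have ab: "0 \<le> a" "a \<le> b" "b \<le> T" and L: "valid L" using Cons.prems by (auto simp: B valid_block_def)
  have c: "continuous_on {0..T} (\<lambda>t. W (min t d) \<omega>)" if "0 \<le> d" for d
    using that by (intro continuous_on_compose2[OF assms(2)] continuous_intros) auto
  show ?case unfolding B wi_simps using ab by (intro continuous_intros c Cons.IH[OF L]) auto
qed simp

text \<open>Approximants within \<open>(1/4)^n\<close> of \<open>v\<close> have integrals that, by
  the maximal inequality and Borel-Cantelli, eventually differ from their successors by at most
  \<open>(1/2)^n\<close> uniformly in time. Continuity is arranged in every scenario, not just
  almost surely, because joint measurability of the integral will be read off from its
  paths.\<close>

lemma ito_exists:
  assumes v: "v \<in> L2_adapted M T W"
  obtains I where "is_ito_integral M T W v I" "\<And>\<omega>. \<omega> \<in> space M \<Longrightarrow> continuous_on {0..T} (\<lambda>t. I t \<omega>)"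
proof -
  have vP: "case_prod v \<in> L2 P" using v by (simp add: L2_adapted_iff)
  have "\<forall>n. \<exists>k h. elem k h \<and> l2norm P (\<lambda>z. case_prod (ep k h) z - case_prod v z) < (1/4)^n"
    by (intro allI step_density[OF v]) simp
  then obtain m h where mh: "\<forall>n. elem (m n) (h n) \<and> l2norm P (\<lambda>z. case_prod (ep (m n) (h n)) z - case_prod v z) < (1/4)^n"
    unfolding choice_iff by blast
  then have el: "\<And>n. elem (m n) (h n)"
    and close: "\<And>n. l2norm P (\<lambda>z. case_prod (ep (m n) (h n)) z - case_prod v z) < (1/4)^n" by simp_all
  define L where "L = (\<lambda>n. partition_blocks (2 ^ m n) (grid (m n)) (h n))"
  have vL: "valid (L n)" for n unfolding L_def by (rule valid_partition_blocks[OF el])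
  have bpL: "ep (m n) (h n) = bp (L n)" and wiL: "elementary_integral W (2 ^ m n) (grid (m n)) (h n) = wi (L n)" for n
    by (simp_all add: L_def bp_partition)
  have q0: "(\<lambda>n. (1/4 :: real)^n) \<longlonglongrightarrow> 0" by (rule LIMSEQ_power_zero) (simp add: real_norm_def)
  have tP: "L2_tends P (\<lambda>n. case_prod (bp (L n))) (case_prod v)"
    using close by (intro L2_tends_I[OF bp_L2[OF vL] vP _ q0]) (auto simp: bpL less_imp_le)
  define D where "D = (\<lambda>n. L (Suc n) @ scale_blocks (-1) (L n))"
  have vD: "valid (D n)" for n by (simp add: D_def vL valid_scale_blocks)
  have wiD: "wi (D n) t \<omega> = wi (L (Suc n)) t \<omega> - wi (L n) t \<omega>" for n t \<omega> by (simp add: D_def scale_blocks)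
  have bpD: "case_prod (bp (D n)) = (\<lambda>z. case_prod (bp (L (Suc n))) z - case_prod (bp (L n)) z)" for n
    by (auto simp: D_def scale_blocks)
  have nD: "l2norm P (case_prod (bp (D n))) \<le> 2 * (1/4)^n" for n
  proof -
    have "l2norm P (case_prod (bp (D n))) \<le> l2norm P (\<lambda>z. case_prod (bp (L (Suc n))) z - case_prod v z)
       + l2norm P (\<lambda>z. case_prod v z - case_prod (bp (L n)) z)"
      unfolding bpD by (rule l2norm_triangle_via[OF bp_L2[OF vL] vP bp_L2[OF vL]])
    also have "\<dots> \<le> (1/4)^Suc n + (1/4)^n"
      using close[of "Suc n"] close[of n] unfolding bpL l2norm_minus_commute[of P "case_prod v"]
      by linarith
    also have "\<dots> \<le> 2 * (1/4)^n" by simp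
    finally show ?thesis .
  qed
  define A where "A = (\<lambda>n. {\<omega>\<in>space M. \<exists>k. \<exists>j\<le>2^k. (1/2)^n \<le> \<bar>wi (D n) (grid k j) \<omega>\<bar>})"
  have pos: "0 < (1/2 :: real)^n" for n by simp
  note mx = maximal_inequality[of "wi (D _)", OF wi_L2[OF vD] wi_measurable[OF vD] wi_martingale[OF vD] pos]
  have Am: "A n \<in> events" for n unfolding A_def by (rule mx(1))
  \<comment> \<open>Squaring the error \<open>2 * (1/4)^n\<close> and dividing by the squared level,
    which is \<open>(1/4)^n\<close>, leaves \<open>4 * (1/4)^n\<close>: the quadratically smaller
    error beats the level, and the sum is finite.\<close>
  have Ap: "prob (A n) \<le> 4 * (1/4)^n" for n
  proof -
    have TT: "T \<in> {0..T}" using T_pos by simp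
    have "prob (A n) \<le> (l2norm M (wi (D n) T))\<^sup>2 / ((1/2)^n)\<^sup>2" unfolding A_def by (rule mx(2))
    also have "\<dots> \<le> (2 * (1/4)^n)\<^sup>2 / ((1/2)^n)\<^sup>2"
      using order_trans[OF l2norm_wi_le[OF vD TT] nD] by (intro divide_right_mono power_mono) auto
    also have "((1/2 :: real)^n)\<^sup>2 = (1/4)^n"
    proof -
      have "((1/2 :: real)^n)\<^sup>2 = ((1/2)\<^sup>2)^n" by (metis power_mult mult.commute)
      then show ?thesis by (simp add: power2_eq_square)
    qed
    also have "(2 * (1/4 :: real)^n)\<^sup>2 / (1/4)^n = 4 * (1/4)^n" unfolding power2_eq_square by simp
    finally show ?thesis .
  qed
  have "summable (\<lambda>n. prob (A n))"
  proof (rule summable_comparison_test')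
    show "summable (\<lambda>n. 4 * (1/4 :: real)^n)" by (intro summable_mult summable_geometric) (simp add: real_norm_def)
    show "norm (prob (A n)) \<le> 4 * (1/4)^n" if "0 \<le> n" for n using Ap[of n] by simp
  qed
  then have bc: "AE \<omega> in M. eventually (\<lambda>n. \<omega> \<in> space M - A n) sequentially"
    by (intro borel_cantelli_AE1 Am) (auto simp: emeasure_eq_measure)
  have Wc: "AE \<omega> in M. continuous_on {0..T} (\<lambda>t. W t \<omega>)" using BM by (simp add: brownian_motion_def)
  from bc Wc have "AE \<omega> in M. eventually (\<lambda>n. \<omega> \<in> space M - A n) sequentially \<and> continuous_on {0..T} (\<lambda>t. W t \<omega>)"
    by eventually_elim auto
  then obtain N where N: "N \<in> null_sets M"
    "\<And>\<omega>. \<omega> \<in> space M - N \<Longrightarrow> eventually (\<lambda>n. \<omega> \<in> space M - A n) sequentially \<and> continuous_on {0..T} (\<lambda>t. W t \<omega>)"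
    by (auto simp: eventually_ae_filter)
  \<comment> \<open>The default 0 on \<open>N\<close> makes the exceptional paths continuous too.
    Since \<open>N\<close> belongs to every \<open>F t\<close>, measurability survives.\<close>
  define I where "I = (\<lambda>t \<omega>. if \<omega> \<in> N then 0 else lim (\<lambda>n. wi (L n) t \<omega>))"
  have unif: "uniform_limit {0..T} (\<lambda>n t. wi (L n) t \<omega>) (\<lambda>t. I t \<omega>) sequentially"
    and cont0: "\<And>n. continuous_on {0..T} (\<lambda>t. wi (L n) t \<omega>)" if \<omega>: "\<omega> \<in> space M - N" for \<omega>
  proof -
    show ct: "\<And>n. continuous_on {0..T} (\<lambda>t. wi (L n) t \<omega>)" using wi_continuous[OF vL] N(2)[OF \<omega>] by blast
    obtain n0 where n0: "\<And>n. n0 \<le> n \<Longrightarrow> \<omega> \<in> space M - A n"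
      using N(2)[OF \<omega>] by (auto simp: eventually_sequentially)
    have step: "\<bar>wi (L (Suc n)) t \<omega> - wi (L n) t \<omega>\<bar> \<le> (1/2)^n" if n: "n0 \<le> n" and t: "t \<in> {0..T}" for n t
    proof (rule grid_bound_extends[OF _ _ t])
      show "continuous_on {0..T} (\<lambda>t. wi (L (Suc n)) t \<omega> - wi (L n) t \<omega>)"
        by (intro continuous_intros ct)
      show "\<bar>wi (L (Suc n)) (grid k j) \<omega> - wi (L n) (grid k j) \<omega>\<bar> \<le> (1/2)^n" if "j \<le> 2 ^ k" for k j
      proof -
        have "\<not> (\<exists>k. \<exists>j\<le>2^k. (1/2)^n \<le> \<bar>wi (D n) (grid k j) \<omega>\<bar>)" using n0[OF n] by (simp add: A_def)
        then have "\<not> (1/2)^n \<le> \<bar>wi (D n) (grid k j) \<omega>\<bar>" using that by blast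
        then show ?thesis by (simp add: wiD)
      qed
    qed
    \<comment> \<open>The subtracted term is the tail of the geometric series not yet used up; it
      lets the induction on \<open>d\<close> close and is dropped afterwards.\<close>
    have far: "\<bar>wi (L (n + d)) t \<omega> - wi (L n) t \<omega>\<bar> \<le> 2 * (1/2)^n - (1/2)^(n + d) * 2"
      if n: "n0 \<le> n" and t: "t \<in> {0..T}" for n d t
    proof (induction d)
      case (Suc d)
      have "\<bar>wi (L (Suc (n + d))) t \<omega> - wi (L (n + d)) t \<omega>\<bar> \<le> (1/2)^(n + d)" using n by (intro step t) simp
      then show ?case using Suc.IH by (simp add: power_add)
    qed simp
    have "uniformly_Cauchy_on {0..T} (\<lambda>n t. wi (L n) t \<omega>)"
    proof (rule uniformly_Cauchy_onI')
      fix e :: real assume e: "0 < e"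
      have "(\<lambda>n. 2 * (1/2 :: real)^n) \<longlonglongrightarrow> 2 * 0"
        by (intro tendsto_mult tendsto_const LIMSEQ_power_zero) (simp add: real_norm_def)
      then have "eventually (\<lambda>n. 2 * (1/2)^n < e) sequentially" using e by (intro order_tendstoD(2)) auto
      then obtain n1 where n1: "\<And>n. n1 \<le> n \<Longrightarrow> 2 * (1/2)^n < e" by (auto simp: eventually_sequentially)
      have "dist (wi (L p) t \<omega>) (wi (L q) t \<omega>) < e" if t: "t \<in> {0..T}" and pq: "max n0 n1 \<le> p" "p < q" for t p q
      proof -
        have "\<bar>wi (L (p + (q - p))) t \<omega> - wi (L p) t \<omega>\<bar> \<le> 2 * (1/2)^p - (1/2)^(p + (q - p)) * 2"
          using pq by (intro far t) auto
        also have "\<dots> < e"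
        proof -
          have "0 \<le> (1/2 :: real)^(p + (q - p))" by simp
          then show ?thesis using n1[of p] pq by linarith
        qed
        finally show ?thesis using pq by (simp add: dist_real_def abs_minus_commute)
      qed
      then show "\<exists>M. \<forall>x\<in>{0..T}. \<forall>m\<ge>M. \<forall>n>m. dist (wi (L m) x \<omega>) (wi (L n) x \<omega>) < e" by blast
    qed
    then have "uniformly_convergent_on {0..T} (\<lambda>n t. wi (L n) t \<omega>)" by (rule Cauchy_uniformly_convergent)
    then show "uniform_limit {0..T} (\<lambda>n t. wi (L n) t \<omega>) (\<lambda>t. I t \<omega>) sequentially"
      using \<omega> by (simp add: uniformly_convergent_uniform_limit_iff I_def)
  qed
  have cont: "continuous_on {0..T} (\<lambda>t. I t \<omega>)" if "\<omega> \<in> space M" for \<omega>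
  proof (cases "\<omega> \<in> N")
    case True
    then show ?thesis by (simp add: I_def)
  next
    case False
    then have \<omega>: "\<omega> \<in> space M - N" using that by simp
    show ?thesis
      by (rule uniform_limit_theorem[OF _ unif[OF \<omega>]]) (use cont0[OF \<omega>] in auto)
  qed
  have IF: "I t \<in> borel_measurable (F t)" if t: "t \<in> {0..T}" for t
  proof -
    have wF[measurable]: "wi (L n) t \<in> borel_measurable (F t)" for n by (rule wi_measurable[OF vL t])
    have "(\<lambda>\<omega>. lim (\<lambda>n. wi (L n) t \<omega>)) \<in> borel_measurable (F t)" by measurable
    then show ?thesis unfolding I_def using null_sets_F[OF N(1), of t] by measurable
  qed
  have tM: "L2_tends M (\<lambda>n. wi (L n) t) (I t)" if t: "t \<in> {0..T}" for t
  proof -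
    have wL: "wi (L n) t \<in> L2 M" for n by (rule wi_L2[OF vL t])
    have "\<exists>K. \<forall>j\<ge>K. \<forall>k\<ge>K. l2norm M (\<lambda>x. wi (L j) t x - wi (L k) t x) < e" if e: "0 < e" for e
    proof -
      obtain K where K: "\<forall>j\<ge>K. \<forall>k\<ge>K. l2norm P (\<lambda>z. case_prod (bp (L j)) z - case_prod (bp (L k)) z) < e"
        using L2_tends_Cauchy[OF tP e] by blast
      have "l2norm M (\<lambda>x. wi (L j) t x - wi (L k) t x) \<le> l2norm P (\<lambda>z. case_prod (bp (L j)) z - case_prod (bp (L k)) z)" for j k
      proof -
        have v: "valid (L j @ scale_blocks (-1) (L k))" by (simp add: vL valid_scale_blocks)
        have b: "case_prod (bp (L j @ scale_blocks (-1) (L k))) = (\<lambda>z. case_prod (bp (L j)) z - case_prod (bp (L k)) z)"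
          by (auto simp: scale_blocks)
        have w: "wi (L j @ scale_blocks (-1) (L k)) t = (\<lambda>x. wi (L j) t x - wi (L k) t x)"
          by (auto simp: scale_blocks)
        show ?thesis using l2norm_wi_le[OF v t] unfolding b w .
      qed
      then show ?thesis using K by (meson order_le_less_trans)
    qed
    from L2_complete_pointwise[OF wL this] obtain r where r: "strict_mono r"
      "L2_tends M (\<lambda>n. wi (L n) t) (\<lambda>x. lim (\<lambda>k. wi (L (r k)) t x))" by blast
    show ?thesis
    proof (rule L2_tends_cong_AE[OF r(2)])
      show "I t \<in> borel_measurable M" using measurable_F_M[OF IF[OF t]] t by simp
      have "AE \<omega> in M. \<omega> \<notin> N" using N(1) by (rule AE_not_in)
      then show "AE x in M. lim (\<lambda>k. wi (L (r k)) t x) = I t x"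
        using AE_space
      proof eventually_elim
        case (elim \<omega>)
        then have "\<omega> \<in> space M - N" by simp
        from tendsto_uniform_limitI[OF unif[OF this] t]
        have "(\<lambda>n. wi (L n) t \<omega>) \<longlonglongrightarrow> I t \<omega>" .
        from LIMSEQ_subseq_LIMSEQ[OF this r(1)] show ?case by (simp add: o_def limI)
      qed
    qed
  qed
  have "is_ito_integral M T W v I"
    unfolding is_ito_integral_def
  proof (intro conjI exI)
    show "v \<in> L2_adapted M T W" by (rule v)
    show "\<forall>t\<in>{0..T}. I t \<in> borel_measurable (F t)" using IF by blast
    show "AE \<omega> in M. continuous_on {0..T} (\<lambda>t. I t \<omega>)" using cont by (intro AE_I2)
    show "\<forall>k. elementary M T W (2 ^ m k) (grid (m k)) (h k)" using el by blast
    have dL: "(\<lambda>z. case_prod (bp (L k)) z - case_prod v z) \<in> L2 P" for k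
      by (rule L2_diff[OF bp_L2[OF vL] vP])
    have dP: "case_prod (\<lambda>t \<omega>. bp (L k) t \<omega> - v t \<omega>) = (\<lambda>z. case_prod (bp (L k)) z - case_prod v z)" for k
      by auto
    have "energy M T (\<lambda>t \<omega>. bp (L k) t \<omega> - v t \<omega>)
      = ennreal ((l2norm P (\<lambda>z. case_prod (bp (L k)) z - case_prod v z))\<^sup>2)" for k
      using energy_eq_l2norm[of "\<lambda>t \<omega>. bp (L k) t \<omega> - v t \<omega>"] dL unfolding dP by simp
    then show "(\<lambda>k. energy M T (\<lambda>t \<omega>. ep (m k) (h k) t \<omega> - v t \<omega>)) \<longlonglongrightarrow> 0"
      unfolding bpL using tP by (simp add: L2_tends_def ennreal_square_tendsto_0_iff)
    show "\<forall>t\<in>{0..T}. (\<lambda>k. \<integral>\<^sup>+\<omega>. ennreal ((elementary_integral W (2 ^ m k) (grid (m k)) (h k) t \<omega> - I t \<omega>)\<^sup>2) \<partial>M) \<longlonglongrightarrow> 0"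
    proof
      fix t assume t: "t \<in> {0..T}"
      have "(\<integral>\<^sup>+\<omega>. ennreal ((wi (L k) t \<omega> - I t \<omega>)\<^sup>2) \<partial>M) = ennreal ((l2norm M (\<lambda>\<omega>. wi (L k) t \<omega> - I t \<omega>))\<^sup>2)" for k
        using tM[OF t] by (intro nn_integral_square_l2norm L2_diff) (auto simp: L2_tends_def)
      then show "(\<lambda>k. \<integral>\<^sup>+\<omega>. ennreal ((elementary_integral W (2 ^ m k) (grid (m k)) (h k) t \<omega> - I t \<omega>)\<^sup>2) \<partial>M) \<longlonglongrightarrow> 0"
        unfolding wiL using tM[OF t] by (simp add: L2_tends_def ennreal_square_tendsto_0_iff)
    qed
  qed
  then show thesis using that cont by blast
qed

lemma ito_exists':
  assumes "v \<in> L2_adapted M T W" shows "\<exists>I. ito v I"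
proof -
  obtain I where "is_ito_integral M T W v I" using ito_exists[OF assms] .
  then show ?thesis by (intro exI is_ito_integral_imp_ito)
qed

text \<open>The isometry gives equality at each dyadic time. These are countably many, and
  continuity extends the equality to all times off one null set.\<close>

lemma is_ito_integral_unique:
  assumes "is_ito_integral M T W v I" "is_ito_integral M T W w J" "AE z in P. case_prod v z = case_prod w z"
  shows "AE \<omega> in M. \<forall>t\<in>{0..T}. I t \<omega> = J t \<omega>"
proof -
  have c: "AE \<omega> in M. continuous_on {0..T} (\<lambda>t. I t \<omega>)" "AE \<omega> in M. continuous_on {0..T} (\<lambda>t. J t \<omega>)"
    using assms by (auto simp: is_ito_integral_def)
  have "AE \<omega> in M. \<forall>k j. j \<le> 2 ^ k \<longrightarrow> I (grid k j) \<omega> = J (grid k j) \<omega>"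
    using ito_unique[OF assms(1,2)[THEN is_ito_integral_imp_ito] assms(3) grid_in] by (simp add: AE_all_countable)
  with c show ?thesis
  proof eventually_elim
    case (elim \<omega>)
    have "\<bar>I t \<omega> - J t \<omega>\<bar> \<le> 0" if t: "t \<in> {0..T}" for t
      by (rule grid_bound_extends[OF continuous_on_diff[OF elim(1,2)] _ t]) (use elim(3) in auto)
    then show ?case by simp
  qed
qed

text \<open>The process sampled at the next grid point is a finite sum of products of a function of
  time and a function of the scenario; by continuity it converges to \<open>X\<close> everywhere on
  the product.\<close>

lemma continuous_joint_measurable:
  fixes X :: "'a process"
  assumes X: "\<And>t. t \<in> {0..T} \<Longrightarrow> X t \<in> borel_measurable M"
    and c: "\<And>\<omega>. \<omega> \<in> space M \<Longrightarrow> continuous_on {0..T} (\<lambda>t. X t \<omega>)"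
  shows "case_prod X \<in> borel_measurable P"
proof -
  let ?Y = "\<lambda>k z. \<Sum>j\<le>2^k. indicator {t. gidx k t = j} (fst z) * X (grid k j) (snd z)"
  have Y: "?Y k \<in> borel_measurable P" for k
  proof (intro borel_measurable_sum borel_measurable_times)
    fix j :: nat assume "j \<in> {..2 ^ k}"
    then show "(\<lambda>z. X (grid k j) (snd z)) \<in> borel_measurable P" using X[OF grid_in] by (intro lift_M_P) auto
    have "{t. gidx k t = j} \<in> sets borel" unfolding gidx_def by measurable
    then show "(\<lambda>z. indicator {t. gidx k t = j} (fst z) :: real) \<in> borel_measurable P" by (rule indicator_P)
  qed
  have lim: "(\<lambda>k. ?Y k z) \<longlonglongrightarrow> case_prod X z" if "z \<in> space P" for z
  proof -
    from that obtain t \<omega> where z: "z = (t, \<omega>)" "t \<in> {0..T}" "\<omega> \<in> space M" by (auto simp: space_P)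
  have "?Y k z = X (grid k (gidx k t)) \<omega>" for k
  proof -
    have "?Y k z = (\<Sum>j\<le>2^k. if j = gidx k t then X (grid k j) \<omega> else 0)"
      unfolding z by (intro sum.cong) (auto simp: indicator_def)
    also have "\<dots> = X (grid k (gidx k t)) \<omega>" using gidx_le[OF z(2)] by simp
    finally show ?thesis .
  qed
  moreover have "(\<lambda>k. X (grid k (gidx k t)) \<omega>) \<longlonglongrightarrow> X t \<omega>"
    using grid_in gidx_le[OF z(2)]
    by (intro continuous_on_tendsto_compose[OF c[OF z(3)] grid_gidx_tendsto[OF z(2)] z(2)] always_eventually) blast
  ultimately show ?thesis by (simp add: z)
  qed
  show ?thesis by (rule borel_measurable_LIMSEQ_metric[OF Y lim])
qed

text \<open>By the isometry the norm of every time slice is at most that of \<open>v\<close>, so the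
  energy is at most \<open>T\<close> times the squared norm of \<open>v\<close>.\<close>

lemma ito_continuous_L2_adapted:
  assumes I: "ito v I" and c: "\<And>\<omega>. \<omega> \<in> space M \<Longrightarrow> continuous_on {0..T} (\<lambda>t. I t \<omega>)"
  shows "I \<in> L2_adapted M T W"
proof -
  have m: "case_prod I \<in> borel_measurable P"
    by (rule continuous_joint_measurable[OF L2_measurable[OF ito_L2[OF I]] c])
  have "(\<integral>\<^sup>+z. ennreal (norm ((case_prod I z)\<^sup>2)) \<partial>P) = (\<integral>\<^sup>+t. \<integral>\<^sup>+\<omega>. ennreal ((I t \<omega>)\<^sup>2) \<partial>M \<partial>R)"
    using m unfolding time_scenario_def by (subst nn_integral_fst[symmetric]) auto
  also have "\<dots> \<le> (\<integral>\<^sup>+t. ennreal ((l2norm P (case_prod v))\<^sup>2) \<partial>R)"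
  proof (rule nn_integral_mono)
    fix t assume "t \<in> space R"
    then have t: "t \<in> {0..T}" by (simp add: space_R)
    have "l2norm M (I t) \<le> l2norm P (case_prod v)"
      unfolding ito_norm[OF I t] by (rule l2norm_indicator_P_le[OF ito_integrand_L2[OF I]]) simp
    then have "(l2norm M (I t))\<^sup>2 \<le> (l2norm P (case_prod v))\<^sup>2" by (intro power_mono) auto
    then show "(\<integral>\<^sup>+\<omega>. ennreal ((I t \<omega>)\<^sup>2) \<partial>M) \<le> ennreal ((l2norm P (case_prod v))\<^sup>2)"
      unfolding nn_integral_square_l2norm[OF ito_L2[OF I t]] by (rule ennreal_leI)
  qed
  also have "\<dots> = ennreal ((l2norm P (case_prod v))\<^sup>2) * emeasure R (space R)" by simp
  also have "\<dots> < \<infinity>"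
    using R.emeasure_finite[of "space R"] unfolding infinity_ennreal_def
    by (intro ennreal_mult_less_top[THEN iffD2] disjI2 conjI) (simp, metis top.not_eq_extremum)
  finally have "case_prod I \<in> L2 P" using m by (intro L2_I integrableI_bounded) auto
  then show ?thesis using ito_measurable[OF I] m by (auto simp: L2_adapted_iff adapted_def)
qed

end

section \<open>Pathwise linear equations\<close>

text \<open>Over \<open>N\<close> equal pieces the bounds telescope to
  \<open>t / N * (K t - K 0)\<close>, which tends to 0. This takes the place of differentiation for
  integrands that are merely measurable.\<close>

lemma constant_if_increments_small:
  fixes Q K :: "real \<Rightarrow> real"
  assumes inc: "\<And>s t. 0 \<le> s \<Longrightarrow> s \<le> t \<Longrightarrow> t \<le> b \<Longrightarrow> \<bar>Q t - Q s\<bar> \<le> (t - s) * (K t - K s)"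
    and t: "0 \<le> t" "t \<le> b"
  shows "Q t = Q 0"
proof -
  have n: "\<bar>Q t - Q 0\<bar> * real (Suc n) \<le> t * (K t - K 0)" for n
  proof -
    define N where "N = real (Suc n)"
    have N: "0 < N" by (simp add: N_def)
    define p where "p = (\<lambda>j. t * real j / N)"
    have p0: "p 0 = 0" and pn: "p (Suc n) = t" using N by (simp_all add: p_def N_def[symmetric] del: of_nat_Suc)
    have pm: "0 \<le> p j" "p j \<le> p (Suc j)" for j
      using t N by (auto simp: p_def intro!: divide_right_mono mult_left_mono)
    have pt: "p j \<le> t" if "j \<le> Suc n" for j
    proof -
      have "real j \<le> N" using that unfolding N_def by (simp only: of_nat_le_iff)
      then have "t * real j \<le> t * N" using t by (intro mult_left_mono) auto
      then show ?thesis using N by (simp add: p_def field_simps)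
    qed
    have ps: "p (Suc j) - p j = t / N" for j using N by (simp add: p_def field_simps)
    have "Q t - Q 0 = (\<Sum>j<Suc n. Q (p (Suc j)) - Q (p j))"
      by (subst sum_lessThan_telescope) (simp add: p0 pn)
    then have "\<bar>Q t - Q 0\<bar> \<le> (\<Sum>j<Suc n. \<bar>Q (p (Suc j)) - Q (p j)\<bar>)" by (metis sum_abs)
    also have "\<dots> \<le> (\<Sum>j<Suc n. t / N * (K (p (Suc j)) - K (p j)))"
    proof (rule sum_mono)
      fix j assume "j \<in> {..<Suc n}"
      then have "p (Suc j) \<le> t" by (intro pt) simp
      then show "\<bar>Q (p (Suc j)) - Q (p j)\<bar> \<le> t / N * (K (p (Suc j)) - K (p j))"
        using inc[OF pm(1)[of j] pm(2)[of j]] t by (simp add: ps)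
    qed
    also have "\<dots> = t / N * (K t - K 0)"
      unfolding sum_distrib_left[symmetric] by (subst sum_lessThan_telescope) (simp only: p0 pn)
    finally show ?thesis using N unfolding N_def[symmetric] by (simp add: field_simps)
  qed
  show ?thesis
  proof (rule ccontr)
    assume "Q t \<noteq> Q 0"
    then have pos: "0 < \<bar>Q t - Q 0\<bar>" by simp
    obtain n where "t * (K t - K 0) / \<bar>Q t - Q 0\<bar> < real n" using reals_Archimedean2 by blast
    then have "t * (K t - K 0) < \<bar>Q t - Q 0\<bar> * real n" using pos by (simp add: field_simps)
    also have "\<dots> \<le> \<bar>Q t - Q 0\<bar> * real (Suc n)" by (intro mult_left_mono) auto
    finally show False using n[of n] by simp
  qed
qed

lemma abs_exp_minus_one_le: "\<bar>exp x - 1\<bar> \<le> \<bar>x\<bar> * exp \<bar>x\<bar>" for x :: real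
proof (cases "0 \<le> x")
  case True
  have "(1 - x) * exp x \<le> exp (- x) * exp x"
    using exp_ge_add_one_self[of "- x"] by (intro mult_right_mono) auto
  then show ?thesis using True by (simp add: exp_minus algebra_simps)
next
  case False
  have "1 - exp x \<le> - x" using exp_ge_add_one_self[of x] by linarith
  also have "\<dots> \<le> \<bar>x\<bar> * exp \<bar>x\<bar>" using False mult_left_mono[of 1 "exp \<bar>x\<bar>" "\<bar>x\<bar>"] by simp
  finally show ?thesis using False by simp
qed

lemma abs_exp_minus_one_minus_le: "\<bar>exp x - 1 - x\<bar> \<le> x\<^sup>2 * exp \<bar>x\<bar>" for x :: real
proof -
  have "(1 - x) * exp x \<le> exp (- x) * exp x"
    using exp_ge_add_one_self[of "- x"] by (intro mult_right_mono) auto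
  then have "exp x - 1 - x \<le> x * (exp x - 1)" by (simp add: exp_minus algebra_simps)
  also have "\<dots> \<le> \<bar>x\<bar> * \<bar>exp x - 1\<bar>" by (metis abs_ge_self abs_mult)
  also have "\<dots> \<le> \<bar>x\<bar> * (\<bar>x\<bar> * exp \<bar>x\<bar>)" by (intro mult_left_mono abs_exp_minus_one_le) simp
  also have "\<dots> = x\<^sup>2 * exp \<bar>x\<bar>" by (simp add: power2_eq_square)
  finally show ?thesis using exp_ge_add_one_self[of x] by linarith
qed

context brownian_setting
begin

section \<open>Indefinite integrals along a single path: product rule, exponential, linear
  equations\<close>

definition pint :: "(real \<Rightarrow> real) \<Rightarrow> real \<Rightarrow> real" where
  "pint f t = (\<integral>s. indicator {..t} s * f s \<partial>R)"

lemma TI_pint: "TI v t \<omega> = pint (\<lambda>s. v s \<omega>) t"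
  by (simp add: TI_def pint_def)

lemma borel_R: "f \<in> borel_measurable borel \<Longrightarrow> f \<in> borel_measurable R" for f :: "real \<Rightarrow> real"
  by (rule measurable_restrict_space1) simp

lemma indicator_R: "A \<in> sets borel \<Longrightarrow> (\<lambda>s. indicator A s :: real) \<in> borel_measurable R"
  by (rule borel_R) simp

lemma integrable_indicator_R:
  fixes f :: "real \<Rightarrow> real"
  assumes "integrable R f" "A \<in> sets borel"
  shows "integrable R (\<lambda>s. indicator A s * f s)"
proof (rule Bochner_Integration.integrable_bound[OF assms(1)])
  show "(\<lambda>s. indicator A s * f s) \<in> borel_measurable R" using indicator_R[OF assms(2)] assms(1) by auto
qed (auto simp: indicator_def)

lemma integrable_bounded_mult_R:
  fixes f g :: "real \<Rightarrow> real"
  assumes "integrable R f" "g \<in> borel_measurable R" "\<And>s. s \<in> {0..T} \<Longrightarrow> \<bar>g s\<bar> \<le> C"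
  shows "integrable R (\<lambda>s. g s * f s)"
proof (rule Bochner_Integration.integrable_bound)
  show "integrable R (\<lambda>s. C * \<bar>f s\<bar>)" using assms(1) by auto
  show "(\<lambda>s. g s * f s) \<in> borel_measurable R" using assms by auto
  show "AE s in R. norm (g s * f s) \<le> norm (C * \<bar>f s\<bar>)"
  proof (rule AE_I2)
    fix s assume "s \<in> space R"
    then have "\<bar>g s\<bar> \<le> C" using assms(3) by (simp add: space_R)
    then have "\<bar>g s\<bar> * \<bar>f s\<bar> \<le> C * \<bar>f s\<bar>" by (rule mult_right_mono) simp
    then show "norm (g s * f s) \<le> norm (C * \<bar>f s\<bar>)"
      unfolding real_norm_def abs_mult[of "g s"] by (rule order_trans[OF _ abs_ge_self])
  qed
qed

lemma integrable_bounded_R: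
  fixes g :: "real \<Rightarrow> real"
  assumes "g \<in> borel_measurable R" "\<And>s. s \<in> {0..T} \<Longrightarrow> \<bar>g s\<bar> \<le> C"
  shows "integrable R g"
  using integrable_bounded_mult_R[of "\<lambda>_. 1" g C] assms by simp

lemma pint_increment:
  assumes "integrable R f" "s \<le> t"
  shows "pint f t - pint f s = (\<integral>u. indicator {s<..t} u * f u \<partial>R)"
proof -
  have "pint f t - pint f s = (\<integral>u. indicator {..t} u * f u - indicator {..s} u * f u \<partial>R)"
    unfolding pint_def using integrable_indicator_R[OF assms(1)] by simp
  also have "\<dots> = (\<integral>u. indicator {s<..t} u * f u \<partial>R)"
    using assms(2) by (intro Bochner_Integration.integral_cong) (auto simp: indicator_def)
  finally show ?thesis .
qed

lemma AE_R_neq: "AE s in R. s \<noteq> t"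
proof -
  have "AE s in lborel. s \<in> {0..T} \<longrightarrow> s \<noteq> t" using AE_lborel_singleton[of t] by eventually_elim simp
  then show ?thesis by (subst AE_restrict_space_iff) auto
qed

lemma pint_0: "pint f 0 = 0"
  unfolding pint_def
proof (rule integral_eq_zero_AE)
  show "AE s in R. indicator {..0} s * f s = 0"
    using AE_R_neq[of 0] AE_space[of R] by eventually_elim (auto simp: indicator_def space_R)
qed

lemma pint_cong: "(\<And>s. s \<in> {0..T} \<Longrightarrow> f s = g s) \<Longrightarrow> pint f t = pint g t"
  unfolding pint_def by (intro Bochner_Integration.integral_cong) (auto simp: space_R)

lemma pint_cong_AE:
  assumes "AE s in R. f s = g s" "f \<in> borel_measurable R" "g \<in> borel_measurable R"
  shows "pint f t = pint g t"
  unfolding pint_def using assms indicator_R[of "{..t}"] by (intro integral_cong_AE) auto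

lemma pint_add: "integrable R f \<Longrightarrow> integrable R g \<Longrightarrow> pint (\<lambda>s. f s + g s) t = pint f t + pint g t"
  unfolding pint_def distrib_left
  by (rule Bochner_Integration.integral_add) (auto intro: integrable_indicator_R)

lemma pint_T: "pint f T = (\<integral>s. f s \<partial>R)"
  unfolding pint_def by (intro Bochner_Integration.integral_cong) (auto simp: space_R)

lemma pint_bound:
  assumes "integrable R f" shows "\<bar>pint f t\<bar> \<le> (\<integral>s. \<bar>f s\<bar> \<partial>R)"
proof -
  have "\<bar>pint f t\<bar> \<le> (\<integral>s. \<bar>indicator {..t} s * f s\<bar> \<partial>R)" unfolding pint_def by (rule integral_abs_bound)
  also have "\<dots> \<le> (\<integral>s. \<bar>f s\<bar> \<partial>R)"
    using assms integrable_indicator_R[OF assms, of "{..t}"]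
    by (intro integral_mono) (auto simp: indicator_def)
  finally show ?thesis .
qed

lemma pint_measurable:
  assumes "integrable R f" shows "pint f \<in> borel_measurable R"
proof -
  have f[measurable]: "f \<in> borel_measurable R" using assms by auto
  have id[measurable]: "(\<lambda>s. s) \<in> borel_measurable R" by (rule borel_R) simp
  have "(\<lambda>z. indicator {s. s \<le> fst z} (snd z) * f (snd z)) \<in> borel_measurable (R \<Otimes>\<^sub>M R)"
  proof -
    have a: "(\<lambda>z. fst z) \<in> borel_measurable (R \<Otimes>\<^sub>M R)" "(\<lambda>z. snd z) \<in> borel_measurable (R \<Otimes>\<^sub>M R)"
      using measurable_compose[OF measurable_fst id] measurable_compose[OF measurable_snd id] by auto
    have "{z \<in> space (R \<Otimes>\<^sub>M R). snd z \<le> fst z} \<in> sets (R \<Otimes>\<^sub>M R)"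
      using a by measurable
    then have "(\<lambda>z. indicator {z \<in> space (R \<Otimes>\<^sub>M R). snd z \<le> fst z} z * f (snd z)) \<in> borel_measurable (R \<Otimes>\<^sub>M R)"
      by measurable
    then show ?thesis by (rule measurable_cong[THEN iffD1, rotated]) (auto simp: indicator_def)
  qed
  from R.borel_measurable_lebesgue_integral[of "\<lambda>t s. indicator {..t} s * f s" R] this
  show ?thesis unfolding pint_def[abs_def] by (simp add: split_beta' indicator_def)
qed

text \<open>Dominated convergence: as the upper limit tends to \<open>a\<close>, the indicators
  converge at every time other than \<open>a\<close>, and a single time is null.\<close>

lemma pint_continuous:
  assumes f: "integrable R f" shows "continuous_on A (pint f)"
  unfolding continuous_on_sequentially
proof (intro allI ballI impI, elim conjE)
  fix x a assume "\<forall>n. x n \<in> A" and lim: "x \<longlonglongrightarrow> a"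
  show "(pint f \<circ> x) \<longlonglongrightarrow> pint f a"
    unfolding o_def pint_def
  proof (rule integral_dominated_convergence[where w="\<lambda>s. \<bar>f s\<bar>"])
    show "AE s in R. (\<lambda>n. indicator {..x n} s * f s) \<longlonglongrightarrow> indicator {..a} s * f s"
      using AE_R_neq[of a]
    proof eventually_elim
      case (elim s)
      then consider "s < a" | "a < s" by linarith
      then show ?case
      proof cases
        case 1
        then have "eventually (\<lambda>n. s < x n) sequentially" using order_tendstoD(1)[OF lim] by blast
        then have "eventually (\<lambda>n. indicator {..x n} s * f s = indicator {..a} s * f s) sequentially"
          by eventually_elim (use 1 in \<open>auto simp: indicator_def\<close>)
        then show ?thesis by (rule tendsto_eventually)
      next
        case 2
        then have "eventually (\<lambda>n. x n < s) sequentially" using order_tendstoD(2)[OF lim] by blast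
        then have "eventually (\<lambda>n. indicator {..x n} s * f s = indicator {..a} s * f s) sequentially"
          by eventually_elim (use 2 in \<open>auto simp: indicator_def\<close>)
        then show ?thesis by (rule tendsto_eventually)
      qed
    qed
    show "AE s in R. norm (indicator {..x n} s * f s) \<le> \<bar>f s\<bar>" for n by (auto simp: indicator_def)
    show "(\<lambda>s. indicator {..x n} s * f s) \<in> borel_measurable R" for n
      using integrable_indicator_R[OF f, of "{..x n}"] by auto
    show "(\<lambda>s. indicator {..a} s * f s) \<in> borel_measurable R"
      using integrable_indicator_R[OF f, of "{..a}"] by auto
  qed (use f in auto)
qed

lemma measure_Ioc_R:
  assumes "0 \<le> s" "s \<le> t" "t \<le> T"
  shows "(\<integral>u. indicator {s<..t} u \<partial>R) = t - s"
proof -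
  have "{s<..t} \<inter> {0..T} = {s<..t}" using assms by auto
  then show ?thesis using integral_indicator_R[of "{s<..t}"] assms by simp
qed

lemma pint_lipschitz:
  assumes g: "g \<in> borel_measurable R" "\<And>s. s \<in> {0..T} \<Longrightarrow> \<bar>g s\<bar> \<le> C" and st: "0 \<le> s" "s \<le> t" "t \<le> T"
  shows "\<bar>pint g t - pint g s\<bar> \<le> C * (t - s)"
proof -
  have gi: "integrable R g" by (rule integrable_bounded_R[OF g])
  have "\<bar>pint g t - pint g s\<bar> \<le> (\<integral>u. \<bar>indicator {s<..t} u * g u\<bar> \<partial>R)"
    unfolding pint_increment[OF gi st(2)] by (rule integral_abs_bound)
  also have "\<dots> \<le> (\<integral>u. indicator {s<..t} u * C \<partial>R)"
  proof (rule integral_mono)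
    show "integrable R (\<lambda>u. \<bar>indicator {s<..t} u * g u\<bar>)" using integrable_indicator_R[OF gi] by auto
    show "integrable R (\<lambda>u. indicator {s<..t} u * C)" by (rule integrable_indicator_R) auto
  qed (use g(2) in \<open>auto simp: indicator_def space_R\<close>)
  also have "\<dots> = C * (t - s)" using measure_Ioc_R[OF st] by simp
  finally show ?thesis .
qed

text \<open>The difference \<open>Q\<close> of the two sides has increments of second order: over
  \<open>(s, t]\<close> the function \<open>g\<close> is multiplied by an increment of
  \<open>H\<close>, and \<open>h\<close> by an increment of \<open>G\<close>, so
  \<open>constant_if_increments_small\<close> applies.\<close>

lemma pint_product_rule:
  assumes g: "g \<in> borel_measurable R" "\<And>s. s \<in> {0..T} \<Longrightarrow> \<bar>g s\<bar> \<le> C" and h: "integrable R h"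
    and G: "\<And>t. t \<in> {0..T} \<Longrightarrow> G t = G0 + pint g t" and H: "\<And>t. t \<in> {0..T} \<Longrightarrow> H t = H0 + pint h t"
    and t: "t \<in> {0..T}"
  shows "G t * H t = G0 * H0 + pint (\<lambda>s. g s * H s + G s * h s) t"
    and "integrable R (\<lambda>s. g s * H s + G s * h s)"
proof -
  have gi: "integrable R g" by (rule integrable_bounded_R[OF g])
  have C0: "0 \<le> C" using g(2)[OF t] by linarith
  have Gm: "G \<in> borel_measurable R"
  proof -
    have "(\<lambda>t. G0 + pint g t) \<in> borel_measurable R" using pint_measurable[OF gi] by measurable
    then show ?thesis by (rule measurable_cong[THEN iffD1, rotated]) (simp add: G space_R)
  qed
  have Hm: "H \<in> borel_measurable R"
  proof -
    have "(\<lambda>t. H0 + pint h t) \<in> borel_measurable R" using pint_measurable[OF h] by measurable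
    then show ?thesis by (rule measurable_cong[THEN iffD1, rotated]) (simp add: H space_R)
  qed
  have Gb: "\<bar>G s\<bar> \<le> \<bar>G0\<bar> + (\<integral>s. \<bar>g s\<bar> \<partial>R)" if "s \<in> {0..T}" for s
    using G[OF that] pint_bound[OF gi, of s] by linarith
  have Hb: "\<bar>H s\<bar> \<le> \<bar>H0\<bar> + (\<integral>s. \<bar>h s\<bar> \<partial>R)" if "s \<in> {0..T}" for s
    using H[OF that] pint_bound[OF h, of s] by linarith
  have Hi: "integrable R H" by (rule integrable_bounded_R[OF Hm Hb])
  have i1: "integrable R (\<lambda>s. g s * H s)" by (rule integrable_bounded_mult_R[OF Hi g])
  have i2: "integrable R (\<lambda>s. G s * h s)" by (rule integrable_bounded_mult_R[OF h Gm Gb])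
  show i: "integrable R (\<lambda>s. g s * H s + G s * h s)" using i1 i2 by simp
  define Q where "Q = (\<lambda>t. G t * H t - pint (\<lambda>s. g s * H s + G s * h s) t)"
  \<comment> \<open>There are two error terms. In one \<open>g\<close> is at most \<open>C\<close>
    and \<open>H\<close> moves by at most the integral of \<open>\<bar>h\<bar>\<close> over the
    interval; in the other \<open>G\<close> moves by at most \<open>C * (t - s)\<close>. Hence the
    factor \<open>2 * C\<close>.\<close>
  define K where "K = (\<lambda>t. 2 * C * pint (\<lambda>s. \<bar>h s\<bar>) t)"
  have ha: "integrable R (\<lambda>s. \<bar>h s\<bar>)" using h by simp
  have "Q t = Q 0"
  proof (rule constant_if_increments_small[of T Q K])
    fix s t assume st: "0 \<le> s" "s \<le> t" "t \<le> T"
    then have sT: "s \<in> {0..T}" "t \<in> {0..T}" by auto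
    let ?i = "\<lambda>u. indicator {s<..t} u :: real"
    have ig: "integrable R (\<lambda>u. ?i u * g u)" and ih: "integrable R (\<lambda>u. ?i u * h u)"
      and iH: "integrable R (\<lambda>u. ?i u * (g u * H u + G u * h u))"
      using integrable_indicator_R gi h i by auto
    define k where "k = pint (\<lambda>s. \<bar>h s\<bar>) t - pint (\<lambda>s. \<bar>h s\<bar>) s"
    have k: "k = (\<integral>u. ?i u * \<bar>h u\<bar> \<partial>R)" unfolding k_def by (rule pint_increment[OF ha st(2)])
    have "Q t - Q s = (G t - G s) * H t + G s * (H t - H s)
        - (pint (\<lambda>s. g s * H s + G s * h s) t - pint (\<lambda>s. g s * H s + G s * h s) s)"
      by (simp add: Q_def algebra_simps)
    also have "\<dots> = (\<integral>u. ?i u * g u \<partial>R) * H t + G s * (\<integral>u. ?i u * h u \<partial>R) - (\<integral>u. ?i u * (g u * H u + G u * h u) \<partial>R)"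
      using pint_increment[OF gi st(2)] pint_increment[OF h st(2)] pint_increment[OF i st(2)] G[OF sT(1)] G[OF sT(2)]
        H[OF sT(1)] H[OF sT(2)] by simp
    also have "\<dots> = (\<integral>u. (?i u * g u) * H t + G s * (?i u * h u) - ?i u * (g u * H u + G u * h u) \<partial>R)"
      using ig ih iH by simp
    also have "\<dots> = (\<integral>u. ?i u * (g u * (H t - H u) + (G s - G u) * h u) \<partial>R)"
      by (intro Bochner_Integration.integral_cong) (auto simp: algebra_simps)
    finally have e: "Q t - Q s = (\<integral>u. ?i u * (g u * (H t - H u) + (G s - G u) * h u) \<partial>R)" .
    have ii: "integrable R (\<lambda>u. ?i u * (g u * (H t - H u) + (G s - G u) * h u))"
    proof (rule integrable_indicator_R)
      have "integrable R (\<lambda>u. (H t * g u - g u * H u) + (G s * h u - G u * h u))"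
        using gi i1 i2 h by simp
      then show "integrable R (\<lambda>u. g u * (H t - H u) + (G s - G u) * h u)" by (simp add: algebra_simps)
    qed simp
    have "\<bar>Q t - Q s\<bar> \<le> (\<integral>u. \<bar>?i u * (g u * (H t - H u) + (G s - G u) * h u)\<bar> \<partial>R)"
      unfolding e by (rule integral_abs_bound)
    also have "\<dots> \<le> (\<integral>u. ?i u * (C * k) + (C * (t - s)) * (?i u * \<bar>h u\<bar>) \<partial>R)"
    proof (rule integral_mono)
      show "integrable R (\<lambda>u. ?i u * (C * k) + (C * (t - s)) * (?i u * \<bar>h u\<bar>))"
        using integrable_indicator_R[OF ha, of "{s<..t}"] integrable_indicator_R[of "\<lambda>_. C * k" "{s<..t}"] by simp
      fix u
      show "\<bar>?i u * (g u * (H t - H u) + (G s - G u) * h u)\<bar> \<le> ?i u * (C * k) + (C * (t - s)) * (?i u * \<bar>h u\<bar>)"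
      proof (cases "u \<in> {s<..t}")
        case True
        then have u: "s \<le> u" "u \<le> t" "u \<in> {0..T}" using st by auto
        have "\<bar>H t - H u\<bar> \<le> k"
        proof -
          have "\<bar>H t - H u\<bar> \<le> (\<integral>v. \<bar>indicator {u<..t} v * h v\<bar> \<partial>R)"
            using pint_increment[OF h u(2)] H[OF sT(2)] H[OF u(3)] integral_abs_bound[of R "\<lambda>v. indicator {u<..t} v * h v"] by simp
          also have "\<dots> \<le> k" unfolding k
            using integrable_indicator_R[OF h, of "{u<..t}"] integrable_indicator_R[OF ha, of "{s<..t}"] u(1)
            by (intro integral_mono) (auto simp: indicator_def)
          finally show ?thesis .
        qed
        then have 1: "\<bar>g u * (H t - H u)\<bar> \<le> C * k" using g(2)[OF u(3)] C0 unfolding abs_mult by (intro mult_mono) auto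
        have "\<bar>G s - G u\<bar> \<le> C * (u - s)"
          using pint_lipschitz[OF g st(1) u(1)] u(2) st(3) G[OF sT(1)] G[OF u(3)] by simp
        also have "\<dots> \<le> C * (t - s)" using u C0 by (intro mult_left_mono) auto
        finally have 2: "\<bar>(G s - G u) * h u\<bar> \<le> C * (t - s) * \<bar>h u\<bar>" unfolding abs_mult by (intro mult_right_mono) auto
        show ?thesis using True 1 2 abs_triangle_ineq[of "g u * (H t - H u)" "(G s - G u) * h u"] by simp
      qed simp
    qed (use ii in simp)
    also have "\<dots> = (t - s) * (C * k) + (C * (t - s)) * k"
      using integrable_indicator_R[OF ha, of "{s<..t}"] integrable_indicator_R[of "\<lambda>_. C * k" "{s<..t}"] measure_Ioc_R[OF st] k
      by simp
    also have "\<dots> = (t - s) * (K t - K s)" by (simp add: K_def k_def algebra_simps)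
    finally show "\<bar>Q t - Q s\<bar> \<le> (t - s) * (K t - K s)" .
  qed (use t in auto)
  moreover have "Q 0 = G0 * H0" using G[of 0] H[of 0] T_pos by (simp add: Q_def pint_0)
  ultimately show "G t * H t = G0 * H0 + pint (\<lambda>s. g s * H s + G s * h s) t" by (simp add: Q_def)
qed

text \<open>The chain rule, again from increments of second order: the Taylor remainder of
  \<open>exp\<close> over \<open>(s, t]\<close> and the error of freezing \<open>E\<close> at
  \<open>s\<close> under the integral are each at most \<open>m * m * C^2 * (t - s)^2\<close>. Their
  sum accounts for the choice of \<open>K\<close> in the proof.\<close>

lemma exp_pint:
  assumes g: "g \<in> borel_measurable R" "\<And>s. s \<in> {0..T} \<Longrightarrow> \<bar>g s\<bar> \<le> C" and t: "t \<in> {0..T}"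
  shows "exp (pint g t) = 1 + pint (\<lambda>s. g s * exp (pint g s)) t"
    and "\<bar>pint g t\<bar> \<le> C * T"
    and "(\<lambda>s. g s * exp (pint g s)) \<in> borel_measurable R"
proof -
  have gi: "integrable R g" by (rule integrable_bounded_R[OF g])
  have C0: "0 \<le> C" using g(2)[OF t] by linarith
  have pb: "\<bar>pint g s\<bar> \<le> C * T" if "s \<in> {0..T}" for s
  proof -
    have "\<bar>pint g s\<bar> \<le> C * s" using pint_lipschitz[OF g, of 0 s] that by (simp add: pint_0)
    also have "\<dots> \<le> C * T" using that C0 by (intro mult_left_mono) auto
    finally show ?thesis .
  qed
  show "\<bar>pint g t\<bar> \<le> C * T" by (rule pb[OF t])
  define E where "E = (\<lambda>s. exp (pint g s))"
  have Em [measurable]: "E \<in> borel_measurable R" unfolding E_def using pint_measurable[OF gi] by measurable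
  show gEm: "(\<lambda>s. g s * exp (pint g s)) \<in> borel_measurable R" using Em g(1) unfolding E_def by measurable
  define m where "m = exp (C * T)"
  have m1: "1 \<le> m" unfolding m_def using C0 T_pos by simp
  have Eb: "\<bar>E s\<bar> \<le> m" if "s \<in> {0..T}" for s using pb[OF that] by (simp add: E_def m_def)
  have gE: "integrable R (\<lambda>s. g s * E s)"
    by (rule integrable_bounded_mult_R[OF integrable_bounded_R[OF Em Eb] g])
  have incr: "\<bar>E u - E s\<bar> \<le> m * m * (C * (u - s))" "\<bar>E u - E s - E s * (pint g u - pint g s)\<bar> \<le> m * m * (C * (u - s))\<^sup>2"
    if su: "0 \<le> s" "s \<le> u" "u \<le> T" for s u
  proof -
    define x where "x = pint g u - pint g s"
    have xb: "\<bar>x\<bar> \<le> C * (u - s)" unfolding x_def by (rule pint_lipschitz[OF g su])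
    have "C * (u - s) \<le> C * T" using su C0 by (intro mult_left_mono) auto
    then have xm: "exp \<bar>x\<bar> \<le> m" using xb by (simp add: m_def)
    have Es: "0 < E s" "E s \<le> m" using Eb[of s] su by (auto simp: E_def)
    have e: "E u = E s * exp x" by (simp add: E_def x_def exp_add[symmetric])
    have "E u - E s = E s * (exp x - 1)" by (simp add: e algebra_simps)
    then have "\<bar>E u - E s\<bar> = E s * \<bar>exp x - 1\<bar>" using Es by (simp add: abs_mult)
    also have "\<dots> \<le> m * (C * (u - s) * m)"
      using abs_exp_minus_one_le[of x] Es xb xm m1 by (intro mult_mono order_trans[OF abs_exp_minus_one_le[of x]] mult_mono) auto
    finally show "\<bar>E u - E s\<bar> \<le> m * m * (C * (u - s))" by (simp add: mult_ac)
    have "E u - E s - E s * x = E s * (exp x - 1 - x)" by (simp add: e algebra_simps)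
    then have "\<bar>E u - E s - E s * x\<bar> = E s * \<bar>exp x - 1 - x\<bar>" using Es by (simp add: abs_mult)
    also have "\<dots> \<le> m * ((C * (u - s))\<^sup>2 * m)"
    proof (rule mult_mono)
      have "x\<^sup>2 \<le> (C * (u - s))\<^sup>2" using power_mono[OF xb, of 2] by simp
      then have "x\<^sup>2 * exp \<bar>x\<bar> \<le> (C * (u - s))\<^sup>2 * m" using xm by (intro mult_mono) auto
      then show "\<bar>exp x - 1 - x\<bar> \<le> (C * (u - s))\<^sup>2 * m" using abs_exp_minus_one_minus_le[of x] by linarith
    qed (use Es m1 in auto)
    finally show "\<bar>E u - E s - E s * (pint g u - pint g s)\<bar> \<le> m * m * (C * (u - s))\<^sup>2" by (simp add: x_def mult_ac)
  qed
  define Q where "Q = (\<lambda>t. E t - pint (\<lambda>s. g s * E s) t)"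
  define K where "K = (\<lambda>t. 2 * m * m * C\<^sup>2 * t)"
  have "Q t = Q 0"
  proof (rule constant_if_increments_small[of T Q K])
    fix s t assume st: "0 \<le> s" "s \<le> t" "t \<le> T"
    let ?i = "\<lambda>u. indicator {s<..t} u :: real"
    have "Q t - Q s = (E t - E s - E s * (pint g t - pint g s)) + (E s * (pint g t - pint g s) - (pint (\<lambda>s. g s * E s) t - pint (\<lambda>s. g s * E s) s))"
      by (simp add: Q_def)
    also have "E s * (pint g t - pint g s) - (pint (\<lambda>s. g s * E s) t - pint (\<lambda>s. g s * E s) s)
      = (\<integral>u. E s * (?i u * g u) - ?i u * (g u * E u) \<partial>R)"
      using pint_increment[OF gi st(2)] pint_increment[OF gE st(2)] integrable_indicator_R[OF gi] integrable_indicator_R[OF gE]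
      by simp
    finally have "\<bar>Q t - Q s\<bar> \<le> \<bar>E t - E s - E s * (pint g t - pint g s)\<bar> + \<bar>\<integral>u. E s * (?i u * g u) - ?i u * (g u * E u) \<partial>R\<bar>"
      by linarith
    also have "\<bar>E t - E s - E s * (pint g t - pint g s)\<bar> \<le> m * m * (C * (t - s))\<^sup>2" by (rule incr(2)[OF st])
    also have "\<bar>\<integral>u. E s * (?i u * g u) - ?i u * (g u * E u) \<partial>R\<bar> \<le> (\<integral>u. \<bar>E s * (?i u * g u) - ?i u * (g u * E u)\<bar> \<partial>R)"
      by (rule integral_abs_bound)
    also have "\<dots> \<le> (\<integral>u. ?i u * (C * (m * m * (C * (t - s)))) \<partial>R)"
    proof (rule integral_mono)
      show "integrable R (\<lambda>u. \<bar>E s * (?i u * g u) - ?i u * (g u * E u)\<bar>)"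
        using integrable_indicator_R[OF gi, of "{s<..t}"] integrable_indicator_R[OF gE, of "{s<..t}"] by simp
      show "integrable R (\<lambda>u. ?i u * (C * (m * m * (C * (t - s)))))" by (rule integrable_indicator_R) auto
      fix u
      show "\<bar>E s * (?i u * g u) - ?i u * (g u * E u)\<bar> \<le> ?i u * (C * (m * m * (C * (t - s))))"
      proof (cases "u \<in> {s<..t}")
        case True
        then have u: "s \<le> u" "u \<le> t" "u \<le> T" using st by auto
        have "\<bar>E u - E s\<bar> \<le> m * m * (C * (t - s))"
        proof -
          have "m * m * (C * (u - s)) \<le> m * m * (C * (t - s))" using u m1 C0 by (intro mult_left_mono) auto
          then show ?thesis using incr(1)[OF st(1) u(1,3)] by linarith
        qed
        then have "\<bar>g u\<bar> * \<bar>E u - E s\<bar> \<le> C * (m * m * (C * (t - s)))"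
          using g(2)[of u] u st C0 by (intro mult_mono) auto
        moreover have "\<bar>E s * g u - g u * E u\<bar> = \<bar>g u\<bar> * \<bar>E u - E s\<bar>"
          by (simp add: abs_mult[symmetric] algebra_simps abs_minus_commute)
        ultimately show ?thesis using True by simp
      qed simp
    qed
    also have "\<dots> = (t - s) * (C * (m * m * (C * (t - s))))" using measure_Ioc_R[OF st] by simp
    also have "m * m * (C * (t - s))\<^sup>2 + (t - s) * (C * (m * m * (C * (t - s)))) = (t - s) * (K t - K s)"
      by (simp add: K_def power2_eq_square algebra_simps)
    finally show "\<bar>Q t - Q s\<bar> \<le> (t - s) * (K t - K s)" by simp
  qed (use t in auto)
  then show "exp (pint g t) = 1 + pint (\<lambda>s. g s * exp (pint g s)) t" by (simp add: Q_def E_def pint_0)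
qed

lemma pint_uminus: "pint (\<lambda>s. - g s) t = - pint g t"
  unfolding pint_def by simp

text \<open>The equation \<open>X = x + \<integral> (r X + f) + I\<close> becomes an ordinary one for \<open>X - I\<close>.\<close>

lemma linear_equation_solution:
  fixes r :: "real \<Rightarrow> real" and x C :: real
  assumes r: "r \<in> borel_measurable R" "\<And>s. s \<in> {0..T} \<Longrightarrow> \<bar>r s\<bar> \<le> C" and f: "integrable R f" and I: "integrable R I"
  defines "X \<equiv> \<lambda>t. exp (pint r t) * (x + pint (\<lambda>s. exp (- pint r s) * (f s + r s * I s)) t) + I t"
  assumes t: "t \<in> {0..T}"
  shows "X t = x + pint (\<lambda>s. r s * X s + f s) t + I t"
    and "integrable R (\<lambda>s. r s * X s + f s)"
    and "continuous_on {0..T} I \<Longrightarrow> continuous_on {0..T} X"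
proof -
  have ri: "integrable R r" by (rule integrable_bounded_R[OF r])
  have fr: "integrable R (\<lambda>s. f s + r s * I s)" using f integrable_bounded_mult_R[OF I r] by simp
  have Am: "(\<lambda>s. exp (- pint r s)) \<in> borel_measurable R" using pint_measurable[OF ri] by measurable
  have Ab: "\<bar>exp (- pint r s)\<bar> \<le> exp (C * T)" if "s \<in> {0..T}" for s using exp_pint(2)[OF r that] by simp
  have Af: "integrable R (\<lambda>s. exp (- pint r s) * (f s + r s * I s))" by (rule integrable_bounded_mult_R[OF fr Am Ab])
  have Bb: "\<bar>r s * exp (pint r s)\<bar> \<le> C * exp (C * T)" if "s \<in> {0..T}" for s
    using exp_pint(2)[OF r that] r(2)[OF that] unfolding abs_mult by (intro mult_mono) auto
  have Bm: "(\<lambda>s. r s * exp (pint r s)) \<in> borel_measurable R" by (rule exp_pint(3)[OF r t])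
  define Y where "Y = (\<lambda>t. exp (pint r t) * (x + pint (\<lambda>s. exp (- pint r s) * (f s + r s * I s)) t))"
  \<comment> \<open>Variation of constants: the product rule for the growth factor and the
    accumulated discounted source gives the integral equation of \<open>X - I\<close>.\<close>
  note pr = pint_product_rule[OF Bm Bb Af exp_pint(1)[OF r] refl t, of x]
  have e: "r s * exp (pint r s) * (x + pint (\<lambda>s. exp (- pint r s) * (f s + r s * I s)) s)
     + exp (pint r s) * (exp (- pint r s) * (f s + r s * I s)) = r s * X s + f s" for s
  proof -
    have "exp (pint r s) * (exp (- pint r s) * (f s + r s * I s)) = f s + r s * I s"
      by (simp add: exp_minus)
    then show ?thesis by (simp add: X_def algebra_simps)
  qed
  show "integrable R (\<lambda>s. r s * X s + f s)" using pr(2) unfolding e .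
  show "X t = x + pint (\<lambda>s. r s * X s + f s) t + I t" using pr(1) unfolding e by (simp add: X_def)
  show "continuous_on {0..T} X" if "continuous_on {0..T} I"
    unfolding X_def by (intro continuous_intros pint_continuous ri Af that)
qed

text \<open>The rough term \<open>I\<close> never enters a product rule: \<open>X - I\<close> is an
  indefinite integral by the equation, and it is this difference that is multiplied by the
  integrating factor.\<close>

lemma linear_equation_unique:
  fixes r :: "real \<Rightarrow> real" and C :: real
  assumes r: "r \<in> borel_measurable R" "\<And>s. s \<in> {0..T} \<Longrightarrow> \<bar>r s\<bar> \<le> C" and f: "integrable R f"
    and I: "continuous_on {0..T} I" and X: "continuous_on {0..T} X"
    and eq: "\<And>t. t \<in> {0..T} \<Longrightarrow> X t = x + pint (\<lambda>s. r s * X s + f s) t + I t" and t: "t \<in> {0..T}"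
  shows "X t = exp (pint r t) * (x + pint (\<lambda>s. exp (- pint r s) * (f s + r s * I s)) t) + I t"
proof -
  have cont: "integrable R Z" if "continuous_on {0..T} Z" for Z :: "real \<Rightarrow> real"
    using borel_integrable_compact[of "{0..T}" Z] that integrable_restrict_space[of "{0..T}" lborel Z]
    by (simp add: set_integrable_def)
  have nr: "(\<lambda>s. - r s) \<in> borel_measurable R" "\<And>s. s \<in> {0..T} \<Longrightarrow> \<bar>- r s\<bar> \<le> C" using r by auto
  have iX: "integrable R (\<lambda>s. r s * X s + f s)" using f integrable_bounded_mult_R[OF cont[OF X] r] by simp
  have nb: "\<bar>- r s * exp (pint (\<lambda>s. - r s) s)\<bar> \<le> C * exp (C * T)" if "s \<in> {0..T}" for s
    using exp_pint(2)[OF nr that] nr(2)[OF that] unfolding abs_mult by (intro mult_mono) auto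
  have Y: "X t - I t = x + pint (\<lambda>s. r s * X s + f s) t" if "t \<in> {0..T}" for t using eq[OF that] by simp
  note pr = pint_product_rule[OF exp_pint(3)[OF nr t] nb iX exp_pint(1)[OF nr] Y t]
  have e: "- r s * exp (pint (\<lambda>s. - r s) s) * (X s - I s) + exp (pint (\<lambda>s. - r s) s) * (r s * X s + f s)
    = exp (- pint r s) * (f s + r s * I s)" for s
    by (simp add: pint_uminus algebra_simps)
  have "exp (pint (\<lambda>s. - r s) t) * (X t - I t) = x + pint (\<lambda>s. exp (- pint r s) * (f s + r s * I s)) t"
    using pr(1) unfolding e by simp
  then have "exp (pint r t) * (exp (- pint r t) * (X t - I t))
    = exp (pint r t) * (x + pint (\<lambda>s. exp (- pint r s) * (f s + r s * I s)) t)"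
    by (simp add: pint_uminus)
  moreover have "exp (pint r t) * (exp (- pint r t) * (X t - I t)) = X t - I t"
    by (simp add: exp_minus)
  ultimately show ?thesis by linarith
qed

end

section \<open>Discounting\<close>

context brownian_setting
begin

text \<open>The grid cells are open on the left and miss time 0, which is discarded here.\<close>

lemma AE_P_fst_neq: "AE z in P. fst z \<noteq> t"
proof -
  have "AE z in R \<Otimes>\<^sub>M M. fst z \<noteq> t"
  proof (rule RM.AE_pair_measure)
    have "{z \<in> space P. fst z \<noteq> t} \<in> sets P" using fst_P by measurable
    then show "{z \<in> space (R \<Otimes>\<^sub>M M). fst z \<noteq> t} \<in> sets (R \<Otimes>\<^sub>M M)" by (simp only: time_scenario_def)
    show "AE x in R. AE y in M. fst (x, y) \<noteq> t" using AE_R_neq[of t] by eventually_elim simp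
  qed
  then show ?thesis by (simp only: time_scenario_def)
qed

lemma L2_adapted_mult:
  assumes v: "v \<in> L2_adapted M T W" and a: "adapted M T W a" and K: "AE z in P. \<bar>case_prod a z\<bar> \<le> K"
  shows "(\<lambda>t \<omega>. a t \<omega> * v t \<omega>) \<in> L2_adapted M T W"
proof -
  have vL: "case_prod v \<in> L2 P" and vF: "\<And>t. t \<in> {0..T} \<Longrightarrow> v t \<in> borel_measurable (F t)"
    using v by (auto simp: L2_adapted_iff adapted_def)
  have am: "case_prod a \<in> borel_measurable P" and aF: "\<And>t. t \<in> {0..T} \<Longrightarrow> a t \<in> borel_measurable (F t)"
    using a by (auto simp: adapted_def)
  have e: "case_prod (\<lambda>t \<omega>. a t \<omega> * v t \<omega>) = (\<lambda>z. case_prod a z * case_prod v z)" by auto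
  have L: "(\<lambda>z. case_prod a z * case_prod v z) \<in> L2 P"
  proof (rule L2_dominated[OF vL])
    show "(\<lambda>z. case_prod a z * case_prod v z) \<in> borel_measurable P"
      by (intro borel_measurable_times am L2_measurable[OF vL])
    show "AE z in P. \<bar>case_prod a z * case_prod v z\<bar> \<le> K * \<bar>case_prod v z\<bar>"
      using K by eventually_elim (simp add: abs_mult mult_right_mono)
  qed
  have "(\<lambda>\<omega>. a t \<omega> * v t \<omega>) \<in> borel_measurable (F t)" if "t \<in> {0..T}" for t
    by (intro borel_measurable_times aF vF that)
  then show ?thesis using L unfolding L2_adapted_iff adapted_def e by (auto dest: L2_measurable)
qed

lemma L2_adapted_bounded:
  assumes a: "adapted M T W a" and K: "AE z in P. \<bar>case_prod a z\<bar> \<le> K"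
  shows "a \<in> L2_adapted M T W"
  using a P.L2_bounded[OF _ K] by (auto simp: L2_adapted_iff adapted_def)

lemma ito_0: "ito v I \<Longrightarrow> AE \<omega> in M. I 0 \<omega> = 0"
proof -
  assume I: "ito v I"
  have T0: "0 \<in> {0..T}" using T_pos by simp
  have "l2norm P (\<lambda>z. indicator {..0} (fst z) * case_prod v z) = l2norm P (\<lambda>z. 0)"
  proof (rule l2norm_cong_AE)
    show "AE z in P. indicator {..0} (fst z) * case_prod v z = 0"
      using AE_P_fst_neq[of 0] AE_space[of P]
      by eventually_elim (auto simp: indicator_def space_P)
    show "(\<lambda>z. indicator {..0} (fst z) * case_prod v z) \<in> borel_measurable P"
      by (rule L2_measurable[OF L2_indicator_P[OF ito_integrand_L2[OF I]]]) simp
  qed simp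
  then have "l2norm M (I 0) = 0" unfolding ito_norm[OF I T0] by (simp add: l2norm_def)
  then show ?thesis by (rule l2norm_eq_0_AE[OF ito_L2[OF I T0]])
qed

lemma ito_zero: "ito (\<lambda>t \<omega>. 0) (\<lambda>t \<omega>. 0)"
proof -
  have e: "case_prod (\<lambda>t \<omega>. 0 :: real) = (\<lambda>z. 0)" by auto
  have b: "case_prod (bp []) = (\<lambda>z. 0)" and w: "wi [] t = (\<lambda>\<omega>. 0)" for t by auto
  have "adapted M T W (\<lambda>t \<omega>. 0)" unfolding adapted_def e by simp
  then have "(\<lambda>t \<omega>. 0) \<in> L2_adapted M T W" unfolding L2_adapted_iff e by (simp add: L2_zero)
  then show ?thesis
    by (rule itoI[of _ "\<lambda>_. []"]) (unfold e b w, auto intro: L2_tends_const L2_zero)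
qed

text \<open>Multipliers that are constant on each cell and known at its left end are integrated cell
  by cell. In \<open>ito_discount\<close> they are the discount factor frozen at the left
  ends.\<close>

lemma ito_grid_sum:
  assumes v: "ito v I" and g: "\<And>j. j < 2 ^ k \<Longrightarrow> g j \<in> borel_measurable (F (grid k j))"
    "\<And>j \<omega>. j < 2 ^ k \<Longrightarrow> \<omega> \<in> space M \<Longrightarrow> \<bar>g j \<omega>\<bar> \<le> K" and n: "n \<le> 2 ^ k"
  shows "ito (\<lambda>t \<omega>. (\<Sum>j<n. g j \<omega> * indicator {grid k j<..grid k (Suc j)} t * v t \<omega>))
    (\<lambda>t \<omega>. (\<Sum>j<n. g j \<omega> * (I (min t (grid k (Suc j))) \<omega> - I (min t (grid k j)) \<omega>)))"
  using n
proof (induction n)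
  case 0
  then show ?case using ito_zero by simp
next
  case (Suc n)
  have j: "n < 2 ^ k" using Suc.prems by simp
  have "ito (\<lambda>t \<omega>. g n \<omega> * indicator {grid k n<..grid k (Suc n)} t * v t \<omega>)
      (\<lambda>t \<omega>. g n \<omega> * (I (min t (grid k (Suc n))) \<omega> - I (min t (grid k n)) \<omega>))"
    using grid_in[of n k] grid_in[of "Suc n" k] Suc.prems
    by (intro ito_localize[OF v _ _ _ g(1)[OF j], of _ K] grid_mono) (auto simp: g(2)[OF j])
  from ito_linear[OF Suc.IH this, of 1] Suc.prems show ?case by simp
qed

lemma gidx_eq:
  assumes "s \<in> {grid k j<..grid k (Suc j)}"
  shows "gidx k s = Suc j"
proof -
  have "real j < s * 2 ^ k / T" "s * 2 ^ k / T \<le> real j + 1"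
    using assms T_pos by (auto simp: grid_def field_simps)
  then have "\<lceil>s * 2 ^ k / T\<rceil> = int j + 1" by (intro ceiling_unique) auto
  then show ?thesis by (simp add: gidx_def)
qed

lemma gidx_interval:
  assumes "s \<in> {0..T}" "s \<noteq> 0"
  shows "\<exists>j<2^k. s \<in> {grid k j<..grid k (Suc j)}"
proof -
  have s: "0 < s" using assms by auto
  have pos: "0 < s * 2 ^ k / T" using s T_pos by simp
  have "0 < \<lceil>s * 2 ^ k / T\<rceil>" using pos by simp
  then have g: "0 < gidx k s" by (simp add: gidx_def)
  then obtain j where j: "gidx k s = Suc j" using gr0_implies_Suc by blast
  have "j < 2 ^ k" using gidx_le[OF assms(1), of k] j by simp
  moreover have "s \<le> grid k (Suc j)" using grid_gidx(1)[OF assms(1), of k] j by simp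
  moreover have "grid k j < s"
  proof -
    have "real (Suc j) = real_of_int \<lceil>s * 2 ^ k / T\<rceil>" using j g by (simp add: gidx_def nat_eq_iff)
    then have "real j < s * 2 ^ k / T" using ceiling_correct[of "s * 2 ^ k / T"] by simp
    then show ?thesis using T_pos by (simp add: grid_def field_simps)
  qed
  ultimately show ?thesis by auto
qed

text \<open>The cell is fixed before the coefficients, so a single \<open>j\<close> evaluates
  several step functions at the same time, for instance two factors and their product.\<close>

lemma grid_step_function:
  assumes "s \<in> {0..T}" "s \<noteq> 0"
  shows "\<exists>j<2^k. s \<in> {grid k j<..grid k (Suc j)} \<and> gidx k s = Suc j \<and>
    (\<forall>c. (\<Sum>i<2^k. c i * indicator {grid k i<..grid k (Suc i)} s) = (c j :: real))"
proof -
  obtain j where j: "j < 2 ^ k" "s \<in> {grid k j<..grid k (Suc j)}" using gidx_interval[OF assms] by blast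
  have "(\<Sum>i<2^k. c i * indicator {grid k i<..grid k (Suc i)} s) = (c j :: real)" for c
  proof -
    have "(\<Sum>i<2^k. c i * indicator {grid k i<..grid k (Suc i)} s) = (\<Sum>i<2^k. if i = j then c j else 0)"
    proof (rule sum.cong[OF refl])
      fix i
      show "c i * indicator {grid k i<..grid k (Suc i)} s = (if i = j then c j else 0)"
      proof (cases "s \<in> {grid k i<..grid k (Suc i)}")
        case True
        have "i = j" using gidx_eq[OF j(2)] gidx_eq[OF True] by simp
        then show ?thesis using True by simp
      next
        case False
        then have "i \<noteq> j" using j(2) by blast
        then show ?thesis using False by simp
      qed
    qed
    then show ?thesis using j(1) by simp
  qed
  then show ?thesis using j gidx_eq[OF j(2)] by (intro exI[of _ j] conjI allI)
qed

end

text \<open>The bound holds everywhere, not only almost everywhere, so that estimates along paths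
  need no exceptional set; the market's rate will be replaced by a truncation of itself.\<close>

locale discounting = brownian_setting +
  fixes r :: "'a process" and C :: real
  assumes r_adapted: "adapted M T W r" and r_bound: "\<And>t \<omega>. \<bar>r t \<omega>\<bar> \<le> C"
begin

definition disc :: "'a process" where "disc t \<omega> = exp (- TI r t \<omega>)"

lemma C_nonneg: "0 \<le> C" using r_bound[of undefined undefined] by linarith

lemma r_L2_adapted: "r \<in> L2_adapted M T W"
  by (rule L2_adapted_bounded[OF r_adapted, of C]) (simp add: r_bound split_beta')

lemma r_section: "\<omega> \<in> space M \<Longrightarrow> (\<lambda>t. r t \<omega>) \<in> borel_measurable R"
  using section_measurable(2)[of "case_prod r" \<omega>] r_adapted by (simp add: adapted_def)

lemma r_integrable: "\<omega> \<in> space M \<Longrightarrow> integrable R (\<lambda>t. r t \<omega>)"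
  by (rule integrable_bounded_R[OF r_section r_bound])

lemma TI_r_bound: "\<omega> \<in> space M \<Longrightarrow> t \<in> {0..T} \<Longrightarrow> \<bar>TI r t \<omega>\<bar> \<le> C * T"
  unfolding TI_pint by (rule exp_pint(2)[OF r_section r_bound])

lemma TI_r_adapted: "t \<in> {0..T} \<Longrightarrow> TI r t \<in> borel_measurable (F t)"
  by (rule TI_adapted[OF r_L2_adapted])

lemma TI_r_continuous: "\<omega> \<in> space M \<Longrightarrow> continuous_on {0..T} (\<lambda>t. TI r t \<omega>)"
  unfolding TI_pint by (rule pint_continuous[OF r_integrable])

text \<open>The parameter \<open>c\<close> serves both the discount factor, with -1, and the bond,
  with 1.\<close>

lemma adapted_exp_TI: "adapted M T W (\<lambda>t \<omega>. exp (c * TI r t \<omega>))"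
proof -
  have F: "(\<lambda>\<omega>. exp (c * TI r t \<omega>)) \<in> borel_measurable (F t)" if "t \<in> {0..T}" for t
    using TI_r_adapted[OF that] by measurable
  have "case_prod (\<lambda>t \<omega>. exp (c * TI r t \<omega>)) \<in> borel_measurable P"
  proof (rule continuous_joint_measurable)
    show "(\<lambda>\<omega>. exp (c * TI r t \<omega>)) \<in> borel_measurable M" if "t \<in> {0..T}" for t
      using measurable_F_M[OF F[OF that]] that by simp
    show "continuous_on {0..T} (\<lambda>t. exp (c * TI r t \<omega>))" if "\<omega> \<in> space M" for \<omega>
      by (intro continuous_intros TI_r_continuous that)
  qed
  then show ?thesis using F by (simp add: adapted_def)
qed

lemma disc_adapted: "adapted M T W disc"
  using adapted_exp_TI[of "-1"] by (simp add: disc_def[abs_def])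

lemma exp_TI_bound: "\<omega> \<in> space M \<Longrightarrow> t \<in> {0..T} \<Longrightarrow> \<bar>c\<bar> \<le> 1 \<Longrightarrow> \<bar>exp (c * TI r t \<omega>)\<bar> \<le> exp (C * T)"
proof -
  assume a: "\<omega> \<in> space M" "t \<in> {0..T}" "\<bar>c\<bar> \<le> 1"
  have "\<bar>c * TI r t \<omega>\<bar> \<le> 1 * (C * T)" unfolding abs_mult using TI_r_bound[OF a(1,2)] a(3) by (intro mult_mono) auto
  then show ?thesis by simp
qed

lemma disc_bound: "\<omega> \<in> space M \<Longrightarrow> t \<in> {0..T} \<Longrightarrow> \<bar>disc t \<omega>\<bar> \<le> exp (C * T)"
  using exp_TI_bound[of \<omega> t "-1"] by (simp add: disc_def)

lemma AE_P_exp_TI_bound: "\<bar>c\<bar> \<le> 1 \<Longrightarrow> AE z in P. \<bar>case_prod (\<lambda>t \<omega>. exp (c * TI r t \<omega>)) z\<bar> \<le> exp (C * T)"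
  using exp_TI_bound by (intro AE_I2) (auto simp: space_P)

lemma disc_mult_L2_adapted: "v \<in> L2_adapted M T W \<Longrightarrow> (\<lambda>t \<omega>. disc t \<omega> * v t \<omega>) \<in> L2_adapted M T W"
  using L2_adapted_mult[OF _ disc_adapted] AE_P_exp_TI_bound[of "-1"] by (simp add: disc_def[abs_def])

lemma disc_pint:
  assumes "\<omega> \<in> space M" "t \<in> {0..T}"
  shows "disc t \<omega> = 1 + pint (\<lambda>s. - r s \<omega> * disc s \<omega>) t"
    and "(\<lambda>s. - r s \<omega> * disc s \<omega>) \<in> borel_measurable R"
    and "\<bar>- r t \<omega> * disc t \<omega>\<bar> \<le> C * exp (C * T)"
proof -
  have nr: "(\<lambda>s. - r s \<omega>) \<in> borel_measurable R" "\<And>s. s \<in> {0..T} \<Longrightarrow> \<bar>- r s \<omega>\<bar> \<le> C"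
    using r_section[OF assms(1)] r_bound by auto
  have e: "disc s \<omega> = exp (pint (\<lambda>s. - r s \<omega>) s)" for s by (simp add: disc_def TI_pint pint_uminus)
  show "disc t \<omega> = 1 + pint (\<lambda>s. - r s \<omega> * disc s \<omega>) t" unfolding e by (rule exp_pint(1)[OF nr assms(2)])
  show "(\<lambda>s. - r s \<omega> * disc s \<omega>) \<in> borel_measurable R" unfolding e by (rule exp_pint(3)[OF nr assms(2)])
  show "\<bar>- r t \<omega> * disc t \<omega>\<bar> \<le> C * exp (C * T)"
    unfolding abs_mult using disc_bound[OF assms] r_bound[of t \<omega>] C_nonneg by (intro mult_mono) auto
qed

text \<open>Integration by parts for the Lipschitz process \<open>disc\<close>: summation by parts along the dyadic grids,
  where one sum converges in mean square and the other one pathwise.\<close>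

lemma ito_discount:
  assumes I: "ito v I" and c: "\<And>\<omega>. \<omega> \<in> space M \<Longrightarrow> continuous_on {0..T} (\<lambda>t. I t \<omega>)"
    and J: "ito (\<lambda>t \<omega>. disc t \<omega> * v t \<omega>) J"
  shows "AE \<omega> in M. J T \<omega> = disc T \<omega> * I T \<omega> + pint (\<lambda>s. r s \<omega> * disc s \<omega> * I s \<omega>) T"
proof -
  define L where "L = C * exp (C * T)"
  have TT: "T \<in> {0..T}" using T_pos by simp
  have vL: "case_prod v \<in> L2 P" by (rule ito_integrand_L2[OF I])
  let ?Ak = "\<lambda>k t \<omega>. (\<Sum>j<2^k. disc (grid k j) \<omega> * indicator {grid k j<..grid k (Suc j)} t * v t \<omega>)"
  let ?S = "\<lambda>k \<omega>. (\<Sum>j<2^k. disc (grid k j) \<omega> * (I (grid k (Suc j)) \<omega> - I (grid k j) \<omega>))"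
  have itoA: "ito (?Ak k) (\<lambda>t \<omega>. (\<Sum>j<2^k. disc (grid k j) \<omega> * (I (min t (grid k (Suc j))) \<omega> - I (min t (grid k j)) \<omega>)))" for k
    using disc_adapted grid_in disc_bound by (intro ito_grid_sum[OF I, of _ _ "exp (C * T)"]) (auto simp: adapted_def)
  have S: "(\<Sum>j<2^k. disc (grid k j) \<omega> * (I (min T (grid k (Suc j))) \<omega> - I (min T (grid k j)) \<omega>)) = ?S k \<omega>" for k \<omega>
    using grid_in[of _ k] by (intro sum.cong) (auto simp: min_absorb2 Suc_le_eq)
  have lip: "\<bar>disc t \<omega> - disc s \<omega>\<bar> \<le> L * (t - s)" if "\<omega> \<in> space M" "0 \<le> s" "s \<le> t" "t \<le> T" for s t \<omega>
  proof -
    have sT: "s \<in> {0..T}" "t \<in> {0..T}" using that by auto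
    have b: "\<bar>- r u \<omega> * disc u \<omega>\<bar> \<le> L" if "u \<in> {0..T}" for u
      using disc_pint(3)[OF \<open>\<omega> \<in> space M\<close> that] unfolding L_def .
    show ?thesis using pint_lipschitz[OF disc_pint(2)[OF that(1) sT(1)] b that(2-4)]
      by (simp only: disc_pint(1)[OF that(1) sT(1)] disc_pint(1)[OF that(1) sT(2)]) simp
  qed
  have L0: "0 \<le> L" unfolding L_def using C_nonneg by simp
  \<comment> \<open>Freezing \<open>disc\<close> at the left end of each cell changes the integrand
    by at most \<open>L\<close> times the mesh times \<open>v\<close>; the isometry turns this into
    convergence of the sums.\<close>
  have "L2_tends M ?S (J T)"
  proof (rule L2_tends_I)
    show "?S k \<in> L2 M" for k using ito_L2[OF itoA TT, of k] unfolding S .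
    show "J T \<in> L2 M" by (rule ito_L2[OF J TT])
    have "(\<lambda>k. (1 / 2 :: real) ^ k) \<longlonglongrightarrow> 0" by (rule LIMSEQ_power_zero) (simp add: real_norm_def)
    then have "(\<lambda>k. (L * T * l2norm P (case_prod v)) * (1 / 2) ^ k) \<longlonglongrightarrow> 0" by (rule tendsto_mult_right_zero)
    then show "(\<lambda>k. (L * T * l2norm P (case_prod v)) * (1 / 2) ^ k) \<longlonglongrightarrow> 0" .
    fix k
    let ?e = "L * (T / 2 ^ k)"
    have "l2norm M (\<lambda>\<omega>. ?S k \<omega> - J T \<omega>) \<le> l2norm P (\<lambda>z. case_prod (?Ak k) z - case_prod (\<lambda>t \<omega>. disc t \<omega> * v t \<omega>) z)"
      using ito_diff_norm_le[OF itoA J TT, of k] unfolding S .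
    also have "\<dots> \<le> l2norm P (\<lambda>z. ?e * case_prod v z)"
    proof (rule l2norm_mono[OF L2_cmult[OF vL]])
      show "(\<lambda>z. case_prod (?Ak k) z - case_prod (\<lambda>t \<omega>. disc t \<omega> * v t \<omega>) z) \<in> borel_measurable P"
        by (intro L2_measurable[OF L2_diff] ito_integrand_L2[OF itoA] ito_integrand_L2[OF J])
      show "AE z in P. \<bar>case_prod (?Ak k) z - case_prod (\<lambda>t \<omega>. disc t \<omega> * v t \<omega>) z\<bar> \<le> \<bar>?e * case_prod v z\<bar>"
        using AE_P_fst_neq[of 0] AE_space[of P]
      proof eventually_elim
        case (elim z)
        then obtain t \<omega> where z: "z = (t, \<omega>)" "t \<in> {0..T}" "\<omega> \<in> space M" "t \<noteq> 0" by (auto simp: space_P)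
        obtain j where j: "j < 2 ^ k" "t \<in> {grid k j<..grid k (Suc j)}"
          "\<And>c :: nat \<Rightarrow> real. (\<Sum>i<2^k. c i * indicator {grid k i<..grid k (Suc i)} t) = c j"
          using grid_step_function[OF z(2,4), of k] by blast
        have "?Ak k t \<omega> = disc (grid k j) \<omega> * v t \<omega>" by (simp add: sum_distrib_right[symmetric] j(3))
        then have "\<bar>?Ak k t \<omega> - disc t \<omega> * v t \<omega>\<bar> = \<bar>disc t \<omega> - disc (grid k j) \<omega>\<bar> * \<bar>v t \<omega>\<bar>"
          by (simp add: left_diff_distrib[symmetric] abs_mult abs_minus_commute)
        also have "\<dots> \<le> ?e * \<bar>v t \<omega>\<bar>"
        proof (rule mult_right_mono)
          have "\<bar>disc t \<omega> - disc (grid k j) \<omega>\<bar> \<le> L * (t - grid k j)"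
            using grid_in[of j k] j z by (intro lip) auto
          also have "\<dots> \<le> L * (T / 2 ^ k)" using j(2) grid_step[of k j] L0 by (intro mult_left_mono) auto
          finally show "\<bar>disc t \<omega> - disc (grid k j) \<omega>\<bar> \<le> ?e" .
        qed simp
        also have "\<dots> = \<bar>?e * v t \<omega>\<bar>" using L0 T_pos by (simp add: abs_mult)
        finally show ?case by (simp add: z(1))
      qed
    qed
    also have "\<dots> = (L * T * l2norm P (case_prod v)) * (1 / 2) ^ k"
      unfolding l2norm_cmult using L0 T_pos by (simp add: power_divide)
    finally show "l2norm M (\<lambda>\<omega>. ?S k \<omega> - J T \<omega>) \<le> (L * T * l2norm P (case_prod v)) * (1 / 2) ^ k" .
  qed
  then obtain q where q: "strict_mono q" "AE \<omega> in M. (\<lambda>k. ?S (q k) \<omega>) \<longlonglongrightarrow> J T \<omega>"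
    using L2_tends_AE_subseq by blast
  have lim: "(\<lambda>k. ?S k \<omega>) \<longlonglongrightarrow> disc T \<omega> * I T \<omega> + pint (\<lambda>s. r s \<omega> * disc s \<omega> * I s \<omega>) T"
    if \<omega>: "\<omega> \<in> space M" and I0: "I 0 \<omega> = 0" for \<omega>
  proof -
    let ?g = "\<lambda>s. - r s \<omega> * disc s \<omega>"
    have gb: "\<bar>?g s\<bar> \<le> L" if "s \<in> {0..T}" for s using disc_pint(3)[OF \<omega> that] by (simp add: L_def)
    have gm: "?g \<in> borel_measurable R" by (rule disc_pint(2)[OF \<omega> TT])
    have gi: "integrable R ?g" by (rule integrable_bounded_R[OF gm gb])
    obtain K where "\<forall>s\<in>{0..T}. \<bar>I s \<omega>\<bar> \<le> K"
      using compact_imp_bounded[OF compact_continuous_image[OF c[OF \<omega>] compact_Icc]]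
      by (auto simp: bounded_iff)
    then have K: "\<And>s. s \<in> {0..T} \<Longrightarrow> \<bar>I s \<omega>\<bar> \<le> K" by blast
    have K0: "0 \<le> K" using K[OF TT] by linarith
    have Im: "(\<lambda>s. I s \<omega>) \<in> borel_measurable R"
      using section_measurable(2)[OF continuous_joint_measurable[OF L2_measurable[OF ito_L2[OF I]] c] \<omega>] by simp
    let ?H = "\<lambda>k s. \<Sum>j<2^k. (I (grid k (Suc j)) \<omega> * indicator {grid k j<..grid k (Suc j)} s)"
    have abel: "(\<Sum>j<n. a j * (b (Suc j) - b j)) = a n * b n - a 0 * b 0 - (\<Sum>j<n. b (Suc j) * (a (Suc j) - a j))"
      for a b :: "nat \<Rightarrow> real" and n by (induction n) (auto simp: algebra_simps)
    \<comment> \<open>Summation by parts moves the differences onto \<open>disc\<close>, whose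
      increments are time integrals. The integral \<open>I\<close> is then read at the right end of
      each cell, and \<open>I 0 \<omega> = 0\<close> removes the lower boundary term.\<close>
    have Sk: "?S k \<omega> = disc T \<omega> * I T \<omega> - (\<integral>s. ?H k s * ?g s \<partial>R)" for k
    proof -
      have "(\<Sum>j<2^k. I (grid k (Suc j)) \<omega> * (disc (grid k (Suc j)) \<omega> - disc (grid k j) \<omega>))
        = (\<Sum>j<2^k. (\<integral>s. I (grid k (Suc j)) \<omega> * (indicator {grid k j<..grid k (Suc j)} s * ?g s) \<partial>R))"
      proof (rule sum.cong[OF refl])
        fix j :: nat assume "j \<in> {..<2 ^ k}"
        then have gr: "grid k j \<in> {0..T}" "grid k (Suc j) \<in> {0..T}" by (auto intro!: grid_in simp del: atLeastAtMost_iff)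
        have "disc (grid k (Suc j)) \<omega> - disc (grid k j) \<omega> = pint ?g (grid k (Suc j)) - pint ?g (grid k j)"
          by (simp only: disc_pint(1)[OF \<omega> gr(1)] disc_pint(1)[OF \<omega> gr(2)])
        also have "\<dots> = (\<integral>s. indicator {grid k j<..grid k (Suc j)} s * ?g s \<partial>R)"
          by (rule pint_increment[OF gi grid_mono]) simp
        finally have "disc (grid k (Suc j)) \<omega> - disc (grid k j) \<omega> = (\<integral>s. indicator {grid k j<..grid k (Suc j)} s * ?g s \<partial>R)" .
        then show "I (grid k (Suc j)) \<omega> * (disc (grid k (Suc j)) \<omega> - disc (grid k j) \<omega>)
          = (\<integral>s. I (grid k (Suc j)) \<omega> * (indicator {grid k j<..grid k (Suc j)} s * ?g s) \<partial>R)"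
          by (simp only: integral_mult_right_zero)
      qed
      also have "\<dots> = (\<integral>s. (\<Sum>j<2^k. I (grid k (Suc j)) \<omega> * (indicator {grid k j<..grid k (Suc j)} s * ?g s)) \<partial>R)"
        by (intro Bochner_Integration.integral_sum[symmetric] integrable_mult_right integrable_indicator_R[OF gi]) simp
      also have "\<dots> = (\<integral>s. ?H k s * ?g s \<partial>R)" by (simp only: sum_distrib_right mult.assoc)
      finally show ?thesis
        using abel[of "\<lambda>j. disc (grid k j) \<omega>" "\<lambda>j. I (grid k j) \<omega>" "2 ^ k"] I0 by simp
    qed
    have "(\<lambda>k. \<integral>s. ?H k s * ?g s \<partial>R) \<longlonglongrightarrow> (\<integral>s. I s \<omega> * ?g s \<partial>R)"
    proof (rule integral_dominated_convergence[where w="\<lambda>s. K * L"])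
      show "(\<lambda>s. I s \<omega> * ?g s) \<in> borel_measurable R" by (intro borel_measurable_times Im gm)
      show "(\<lambda>s. ?H k s * ?g s) \<in> borel_measurable R" for k
        by (intro borel_measurable_times borel_measurable_sum borel_measurable_const indicator_R gm) simp
      have H: "?H k s = I (grid k (gidx k s)) \<omega>" if s: "s \<in> {0..T}" "s \<noteq> 0" for k s
        using grid_step_function[OF s, of k] by metis
      show "AE s in R. (\<lambda>k. ?H k s * ?g s) \<longlonglongrightarrow> I s \<omega> * ?g s"
        using AE_R_neq[of 0] AE_space[of R]
      proof eventually_elim
        case (elim s)
        then have s: "s \<in> {0..T}" "s \<noteq> 0" by (auto simp: space_R)
        have "(\<lambda>k. I (grid k (gidx k s)) \<omega>) \<longlonglongrightarrow> I s \<omega>"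
          using grid_in gidx_le[OF s(1)]
          by (intro continuous_on_tendsto_compose[OF c[OF \<omega>] grid_gidx_tendsto[OF s(1)] s(1)] always_eventually) blast
        then show ?case unfolding H[OF s] by (intro tendsto_mult tendsto_const)
      qed
      show "AE s in R. norm (?H k s * ?g s) \<le> K * L" for k
        using AE_R_neq[of 0] AE_space[of R]
      proof eventually_elim
        case (elim s)
        then have s: "s \<in> {0..T}" "s \<noteq> 0" by (auto simp: space_R)
        show ?case unfolding H[OF s] real_norm_def abs_mult[of "I _ _"]
          using K[OF grid_in[OF gidx_le[OF s(1), of k]]] gb[OF s(1)] K0 by (intro mult_mono) auto
      qed
    qed simp
    then have "(\<lambda>k. ?S k \<omega>) \<longlonglongrightarrow> disc T \<omega> * I T \<omega> - (\<integral>s. I s \<omega> * ?g s \<partial>R)"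
      unfolding Sk by (intro tendsto_diff tendsto_const)
    moreover have "- (\<integral>s. I s \<omega> * ?g s \<partial>R) = pint (\<lambda>s. r s \<omega> * disc s \<omega> * I s \<omega>) T"
      unfolding pint_T integral_minus[symmetric] by (intro Bochner_Integration.integral_cong) auto
    ultimately show ?thesis by simp
  qed
  show ?thesis
    using q(2) ito_0[OF I] AE_space
  proof eventually_elim
    case (elim \<omega>)
    show ?case
      using LIMSEQ_unique[OF elim(1)] LIMSEQ_subseq_LIMSEQ[OF lim[OF elim(3,2)] q(1)] by (simp add: o_def)
  qed
qed

end

section \<open>Gains from trade\<close>

lemma l2norm_sum_le:
  fixes n :: nat
  assumes "\<And>j. j < n \<Longrightarrow> f j \<in> L2 N"
  shows "l2norm N (\<lambda>x. \<Sum>j<n. f j x) \<le> (\<Sum>j<n. l2norm N (f j))"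
  using assms
proof (induction n)
  case 0
  then show ?case by (simp add: l2norm_def)
next
  case (Suc n)
  have "l2norm N (\<lambda>x. (\<Sum>j<n. f j x) + f n x) \<le> l2norm N (\<lambda>x. \<Sum>j<n. f j x) + l2norm N (f n)"
    by (rule l2norm_triangle[OF L2_sum]) (use Suc.prems in auto)
  then show ?case using Suc.IH Suc.prems by simp
qed

lemma (in brownian_setting) ito_blocks:
  assumes "valid L" shows "ito (bp L) (wi L)"
  by (rule itoI[OF bp_L2_adapted[OF assms] assms L2_tends_const[OF bp_L2[OF assms]]
      L2_tends_const[OF wi_L2[OF assms]]])

lemma (in brownian_setting) AE_section_integrable:
  assumes "w \<in> L2 P" shows "AE \<omega> in M. integrable R (\<lambda>t. w (t, \<omega>))"
  using time_integral_L2(3)[OF assms, of UNIV] by auto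

locale trading = brownian_setting +
  fixes \<rho> :: "'a process" and K :: real
  assumes \<rho>_adapted: "adapted M T W \<rho>" and \<rho>_bound: "\<And>t \<omega>. \<bar>\<rho> t \<omega>\<bar> \<le> K"
begin

text \<open>The discounted gain of the discounted position \<open>v\<close>. The stochastic integral
  is passed as an argument \<open>J\<close>, tied to \<open>v\<close> by \<open>ito v J\<close>,
  because it is determined only up to modification.\<close>

definition gain :: "'a process \<Rightarrow> 'a process \<Rightarrow> 'a process" where
  "gain v J t \<omega> = TI (\<lambda>t \<omega>. \<rho> t \<omega> * v t \<omega>) t \<omega> + J t \<omega>"

lemma K_nonneg: "0 \<le> K" using \<rho>_bound[of undefined undefined] by linarith

lemma AE_\<rho>_bound: "AE z in P. \<bar>case_prod \<rho> z\<bar> \<le> K"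
  by (simp add: \<rho>_bound split_beta')

lemma \<rho>_L2_adapted: "\<rho> \<in> L2_adapted M T W"
  by (rule L2_adapted_bounded[OF \<rho>_adapted AE_\<rho>_bound])

lemma \<rho>_mult: "v \<in> L2_adapted M T W \<Longrightarrow> (\<lambda>t \<omega>. \<rho> t \<omega> * v t \<omega>) \<in> L2_adapted M T W"
  by (rule L2_adapted_mult[OF _ \<rho>_adapted AE_\<rho>_bound])

lemma case_prod_mult: "case_prod (\<lambda>t \<omega>. u t \<omega> * v t \<omega>) = (\<lambda>z. case_prod u z * case_prod v z)"
  by auto

lemma \<rho>_mult_L2: "v \<in> L2_adapted M T W \<Longrightarrow> (\<lambda>z. case_prod \<rho> z * case_prod v z) \<in> L2 P"
  using \<rho>_mult[of v] unfolding L2_adapted_iff case_prod_mult by blast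

lemma gain_L2:
  assumes "ito v J" "t \<in> {0..T}"
  shows "gain v J t \<in> L2 M" "gain v J t \<in> borel_measurable (F t)"
proof -
  have v: "(\<lambda>t \<omega>. \<rho> t \<omega> * v t \<omega>) \<in> L2_adapted M T W" by (rule \<rho>_mult[OF ito_integrand[OF assms(1)]])
  then have vL: "case_prod (\<lambda>t \<omega>. \<rho> t \<omega> * v t \<omega>) \<in> L2 P" by (simp add: L2_adapted_iff)
  show "gain v J t \<in> L2 M" unfolding gain_def[abs_def]
    by (intro L2_add TI_L2[OF vL] ito_L2[OF assms])
  show "gain v J t \<in> borel_measurable (F t)" unfolding gain_def[abs_def]
    by (intro borel_measurable_add TI_adapted[OF v assms(2)] ito_measurable[OF assms])
qed

text \<open>Localizing to \<open>(a, b]\<close> with factor 1 turns the increment into a terminal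
  value, to which the isometry applies.\<close>

lemma ito_increment_norm:
  assumes v: "ito v J" and ab: "0 \<le> a" "a \<le> b" "b \<le> T"
  shows "l2norm M (\<lambda>\<omega>. J b \<omega> - J a \<omega>) = l2norm P (\<lambda>z. indicator {a<..b} (fst z) * case_prod v z)"
proof -
  have TT: "T \<in> {0..T}" using T_pos by simp
  have "ito (\<lambda>t \<omega>. 1 * indicator {a<..b} t * v t \<omega>) (\<lambda>t \<omega>. 1 * (J (min t b) \<omega> - J (min t a) \<omega>))"
    by (rule ito_localize[OF v ab, of "\<lambda>_. 1" 1]) auto
  from ito_norm[OF this TT]
  have "l2norm M (\<lambda>\<omega>. J b \<omega> - J a \<omega>)
    = l2norm P (\<lambda>z. indicator {..T} (fst z) * case_prod (\<lambda>t \<omega>. 1 * indicator {a<..b} t * v t \<omega>) z)"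
    using ab by (simp add: min_absorb2)
  also have "(\<lambda>z. indicator {..T} (fst z) * case_prod (\<lambda>t \<omega>. 1 * indicator {a<..b} t * v t \<omega>) z)
      = (\<lambda>z. indicator {a<..b} (fst z) * case_prod v z)"
    using ab by (auto simp: indicator_def)
  finally show ?thesis .
qed

text \<open>Removing the drift \<open>D\<close> from the gain at \<open>b\<close> leaves the gain at
  \<open>a\<close> plus a martingale increment of norm \<open>m\<close>, and these two are
  orthogonal. So both are bounded by the norm of the gain at \<open>b\<close> plus that of
  \<open>D\<close>; by \<open>small\<close> the latter is at most \<open>m / 2\<close> and is
  absorbed.\<close>

lemma gain_step:
  assumes v: "ito v J" and ab: "0 \<le> a" "a \<le> b" "b \<le> T" and small: "sqrt (b - a) * K \<le> 1 / 2"
  shows "l2norm P (\<lambda>z. indicator {a<..b} (fst z) * case_prod v z) \<le> 2 * l2norm M (gain v J b)"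
    and "l2norm M (gain v J a) \<le> 2 * l2norm M (gain v J b)"
proof -
  have abT: "a \<in> {0..T}" "b \<in> {0..T}" using ab by auto
  have vA: "v \<in> L2_adapted M T W" by (rule ito_integrand[OF v])
  have vL: "case_prod v \<in> L2 P" by (rule ito_integrand_L2[OF v])
  note \<rho>v = \<rho>_mult_L2[OF vA]
  define m where "m = l2norm P (\<lambda>z. indicator {a<..b} (fst z) * case_prod v z)"
  define D where "D = (\<lambda>\<omega>. \<integral>t. indicator {a<..b} t * (case_prod \<rho> (t, \<omega>) * case_prod v (t, \<omega>)) \<partial>R)"
  let ?Y = "gain v J" and ?d = "\<lambda>\<omega>. J b \<omega> - J a \<omega>"
  have DL: "D \<in> L2 M" unfolding D_def by (rule time_integral_L2(1)[OF \<rho>v]) simp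
  have YL: "?Y a \<in> L2 M" "?Y b \<in> L2 M" by (rule gain_L2(1)[OF v abT(1)], rule gain_L2(1)[OF v abT(2)])
  have dL: "?d \<in> L2 M" by (intro L2_diff ito_L2[OF v] abT)
  have "{a<..b} \<inter> {0..T} = {a<..b}" using ab by auto
  then have "measure lborel ({a<..b} \<inter> {0..T}) = b - a" using ab by simp
  then have "l2norm M D \<le> sqrt (b - a) * l2norm P (\<lambda>z. indicator {a<..b} (fst z) * (case_prod \<rho> z * case_prod v z))"
    using time_integral_L2(2)[OF \<rho>v, of "{a<..b}"] unfolding D_def by simp
  also have "\<dots> \<le> sqrt (b - a) * (K * m)"
  proof (rule mult_left_mono)
    have "l2norm P (\<lambda>z. indicator {a<..b} (fst z) * (case_prod \<rho> z * case_prod v z))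
      \<le> l2norm P (\<lambda>z. K * (indicator {a<..b} (fst z) * case_prod v z))"
    proof (rule l2norm_mono)
      show "(\<lambda>z. K * (indicator {a<..b} (fst z) * case_prod v z)) \<in> L2 P" by (intro L2_cmult L2_indicator_P[OF vL]) simp
      show "(\<lambda>z. indicator {a<..b} (fst z) * (case_prod \<rho> z * case_prod v z)) \<in> borel_measurable P"
        by (intro L2_measurable[OF L2_indicator_P[OF \<rho>v]]) simp
      show "AE z in P. \<bar>indicator {a<..b} (fst z) * (case_prod \<rho> z * case_prod v z)\<bar> \<le> \<bar>K * (indicator {a<..b} (fst z) * case_prod v z)\<bar>"
        using AE_\<rho>_bound by eventually_elim (use K_nonneg in \<open>auto simp: indicator_def abs_mult intro: mult_right_mono\<close>)
    qed
    then show "l2norm P (\<lambda>z. indicator {a<..b} (fst z) * (case_prod \<rho> z * case_prod v z)) \<le> K * m"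
      using K_nonneg by (simp add: l2norm_cmult m_def)
  qed (use ab in simp)
  also have "\<dots> = (sqrt (b - a) * K) * m" by simp
  also have "\<dots> \<le> 1 / 2 * m" by (rule mult_right_mono[OF small]) (simp add: m_def)
  finally have Dn: "l2norm M D \<le> m / 2" by simp
  have AEeq: "AE \<omega> in M. ?Y b \<omega> - D \<omega> = ?Y a \<omega> + ?d \<omega>"
    using AE_section_integrable[OF \<rho>v]
  proof eventually_elim
    case (elim \<omega>)
    have "TI (\<lambda>t \<omega>. \<rho> t \<omega> * v t \<omega>) b \<omega> - TI (\<lambda>t \<omega>. \<rho> t \<omega> * v t \<omega>) a \<omega> = D \<omega>"
      unfolding TI_pint D_def using pint_increment[of "\<lambda>s. \<rho> s \<omega> * v s \<omega>" a b] elim ab by simp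
    then show ?case by (simp add: gain_def)
  qed
  have "expectation (\<lambda>\<omega>. ?d \<omega> * ?Y a \<omega>) = 0"
    by (rule ito_martingale[OF v ab gain_L2(2)[OF v abT(1)] YL(1)])
  moreover have "(l2norm M (\<lambda>\<omega>. ?Y a \<omega> + ?d \<omega>))\<^sup>2 = expectation (\<lambda>\<omega>. (?Y a \<omega>)\<^sup>2 + 2 * (?d \<omega> * ?Y a \<omega>) + (?d \<omega>)\<^sup>2)"
    unfolding l2norm_square by (intro Bochner_Integration.integral_cong) (auto simp: power2_eq_square algebra_simps)
  moreover have "\<dots> = (l2norm M (?Y a))\<^sup>2 + 2 * expectation (\<lambda>\<omega>. ?d \<omega> * ?Y a \<omega>) + (l2norm M ?d)\<^sup>2"
    using L2_integrable_square[OF YL(1)] L2_integrable_square[OF dL] L2_integrable_mult[OF dL YL(1)]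
    by (simp add: l2norm_square)
  ultimately have sq: "(l2norm M (\<lambda>\<omega>. ?Y a \<omega> + ?d \<omega>))\<^sup>2 = (l2norm M (?Y a))\<^sup>2 + m\<^sup>2"
    using ito_increment_norm[OF v ab] by (simp add: m_def)
  have "l2norm M (\<lambda>\<omega>. ?Y a \<omega> + ?d \<omega>) = l2norm M (\<lambda>\<omega>. ?Y b \<omega> - D \<omega>)"
    by (rule l2norm_cong_AE[OF L2_measurable[OF L2_add[OF YL(1) dL]] L2_measurable[OF L2_diff[OF YL(2) DL]]])
      (use AEeq in \<open>auto elim: eventually_mono\<close>)
  also have "\<dots> \<le> l2norm M (?Y b) + l2norm M D" by (rule l2norm_triangle_diff[OF YL(2) DL])
  finally have up: "l2norm M (\<lambda>\<omega>. ?Y a \<omega> + ?d \<omega>) \<le> l2norm M (?Y b) + m / 2" using Dn by simp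
  have "m \<le> l2norm M (\<lambda>\<omega>. ?Y a \<omega> + ?d \<omega>)" by (rule power2_le_imp_le) (simp_all add: sq)
  then show 1: "l2norm P (\<lambda>z. indicator {a<..b} (fst z) * case_prod v z) \<le> 2 * l2norm M (?Y b)"
    using up by (simp add: m_def)
  have "l2norm M (?Y a) \<le> l2norm M (\<lambda>\<omega>. ?Y a \<omega> + ?d \<omega>)" by (rule power2_le_imp_le) (simp_all add: sq)
  then show "l2norm M (?Y a) \<le> 2 * l2norm M (?Y b)" using up 1 by (simp add: m_def)
qed

text \<open>\<open>gain_step\<close> is iterated backward from \<open>T\<close>, the only time at
  which the gain is given. The grid is chosen from \<open>T\<close> and \<open>K\<close> alone, so
  one constant serves all strategies.\<close>

lemma gain_lower_bound:
  "\<exists>c\<ge>0. \<forall>v J. ito v J \<longrightarrow> l2norm P (case_prod v) \<le> c * l2norm M (gain v J T)"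
proof -
  have "(\<lambda>k. (1 / 2 :: real) ^ k) \<longlonglongrightarrow> 0" by (rule LIMSEQ_power_zero) (simp add: real_norm_def)
  then have "(\<lambda>k. sqrt (T * (1 / 2) ^ k) * K) \<longlonglongrightarrow> sqrt (T * 0) * K"
    by (intro tendsto_mult tendsto_real_sqrt tendsto_const)
  then have "eventually (\<lambda>k. sqrt (T * (1 / 2) ^ k) * K < 1 / 2) sequentially"
    by (intro order_tendstoD(2)) auto
  then obtain k where k: "sqrt (T * (1 / 2) ^ k) * K < 1 / 2"
    using eventually_happens' sequentially_bot by blast
  define N :: nat where "N = 2 ^ k"
  have small: "sqrt (grid k (Suc j) - grid k j) * K \<le> 1 / 2" for j
    using k by (simp add: grid_step power_divide)
  \<comment> \<open>Each of the \<open>N\<close> pieces of \<open>v\<close> is bounded by the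
    terminal gain after at most \<open>N\<close> doublings, and the pieces are added by the triangle
    inequality.\<close>
  have "l2norm P (case_prod v) \<le> (real N * 2 ^ N) * l2norm M (gain v J T)" if v: "ito v J" for v J
  proof -
    have g: "0 \<le> grid k j" "grid k j \<le> grid k (Suc j)" for j
      using grid_mono[of 0 j k] grid_mono[of j "Suc j" k] by auto
    have gT: "grid k (Suc j) \<le> T" if "j < N" for j using grid_in[of "Suc j" k] that by (simp add: N_def)
    have y: "l2norm M (gain v J (grid k (N - i))) \<le> 2 ^ i * l2norm M (gain v J T)" if "i \<le> N" for i
      using that
    proof (induction i)
      case 0
      then show ?case by (simp add: N_def)
    next
      case (Suc i)
      have j: "N - Suc i < N" "Suc (N - Suc i) = N - i" using Suc.prems by auto
      show ?case using gain_step(2)[OF v g(1) g(2) gT[OF j(1)] small] Suc j by simp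
    qed
    have m: "l2norm P (\<lambda>z. indicator {grid k j<..grid k (Suc j)} (fst z) * case_prod v z) \<le> 2 ^ N * l2norm M (gain v J T)"
      if j: "j < N" for j
    proof -
      have "l2norm P (\<lambda>z. indicator {grid k j<..grid k (Suc j)} (fst z) * case_prod v z)
         \<le> 2 * l2norm M (gain v J (grid k (Suc j)))"
        by (rule gain_step(1)[OF v g(1) g(2) gT[OF j] small])
      also have "\<dots> \<le> 2 * (2 ^ (N - Suc j) * l2norm M (gain v J T))"
        using y[of "N - Suc j"] j by simp
      also have "\<dots> = 2 ^ (N - j) * l2norm M (gain v J T)" using j by (simp add: Suc_diff_Suc flip: power_Suc)
      also have "\<dots> \<le> 2 ^ N * l2norm M (gain v J T)" by (intro mult_right_mono power_increasing) auto
      finally show ?thesis .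
    qed
    have vL: "case_prod v \<in> L2 P" by (rule ito_integrand_L2[OF v])
    have pL: "(\<lambda>z. indicator {grid k j<..grid k (Suc j)} (fst z) * case_prod v z) \<in> L2 P" for j
      by (rule L2_indicator_P[OF vL]) simp
    have "l2norm P (case_prod v) = l2norm P (\<lambda>z. \<Sum>j<N. indicator {grid k j<..grid k (Suc j)} (fst z) * case_prod v z)"
    proof (rule l2norm_cong_AE[OF L2_measurable[OF vL] L2_measurable[OF L2_sum[OF pL]]])
      show "AE z in P. case_prod v z = (\<Sum>j<N. indicator {grid k j<..grid k (Suc j)} (fst z) * case_prod v z)"
        using AE_P_fst_neq[of 0] AE_space[of P]
      proof eventually_elim
        case (elim z)
        then have z: "fst z \<in> {0..T}" "fst z \<noteq> 0" by (auto simp: space_P)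
        have "(\<Sum>i<N. case_prod v z * indicator {grid k i<..grid k (Suc i)} (fst z)) = case_prod v z"
        proof -
          obtain j where "\<forall>c. (\<Sum>i<2^k. c i * indicator {grid k i<..grid k (Suc i)} (fst z)) = (c j :: real)"
            using grid_step_function[OF z, of k] by blast
          from spec[OF this, of "\<lambda>_. case_prod v z"] show ?thesis unfolding N_def .
        qed
        then show ?case by (simp add: mult.commute)
      qed
    qed
    also have "\<dots> \<le> (\<Sum>j<N. l2norm P (\<lambda>z. indicator {grid k j<..grid k (Suc j)} (fst z) * case_prod v z))"
      by (rule l2norm_sum_le[OF pL])
    also have "\<dots> \<le> (\<Sum>j<N. 2 ^ N * l2norm M (gain v J T))" by (intro sum_mono m) simp
    finally show ?thesis by simp
  qed
  then show ?thesis by (intro exI[of _ "real N * 2 ^ N"]) auto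
qed

lemma gain_diff:
  assumes "ito v J" "ito w I"
  shows "AE \<omega> in M. gain (\<lambda>t \<omega>. v t \<omega> + c * w t \<omega>) (\<lambda>t \<omega>. J t \<omega> + c * I t \<omega>) T \<omega> = gain v J T \<omega> + c * gain w I T \<omega>"
  using AE_section_integrable[OF \<rho>_mult_L2[OF ito_integrand[OF assms(1)]]]
    AE_section_integrable[OF \<rho>_mult_L2[OF ito_integrand[OF assms(2)]]]
proof eventually_elim
  case (elim \<omega>)
  have "pint (\<lambda>s. \<rho> s \<omega> * (v s \<omega> + c * w s \<omega>)) T = pint (\<lambda>s. \<rho> s \<omega> * v s \<omega> + c * (\<rho> s \<omega> * w s \<omega>)) T"
    by (rule pint_cong) (simp add: algebra_simps)
  also have "\<dots> = pint (\<lambda>s. \<rho> s \<omega> * v s \<omega>) T + c * pint (\<lambda>s. \<rho> s \<omega> * w s \<omega>) T"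
    unfolding pint_T using elim by simp
  finally show ?case by (simp add: gain_def TI_pint algebra_simps)
qed

lemma gain_upper_bound:
  assumes v: "ito v J"
  shows "l2norm M (gain v J T) \<le> (sqrt T * K + 1) * l2norm P (case_prod v)"
proof -
  have TT: "T \<in> {0..T}" using T_pos by simp
  have vA: "v \<in> L2_adapted M T W" by (rule ito_integrand[OF v])
  have vL: "case_prod v \<in> L2 P" by (rule ito_integrand_L2[OF v])
  note \<rho>v = \<rho>_mult_L2[OF vA]
  have e: "case_prod (\<lambda>t \<omega>. \<rho> t \<omega> * v t \<omega>) \<in> L2 P" unfolding case_prod_mult by (rule \<rho>v)
  have "l2norm M (gain v J T) \<le> l2norm M (TI (\<lambda>t \<omega>. \<rho> t \<omega> * v t \<omega>) T) + l2norm M (J T)"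
    unfolding gain_def[abs_def] by (rule l2norm_triangle[OF TI_L2[OF e] ito_L2[OF v TT]])
  also have "l2norm M (J T) \<le> l2norm P (case_prod v)"
    unfolding ito_norm[OF v TT] by (rule l2norm_indicator_P_le[OF vL]) simp
  also have "l2norm M (TI (\<lambda>t \<omega>. \<rho> t \<omega> * v t \<omega>) T) \<le> sqrt T * (K * l2norm P (case_prod v))"
  proof -
    have "{..T} \<inter> {0..T} = {0..T}" by auto
    then have "measure lborel ({..T} \<inter> {0..T}) = T" using T_pos by simp
    then have "l2norm M (TI (\<lambda>t \<omega>. \<rho> t \<omega> * v t \<omega>) T)
        \<le> sqrt T * l2norm P (\<lambda>z. indicator {..T} (fst z) * (case_prod \<rho> z * case_prod v z))"
      using time_integral_L2(2)[OF \<rho>v, of "{..T}"] by (simp add: TI_def[abs_def])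
    also have "\<dots> \<le> sqrt T * (K * l2norm P (case_prod v))"
    proof (rule mult_left_mono)
      have "l2norm P (\<lambda>z. indicator {..T} (fst z) * (case_prod \<rho> z * case_prod v z)) \<le> l2norm P (\<lambda>z. K * case_prod v z)"
      proof (rule l2norm_mono[OF L2_cmult[OF vL]])
        show "(\<lambda>z. indicator {..T} (fst z) * (case_prod \<rho> z * case_prod v z)) \<in> borel_measurable P"
          by (intro L2_measurable[OF L2_indicator_P[OF \<rho>v]]) simp
        show "AE z in P. \<bar>indicator {..T} (fst z) * (case_prod \<rho> z * case_prod v z)\<bar> \<le> \<bar>K * case_prod v z\<bar>"
          using AE_\<rho>_bound by eventually_elim (use K_nonneg in \<open>auto simp: indicator_def abs_mult intro: mult_right_mono\<close>)
      qed
      then show "l2norm P (\<lambda>z. indicator {..T} (fst z) * (case_prod \<rho> z * case_prod v z)) \<le> K * l2norm P (case_prod v)"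
        using K_nonneg by (simp add: l2norm_cmult)
    qed (use T_pos in simp)
    finally show ?thesis .
  qed
  finally show ?thesis by (simp add: algebra_simps)
qed

end

section \<open>Absence of arbitrage\<close>

context brownian_setting
begin

definition bounded_F :: "real \<Rightarrow> ('a \<Rightarrow> real) \<Rightarrow> bool" where
  "bounded_F t g \<longleftrightarrow> g \<in> borel_measurable (F t) \<and> (\<exists>B. \<forall>\<omega>\<in>space M. \<bar>g \<omega>\<bar> \<le> B)"

lemma bounded_F_const: "bounded_F t (\<lambda>_. c)"
  by (auto simp: bounded_F_def)

lemma bounded_F_mult: "bounded_F t f \<Longrightarrow> bounded_F t g \<Longrightarrow> bounded_F t (\<lambda>\<omega>. f \<omega> * g \<omega>)"
proof -
  assume a: "bounded_F t f" "bounded_F t g"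
  then obtain B D where B: "\<forall>\<omega>\<in>space M. \<bar>f \<omega>\<bar> \<le> B" "\<forall>\<omega>\<in>space M. \<bar>g \<omega>\<bar> \<le> D"
    unfolding bounded_F_def by blast
  have "\<bar>f \<omega> * g \<omega>\<bar> \<le> B * D" if "\<omega> \<in> space M" for \<omega>
  proof -
    have "\<bar>f \<omega>\<bar> \<le> B" "\<bar>g \<omega>\<bar> \<le> D" using B that by auto
    then show ?thesis unfolding abs_mult by (intro mult_mono) linarith+
  qed
  then show ?thesis using a by (auto simp: bounded_F_def intro: borel_measurable_times)
qed

lemma bounded_F_add: "bounded_F t f \<Longrightarrow> bounded_F t g \<Longrightarrow> bounded_F t (\<lambda>\<omega>. f \<omega> + g \<omega>)"
proof -
  assume a: "bounded_F t f" "bounded_F t g"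
  then obtain B D where B: "\<forall>\<omega>\<in>space M. \<bar>f \<omega>\<bar> \<le> B" "\<forall>\<omega>\<in>space M. \<bar>g \<omega>\<bar> \<le> D"
    unfolding bounded_F_def by blast
  have "\<bar>f \<omega> + g \<omega>\<bar> \<le> B + D" if "\<omega> \<in> space M" for \<omega>
    using abs_triangle_ineq[of "f \<omega>" "g \<omega>"] B that by fastforce
  then show ?thesis using a by (auto simp: bounded_F_def intro: borel_measurable_add)
qed

lemma bounded_F_mono: "bounded_F s f \<Longrightarrow> s \<le> t \<Longrightarrow> bounded_F t f"
  using measurable_F_mono unfolding bounded_F_def by blast

lemma bounded_F_imp_L2: "bounded_F t f \<Longrightarrow> t \<le> T \<Longrightarrow> f \<in> L2 M"
  using bounded_F_L2 unfolding bounded_F_def by blast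

lemma bounded_F_sgn_increment: "0 \<le> s \<Longrightarrow> s \<le> t \<Longrightarrow> bounded_F t (\<lambda>\<omega>. sgn (W t \<omega> - W s \<omega>))"
proof -
  assume st: "0 \<le> s" "s \<le> t"
  have "(\<lambda>\<omega>. W t \<omega> - W s \<omega>) \<in> borel_measurable (F t)" using W_adapted st by auto
  then have "(\<lambda>\<omega>. sgn (W t \<omega> - W s \<omega>)) \<in> borel_measurable (F t)"
    by (rule measurable_compose) (rule borel_measurable_sgn)
  moreover have "\<forall>\<omega>\<in>space M. \<bar>sgn (W t \<omega> - W s \<omega>)\<bar> \<le> 1" by (simp add: sgn_if)
  ultimately show ?thesis unfolding bounded_F_def by blast
qed

lemma increment_expectation_bounded:
  assumes st: "0 \<le> s" "s < t" "t \<le> T" and g: "bounded_F s g"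
  shows "expectation (\<lambda>\<omega>. g \<omega> * sgn (W t \<omega> - W s \<omega>)) = 0"
    and "expectation (\<lambda>\<omega>. g \<omega> * (W t \<omega> - W s \<omega>)) = 0"
    and "expectation (\<lambda>\<omega>. g \<omega> * \<bar>W t \<omega> - W s \<omega>\<bar>) = expectation g * (sqrt (t - s) * sqrt (2 / pi))"
    and "integrable M (\<lambda>\<omega>. g \<omega> * (W t \<omega> - W s \<omega>))" and "integrable M (\<lambda>\<omega>. g \<omega> * \<bar>W t \<omega> - W s \<omega>\<bar>)"
proof -
  have gF: "g \<in> borel_measurable (F s)" and gi: "integrable M g"
    using g bounded_F_imp_L2[OF g] st by (auto simp: bounded_F_def intro: L2_integrable)
  note m = increment_moments[OF st]
  note e = increment_expectation[OF st gF gi]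
  show "expectation (\<lambda>\<omega>. g \<omega> * sgn (W t \<omega> - W s \<omega>)) = 0"
    using e(2)[of sgn] borel_measurable_sgn m by simp
  show "expectation (\<lambda>\<omega>. g \<omega> * (W t \<omega> - W s \<omega>)) = 0" using e(2)[of "\<lambda>x. x"] m by simp
  show "expectation (\<lambda>\<omega>. g \<omega> * \<bar>W t \<omega> - W s \<omega>\<bar>) = expectation g * (sqrt (t - s) * sqrt (2 / pi))"
    using e(2)[of "\<lambda>x. \<bar>x\<bar>"] m by simp
  show "integrable M (\<lambda>\<omega>. g \<omega> * (W t \<omega> - W s \<omega>))" using e(1)[of "\<lambda>x. x"] m by simp
  show "integrable M (\<lambda>\<omega>. g \<omega> * \<bar>W t \<omega> - W s \<omega>\<bar>)" using e(1)[of "\<lambda>x. \<bar>x\<bar>"] m by simp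
qed

text \<open>A discrete density for a change of measure: since \<open>E |W t - W s| = sqrt (2 (t - s) / \<pi>)\<close>, the factor
  \<open>1 - \<theta> q sgn (W t - W s)\<close> with \<open>q = sqrt (\<pi> (t - s) / 2)\<close> turns \<open>W t - W s + \<theta> (t - s)\<close> into a variable
  of mean \<open>0\<close>. Unlike the Girsanov exponential, it is bounded.\<close>

definition dens :: "nat \<Rightarrow> (nat \<Rightarrow> 'a \<Rightarrow> real) \<Rightarrow> nat \<Rightarrow> 'a \<Rightarrow> real" where
  "dens k \<theta> n \<omega> = (\<Prod>j<n. 1 - \<theta> j \<omega> * (sqrt (pi / 2 * (T / 2 ^ k)) * sgn (W (grid k (Suc j)) \<omega> - W (grid k j) \<omega>)))"

text \<open>The sign of an increment has mean 0 and is independent of the past. Hence a later factor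
  may be dropped against anything known before its cell, and the cross term in the second moment
  vanishes, which leaves growth by at most \<open>1 + B^2 * q^2\<close> per cell. The condition
  \<open>small\<close> keeps every factor nonnegative.\<close>

lemma dens_properties:
  fixes k :: nat and \<theta> :: "nat \<Rightarrow> 'a \<Rightarrow> real" and B :: real
  defines "q \<equiv> sqrt (pi / 2 * (T / 2 ^ k))"
  assumes \<theta>F: "\<And>j. j < 2 ^ k \<Longrightarrow> \<theta> j \<in> borel_measurable (F (grid k j))"
    and \<theta>B: "\<And>j \<omega>. j < 2 ^ k \<Longrightarrow> \<omega> \<in> space M \<Longrightarrow> \<bar>\<theta> j \<omega>\<bar> \<le> B" and small: "B * q \<le> 1"
  shows "n \<le> 2 ^ k \<Longrightarrow> bounded_F (grid k n) (dens k \<theta> n)"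
    and "n \<le> 2 ^ k \<Longrightarrow> \<omega> \<in> space M \<Longrightarrow> 0 \<le> dens k \<theta> n \<omega>"
    and "n \<le> m \<Longrightarrow> m \<le> 2 ^ k \<Longrightarrow> X \<in> borel_measurable (F (grid k n)) \<Longrightarrow> X \<in> L2 M \<Longrightarrow>
      expectation (\<lambda>\<omega>. dens k \<theta> m \<omega> * X \<omega>) = expectation (\<lambda>\<omega>. dens k \<theta> n \<omega> * X \<omega>)"
    and "n \<le> 2 ^ k \<Longrightarrow> (l2norm M (dens k \<theta> n))\<^sup>2 \<le> (1 + B\<^sup>2 * q\<^sup>2) ^ n"
    and "j < 2 ^ k \<Longrightarrow> bounded_F (grid k j) h \<Longrightarrow>
      expectation (\<lambda>\<omega>. dens k \<theta> (Suc j) \<omega> * (h \<omega> * (W (grid k (Suc j)) \<omega> - W (grid k j) \<omega> + \<theta> j \<omega> * (T / 2 ^ k)))) = 0"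
proof -
  define \<delta> where "\<delta> = T / 2 ^ k"
  have \<delta>: "0 < \<delta>" using T_pos by (simp add: \<delta>_def)
  have q0: "0 \<le> q" unfolding q_def using T_pos by simp
  define s where "s = (\<lambda>j \<omega>. sgn (W (grid k (Suc j)) \<omega> - W (grid k j) \<omega>))"
  define d where "d = (\<lambda>j \<omega>. W (grid k (Suc j)) \<omega> - W (grid k j) \<omega>)"
  let ?Z = "dens k \<theta>"
  have Z0: "?Z 0 \<omega> = 1" for \<omega> by (simp add: dens_def)
  have ZS: "?Z (Suc n) \<omega> = ?Z n \<omega> * (1 - \<theta> n \<omega> * (q * s n \<omega>))" for n \<omega>
    by (simp add: dens_def q_def s_def)
  have st: "0 \<le> grid k j" "grid k j < grid k (Suc j)" "grid k j \<le> T" "grid k (Suc j) \<le> T" if "j < 2 ^ k" for j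
  proof -
    have "0 < T / 2 ^ k" using T_pos by simp
    then have "grid k j < grid k (Suc j)" using grid_step[of k j] by linarith
    then show "0 \<le> grid k j" "grid k j < grid k (Suc j)" "grid k j \<le> T" "grid k (Suc j) \<le> T"
      using grid_in[of j k] grid_in[of "Suc j" k] that by auto
  qed
  have \<theta>b: "bounded_F (grid k j) (\<theta> j)" if "j < 2 ^ k" for j
    using \<theta>F[OF that] \<theta>B[OF that] unfolding bounded_F_def by blast
  have sb: "bounded_F (grid k (Suc j)) (s j)" if "j < 2 ^ k" for j
    unfolding s_def using st[OF that] by (intro bounded_F_sgn_increment) auto
  have sa: "\<bar>s j \<omega>\<bar> \<le> 1" for j \<omega> by (simp add: s_def sgn_if)
  show bZ: "bounded_F (grid k n) (?Z n)" if "n \<le> 2 ^ k" for n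
    using that
  proof (induction n)
    case 0
    then show ?case using bounded_F_const[of 0 1] by (simp add: Z0[abs_def])
  next
    case (Suc n)
    have n: "n < 2 ^ k" using Suc.prems by simp
    have le: "grid k n \<le> grid k (Suc n)" by (rule grid_mono) simp
    have "bounded_F (grid k (Suc n)) (\<lambda>\<omega>. ?Z n \<omega> * (1 + (- q) * (\<theta> n \<omega> * s n \<omega>)))"
      using Suc n by (intro bounded_F_mult bounded_F_add bounded_F_const sb bounded_F_mono[OF _ le] \<theta>b) auto
    then show ?case by (simp add: ZS[abs_def] algebra_simps)
  qed
  show "0 \<le> ?Z n \<omega>" if "n \<le> 2 ^ k" "\<omega> \<in> space M" for n \<omega>
    using that
  proof (induction n)
    case (Suc n)
    have "\<bar>\<theta> n \<omega> * (q * s n \<omega>)\<bar> \<le> B * (q * 1)"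
      unfolding abs_mult using \<theta>B[of n \<omega>] Suc.prems q0 sa[of n \<omega>] by (intro mult_mono) (auto simp: mult_left_le)
    then have "0 \<le> 1 - \<theta> n \<omega> * (q * s n \<omega>)" using small by linarith
    then show ?case using Suc unfolding ZS by (intro mult_nonneg_nonneg) auto
  qed (simp add: Z0)
  have drop: "expectation (\<lambda>\<omega>. ?Z (Suc m) \<omega> * X \<omega>) = expectation (\<lambda>\<omega>. ?Z m \<omega> * X \<omega>)"
    if m: "m < 2 ^ k" and X: "X \<in> borel_measurable (F (grid k m))" "X \<in> L2 M" for m X
  proof -
    have Zb: "bounded_F (grid k m) (?Z m)" using bZ m by simp
    have Zt: "bounded_F (grid k m) (\<lambda>\<omega>. ?Z m \<omega> * \<theta> m \<omega>)" by (rule bounded_F_mult[OF Zb \<theta>b[OF m]])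
    have b2: "f \<in> borel_measurable (F (grid k m)) \<and> integrable M (\<lambda>\<omega>. f \<omega> * X \<omega>)" if "bounded_F (grid k m) f" for f
      using that bounded_F_imp_L2[OF that st(3)[OF m]] X(2) by (auto simp: bounded_F_def intro: L2_integrable_mult)
    have gF: "(\<lambda>\<omega>. ?Z m \<omega> * \<theta> m \<omega> * X \<omega>) \<in> borel_measurable (F (grid k m))"
      by (intro borel_measurable_times conjunct1[OF b2[OF Zt]] X(1))
    note e = increment_expectation[OF st(1,2,4)[OF m] gF conjunct2[OF b2[OF Zt]] borel_measurable_sgn
        increment_moments(7)[OF st(1,2,4)[OF m]], folded s_def]
    have "expectation (\<lambda>\<omega>. ?Z (Suc m) \<omega> * X \<omega>)
      = expectation (\<lambda>\<omega>. ?Z m \<omega> * X \<omega> - q * (?Z m \<omega> * \<theta> m \<omega> * X \<omega> * sgn (W (grid k (Suc m)) \<omega> - W (grid k m) \<omega>)))"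
      by (intro Bochner_Integration.integral_cong) (auto simp: ZS s_def algebra_simps)
    also have "\<dots> = expectation (\<lambda>\<omega>. ?Z m \<omega> * X \<omega>)"
      using e b2[OF Zb] increment_moments(8)[OF st(1,2,4)[OF m]] by simp
    finally show ?thesis .
  qed
  show "expectation (\<lambda>\<omega>. ?Z m \<omega> * X \<omega>) = expectation (\<lambda>\<omega>. ?Z n \<omega> * X \<omega>)"
    if "n \<le> m" "m \<le> 2 ^ k" "X \<in> borel_measurable (F (grid k n))" "X \<in> L2 M" for n m X
    using that(1,2)
  proof (induction m rule: dec_induct)
    case (step m)
    have "X \<in> borel_measurable (F (grid k m))" by (rule measurable_F_mono[OF that(3) grid_mono[OF step(1)]])
    then show ?case using drop[of m X] step that(4) by simp
  qed simp
  show "(l2norm M (?Z n))\<^sup>2 \<le> (1 + B\<^sup>2 * q\<^sup>2) ^ n" if "n \<le> 2 ^ k" for n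
    using that
  proof (induction n)
    case 0
    then show ?case by (simp add: l2norm_square Z0 prob_space)
  next
    case (Suc n)
    have n: "n < 2 ^ k" using Suc.prems by simp
    have Zb: "bounded_F (grid k n) (?Z n)" using bZ n by simp
    let ?g = "\<lambda>\<omega>. ?Z n \<omega> * ?Z n \<omega> * \<theta> n \<omega>"
    let ?f = "\<lambda>\<omega>. ?Z n \<omega> * \<theta> n \<omega> * (?Z n \<omega> * \<theta> n \<omega>) * (s n \<omega> * s n \<omega>)"
    have gb: "bounded_F (grid k n) ?g" by (intro bounded_F_mult Zb \<theta>b n)
    have le: "grid k n \<le> grid k (Suc n)" by (rule grid_mono) simp
    have fi: "integrable M ?f"
      by (rule L2_integrable[OF bounded_F_imp_L2[OF _ st(4)[OF n]]])
        (intro bounded_F_mult sb n bounded_F_mono[OF Zb le] bounded_F_mono[OF \<theta>b[OF n] le])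
    have Zi: "integrable M (\<lambda>\<omega>. (?Z n \<omega>)\<^sup>2)" by (rule L2_integrable_square[OF bounded_F_imp_L2[OF Zb st(3)[OF n]]])
    have gsi: "integrable M (\<lambda>\<omega>. ?g \<omega> * s n \<omega>)"
      by (rule L2_integrable[OF bounded_F_imp_L2[OF _ st(4)[OF n]]])
        (intro bounded_F_mult sb n bounded_F_mono[OF Zb le] bounded_F_mono[OF \<theta>b[OF n] le])
    have "(l2norm M (?Z (Suc n)))\<^sup>2 = expectation (\<lambda>\<omega>. (?Z n \<omega>)\<^sup>2 - 2 * q * (?g \<omega> * s n \<omega>) + q\<^sup>2 * ?f \<omega>)"
      unfolding l2norm_square
      by (intro Bochner_Integration.integral_cong) (auto simp: ZS power2_eq_square algebra_simps)
    also have "\<dots> = expectation (\<lambda>\<omega>. (?Z n \<omega>)\<^sup>2) - 2 * q * expectation (\<lambda>\<omega>. ?g \<omega> * s n \<omega>) + q\<^sup>2 * expectation ?f"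
      using fi Zi gsi by simp
    also have "expectation (\<lambda>\<omega>. ?g \<omega> * s n \<omega>) = 0"
      unfolding s_def by (rule increment_expectation_bounded(1)[OF st(1,2,4)[OF n] gb])
    also have "expectation ?f \<le> expectation (\<lambda>\<omega>. B\<^sup>2 * (?Z n \<omega>)\<^sup>2)"
    proof (rule integral_mono[OF fi])
      fix \<omega> assume w: "\<omega> \<in> space M"
      have "(\<theta> n \<omega>)\<^sup>2 \<le> B\<^sup>2" using \<theta>B[OF n w] by (metis abs_ge_zero power2_abs power_mono)
      moreover have "(s n \<omega>)\<^sup>2 \<le> 1" using sa[of n \<omega>] by (simp add: abs_square_le_1)
      ultimately have "(\<theta> n \<omega>)\<^sup>2 * (s n \<omega>)\<^sup>2 \<le> B\<^sup>2 * 1" by (intro mult_mono) auto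
      then have "(?Z n \<omega>)\<^sup>2 * ((\<theta> n \<omega>)\<^sup>2 * (s n \<omega>)\<^sup>2) \<le> (?Z n \<omega>)\<^sup>2 * (B\<^sup>2 * 1)" by (rule mult_left_mono) simp
      then show "?f \<omega> \<le> B\<^sup>2 * (?Z n \<omega>)\<^sup>2" by (simp add: power2_eq_square mult_ac)
    qed (use Zi in simp)
    then have "expectation (\<lambda>\<omega>. (?Z n \<omega>)\<^sup>2) - 2 * q * 0 + q\<^sup>2 * expectation ?f
        \<le> expectation (\<lambda>\<omega>. (?Z n \<omega>)\<^sup>2) - 2 * q * 0 + q\<^sup>2 * expectation (\<lambda>\<omega>. B\<^sup>2 * (?Z n \<omega>)\<^sup>2)"
      by (intro add_left_mono mult_left_mono) auto
    also have "\<dots> = (1 + B\<^sup>2 * q\<^sup>2) * (l2norm M (?Z n))\<^sup>2"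
      using Zi by (simp add: l2norm_square algebra_simps)
    also have "\<dots> \<le> (1 + B\<^sup>2 * q\<^sup>2) * (1 + B\<^sup>2 * q\<^sup>2) ^ n"
      using Suc by (intro mult_left_mono) auto
    finally show ?case by simp
  qed
  show "expectation (\<lambda>\<omega>. ?Z (Suc j) \<omega> * (h \<omega> * (W (grid k (Suc j)) \<omega> - W (grid k j) \<omega> + \<theta> j \<omega> * (T / 2 ^ k)))) = 0"
    if j: "j < 2 ^ k" and h: "bounded_F (grid k j) h" for j h
  proof -
    let ?a = "grid k j" and ?b = "grid k (Suc j)"
    let ?g = "\<lambda>\<omega>. ?Z j \<omega> * h \<omega>"
    have gb: "bounded_F ?a ?g" using bZ j by (intro bounded_F_mult h) simp
    have gt: "bounded_F ?a (\<lambda>\<omega>. ?g \<omega> * \<theta> j \<omega>)" by (rule bounded_F_mult[OF gb \<theta>b[OF j]])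
    have gtt: "bounded_F ?a (\<lambda>\<omega>. ?g \<omega> * \<theta> j \<omega> * \<theta> j \<omega>)" by (rule bounded_F_mult[OF gt \<theta>b[OF j]])
    have le: "?a \<le> ?b" by (rule grid_mono) simp
    have i3: "integrable M (\<lambda>\<omega>. ?g \<omega> * \<theta> j \<omega> * \<theta> j \<omega> * s j \<omega>)"
      by (rule L2_integrable[OF bounded_F_imp_L2[OF _ st(4)[OF j]]])
        (intro bounded_F_mult sb j bounded_F_mono[OF h le] bounded_F_mono[OF \<theta>b[OF j] le] bounded_F_mono[OF bZ le] less_imp_le)
    have i2: "integrable M (\<lambda>\<omega>. ?g \<omega> * \<theta> j \<omega>)"
      by (rule L2_integrable[OF bounded_F_imp_L2[OF gt st(3)[OF j]]])
    have sd: "s j \<omega> * d j \<omega> = \<bar>d j \<omega>\<bar>" for \<omega> by (simp add: s_def d_def sgn_if)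
    \<comment> \<open>The product of the sign and the increment is \<open>\<bar>d j\<bar>\<close>,
      the one term in which the density feels the increment. Its mean has to offset the drift
      \<open>\<delta> * \<theta> j\<close>; the terms linear in the increment or its sign have mean
      0.\<close>
    have eq: "?Z (Suc j) \<omega> * (h \<omega> * (d j \<omega> + \<theta> j \<omega> * \<delta>))
      = ?g \<omega> * d j \<omega> + \<delta> * (?g \<omega> * \<theta> j \<omega>) - q * (?g \<omega> * \<theta> j \<omega> * \<bar>d j \<omega>\<bar>) - \<delta> * q * (?g \<omega> * \<theta> j \<omega> * \<theta> j \<omega> * s j \<omega>)" for \<omega>
      unfolding ZS sd[symmetric] by (simp add: algebra_simps)
    have j1: "integrable M (\<lambda>\<omega>. ?g \<omega> * d j \<omega>)" and j2: "integrable M (\<lambda>\<omega>. ?g \<omega> * \<theta> j \<omega> * \<bar>d j \<omega>\<bar>)"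
      using increment_expectation_bounded(4)[OF st(1,2,4)[OF j] gb] increment_expectation_bounded(5)[OF st(1,2,4)[OF j] gt]
      by (simp_all add: d_def)
    have e1: "expectation (\<lambda>\<omega>. ?g \<omega> * d j \<omega>) = 0"
      using increment_expectation_bounded(2)[OF st(1,2,4)[OF j] gb] by (simp add: d_def)
    have e2: "expectation (\<lambda>\<omega>. ?g \<omega> * \<theta> j \<omega> * \<bar>d j \<omega>\<bar>) = expectation (\<lambda>\<omega>. ?g \<omega> * \<theta> j \<omega>) * (sqrt \<delta> * sqrt (2 / pi))"
      using increment_expectation_bounded(3)[OF st(1,2,4)[OF j] gt] by (simp add: d_def grid_step \<delta>_def)
    have e3: "expectation (\<lambda>\<omega>. ?g \<omega> * \<theta> j \<omega> * \<theta> j \<omega> * s j \<omega>) = 0"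
      using increment_expectation_bounded(1)[OF st(1,2,4)[OF j] gtt] by (simp add: s_def)
    have "expectation (\<lambda>\<omega>. ?Z (Suc j) \<omega> * (h \<omega> * (d j \<omega> + \<theta> j \<omega> * \<delta>)))
      = expectation (\<lambda>\<omega>. ?g \<omega> * d j \<omega>) + \<delta> * expectation (\<lambda>\<omega>. ?g \<omega> * \<theta> j \<omega>)
        - q * expectation (\<lambda>\<omega>. ?g \<omega> * \<theta> j \<omega> * \<bar>d j \<omega>\<bar>) - \<delta> * q * expectation (\<lambda>\<omega>. ?g \<omega> * \<theta> j \<omega> * \<theta> j \<omega> * s j \<omega>)"
      unfolding eq using j1 j2 i2 i3 by simp
    also have "\<dots> = expectation (\<lambda>\<omega>. ?g \<omega> * \<theta> j \<omega>) * (\<delta> - q * (sqrt \<delta> * sqrt (2 / pi)))"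
      unfolding e1 e2 e3 by (simp add: algebra_simps)
    \<comment> \<open>The constant \<open>q\<close> was chosen for this identity.\<close>
    also have "q * (sqrt \<delta> * sqrt (2 / pi)) = \<delta>"
    proof -
      have "q * (sqrt \<delta> * sqrt (2 / pi)) = sqrt ((pi / 2 * \<delta>) * (\<delta> * (2 / pi)))"
        by (simp only: q_def \<delta>_def[symmetric] real_sqrt_mult)
      also have "(pi / 2 * \<delta>) * (\<delta> * (2 / pi)) = \<delta>\<^sup>2" by (simp add: power2_eq_square)
      finally show ?thesis using \<delta> by simp
    qed
    finally show ?thesis by (simp add: d_def \<delta>_def)
  qed
qed

end

section \<open>Approximate pricing densities and the exclusion of sure profits\<close>

context trading
begin

lemma step_gain:
  assumes h: "elem k h" and \<theta>: "elem k \<theta>"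
  shows "TI (\<lambda>t \<omega>. ep k \<theta> t \<omega> * ep k h t \<omega>) T \<omega> + elementary_integral W (2 ^ k) (grid k) h T \<omega>
    = (\<Sum>j<2^k. h j \<omega> * (W (grid k (Suc j)) \<omega> - W (grid k j) \<omega> + \<theta> j \<omega> * (T / 2 ^ k)))"
proof -
  have "TI (\<lambda>t \<omega>. ep k \<theta> t \<omega> * ep k h t \<omega>) T \<omega>
    = (\<integral>t. (\<Sum>j<2^k. (\<theta> j \<omega> * h j \<omega>) * indicator {grid k j<..grid k (Suc j)} t) \<partial>R)"
    unfolding TI_pint pint_T
  proof (rule integral_cong_AE)
    have m: "(\<lambda>t. ep k g t \<omega>) \<in> borel_measurable R" for g
      unfolding elementary_process_def
      by (intro borel_measurable_sum borel_measurable_times borel_measurable_const indicator_R) simp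
    show "(\<lambda>s. ep k \<theta> s \<omega> * ep k h s \<omega>) \<in> borel_measurable R" by (intro borel_measurable_times m)
    show "(\<lambda>t. \<Sum>j<2^k. (\<theta> j \<omega> * h j \<omega>) * indicator {grid k j<..grid k (Suc j)} t) \<in> borel_measurable R"
      by (intro borel_measurable_sum borel_measurable_times borel_measurable_const indicator_R) simp
    show "AE t in R. ep k \<theta> t \<omega> * ep k h t \<omega> = (\<Sum>j<2^k. (\<theta> j \<omega> * h j \<omega>) * indicator {grid k j<..grid k (Suc j)} t)"
      using AE_R_neq[of 0] AE_space[of R]
    proof eventually_elim
      case (elim t)
      then have t: "t \<in> {0..T}" "t \<noteq> 0" by (auto simp: space_R)
      obtain j where j: "\<forall>c. (\<Sum>i<2^k. c i * indicator {grid k i<..grid k (Suc i)} t) = (c j :: real)"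
        using grid_step_function[OF t, of k] by blast
      show ?case unfolding elementary_process_def
        using spec[OF j, of "\<lambda>i. \<theta> i \<omega>"] spec[OF j, of "\<lambda>i. h i \<omega>"] spec[OF j, of "\<lambda>i. \<theta> i \<omega> * h i \<omega>"] by simp
    qed
  qed
  also have "\<dots> = (\<Sum>j<2^k. (\<theta> j \<omega> * h j \<omega>) * (T / 2 ^ k))"
  proof -
    have i: "integrable R (\<lambda>t. (\<theta> j \<omega> * h j \<omega>) * indicator {grid k j<..grid k (Suc j)} t)" for j
      using integrable_indicator_R[of "\<lambda>_. \<theta> j \<omega> * h j \<omega>" "{grid k j<..grid k (Suc j)}"] by (simp add: mult.commute)
    have "(\<integral>t. (\<theta> j \<omega> * h j \<omega>) * indicator {grid k j<..grid k (Suc j)} t \<partial>R) = (\<theta> j \<omega> * h j \<omega>) * (T / 2 ^ k)"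
      if "j < 2 ^ k" for j
      using measure_Ioc_R[of "grid k j" "grid k (Suc j)"] grid_in[of j k] grid_in[of "Suc j" k] that
        grid_mono[of j "Suc j" k] by (simp add: grid_step)
    then show ?thesis unfolding Bochner_Integration.integral_sum[OF i] by (intro sum.cong refl) simp
  qed
  finally have 1: "TI (\<lambda>t \<omega>. ep k \<theta> t \<omega> * ep k h t \<omega>) T \<omega> = (\<Sum>j<2^k. (\<theta> j \<omega> * h j \<omega>) * (T / 2 ^ k))" .
  have 2: "elementary_integral W (2 ^ k) (grid k) h T \<omega> = (\<Sum>j<2^k. h j \<omega> * (W (grid k (Suc j)) \<omega> - W (grid k j) \<omega>))"
    unfolding elementary_integral_def
  proof (rule sum.cong[OF refl])
    fix j :: nat assume "j \<in> {..<2 ^ k}"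
    then have "grid k j \<le> T" "grid k (Suc j) \<le> T" using grid_in[of j k] grid_in[of "Suc j" k] by auto
    then show "h j \<omega> * (W (min T (grid k (Suc j))) \<omega> - W (min T (grid k j)) \<omega>) = h j \<omega> * (W (grid k (Suc j)) \<omega> - W (grid k j) \<omega>)"
      by (simp add: min_absorb2)
  qed
  show ?thesis unfolding 1 2 sum.distrib[symmetric] by (simp add: algebra_simps)
qed

text \<open>The density constructed from steps \<open>\<theta>\<close> close to \<open>\<rho>\<close> annihilates the gains of step strategies and is
  bounded in mean square uniformly in the grid.\<close>

lemma approximate_density:
  assumes v: "ito v J" and e: "0 < e"
  shows "\<exists>Z. Z \<in> L2 M \<and> (\<forall>\<omega>\<in>space M. 0 \<le> Z \<omega>) \<and> expectation Z = 1 \<and>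
    \<bar>expectation (\<lambda>\<omega>. Z \<omega> * gain v J T \<omega>)\<bar> \<le> exp (K\<^sup>2 * (pi / 2 * T)) * ((sqrt T * (3 * K + 1) + 1) * e)"
proof -
  have TT: "T \<in> {0..T}" using T_pos by simp
  have vA: "v \<in> L2_adapted M T W" by (rule ito_integrand[OF v])
  have vL: "case_prod v \<in> L2 P" by (rule ito_integrand_L2[OF v])
  have \<rho>L: "case_prod \<rho> \<in> L2 P" using \<rho>_L2_adapted by (simp add: L2_adapted_iff)
  have "(\<lambda>n. l2norm P (\<lambda>z. clip (real n) (case_prod v z) - case_prod v z)) \<longlonglongrightarrow> 0"
    using L2_tends_clip[OF vL] by (simp add: L2_tends_def)
  then have "eventually (\<lambda>n. l2norm P (\<lambda>z. clip (real n) (case_prod v z) - case_prod v z) < e) sequentially"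
    using e by (rule order_tendstoD(2))
  \<comment> \<open>The integrand will be multiplied by the error of \<open>\<theta>\<close>, and a
    product of two merely square-integrable functions is not controlled in mean square. So
    \<open>v\<close> is truncated at \<open>N\<close> first, and the steps for \<open>\<rho>\<close>
    are then required to be within \<open>e / (N + 1)\<close>.\<close>
  then obtain N :: nat where N: "l2norm P (\<lambda>z. clip (real N) (case_prod v z) - case_prod v z) < e"
    using eventually_happens' sequentially_bot by blast
  have e': "0 < e / (real N + 1)" using e by simp
  obtain k1 h1 where h1: "elem k1 h1" "l2norm P (\<lambda>z. case_prod (ep k1 h1) z - case_prod v z) < e"
    using step_density[OF vA e] by blast
  obtain k2 h2 where h2: "elem k2 h2" "l2norm P (\<lambda>z. case_prod (ep k2 h2) z - case_prod \<rho> z) < e / (real N + 1)"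
    using step_density[OF \<rho>_L2_adapted e'] by blast
  have "(\<lambda>k. (1 / 2 :: real) ^ k) \<longlonglongrightarrow> 0" by (rule LIMSEQ_power_zero) (simp add: real_norm_def)
  then have "(\<lambda>k. K * sqrt (pi / 2 * (T * (1 / 2) ^ k))) \<longlonglongrightarrow> K * sqrt (pi / 2 * (T * 0))"
    by (intro tendsto_mult tendsto_real_sqrt tendsto_const)
  then have "eventually (\<lambda>k. K * sqrt (pi / 2 * (T * (1 / 2) ^ k)) < 1) sequentially"
    by (intro order_tendstoD(2)) auto
  \<comment> \<open>On a fine enough grid \<open>K * q \<le> 1\<close>, as nonnegativity of the
    density requires.\<close>
  then obtain k0 where k0: "\<And>k. k0 \<le> k \<Longrightarrow> K * sqrt (pi / 2 * (T * (1 / 2) ^ k)) < 1"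
    by (auto simp: eventually_sequentially)
  define k where "k = max k0 (max k1 k2)"
  define q where "q = sqrt (pi / 2 * (T / 2 ^ k))"
  have small: "K * q \<le> 1" using k0[of k] by (simp add: k_def q_def power_divide)
  have kk: "k1 \<le> k" "k2 \<le> k" by (simp_all add: k_def)
  obtain h where h: "elem k h" "ep k h = ep k1 h1"
    using elem_refine_le[OF h1(1) kk(1), of "\<lambda>_. True"] by blast
  obtain g where g: "elem k g" "ep k g = ep k2 h2"
    using elem_refine_le[OF h2(1) kk(2), of "\<lambda>_. True"] by blast
  \<comment> \<open>Truncation at \<open>K\<close> makes the second moment of the density
    independent of the approximation, and it moves the steps no further from
    \<open>\<rho>\<close>.\<close>
  define \<theta> where "\<theta> = (\<lambda>j \<omega>. clip K (g j \<omega>))"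
  have \<theta>B: "\<bar>\<theta> j \<omega>\<bar> \<le> K" for j \<omega> unfolding \<theta>_def by (rule clip_bound(1)[OF K_nonneg])
  have \<theta>F: "\<theta> j \<in> borel_measurable (F (grid k j))" if "j < 2 ^ k" for j
    unfolding \<theta>_def using g(1) that by (intro measurable_compose[OF _ clip_measurable]) (simp add: elem_iff)
  have \<theta>E: "elem k \<theta>" unfolding elem_iff using \<theta>F \<theta>B by blast
  have ep\<theta>: "ep k \<theta> t \<omega> = clip K (ep k g t \<omega>)" if t: "t \<in> {0..T}" for t \<omega>
  proof (cases "t = 0")
    case True
    have "t \<notin> {grid k j<..grid k (Suc j)}" for j using True grid_mono[of 0 j k] by simp
    then show ?thesis using K_nonneg by (simp add: elementary_process_def clip_def)
  next
    case False
    obtain j where j: "\<forall>c. (\<Sum>i<2^k. c i * indicator {grid k i<..grid k (Suc i)} t) = (c j :: real)"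
      using grid_step_function[OF t False, of k] by blast
    show ?thesis unfolding elementary_process_def
      using spec[OF j, of "\<lambda>i. \<theta> i \<omega>"] spec[OF j, of "\<lambda>i. g i \<omega>"] by (simp add: \<theta>_def)
  qed
  have \<theta>L: "case_prod (ep k \<theta>) \<in> L2 P" by (rule ep_L2[OF \<theta>E])
  have hL: "case_prod (ep k h) \<in> L2 P" by (rule ep_L2[OF h(1)])
  have \<theta>close: "l2norm P (\<lambda>z. case_prod (ep k \<theta>) z - case_prod \<rho> z) \<le> e / (real N + 1)"
  proof -
    have "l2norm P (\<lambda>z. case_prod (ep k \<theta>) z - case_prod \<rho> z) \<le> l2norm P (\<lambda>z. case_prod (ep k g) z - case_prod \<rho> z)"
    proof (rule l2norm_mono[OF L2_diff[OF ep_L2[OF g(1)] \<rho>L] L2_measurable[OF L2_diff[OF \<theta>L \<rho>L]]])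
      show "AE z in P. \<bar>case_prod (ep k \<theta>) z - case_prod \<rho> z\<bar> \<le> \<bar>case_prod (ep k g) z - case_prod \<rho> z\<bar>"
        using ep\<theta> clip_contract[OF K_nonneg \<rho>_bound] by (intro AE_I2) (auto simp: space_P)
    qed
    then show ?thesis using h2(2) unfolding g(2) by simp
  qed
  define L where "L = partition_blocks (2 ^ k) (grid k) h"
  have vL': "valid L" unfolding L_def by (rule valid_partition_blocks[OF h(1)])
  have bpL: "bp L = ep k h" and wiL: "wi L = elementary_integral W (2 ^ k) (grid k) h"
    by (simp_all add: L_def bp_partition)
  have itoL: "ito (ep k h) (elementary_integral W (2 ^ k) (grid k) h)"
    using ito_blocks[OF vL'] unfolding bpL wiL .
  define G' where "G' = (\<lambda>\<omega>. TI (\<lambda>t \<omega>. ep k \<theta> t \<omega> * ep k h t \<omega>) T \<omega> + elementary_integral W (2 ^ k) (grid k) h T \<omega>)"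
  let ?Z = "dens k \<theta> (2 ^ k)"
  note dp = dens_properties[where \<theta> = \<theta> and k = k and B = K, OF \<theta>F \<theta>B small[unfolded q_def]]
  have Zb: "bounded_F T ?Z" using dp(1)[of "2 ^ k"] by simp
  have ZL: "?Z \<in> L2 M" by (rule bounded_F_imp_L2[OF Zb]) simp
  have Zpos: "\<forall>\<omega>\<in>space M. 0 \<le> ?Z \<omega>" using dp(2)[of "2 ^ k"] by simp
  have EZ: "expectation ?Z = 1"
  proof -
    have "dens k \<theta> 0 \<omega> = 1" for \<omega> by (simp add: dens_def)
    then show ?thesis using dp(3)[of 0 "2 ^ k" "\<lambda>_. 1"] by (simp add: L2_const prob_space)
  qed
  \<comment> \<open>Each cell contributes a factor \<open>1 + K^2 * q^2\<close> to the second
    moment, where \<open>q^2\<close> is proportional to the cell length \<open>T / 2 ^ k\<close>;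
    the product over \<open>2 ^ k\<close> cells is bounded by an exponential free of
    \<open>k\<close>.\<close>
  have Znorm: "l2norm M ?Z \<le> exp (K\<^sup>2 * (pi / 2 * T))"
  proof -
    have "q\<^sup>2 = pi / 2 * (T / 2 ^ k)" using T_pos by (simp add: q_def)
    moreover have "1 + K\<^sup>2 * q\<^sup>2 \<le> exp (K\<^sup>2 * q\<^sup>2)" by (rule exp_ge_add_one_self)
    then have "(1 + K\<^sup>2 * q\<^sup>2) ^ (2 ^ k) \<le> exp (K\<^sup>2 * q\<^sup>2) ^ (2 ^ k)" by (intro power_mono) auto
    moreover have "exp (K\<^sup>2 * q\<^sup>2) ^ (2 ^ k) = exp (2 ^ k * (K\<^sup>2 * q\<^sup>2))" by (subst exp_of_nat_mult[symmetric]) simp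
    ultimately have "(l2norm M ?Z)\<^sup>2 \<le> exp (K\<^sup>2 * (pi / 2 * T))"
      using dp(4)[of "2 ^ k"] by (simp add: q_def)
    also have "\<dots> \<le> (exp (K\<^sup>2 * (pi / 2 * T)))\<^sup>2"
      using T_pos by (simp add: power2_eq_square)
    finally show ?thesis by (rule power2_le_imp_le) simp
  qed
  have hb: "bounded_F (grid k j) (h j)" if "j < 2 ^ k" for j
    using h(1) that unfolding elem_iff bounded_F_def by blast
  let ?t = "\<lambda>j \<omega>. h j \<omega> * (W (grid k (Suc j)) \<omega> - W (grid k j) \<omega> + \<theta> j \<omega> * (T / 2 ^ k))"
  have tL: "?t j \<in> L2 M" and tF: "?t j \<in> borel_measurable (F (grid k (Suc j)))" if j: "j < 2 ^ k" for j
  proof -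
    have o: "0 \<le> grid k j" "grid k j \<le> grid k (Suc j)" "grid k (Suc j) \<le> T"
      using grid_in[of j k] grid_in[of "Suc j" k] grid_mono[of j "Suc j" k] j by auto
    obtain B where B: "\<forall>\<omega>\<in>space M. \<bar>h j \<omega>\<bar> \<le> B" using hb[OF j] unfolding bounded_F_def by blast
    have hF: "h j \<in> borel_measurable (F (grid k j))" using hb[OF j] by (simp add: bounded_F_def)
    have hM: "h j \<in> borel_measurable M" using measurable_F_M[OF hF] o by simp
    have \<theta>j: "bounded_F (grid k j) (\<theta> j)" using \<theta>F[OF j] \<theta>B unfolding bounded_F_def by blast
    have "(\<lambda>\<omega>. (T / 2 ^ k) * \<theta> j \<omega>) \<in> L2 M" using bounded_F_imp_L2[OF \<theta>j] o by (intro L2_cmult) auto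
    then have "(\<lambda>\<omega>. \<theta> j \<omega> * (T / 2 ^ k)) \<in> L2 M" by (simp add: mult.commute)
    then show "?t j \<in> L2 M" using B by (intro L2_bounded_mult[OF L2_add[OF increment_L2[OF o]] hM]) auto
    show "?t j \<in> borel_measurable (F (grid k (Suc j)))"
      by (intro borel_measurable_times borel_measurable_add borel_measurable_diff borel_measurable_const
          measurable_F_mono[OF hF o(2)] measurable_F_mono[OF \<theta>F[OF j] o(2)] W_adapted) (use o in linarith)+
  qed
  have G'eq: "G' \<omega> = (\<Sum>j<2^k. ?t j \<omega>)" for \<omega> unfolding G'_def by (rule step_gain[OF h(1) \<theta>E])
  have EG': "expectation (\<lambda>\<omega>. ?Z \<omega> * G' \<omega>) = 0"
  proof -
    have "expectation (\<lambda>\<omega>. ?Z \<omega> * G' \<omega>) = (\<Sum>j<2^k. expectation (\<lambda>\<omega>. ?Z \<omega> * ?t j \<omega>))"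
      unfolding G'eq sum_distrib_left
      by (intro Bochner_Integration.integral_sum L2_integrable_mult ZL tL) simp
    \<comment> \<open>The gain of cell \<open>j\<close> is known at the end of that cell, so all
      later factors of the density drop out.\<close>
    also have "\<dots> = (\<Sum>j<2^k. expectation (\<lambda>\<omega>. dens k \<theta> (Suc j) \<omega> * ?t j \<omega>))"
      by (intro sum.cong refl dp(3) tF tL) auto
    also have "\<dots> = 0" using dp(5)[OF _ _ hb] by simp
    finally show ?thesis .
  qed
  have GL: "gain v J T \<in> L2 M" by (rule gain_L2(1)[OF v TT])
  have G'L: "G' \<in> L2 M" unfolding G'eq[abs_def] by (intro L2_sum tL) simp
  let ?u = "\<lambda>z. case_prod \<rho> z * case_prod v z - case_prod (ep k \<theta>) z * case_prod (ep k h) z"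
  have \<theta>m: "case_prod (ep k \<theta>) \<in> borel_measurable P" by (rule L2_measurable[OF \<theta>L])
  have \<theta>b: "\<bar>case_prod (ep k \<theta>) z\<bar> \<le> K" if "z \<in> space P" for z
    using that ep\<theta> clip_bound(1)[OF K_nonneg] by (auto simp: space_P)
  have \<rho>m: "case_prod \<rho> \<in> borel_measurable P" by (rule L2_measurable[OF \<rho>L])
  have prodL: "(\<lambda>z. case_prod (ep k \<theta>) z * case_prod (ep k h) z) \<in> L2 P" by (rule L2_bounded_mult[OF hL \<theta>m \<theta>b])
  have uL: "?u \<in> L2 P" by (rule L2_diff[OF \<rho>_mult_L2[OF vA] prodL])
  have ub: "l2norm P ?u \<le> (3 * K + 1) * e"
  proof -
    let ?c = "\<lambda>z. clip (real N) (case_prod v z)"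
    let ?f1 = "\<lambda>z. (2 * K) * (?c z - case_prod v z)" and ?f2 = "\<lambda>z. real N * (case_prod (ep k \<theta>) z - case_prod \<rho> z)"
      and ?f3 = "\<lambda>z. K * (case_prod (ep k h) z - case_prod v z)"
    have cL: "?c \<in> L2 P" using L2_tends_clip[OF vL] by (simp add: L2_tends_def)
    have abs_L: "(\<lambda>z. \<bar>f z\<bar>) \<in> L2 P" if "f \<in> L2 P" for f
      using that L2_measurable[OF that] by (intro L2_dominated[OF that, of _ 1]) auto
    have fL: "(\<lambda>z. \<bar>?f1 z\<bar>) \<in> L2 P" "(\<lambda>z. \<bar>?f2 z\<bar>) \<in> L2 P" "(\<lambda>z. \<bar>?f3 z\<bar>) \<in> L2 P"
      by (intro abs_L L2_cmult L2_diff cL vL \<theta>L \<rho>L hL)+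
    have "l2norm P ?u \<le> l2norm P (\<lambda>z. (\<bar>?f1 z\<bar> + \<bar>?f2 z\<bar>) + \<bar>?f3 z\<bar>)"
    proof (rule l2norm_mono[OF L2_add[OF L2_add[OF fL(1,2)] fL(3)] L2_measurable[OF uL]])
      show "AE z in P. \<bar>?u z\<bar> \<le> \<bar>(\<bar>?f1 z\<bar> + \<bar>?f2 z\<bar>) + \<bar>?f3 z\<bar>\<bar>"
        using AE_space[of P] AE_\<rho>_bound
      proof eventually_elim
        case (elim z)
        let ?r = "case_prod \<rho> z" and ?th = "case_prod (ep k \<theta>) z" and ?v = "case_prod v z" and ?h = "case_prod (ep k h) z"
        \<comment> \<open>Three errors: truncating \<open>v\<close> costs \<open>2 * K * e\<close>,
          the error of \<open>\<theta>\<close> meets the truncated integrand and costs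
          \<open>e\<close>, and the error of \<open>h\<close> meets the bounded
          \<open>\<theta>\<close> and costs \<open>K * e\<close>. Together they give
          \<open>(3 * K + 1) * e\<close>.\<close>
        have "r * v - t * h = (r - t) * (v - c) + (r - t) * c - t * (h - v)" for r v t h c :: real
          by (simp add: algebra_simps)
        then have "?u z = (?r - ?th) * (?v - ?c z) + (?r - ?th) * ?c z - ?th * (?h - ?v)" .
        then have "\<bar>?u z\<bar> \<le> \<bar>?r - ?th\<bar> * \<bar>?v - ?c z\<bar> + \<bar>?r - ?th\<bar> * \<bar>?c z\<bar> + \<bar>?th\<bar> * \<bar>?h - ?v\<bar>"
          unfolding abs_mult[symmetric] by linarith
        also have "\<bar>?r - ?th\<bar> * \<bar>?v - ?c z\<bar> \<le> (2 * K) * \<bar>?v - ?c z\<bar>"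
          using elim(2) \<theta>b[OF elim(1)] by (intro mult_right_mono) linarith+
        also have "\<bar>?r - ?th\<bar> * \<bar>?c z\<bar> \<le> \<bar>?r - ?th\<bar> * real N"
          by (intro mult_left_mono clip_bound(1)) auto
        also have "\<bar>?th\<bar> * \<bar>?h - ?v\<bar> \<le> K * \<bar>?h - ?v\<bar>" by (intro mult_right_mono \<theta>b[OF elim(1)]) simp
        finally show ?case using K_nonneg
          unfolding abs_mult abs_minus_commute[of ?v] abs_minus_commute[of ?r] by (simp only: abs_of_nonneg abs_numeral abs_of_nat mult.commute) linarith
      qed
    qed
    also have "\<dots> \<le> (l2norm P (\<lambda>z. \<bar>?f1 z\<bar>) + l2norm P (\<lambda>z. \<bar>?f2 z\<bar>)) + l2norm P (\<lambda>z. \<bar>?f3 z\<bar>)"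
      by (rule order_trans[OF l2norm_triangle[OF L2_add[OF fL(1,2)] fL(3)] add_right_mono[OF l2norm_triangle[OF fL(1,2)]]])
    also have "\<dots> = (2 * K) * l2norm P (\<lambda>z. ?c z - case_prod v z) + real N * l2norm P (\<lambda>z. case_prod (ep k \<theta>) z - case_prod \<rho> z)
       + K * l2norm P (\<lambda>z. case_prod (ep k h) z - case_prod v z)"
    proof -
      have a: "l2norm P (\<lambda>z. \<bar>f z\<bar>) = l2norm P f" for f by (simp add: l2norm_def)
      have b: "\<bar>2 * K\<bar> = 2 * K" "\<bar>K\<bar> = K" "\<bar>real N\<bar> = real N" using K_nonneg by simp_all
      show ?thesis unfolding a l2norm_cmult b ..
    qed
    also have "\<dots> \<le> (2 * K) * e + e + K * e"
    proof (intro add_mono mult_left_mono)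
      show "real N * l2norm P (\<lambda>z. case_prod (ep k \<theta>) z - case_prod \<rho> z) \<le> e"
      proof -
        have "real N * l2norm P (\<lambda>z. case_prod (ep k \<theta>) z - case_prod \<rho> z) \<le> real N * (e / (real N + 1))"
          by (rule mult_left_mono[OF \<theta>close]) simp
        also have "\<dots> \<le> e" using e by (simp add: field_simps)
        finally show ?thesis .
      qed
    qed (use N h1(2) h(2) K_nonneg in auto)
    finally show ?thesis by (simp add: algebra_simps)
  qed
  have dG: "l2norm M (\<lambda>\<omega>. gain v J T \<omega> - G' \<omega>) \<le> (sqrt T * (3 * K + 1) + 1) * e"
  proof -
    have I1: "(\<lambda>\<omega>. \<integral>t. indicator {..T} t * ?u (t, \<omega>) \<partial>R) \<in> L2 M" by (rule time_integral_L2(1)[OF uL]) simp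
    have I2: "(\<lambda>\<omega>. J T \<omega> - elementary_integral W (2 ^ k) (grid k) h T \<omega>) \<in> L2 M"
      by (intro L2_diff ito_L2[OF v TT] ito_L2[OF itoL TT])
    have "l2norm M (\<lambda>\<omega>. gain v J T \<omega> - G' \<omega>)
      = l2norm M (\<lambda>\<omega>. (\<integral>t. indicator {..T} t * ?u (t, \<omega>) \<partial>R) + (J T \<omega> - elementary_integral W (2 ^ k) (grid k) h T \<omega>))"
    proof (rule l2norm_cong_AE[OF L2_measurable[OF L2_diff[OF GL G'L]] L2_measurable[OF L2_add[OF I1 I2]]])
      show "AE \<omega> in M. gain v J T \<omega> - G' \<omega>
        = (\<integral>t. indicator {..T} t * ?u (t, \<omega>) \<partial>R) + (J T \<omega> - elementary_integral W (2 ^ k) (grid k) h T \<omega>)"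
        using AE_section_integrable[OF \<rho>_mult_L2[OF vA]] AE_section_integrable[OF prodL]
      proof eventually_elim
        case (elim \<omega>)
        have "pint (\<lambda>s. \<rho> s \<omega> * v s \<omega>) T - pint (\<lambda>s. ep k \<theta> s \<omega> * ep k h s \<omega>) T
          = pint (\<lambda>s. ?u (s, \<omega>)) T" unfolding pint_T using elim by simp
        then show ?case by (simp add: gain_def G'_def TI_pint) (simp add: pint_def)
      qed
    qed
    also have "\<dots> \<le> l2norm M (\<lambda>\<omega>. \<integral>t. indicator {..T} t * ?u (t, \<omega>) \<partial>R) + l2norm M (\<lambda>\<omega>. J T \<omega> - elementary_integral W (2 ^ k) (grid k) h T \<omega>)"
      by (rule l2norm_triangle[OF I1 I2])
    also have "l2norm M (\<lambda>\<omega>. J T \<omega> - elementary_integral W (2 ^ k) (grid k) h T \<omega>) \<le> e"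
      using ito_diff_norm_le[OF v itoL TT] h1(2) unfolding h(2) l2norm_minus_commute[of P "case_prod v"] by linarith
    also have "l2norm M (\<lambda>\<omega>. \<integral>t. indicator {..T} t * ?u (t, \<omega>) \<partial>R) \<le> sqrt T * ((3 * K + 1) * e)"
    proof -
      have "{..T} \<inter> {0..T} = {0..T}" by auto
      then have "measure lborel ({..T} \<inter> {0..T}) = T" using T_pos by simp
      then have "l2norm M (\<lambda>\<omega>. \<integral>t. indicator {..T} t * ?u (t, \<omega>) \<partial>R) \<le> sqrt T * l2norm P (\<lambda>z. indicator {..T} (fst z) * ?u z)"
        using time_integral_L2(2)[OF uL, of "{..T}"] by simp
      also have "\<dots> \<le> sqrt T * l2norm P ?u" using T_pos by (intro mult_left_mono l2norm_indicator_P_le[OF uL]) auto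
      also have "\<dots> \<le> sqrt T * ((3 * K + 1) * e)" using T_pos by (intro mult_left_mono ub) simp
      finally show ?thesis .
    qed
    finally show ?thesis by (simp add: algebra_simps)
  qed
  have E: "expectation (\<lambda>\<omega>. ?Z \<omega> * gain v J T \<omega>) = expectation (\<lambda>\<omega>. ?Z \<omega> * (gain v J T \<omega> - G' \<omega>))"
  proof -
    have "expectation (\<lambda>\<omega>. ?Z \<omega> * (gain v J T \<omega> - G' \<omega>)) = expectation (\<lambda>\<omega>. ?Z \<omega> * gain v J T \<omega>) - expectation (\<lambda>\<omega>. ?Z \<omega> * G' \<omega>)"
      unfolding right_diff_distrib by (intro Bochner_Integration.integral_diff L2_integrable_mult ZL GL G'L)
    then show ?thesis using EG' by simp
  qed
  have "\<bar>expectation (\<lambda>\<omega>. ?Z \<omega> * gain v J T \<omega>)\<bar> \<le> l2norm M ?Z * l2norm M (\<lambda>\<omega>. gain v J T \<omega> - G' \<omega>)"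
    unfolding E by (rule L2_Cauchy_Schwarz[OF ZL L2_diff[OF GL G'L]])
  also have "\<dots> \<le> exp (K\<^sup>2 * (pi / 2 * T)) * ((sqrt T * (3 * K + 1) + 1) * e)"
    by (intro mult_mono Znorm dG) auto
  finally show ?thesis using ZL Zpos EZ by (intro exI[of _ ?Z] conjI)
qed

text \<open>A nonnegative \<open>Z\<close> of mean 1 prices a gain of at least \<open>c\<close> at
  no less than \<open>c\<close>, whereas approximate densities price it as close to 0 as desired;
  \<open>e\<close> is chosen to make that price at most \<open>c / 2\<close>.\<close>

lemma no_arbitrage:
  assumes v: "ito v J" and c: "0 < c" and ge: "AE \<omega> in M. c \<le> gain v J T \<omega>"
  shows False
proof -
  have TT: "T \<in> {0..T}" using T_pos by simp
  define A where "A = exp (K\<^sup>2 * (pi / 2 * T)) * (sqrt T * (3 * K + 1) + 1)"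
  have A: "0 < A" unfolding A_def using K_nonneg T_pos by (intro mult_pos_pos add_nonneg_pos) auto
  define e where "e = c / (2 * A)"
  have e: "0 < e" using A c by (simp add: e_def)
  obtain Z where Z: "Z \<in> L2 M" "\<forall>\<omega>\<in>space M. 0 \<le> Z \<omega>" "expectation Z = 1"
    "\<bar>expectation (\<lambda>\<omega>. Z \<omega> * gain v J T \<omega>)\<bar> \<le> exp (K\<^sup>2 * (pi / 2 * T)) * ((sqrt T * (3 * K + 1) + 1) * e)"
    using approximate_density[OF v e] by blast
  have "c = expectation (\<lambda>\<omega>. Z \<omega> * c)" using Z(1,3) by simp
  also have "\<dots> \<le> expectation (\<lambda>\<omega>. Z \<omega> * gain v J T \<omega>)"
  proof (rule integral_mono_AE)
    show "integrable M (\<lambda>\<omega>. Z \<omega> * c)" using L2_integrable[OF Z(1)] by simp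
    show "integrable M (\<lambda>\<omega>. Z \<omega> * gain v J T \<omega>)" by (rule L2_integrable_mult[OF Z(1) gain_L2(1)[OF v TT]])
    show "AE \<omega> in M. Z \<omega> * c \<le> Z \<omega> * gain v J T \<omega>"
      using ge AE_space by eventually_elim (use Z(2) in \<open>auto intro: mult_left_mono\<close>)
  qed
  also have "\<dots> \<le> A * e" using Z(4) by (simp add: A_def mult.assoc)
  also have "\<dots> = c / 2" using A by (simp add: e_def)
  finally show False using c by simp
qed

end

section \<open>Mean-variance games over a closed subspace of terminal gains\<close>

locale gains_space = prob_space M for M :: "'a measure" +
  fixes S :: "('a \<Rightarrow> real) set"
  assumes S_L2: "S \<subseteq> L2 M" and S_nonempty: "S \<noteq> {}"
    and S_linear: "\<And>g h c. g \<in> S \<Longrightarrow> h \<in> S \<Longrightarrow> (\<lambda>\<omega>. g \<omega> + c * h \<omega>) \<in> S"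
    and S_closed: "\<And>G g. L2_tends M G g \<Longrightarrow> (\<And>k. G k \<in> S) \<Longrightarrow> g \<in> S"
    and S_no_const: "\<And>g c. g \<in> S \<Longrightarrow> c \<noteq> 0 \<Longrightarrow> \<not> (AE \<omega> in M. g \<omega> = c)"
begin

definition cov :: "('a \<Rightarrow> real) \<Rightarrow> ('a \<Rightarrow> real) \<Rightarrow> real" where
  "cov f g = expectation (\<lambda>\<omega>. f \<omega> * g \<omega>) - expectation f * expectation g"

lemma S_in_L2: "g \<in> S \<Longrightarrow> g \<in> L2 M" using S_L2 by blast

lemma S_zero: "(\<lambda>\<omega>. 0) \<in> S"
proof -
  obtain g where "g \<in> S" using S_nonempty by blast
  from S_linear[OF this this, of "-1"] show ?thesis by simp
qed

lemma S_cmult: "g \<in> S \<Longrightarrow> (\<lambda>\<omega>. c * g \<omega>) \<in> S"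
  using S_linear[OF S_zero, of g c] by simp

lemma S_add: "g \<in> S \<Longrightarrow> h \<in> S \<Longrightarrow> (\<lambda>\<omega>. g \<omega> + h \<omega>) \<in> S"
  using S_linear[of g h 1] by simp

lemma S_diff: "g \<in> S \<Longrightarrow> h \<in> S \<Longrightarrow> (\<lambda>\<omega>. g \<omega> - h \<omega>) \<in> S"
  using S_linear[of g h "-1"] by simp

lemma S_sum: "finite A \<Longrightarrow> (\<And>k. k \<in> A \<Longrightarrow> g k \<in> S) \<Longrightarrow> (\<lambda>\<omega>. \<Sum>k\<in>A. g k \<omega>) \<in> S"
  by (induction A rule: finite_induct) (auto intro: S_zero S_add)

section \<open>Covariance on \<open>S\<close> and mean-variance optimality\<close>

lemma cov_linear:
  assumes "f \<in> L2 M" "g \<in> L2 M" "h \<in> L2 M"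
  shows "cov (\<lambda>\<omega>. f \<omega> + c * g \<omega>) h = cov f h + c * cov g h"
proof -
  have "expectation (\<lambda>\<omega>. (f \<omega> + c * g \<omega>) * h \<omega>) = expectation (\<lambda>\<omega>. f \<omega> * h \<omega> + c * (g \<omega> * h \<omega>))"
    by (intro Bochner_Integration.integral_cong) (auto simp: algebra_simps)
  also have "\<dots> = expectation (\<lambda>\<omega>. f \<omega> * h \<omega>) + c * expectation (\<lambda>\<omega>. g \<omega> * h \<omega>)"
    using assms by (simp add: L2_integrable_mult)
  finally show ?thesis using assms by (simp add: cov_def L2_integrable algebra_simps)
qed

lemma cov_cong_AE:
  assumes "f \<in> L2 M" "g \<in> L2 M" "h \<in> L2 M" "AE \<omega> in M. f \<omega> = g \<omega>"
  shows "cov f h = cov g h"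
proof -
  have "expectation (\<lambda>\<omega>. f \<omega> * h \<omega>) = expectation (\<lambda>\<omega>. g \<omega> * h \<omega>)"
    using assms(4) assms(1-3)[THEN L2_measurable] by (intro integral_cong_AE) auto
  moreover have "expectation f = expectation g"
    using assms(4) assms(1-2)[THEN L2_measurable] by (intro integral_cong_AE) auto
  ultimately show ?thesis by (simp add: cov_def)
qed

lemma S_projection:
  assumes f: "f \<in> L2 M"
  shows "\<exists>p\<in>S. \<forall>s\<in>S. expectation (\<lambda>\<omega>. p \<omega> * s \<omega>) = expectation (\<lambda>\<omega>. f \<omega> * s \<omega>)"
proof -
  obtain k p where k: "\<And>j::nat. k j \<in> S" "L2_tends M k p"
    and orth: "\<And>g. g \<in> S \<Longrightarrow> (\<integral>x. (f x - p x) * g x \<partial>M) = 0"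
    using L2_projection[OF S_L2 S_nonempty S_linear f] by blast
  have p: "p \<in> S" by (rule S_closed[OF k(2,1)])
  have "expectation (\<lambda>\<omega>. p \<omega> * s \<omega>) = expectation (\<lambda>\<omega>. f \<omega> * s \<omega>)" if s: "s \<in> S" for s
  proof -
    have "expectation (\<lambda>\<omega>. f \<omega> * s \<omega>) - expectation (\<lambda>\<omega>. p \<omega> * s \<omega>) = (\<integral>x. (f x - p x) * s x \<partial>M)"
      unfolding left_diff_distrib
      by (intro Bochner_Integration.integral_diff[symmetric] L2_integrable_mult f S_in_L2 s p)
    then show ?thesis using orth[OF s] by simp
  qed
  then show ?thesis using p by blast
qed

text \<open>Let \<open>p\<close> and \<open>y\<close> in \<open>S\<close> represent the mean and the
  functional of \<open>f\<close> in the ordinary inner product. Then \<open>z = y + c * p\<close>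
  works as soon as \<open>c\<close> is the mean of \<open>z\<close>, that is
  \<open>c = E y + c * E p\<close>. This is solvable because \<open>E p = 1\<close> would make
  \<open>p\<close> the constant 1.\<close>

lemma cov_representation:
  assumes f: "f \<in> L2 M"
  shows "\<exists>z\<in>S. \<forall>s\<in>S. cov z s = expectation (\<lambda>\<omega>. f \<omega> * s \<omega>)"
proof -
  obtain p where p: "p \<in> S" "\<And>s. s \<in> S \<Longrightarrow> expectation (\<lambda>\<omega>. p \<omega> * s \<omega>) = expectation s"
    using S_projection[OF L2_const[of 1]] by auto
  obtain y where y: "y \<in> S" "\<And>s. s \<in> S \<Longrightarrow> expectation (\<lambda>\<omega>. y \<omega> * s \<omega>) = expectation (\<lambda>\<omega>. f \<omega> * s \<omega>)"
    using S_projection[OF f] by blast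
  have pL: "p \<in> L2 M" and yL: "y \<in> L2 M" using p y by (auto intro: S_in_L2)
  have p1: "expectation p \<noteq> 1"
  proof
    assume e: "expectation p = 1"
    \<comment> \<open>Testing \<open>p\<close> against itself gives \<open>E (p * p) = E p\<close>,
      so with mean 1 its distance from the constant 1 is 0.\<close>
    have "(l2norm M (\<lambda>\<omega>. p \<omega> - 1))\<^sup>2 = expectation (\<lambda>\<omega>. p \<omega> * p \<omega> - 2 * p \<omega> + 1)"
      unfolding l2norm_square by (intro Bochner_Integration.integral_cong) (auto simp: power2_eq_square algebra_simps)
    also have "\<dots> = 0" using p(2)[OF p(1)] e L2_integrable_mult[OF pL pL] L2_integrable[OF pL]
      by (simp add: prob_space)
    finally have "AE \<omega> in M. p \<omega> - 1 = 0" by (intro l2norm_eq_0_AE L2_diff pL L2_const) simp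
    then show False using S_no_const[OF p(1), of 1] by simp
  qed
  define c where "c = expectation y / (1 - expectation p)"
  have cc: "expectation y + c * expectation p = c" using p1 by (simp add: c_def field_simps)
  have "cov (\<lambda>\<omega>. y \<omega> + c * p \<omega>) s = expectation (\<lambda>\<omega>. f \<omega> * s \<omega>)" if s: "s \<in> S" for s
  proof -
    have "cov (\<lambda>\<omega>. y \<omega> + c * p \<omega>) s = cov y s + c * cov p s"
      by (rule cov_linear[OF yL pL S_in_L2[OF s]])
    also have "\<dots> = expectation (\<lambda>\<omega>. f \<omega> * s \<omega>) + (c - (expectation y + c * expectation p)) * expectation s"
      unfolding cov_def p(2)[OF s] y(2)[OF s] by (simp add: algebra_simps)
    finally show ?thesis using cc by simp
  qed
  then show ?thesis using S_linear[OF y(1) p(1)] by blast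
qed

lemma variance_eq_cov:
  assumes "f \<in> L2 M" shows "variance f = cov f f"
proof -
  have "variance f = expectation (\<lambda>\<omega>. (f \<omega>)\<^sup>2) - (expectation f)\<^sup>2"
    using assms by (intro variance_eq L2_integrable L2_integrable_square)
  then show ?thesis by (simp add: cov_def power2_eq_square)
qed

text \<open>Testing with \<open>z\<close> itself shows that its variance is 0, and the only constant
  in \<open>S\<close> is 0.\<close>

lemma cov_zero_imp_zero:
  assumes z: "z \<in> S" and c: "\<And>s. s \<in> S \<Longrightarrow> cov z s = 0"
  shows "AE \<omega> in M. z \<omega> = 0"
proof -
  have zL: "z \<in> L2 M" by (rule S_in_L2[OF z])
  have "l2norm M (\<lambda>\<omega>. z \<omega> - expectation z) = 0"
    using variance_eq_cov[OF zL] c[OF z] by (simp add: l2norm_def)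
  then have "AE \<omega> in M. z \<omega> - expectation z = 0" by (intro l2norm_eq_0_AE L2_diff zL L2_const)
  then have "AE \<omega> in M. z \<omega> = expectation z" by simp
  then show ?thesis using S_no_const[OF z, of "expectation z"] by (cases "expectation z = 0") auto
qed

text \<open>The payoff is exactly quadratic in \<open>s\<close>, with a nonnegative quadratic part
  subtracted. Optimality therefore means that the linear part vanishes, which scaling
  \<open>s\<close> by small \<open>t\<close> detects; no derivative is taken.\<close>

lemma mean_variance_optimal_iff:
  assumes \<gamma>: "0 < \<gamma>" and Y: "Y \<in> L2 M"
  shows "(\<forall>s\<in>S. expectation (\<lambda>\<omega>. Y \<omega> + s \<omega>) - \<gamma> / 2 * variance (\<lambda>\<omega>. Y \<omega> + s \<omega>)
      \<le> expectation Y - \<gamma> / 2 * variance Y) \<longleftrightarrow> (\<forall>s\<in>S. expectation s = \<gamma> * cov Y s)"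
proof -
  have expand: "expectation (\<lambda>\<omega>. Y \<omega> + s \<omega>) - \<gamma> / 2 * variance (\<lambda>\<omega>. Y \<omega> + s \<omega>)
    = expectation Y - \<gamma> / 2 * variance Y + (expectation s - \<gamma> * cov Y s) - \<gamma> / 2 * variance s"
    if s: "s \<in> L2 M" for s
  proof -
    have sY: "cov s Y = cov Y s" for s by (simp add: cov_def mult.commute)
    have "cov (\<lambda>\<omega>. Y \<omega> + 1 * s \<omega>) (\<lambda>\<omega>. Y \<omega> + 1 * s \<omega>) = cov Y Y + 2 * cov Y s + cov s s"
      using cov_linear[OF Y s L2_add[OF Y L2_cmult[OF s, of 1]], of 1]
        cov_linear[OF Y s Y, of 1] cov_linear[OF Y s s, of 1]
        sY[of s] by (simp add: cov_def mult.commute)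
    then have "variance (\<lambda>\<omega>. Y \<omega> + s \<omega>) = variance Y + 2 * cov Y s + variance s"
      using variance_eq_cov[OF L2_add[OF Y s]] variance_eq_cov[OF Y] variance_eq_cov[OF s] by simp
    moreover have "expectation (\<lambda>\<omega>. Y \<omega> + s \<omega>) = expectation Y + expectation s"
      using Y s by (simp add: L2_integrable)
    ultimately show ?thesis by (simp add: algebra_simps)
  qed
  show ?thesis
  proof (intro iffI ballI)
    fix s assume opt: "\<forall>s\<in>S. expectation (\<lambda>\<omega>. Y \<omega> + s \<omega>) - \<gamma> / 2 * variance (\<lambda>\<omega>. Y \<omega> + s \<omega>)
      \<le> expectation Y - \<gamma> / 2 * variance Y" and s: "s \<in> S"
    have sL: "s \<in> L2 M" by (rule S_in_L2[OF s])
    define b where "b = expectation s - \<gamma> * cov Y s"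
    define a where "a = \<gamma> / 2 * variance s"
    have a: "0 \<le> a" unfolding a_def using \<gamma> by (intro mult_nonneg_nonneg) auto
    have t: "t * b \<le> t\<^sup>2 * a" for t
    proof -
      have tL: "(\<lambda>\<omega>. t * s \<omega>) \<in> L2 M" by (rule L2_cmult[OF sL])
      have "cov (\<lambda>\<omega>. 0 + t * s \<omega>) Y = cov (\<lambda>\<omega>. 0) Y + t * cov s Y" by (rule cov_linear[OF L2_const sL Y])
      then have c: "cov Y (\<lambda>\<omega>. t * s \<omega>) = t * cov Y s" by (simp add: cov_def mult.commute)
      have v: "variance (\<lambda>\<omega>. t * s \<omega>) = t\<^sup>2 * variance s"
        using sL by (simp add: L2_integrable power_mult_distrib right_diff_distrib[symmetric])
      have "expectation (\<lambda>\<omega>. t * s \<omega>) = t * expectation s" by simp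
      then have "(t * expectation s - \<gamma> * (t * cov Y s)) - \<gamma> / 2 * (t\<^sup>2 * variance s) \<le> 0"
        using opt[rule_format, OF S_cmult[OF s, of t]] expand[OF tL] unfolding c v by linarith
      moreover have "t * b = t * expectation s - \<gamma> * (t * cov Y s)" by (simp add: b_def algebra_simps)
      moreover have "t\<^sup>2 * a = \<gamma> / 2 * (t\<^sup>2 * variance s)" unfolding a_def by (simp only: mult.left_commute)
      ultimately show ?thesis by linarith
    qed
    have "b = 0"
    proof (rule ccontr)
      assume "b \<noteq> 0"
      then have bb: "0 < b * b" by (simp add: zero_less_mult_iff) linarith
      \<comment> \<open>Any \<open>m > a\<close> would serve: at \<open>b / m\<close> the fact
        \<open>t\<close> becomes \<open>b * b * m \<le> b * b * a\<close>.\<close>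
      define m where "m = 2 * a + 2"
      have m: "0 < m" using a by (simp add: m_def)
      have "b * b * m \<le> b * b * a" using t[of "b / m"] m by (simp add: power2_eq_square field_simps)
      then have "m \<le> a" using bb by (rule mult_left_le_imp_le)
      then show False using a by (simp add: m_def)
    qed
    then show "expectation s = \<gamma> * cov Y s" by (simp add: b_def)
  next
    fix s assume c: "\<forall>s\<in>S. expectation s = \<gamma> * cov Y s" and s: "s \<in> S"
    have "0 \<le> \<gamma> / 2 * variance s" using \<gamma> by (intro mult_nonneg_nonneg) auto
    then show "expectation (\<lambda>\<omega>. Y \<omega> + s \<omega>) - \<gamma> / 2 * variance (\<lambda>\<omega>. Y \<omega> + s \<omega>)
      \<le> expectation Y - \<gamma> / 2 * variance Y"
      using expand[OF S_in_L2[OF s]] c s by simp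
  qed
qed

section \<open>The linear system of the best responses and the abstract game\<close>

definition relative :: "nat \<Rightarrow> (nat \<Rightarrow> real) \<Rightarrow> (nat \<Rightarrow> 'a \<Rightarrow> real) \<Rightarrow> nat \<Rightarrow> 'a \<Rightarrow> real" where
  "relative n \<theta> X i \<omega> = X i \<omega> - \<theta> i * ((1 / (real n - 1)) * (\<Sum>k\<in>{1..n} - {i}. X k \<omega>))"

text \<open>Given the total \<open>D\<close>, each equation determines its \<open>s i\<close>;
  summing the results yields \<open>D = E + Psi n \<theta> * D\<close>, which has one solution
  because \<open>Psi n \<theta> < 1\<close>. The statement concerns real numbers and is applied in
  each scenario.\<close>

lemma relative_solution:
  fixes s z :: "nat \<Rightarrow> real"
  assumes n: "2 \<le> n" and \<theta>: "\<And>i. i \<in> {1..n} \<Longrightarrow> \<theta> i \<in> {0..1}" and \<Psi>: "Psi n \<theta> < 1"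
  shows "(\<forall>i\<in>{1..n}. s i - \<theta> i * ((1 / (real n - 1)) * (\<Sum>k\<in>{1..n} - {i}. s k)) = z i) \<longleftrightarrow>
    (\<forall>i\<in>{1..n}. s i = ((real n - 1) * z i + \<theta> i * ((\<Sum>k=1..n. (real n - 1) * z k / (real n - 1 + \<theta> k)) / (1 - Psi n \<theta>)))
      / (real n - 1 + \<theta> i))" (is "?l \<longleftrightarrow> ?r")
proof -
  define m where "m = real n - 1"
  have m: "0 < m" using n by (simp add: m_def)
  have m\<theta>: "0 < m + \<theta> i" if "i \<in> {1..n}" for i using \<theta>[OF that] m by auto
  define D where "D = (\<Sum>k=1..n. s k)"
  define E where "E = (\<Sum>k=1..n. m * z k / (m + \<theta> k))"
  have single: "s i - \<theta> i * ((1 / m) * (\<Sum>k\<in>{1..n} - {i}. s k)) = z i \<longleftrightarrow> s i = (m * z i + \<theta> i * D) / (m + \<theta> i)"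
    if i: "i \<in> {1..n}" for i
  proof -
    have "(\<Sum>k\<in>{1..n} - {i}. s k) = D - s i" unfolding D_def using i by (simp add: sum_diff1)
    then show ?thesis using m m\<theta>[OF i] by (simp add: field_simps) (auto simp: algebra_simps)
  qed
  have sum: "(\<Sum>k=1..n. (m * z k + \<theta> k * c) / (m + \<theta> k)) = E + Psi n \<theta> * c" for c
    by (simp add: E_def Psi_def m_def add_divide_distrib sum.distrib sum_distrib_right)
  have "?l \<longleftrightarrow> (\<forall>i\<in>{1..n}. s i = (m * z i + \<theta> i * D) / (m + \<theta> i))"
    unfolding m_def[symmetric] using single by blast
  also have "\<dots> \<longleftrightarrow> (\<forall>i\<in>{1..n}. s i = (m * z i + \<theta> i * (E / (1 - Psi n \<theta>))) / (m + \<theta> i))"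
  proof
    assume a: "\<forall>i\<in>{1..n}. s i = (m * z i + \<theta> i * D) / (m + \<theta> i)"
    have "D = (\<Sum>k=1..n. (m * z k + \<theta> k * D) / (m + \<theta> k))" unfolding D_def[of] using a by (intro sum.cong) (auto simp: D_def)
    then have "D = E + Psi n \<theta> * D" unfolding sum .
    then have "D = E / (1 - Psi n \<theta>)" using \<Psi> by (simp add: field_simps)
    then show "\<forall>i\<in>{1..n}. s i = (m * z i + \<theta> i * (E / (1 - Psi n \<theta>))) / (m + \<theta> i)" using a by simp
  next
    assume a: "\<forall>i\<in>{1..n}. s i = (m * z i + \<theta> i * (E / (1 - Psi n \<theta>))) / (m + \<theta> i)"
    have "D = (\<Sum>k=1..n. (m * z k + \<theta> k * (E / (1 - Psi n \<theta>))) / (m + \<theta> k))" unfolding D_def using a by (intro sum.cong) auto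
    also have "\<dots> = E + Psi n \<theta> * (E / (1 - Psi n \<theta>))" by (rule sum)
    also have "\<dots> = E / (1 - Psi n \<theta>)" using \<Psi> by (simp add: field_simps)
    finally show "\<forall>i\<in>{1..n}. s i = (m * z i + \<theta> i * D) / (m + \<theta> i)" using a by simp
  qed
  finally show ?thesis by (simp add: m_def E_def)
qed

lemma relative_L2: "(\<And>k. k \<in> {1..n} \<Longrightarrow> X k \<in> L2 M) \<Longrightarrow> i \<in> {1..n} \<Longrightarrow> relative n \<theta> X i \<in> L2 M"
  unfolding relative_def[abs_def] by (intro L2_diff L2_cmult L2_sum) auto

lemma relative_S: "(\<And>k. k \<in> {1..n} \<Longrightarrow> X k \<in> S) \<Longrightarrow> i \<in> {1..n} \<Longrightarrow> relative n \<theta> X i \<in> S"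
  unfolding relative_def[abs_def] by (intro S_diff S_cmult S_sum) auto

lemma relative_add:
  "relative n \<theta> (\<lambda>k \<omega>. X k \<omega> + Y k \<omega>) i \<omega> = relative n \<theta> X i \<omega> + relative n \<theta> Y i \<omega>"
  by (simp add: relative_def sum.distrib algebra_simps)

text \<open>Strategies act only through terminal wealth: \<open>range\<close> and
  \<open>onto\<close> identify the choices of agent \<open>i\<close> with the affine space
  \<open>x i * e + S\<close>, and \<open>inj\<close> leads back from wealth to strategy. The
  strategy type is abstract, which separates the game from the stochastic calculus.\<close>

theorem unique_equilibrium:
  fixes X :: "nat \<Rightarrow> 'p \<Rightarrow> 'a \<Rightarrow> real" and U :: "'p set" and same :: "'p \<Rightarrow> 'p \<Rightarrow> bool"
    and x \<theta> \<gamma> :: "nat \<Rightarrow> real" and n :: nat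
  defines "J \<equiv> \<lambda>\<pi> i. expectation (relative n \<theta> (\<lambda>k. X k (\<pi> k)) i) - \<gamma> i / 2 * variance (relative n \<theta> (\<lambda>k. X k (\<pi> k)) i)"
  assumes n: "2 \<le> n" and \<theta>: "\<And>i. i \<in> {1..n} \<Longrightarrow> \<theta> i \<in> {0..1}" and \<gamma>: "\<And>i. i \<in> {1..n} \<Longrightarrow> 0 < \<gamma> i"
    and \<Psi>: "Psi n \<theta> < 1" and e: "e \<in> L2 M"
    and meas: "\<And>i p. i \<in> {1..n} \<Longrightarrow> p \<in> U \<Longrightarrow> X i p \<in> borel_measurable M"
    and range: "\<And>i p. i \<in> {1..n} \<Longrightarrow> p \<in> U \<Longrightarrow> \<exists>s\<in>S. AE \<omega> in M. X i p \<omega> = x i * e \<omega> + s \<omega>"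
    and onto: "\<And>i s. i \<in> {1..n} \<Longrightarrow> s \<in> S \<Longrightarrow> \<exists>p\<in>U. AE \<omega> in M. X i p \<omega> = x i * e \<omega> + s \<omega>"
    and inj: "\<And>i p p'. i \<in> {1..n} \<Longrightarrow> p \<in> U \<Longrightarrow> p' \<in> U \<Longrightarrow> AE \<omega> in M. X i p \<omega> = X i p' \<omega> \<Longrightarrow> same p p'"
  shows "\<exists>\<pi>. ((\<forall>i\<in>{1..n}. \<pi> i \<in> U) \<and> (\<forall>i\<in>{1..n}. \<forall>p\<in>U. J (\<pi>(i := p)) i \<le> J \<pi> i)) \<and>
    (\<forall>\<pi>'. (\<forall>i\<in>{1..n}. \<pi>' i \<in> U) \<and> (\<forall>i\<in>{1..n}. \<forall>p\<in>U. J (\<pi>'(i := p)) i \<le> J \<pi>' i) \<longrightarrow>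
      (\<forall>i\<in>{1..n}. same (\<pi>' i) (\<pi> i)))"
proof -
  have XL: "X i p \<in> L2 M" if i: "i \<in> {1..n}" and p: "p \<in> U" for i p
  proof -
    obtain s where s: "s \<in> S" "AE \<omega> in M. X i p \<omega> = x i * e \<omega> + s \<omega>" using range[OF i p] by blast
    have "(\<lambda>\<omega>. x i * e \<omega> + s \<omega>) \<in> L2 M" by (intro L2_add L2_cmult e S_in_L2 s)
    then show ?thesis by (rule L2_cong_AE[OF _ meas[OF i p]]) (use s(2) in \<open>auto elim: eventually_mono\<close>)
  qed
  let ?Y = "\<lambda>\<pi> i. relative n \<theta> (\<lambda>k. X k (\<pi> k)) i"
  \<comment> \<open>Under a unilateral deviation the wealth of the others is fixed, so the relative
    wealth of agent \<open>i\<close> moves by an element of \<open>S\<close>, and every element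
    occurs.\<close>
  have foc: "(\<forall>p\<in>U. J (\<pi>(i := p)) i \<le> J \<pi> i) \<longleftrightarrow> (\<forall>s\<in>S. expectation s = \<gamma> i * cov (?Y \<pi> i) s)"
    if \<pi>: "\<forall>i\<in>{1..n}. \<pi> i \<in> U" and i: "i \<in> {1..n}" for \<pi> i
  proof -
    have YL: "?Y \<pi> i \<in> L2 M" by (rule relative_L2[OF _ i]) (use \<pi> XL in auto)
    have dev: "J (\<pi>(i := p)) i = expectation (\<lambda>\<omega>. ?Y \<pi> i \<omega> + s \<omega>) - \<gamma> i / 2 * variance (\<lambda>\<omega>. ?Y \<pi> i \<omega> + s \<omega>)"
      if p: "p \<in> U" and s: "s \<in> S" and ps: "AE \<omega> in M. X i p \<omega> = X i (\<pi> i) \<omega> + s \<omega>" for p s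
    proof -
      have ds: "(\<Sum>k\<in>{1..n} - {i}. X k ((\<pi>(i := p)) k) \<omega>) = (\<Sum>k\<in>{1..n} - {i}. X k (\<pi> k) \<omega>)" for \<omega>
        by (intro sum.cong) auto
      have eq: "AE \<omega> in M. ?Y (\<pi>(i := p)) i \<omega> = ?Y \<pi> i \<omega> + s \<omega>"
        using ps by eventually_elim (simp add: relative_def ds)
      have m1: "?Y (\<pi>(i := p)) i \<in> borel_measurable M"
        by (intro L2_measurable relative_L2[OF _ i]) (use \<pi> p XL in auto)
      have m2: "(\<lambda>\<omega>. ?Y \<pi> i \<omega> + s \<omega>) \<in> borel_measurable M" by (intro L2_measurable L2_add YL S_in_L2 s)
      have E: "expectation (?Y (\<pi>(i := p)) i) = expectation (\<lambda>\<omega>. ?Y \<pi> i \<omega> + s \<omega>)"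
        by (rule integral_cong_AE[OF m1 m2 eq])
      moreover have "variance (?Y (\<pi>(i := p)) i) = variance (\<lambda>\<omega>. ?Y \<pi> i \<omega> + s \<omega>)"
        unfolding E by (rule integral_cong_AE) (use m1 m2 eq in \<open>auto elim: eventually_mono\<close>)
      ultimately show ?thesis by (simp add: J_def)
    qed
    have "(\<forall>p\<in>U. J (\<pi>(i := p)) i \<le> J \<pi> i) \<longleftrightarrow>
      (\<forall>s\<in>S. expectation (\<lambda>\<omega>. ?Y \<pi> i \<omega> + s \<omega>) - \<gamma> i / 2 * variance (\<lambda>\<omega>. ?Y \<pi> i \<omega> + s \<omega>)
        \<le> expectation (?Y \<pi> i) - \<gamma> i / 2 * variance (?Y \<pi> i))"
    proof (intro iffI ballI)
      fix s assume a: "\<forall>p\<in>U. J (\<pi>(i := p)) i \<le> J \<pi> i" and s: "s \<in> S"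
      obtain s0 where s0: "s0 \<in> S" "AE \<omega> in M. X i (\<pi> i) \<omega> = x i * e \<omega> + s0 \<omega>" using range[OF i] \<pi> i by blast
      obtain p where p: "p \<in> U" "AE \<omega> in M. X i p \<omega> = x i * e \<omega> + (s0 \<omega> + s \<omega>)" using onto[OF i S_add[OF s0(1) s]] by blast
      have "AE \<omega> in M. X i p \<omega> = X i (\<pi> i) \<omega> + s \<omega>" using p(2) s0(2) by eventually_elim simp
      note d = dev[OF p(1) s this]
      show "expectation (\<lambda>\<omega>. ?Y \<pi> i \<omega> + s \<omega>) - \<gamma> i / 2 * variance (\<lambda>\<omega>. ?Y \<pi> i \<omega> + s \<omega>)
        \<le> expectation (?Y \<pi> i) - \<gamma> i / 2 * variance (?Y \<pi> i)"
        using a[rule_format, OF p(1)] unfolding d unfolding J_def .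
    next
      fix p assume a: "\<forall>s\<in>S. expectation (\<lambda>\<omega>. ?Y \<pi> i \<omega> + s \<omega>) - \<gamma> i / 2 * variance (\<lambda>\<omega>. ?Y \<pi> i \<omega> + s \<omega>)
        \<le> expectation (?Y \<pi> i) - \<gamma> i / 2 * variance (?Y \<pi> i)" and p: "p \<in> U"
      obtain s0 where s0: "s0 \<in> S" "AE \<omega> in M. X i (\<pi> i) \<omega> = x i * e \<omega> + s0 \<omega>" using range[OF i] \<pi> i by blast
      obtain s1 where s1: "s1 \<in> S" "AE \<omega> in M. X i p \<omega> = x i * e \<omega> + s1 \<omega>" using range[OF i p] by blast
      have "AE \<omega> in M. X i p \<omega> = X i (\<pi> i) \<omega> + (s1 \<omega> - s0 \<omega>)" using s1(2) s0(2) by eventually_elim simp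
      note d = dev[OF p S_diff[OF s1(1) s0(1)] this]
      show "J (\<pi>(i := p)) i \<le> J \<pi> i"
        using a[rule_format, OF S_diff[OF s1(1) s0(1)]] unfolding d unfolding J_def .
    qed
    then show ?thesis using mean_variance_optimal_iff[OF \<gamma>[OF i] YL] by simp
  qed
  let ?xe = "\<lambda>k \<omega>. x k * e \<omega>"
  define y where "y = (\<lambda>i \<omega>. relative n \<theta> ?xe i \<omega>)"
  have yL: "y i \<in> L2 M" if "i \<in> {1..n}" for i
    unfolding y_def by (rule relative_L2[OF _ that]) (intro L2_cmult e)
  have "\<exists>z\<in>S. \<forall>s\<in>S. cov z s = expectation s / \<gamma> i - cov (y i) s" if i: "i \<in> {1..n}" for i
  proof -
    \<comment> \<open>Pairing this function with \<open>s\<close> gives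
      \<open>E s / \<gamma> i\<close> minus the covariance of \<open>y i\<close> and
      \<open>s\<close>, where \<open>y i\<close> is the relative wealth from initial endowments
      alone; centering \<open>y i\<close> turns the inner product into a covariance.\<close>
    have fL: "(\<lambda>\<omega>. 1 / \<gamma> i - (y i \<omega> - expectation (y i))) \<in> L2 M" by (intro L2_diff L2_const yL i)
    obtain z where z: "z \<in> S" "\<And>s. s \<in> S \<Longrightarrow> cov z s = expectation (\<lambda>\<omega>. (1 / \<gamma> i - (y i \<omega> - expectation (y i))) * s \<omega>)"
      using cov_representation[OF fL] by blast
    have "expectation (\<lambda>\<omega>. (1 / \<gamma> i - (y i \<omega> - expectation (y i))) * s \<omega>) = expectation s / \<gamma> i - cov (y i) s" if s: "s \<in> S" for s
    proof -
      have "expectation (\<lambda>\<omega>. (1 / \<gamma> i - (y i \<omega> - expectation (y i))) * s \<omega>)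
        = expectation (\<lambda>\<omega>. (1 / \<gamma> i + expectation (y i)) * s \<omega> - y i \<omega> * s \<omega>)"
        by (intro Bochner_Integration.integral_cong) (auto simp: algebra_simps)
      also have "\<dots> = (1 / \<gamma> i + expectation (y i)) * expectation s - expectation (\<lambda>\<omega>. y i \<omega> * s \<omega>)"
        using L2_integrable[OF S_in_L2[OF s]] L2_integrable_mult[OF yL[OF i] S_in_L2[OF s]] by simp
      finally show ?thesis by (simp add: cov_def algebra_simps)
    qed
    then show ?thesis using z by auto
  qed
  then obtain z where z: "\<And>i. i \<in> {1..n} \<Longrightarrow> z i \<in> S"
    "\<And>i s. i \<in> {1..n} \<Longrightarrow> s \<in> S \<Longrightarrow> cov (z i) s = expectation s / \<gamma> i - cov (y i) s" by metis
  \<comment> \<open>For every agent the condition compares covariances of two elements of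
    \<open>S\<close> with all of \<open>S\<close>; definiteness turns it into an equation between
    random variables.\<close>
  have char: "(\<forall>i\<in>{1..n}. \<forall>p\<in>U. J (\<pi>(i := p)) i \<le> J \<pi> i) \<longleftrightarrow>
      (\<forall>i\<in>{1..n}. AE \<omega> in M. relative n \<theta> s i \<omega> = z i \<omega>)"
    if \<pi>: "\<forall>i\<in>{1..n}. \<pi> i \<in> U" and s: "\<And>i. i \<in> {1..n} \<Longrightarrow> s i \<in> S"
      and Xs: "\<And>i. i \<in> {1..n} \<Longrightarrow> AE \<omega> in M. X i (\<pi> i) \<omega> = x i * e \<omega> + s i \<omega>" for \<pi> s
  proof (intro ball_cong refl)
    fix i assume i: "i \<in> {1..n}"
    have YL: "?Y \<pi> i \<in> L2 M" by (rule relative_L2[OF _ i]) (use \<pi> XL in auto)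
    have rS: "relative n \<theta> s i \<in> S" by (rule relative_S[OF s i])
    have "AE \<omega> in M. \<forall>k\<in>{1..n}. X k (\<pi> k) \<omega> = x k * e \<omega> + s k \<omega>"
      using Xs by (intro AE_finite_allI) auto
    then have eq: "AE \<omega> in M. ?Y \<pi> i \<omega> = y i \<omega> + 1 * relative n \<theta> s i \<omega>"
    proof eventually_elim
      case (elim \<omega>)
      have "?Y \<pi> i \<omega> = relative n \<theta> (\<lambda>k \<omega>. x k * e \<omega> + s k \<omega>) i \<omega>"
        using elim i by (simp add: relative_def)
      then show ?case by (simp add: relative_add y_def)
    qed
    have c: "cov (?Y \<pi> i) t = cov (y i) t + cov (relative n \<theta> s i) t" if t: "t \<in> S" for t
    proof -
      have "cov (?Y \<pi> i) t = cov (\<lambda>\<omega>. y i \<omega> + 1 * relative n \<theta> s i \<omega>) t"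
        by (rule cov_cong_AE[OF YL L2_add[OF yL[OF i] L2_cmult[OF S_in_L2[OF rS]]] S_in_L2[OF t] eq])
      also have "\<dots> = cov (y i) t + 1 * cov (relative n \<theta> s i) t"
        by (rule cov_linear[OF yL[OF i] S_in_L2[OF rS] S_in_L2[OF t]])
      finally show ?thesis by simp
    qed
    have zd: "cov (\<lambda>\<omega>. relative n \<theta> s i \<omega> + (-1) * z i \<omega>) t = cov (relative n \<theta> s i) t - cov (z i) t" if t: "t \<in> S" for t
      using cov_linear[OF S_in_L2[OF rS] S_in_L2[OF z(1)[OF i]] S_in_L2[OF t], of "-1"] by simp
    have "(\<forall>p\<in>U. J (\<pi>(i := p)) i \<le> J \<pi> i) \<longleftrightarrow> (\<forall>t\<in>S. cov (relative n \<theta> s i) t = cov (z i) t)"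
      unfolding foc[OF \<pi> i]
    proof (intro ball_cong refl)
      fix t assume t: "t \<in> S"
      have E: "expectation t = \<gamma> i * (cov (y i) t + cov (z i) t)" using z(2)[OF i t] \<gamma>[OF i] by (simp add: field_simps)
      show "(expectation t = \<gamma> i * cov (?Y \<pi> i) t) = (cov (relative n \<theta> s i) t = cov (z i) t)"
        unfolding c[OF t] E using \<gamma>[OF i] by auto
    qed
    also have "\<dots> \<longleftrightarrow> (AE \<omega> in M. relative n \<theta> s i \<omega> = z i \<omega>)"
    proof
      assume "\<forall>t\<in>S. cov (relative n \<theta> s i) t = cov (z i) t"
      then have "AE \<omega> in M. relative n \<theta> s i \<omega> + (-1) * z i \<omega> = 0"
        using zd by (intro cov_zero_imp_zero S_linear rS z(1) i) auto
      then show "AE \<omega> in M. relative n \<theta> s i \<omega> = z i \<omega>" by simp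
    next
      assume "AE \<omega> in M. relative n \<theta> s i \<omega> = z i \<omega>"
      then show "\<forall>t\<in>S. cov (relative n \<theta> s i) t = cov (z i) t"
        using S_in_L2 rS z(1)[OF i] by (intro ballI cov_cong_AE) auto
    qed
    finally show "(\<forall>p\<in>U. J (\<pi>(i := p)) i \<le> J \<pi> i) \<longleftrightarrow> (AE \<omega> in M. relative n \<theta> s i \<omega> = z i \<omega>)" .
  qed
  let ?sol = "\<lambda>i \<omega>. ((real n - 1) * z i \<omega> + \<theta> i * ((\<Sum>k=1..n. (real n - 1) * z k \<omega> / (real n - 1 + \<theta> k)) / (1 - Psi n \<theta>)))
      / (real n - 1 + \<theta> i)"
  have solS: "?sol i \<in> S" if i: "i \<in> {1..n}" for i
  proof -
    have "(\<lambda>\<omega>. (1 / (real n - 1 + \<theta> i)) * ((real n - 1) * z i \<omega> + \<theta> i * ((1 / (1 - Psi n \<theta>)) *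
       (\<Sum>k=1..n. ((real n - 1) / (real n - 1 + \<theta> k)) * z k \<omega>)))) \<in> S"
      by (intro S_cmult S_add S_sum z(1) i) auto
    then show ?thesis by simp
  qed
  have "\<forall>i\<in>{1..n}. \<exists>p. p \<in> U \<and> (AE \<omega> in M. X i p \<omega> = x i * e \<omega> + ?sol i \<omega>)"
    using onto[OF _ solS] by blast
  from bchoice[OF this] obtain \<pi> where \<pi>': "\<forall>i\<in>{1..n}. \<pi> i \<in> U \<and> (AE \<omega> in M. X i (\<pi> i) \<omega> = x i * e \<omega> + ?sol i \<omega>)" ..
  have \<pi>: "\<forall>i\<in>{1..n}. \<pi> i \<in> U" using \<pi>' by blast
  have X\<pi>: "AE \<omega> in M. X i (\<pi> i) \<omega> = x i * e \<omega> + ?sol i \<omega>" if "i \<in> {1..n}" for i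
    using bspec[OF \<pi>' that] by (rule conjunct2)
  have "\<forall>i\<in>{1..n}. AE \<omega> in M. relative n \<theta> ?sol i \<omega> = z i \<omega>"
  proof (intro ballI AE_I2)
    fix i \<omega> assume i: "i \<in> {1..n}"
    have "\<forall>i\<in>{1..n}. ?sol i \<omega> - \<theta> i * ((1 / (real n - 1)) * (\<Sum>k\<in>{1..n} - {i}. ?sol k \<omega>)) = z i \<omega>"
      by (rule iffD2[OF relative_solution[OF n \<theta> \<Psi>]], assumption) (intro ballI refl)
    from bspec[OF this i] show "relative n \<theta> ?sol i \<omega> = z i \<omega>" unfolding relative_def .
  qed
  then have NE: "\<forall>i\<in>{1..n}. \<forall>p\<in>U. J (\<pi>(i := p)) i \<le> J \<pi> i"
    using char[OF \<pi> solS X\<pi>] by simp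
  have uniq: "\<forall>i\<in>{1..n}. same (\<pi>' i) (\<pi> i)"
    if \<pi>': "\<forall>i\<in>{1..n}. \<pi>' i \<in> U" and NE': "\<forall>i\<in>{1..n}. \<forall>p\<in>U. J (\<pi>'(i := p)) i \<le> J \<pi>' i" for \<pi>'
  proof -
    have "\<forall>i\<in>{1..n}. \<exists>s. s \<in> S \<and> (AE \<omega> in M. X i (\<pi>' i) \<omega> = x i * e \<omega> + s \<omega>)"
      using range \<pi>' by blast
    from bchoice[OF this] obtain s where s': "\<forall>i\<in>{1..n}. s i \<in> S \<and> (AE \<omega> in M. X i (\<pi>' i) \<omega> = x i * e \<omega> + s i \<omega>)" ..
    have s: "s i \<in> S" if "i \<in> {1..n}" for i using bspec[OF s' that] by (rule conjunct1)
    have Xs: "AE \<omega> in M. X i (\<pi>' i) \<omega> = x i * e \<omega> + s i \<omega>" if "i \<in> {1..n}" for i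
      using bspec[OF s' that] by (rule conjunct2)
    have "\<forall>i\<in>{1..n}. AE \<omega> in M. relative n \<theta> s i \<omega> = z i \<omega>" using char[OF \<pi>' s Xs] NE' by simp
    \<comment> \<open>The finitely many exceptional sets are merged, so that the whole system can be
      solved in one scenario at a time.\<close>
    then have "AE \<omega> in M. \<forall>i\<in>{1..n}. relative n \<theta> s i \<omega> = z i \<omega>" by (intro AE_finite_allI) auto
    then have all: "AE \<omega> in M. \<forall>i\<in>{1..n}. s i \<omega> = ?sol i \<omega>"
      unfolding relative_def by eventually_elim (rule iffD1[OF relative_solution[OF n \<theta> \<Psi>]])
    show ?thesis
    proof
      fix i assume i: "i \<in> {1..n}"
      have "AE \<omega> in M. X i (\<pi>' i) \<omega> = X i (\<pi> i) \<omega>"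
        using all Xs[OF i] X\<pi>[OF i] by eventually_elim (use i in simp)
      then show "same (\<pi>' i) (\<pi> i)" using \<pi> \<pi>' i by (intro inj) auto
    qed
  qed
  show ?thesis using \<pi> NE uniq by blast
qed

end

section \<open>Wealth\<close>

context brownian_setting
begin

lemma set_integral_pint: "t \<in> {0..T} \<Longrightarrow> (LINT s:{0..t}|lborel. f s) = pint f t"
  unfolding set_lebesgue_integral_def pint_def integral_R
  by (intro Bochner_Integration.integral_cong) (auto simp: indicator_def)

lemma set_integrable_R: "set_integrable lborel {0..T} f \<longleftrightarrow> integrable R f" for f :: "real \<Rightarrow> real"
  using integrable_restrict_space[of "{0..T}" lborel f] by (simp add: set_integrable_def)

lemma continuous_measurable_R: "continuous_on {0..T} f \<Longrightarrow> f \<in> borel_measurable R" for f :: "real \<Rightarrow> real"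
  using borel_measurable_continuous_on_restrict[of "{0..T}" f] sets_restrict_space_cong[of lborel borel "{0..T}"]
  by (simp add: measurable_cong_sets[of R "restrict_space borel {0..T}"])

lemma continuous_integrable_R: "continuous_on {0..T} f \<Longrightarrow> integrable R f" for f :: "real \<Rightarrow> real"
  using borel_integrable_compact[of "{0..T}" f] set_integrable_R[of f] by (simp add: set_integrable_def)

text \<open>The limit is taken pointwise along a subsequence, so each time slice is measurable for
  its own \<open>F t\<close>. A limit in \<open>L2 P\<close> alone does not fix individual time
  slices.\<close>

lemma L2_adapted_tends:
  assumes v: "\<And>k. v k \<in> L2_adapted M T W"
    and C: "\<And>e. 0 < e \<Longrightarrow> \<exists>K. \<forall>j\<ge>K. \<forall>k\<ge>K. l2norm P (\<lambda>z. case_prod (v j) z - case_prod (v k) z) < e"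
  shows "\<exists>w\<in>L2_adapted M T W. L2_tends P (\<lambda>k. case_prod (v k)) (case_prod w)"
proof -
  have vL: "case_prod (v k) \<in> L2 P" for k using v[of k] by (simp add: L2_adapted_iff)
  obtain q where q: "L2_tends P (\<lambda>k. case_prod (v k)) (\<lambda>z. lim (\<lambda>k. case_prod (v (q k)) z))"
    using P.L2_complete_pointwise[OF vL C] by blast
  define w where "w = (\<lambda>t \<omega>. lim (\<lambda>k. v (q k) t \<omega>))"
  have e: "case_prod w = (\<lambda>z. lim (\<lambda>k. case_prod (v (q k)) z))" by (auto simp: w_def)
  have wL: "case_prod w \<in> L2 P" using q unfolding e by (simp add: L2_tends_def)
  have "w t \<in> borel_measurable (F t)" if "t \<in> {0..T}" for t
  proof -
    have [measurable]: "v k t \<in> borel_measurable (F t)" for k using v[of k] that by (simp add: L2_adapted_iff adapted_def)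
    show ?thesis unfolding w_def by measurable
  qed
  then have "w \<in> L2_adapted M T W" using wL by (auto simp: L2_adapted_iff adapted_def dest: L2_measurable)
  then show ?thesis using q unfolding e[symmetric] by blast
qed

end

locale market = discounting M T W r C + trading M T W \<rho> K
  for M :: "'a measure" and T W r C \<rho> K
begin

text \<open>Equality is required only almost surely, so that mean-square limits, which are
  determined up to null sets, stay inside. The bond factor converts discounted gains to terminal
  ones.\<close>

definition attainable :: "('a \<Rightarrow> real) set" where
  "attainable = {s \<in> L2 M. \<exists>v J. ito v J \<and> (AE \<omega> in M. s \<omega> = exp (TI r T \<omega>) * gain v J T \<omega>)}"

lemma T_in: "T \<in> {0..T}" using T_pos by simp

lemma bond_measurable: "(\<lambda>\<omega>. exp (c * TI r T \<omega>)) \<in> borel_measurable M"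
  using measurable_F_M[OF TI_r_adapted[OF T_in]] by measurable

lemma bond_mult_L2: "f \<in> L2 M \<Longrightarrow> \<bar>c\<bar> \<le> 1 \<Longrightarrow> (\<lambda>\<omega>. exp (c * TI r T \<omega>) * f \<omega>) \<in> L2 M"
  by (rule L2_bounded_mult[OF _ bond_measurable exp_TI_bound[OF _ T_in]])

lemma attainable_I:
  assumes "ito v J" "s \<in> borel_measurable M" "AE \<omega> in M. s \<omega> = exp (TI r T \<omega>) * gain v J T \<omega>"
  shows "s \<in> attainable"
proof -
  have "(\<lambda>\<omega>. exp (TI r T \<omega>) * gain v J T \<omega>) \<in> L2 M"
    using bond_mult_L2[OF gain_L2(1)[OF assms(1) T_in], of 1] by simp
  then have "s \<in> L2 M" by (rule L2_cong_AE[OF _ assms(2)]) (use assms(3) in \<open>auto elim: eventually_mono\<close>)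
  then show ?thesis using assms unfolding attainable_def by blast
qed

text \<open>Integrand and discounted gain control each other: the first estimate gives continuity,
  the second injectivity and closedness of the range.\<close>

lemma gain_diff_bound:
  assumes "ito v J" "ito w I"
  shows "l2norm M (\<lambda>\<omega>. gain v J T \<omega> - gain w I T \<omega>) \<le> (sqrt T * K + 1) * l2norm P (\<lambda>z. case_prod v z - case_prod w z)"
    and "c \<ge> 0 \<Longrightarrow> \<forall>v J. ito v J \<longrightarrow> l2norm P (case_prod v) \<le> c * l2norm M (gain v J T) \<Longrightarrow>
      l2norm P (\<lambda>z. case_prod v z - case_prod w z) \<le> c * l2norm M (\<lambda>\<omega>. gain v J T \<omega> - gain w I T \<omega>)"
proof -
  note d = ito_linear[OF assms, of "-1"]
  have e: "case_prod (\<lambda>t \<omega>. v t \<omega> + (-1) * w t \<omega>) = (\<lambda>z. case_prod v z - case_prod w z)" by auto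
  have n: "l2norm M (gain (\<lambda>t \<omega>. v t \<omega> + (-1) * w t \<omega>) (\<lambda>t \<omega>. J t \<omega> + (-1) * I t \<omega>) T)
    = l2norm M (\<lambda>\<omega>. gain v J T \<omega> - gain w I T \<omega>)"
  proof (rule l2norm_cong_AE[OF L2_measurable[OF gain_L2(1)[OF d T_in]] L2_measurable[OF L2_diff]])
    show "AE \<omega> in M. gain (\<lambda>t \<omega>. v t \<omega> + (-1) * w t \<omega>) (\<lambda>t \<omega>. J t \<omega> + (-1) * I t \<omega>) T \<omega> = gain v J T \<omega> - gain w I T \<omega>"
      using gain_diff[OF assms, of "-1"] by eventually_elim simp
  qed (rule gain_L2(1)[OF assms(1) T_in], rule gain_L2(1)[OF assms(2) T_in])
  show "l2norm M (\<lambda>\<omega>. gain v J T \<omega> - gain w I T \<omega>) \<le> (sqrt T * K + 1) * l2norm P (\<lambda>z. case_prod v z - case_prod w z)"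
    using gain_upper_bound[OF d] unfolding n e .
  show "l2norm P (\<lambda>z. case_prod v z - case_prod w z) \<le> c * l2norm M (\<lambda>\<omega>. gain v J T \<omega> - gain w I T \<omega>)"
    if "\<forall>v J. ito v J \<longrightarrow> l2norm P (case_prod v) \<le> c * l2norm M (gain v J T)"
    using that d unfolding n[symmetric] e[symmetric] by blast
qed

lemma gain_unique:
  assumes "ito v J" "ito w I" "AE z in P. case_prod v z = case_prod w z"
  shows "AE \<omega> in M. gain v J T \<omega> = gain w I T \<omega>"
proof -
  have "l2norm P (\<lambda>z. case_prod v z - case_prod w z) = l2norm P (\<lambda>z. 0)"
  proof (rule l2norm_cong_AE)
    show "(\<lambda>z. case_prod v z - case_prod w z) \<in> borel_measurable P"
      by (intro L2_measurable[OF L2_diff] ito_integrand_L2[OF assms(1)] ito_integrand_L2[OF assms(2)])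
    show "AE z in P. case_prod v z - case_prod w z = 0" using assms(3) by eventually_elim simp
  qed simp
  also have "\<dots> = 0" by (simp add: l2norm_def)
  finally have "l2norm M (\<lambda>\<omega>. gain v J T \<omega> - gain w I T \<omega>) \<le> 0"
    using gain_diff_bound(1)[OF assms(1,2)] by simp
  then have "l2norm M (\<lambda>\<omega>. gain v J T \<omega> - gain w I T \<omega>) = 0" using l2norm_nonneg by (rule antisym)
  then have "AE \<omega> in M. gain v J T \<omega> - gain w I T \<omega> = 0"
    by (intro l2norm_eq_0_AE L2_diff gain_L2(1)[OF assms(1) T_in] gain_L2(1)[OF assms(2) T_in])
  then show ?thesis by simp
qed

lemma gain_injective:
  assumes "ito v J" "ito w I" "AE \<omega> in M. gain v J T \<omega> = gain w I T \<omega>"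
  shows "AE z in P. case_prod v z = case_prod w z"
proof -
  obtain c where c: "c \<ge> 0" "\<forall>v J. ito v J \<longrightarrow> l2norm P (case_prod v) \<le> c * l2norm M (gain v J T)"
    using gain_lower_bound by blast
  have L: "(\<lambda>\<omega>. gain v J T \<omega> - gain w I T \<omega>) \<in> L2 M"
    by (intro L2_diff gain_L2(1)[OF assms(1) T_in] gain_L2(1)[OF assms(2) T_in])
  have "l2norm M (\<lambda>\<omega>. gain v J T \<omega> - gain w I T \<omega>) = l2norm M (\<lambda>\<omega>. 0)"
    by (rule l2norm_cong_AE[OF L2_measurable[OF L]]) (use assms(3) in \<open>auto elim: eventually_mono\<close>)
  then have "l2norm P (\<lambda>z. case_prod v z - case_prod w z) \<le> 0"
    using gain_diff_bound(2)[OF assms(1,2) c] by (simp add: l2norm_def)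
  then have "l2norm P (\<lambda>z. case_prod v z - case_prod w z) = 0" using l2norm_nonneg by (rule antisym)
  then have "AE z in P. case_prod v z - case_prod w z = 0"
    by (intro l2norm_eq_0_AE L2_diff ito_integrand_L2[OF assms(1)] ito_integrand_L2[OF assms(2)])
  then show ?thesis by eventually_elim (simp only: right_minus_eq)
qed

lemma gains_space_attainable: "gains_space M attainable"
proof
  show "attainable \<subseteq> L2 M" by (auto simp: attainable_def)
  have g0: "gain (\<lambda>t \<omega>. 0) (\<lambda>t \<omega>. 0) T \<omega> = 0" for \<omega> by (simp add: gain_def TI_def)
  have "(\<lambda>\<omega>. 0) \<in> attainable" by (rule attainable_I[OF ito_zero]) (simp_all add: g0)
  then show "attainable \<noteq> {}" by blast
  show "(\<lambda>\<omega>. g \<omega> + c * h \<omega>) \<in> attainable" if gh: "g \<in> attainable" "h \<in> attainable" for g h c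
  proof -
    obtain v J where v: "ito v J" "AE \<omega> in M. g \<omega> = exp (TI r T \<omega>) * gain v J T \<omega>" using gh(1) unfolding attainable_def by blast
    obtain w I where w: "ito w I" "AE \<omega> in M. h \<omega> = exp (TI r T \<omega>) * gain w I T \<omega>" using gh(2) unfolding attainable_def by blast
    show ?thesis
    proof (rule attainable_I[OF ito_linear[OF v(1) w(1), of c]])
      show "(\<lambda>\<omega>. g \<omega> + c * h \<omega>) \<in> borel_measurable M"
        using gh by (intro L2_measurable[OF L2_add[OF _ L2_cmult]]) (auto simp: attainable_def)
      show "AE \<omega> in M. g \<omega> + c * h \<omega> = exp (TI r T \<omega>) * gain (\<lambda>t \<omega>. v t \<omega> + c * w t \<omega>) (\<lambda>t \<omega>. J t \<omega> + c * I t \<omega>) T \<omega>"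
        using v(2) w(2) gain_diff[OF v(1) w(1), of c] by eventually_elim (simp add: algebra_simps)
    qed
  qed
  show "g \<in> attainable" if G: "L2_tends M G g" "\<And>k. G k \<in> attainable" for G g
  proof -
    have "\<forall>k. \<exists>v. \<exists>J. ito v J \<and> (AE \<omega> in M. G k \<omega> = exp (TI r T \<omega>) * gain v J T \<omega>)"
      using G(2) unfolding attainable_def by blast
    then obtain v J where vJ: "\<forall>k. ito (v k) (J k) \<and> (AE \<omega> in M. G k \<omega> = exp (TI r T \<omega>) * gain (v k) (J k) T \<omega>)"
      unfolding choice_iff by blast
    then have v: "\<And>k. ito (v k) (J k)" and Gv: "\<And>k. AE \<omega> in M. G k \<omega> = exp (TI r T \<omega>) * gain (v k) (J k) T \<omega>" by blast+
    have GL: "G k \<in> L2 M" "g \<in> L2 M" for k using G(1) by (auto simp: L2_tends_def)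
    have gL: "gain (v k) (J k) T \<in> L2 M" for k by (rule gain_L2(1)[OF v T_in])
    let ?D = "\<lambda>\<omega>. exp (- 1 * TI r T \<omega>)"
    \<comment> \<open>The bond factor is bounded in both directions, so removing it transfers
      convergence to the discounted gains; the lower bound then makes the integrands a Cauchy
      sequence.\<close>
    have tD: "L2_tends M (\<lambda>k \<omega>. ?D \<omega> * G k \<omega>) (\<lambda>\<omega>. ?D \<omega> * g \<omega>)"
      by (rule L2_tends_bounded_mult[OF G(1) bond_measurable exp_TI_bound[OF _ T_in]]) auto
    have DG: "AE \<omega> in M. ?D \<omega> * G k \<omega> = gain (v k) (J k) T \<omega>" for k
      using Gv[of k] by eventually_elim (simp add: exp_minus)
    obtain c where c: "c \<ge> 0" "\<forall>v J. ito v J \<longrightarrow> l2norm P (case_prod v) \<le> c * l2norm M (gain v J T)"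
      using gain_lower_bound by blast
    have cd: "l2norm P (\<lambda>z. case_prod (v j) z - case_prod (v k) z) \<le> c * l2norm M (\<lambda>\<omega>. ?D \<omega> * G j \<omega> - ?D \<omega> * G k \<omega>)" for j k
    proof -
      have DL: "(\<lambda>\<omega>. ?D \<omega> * G j \<omega>) \<in> L2 M" for j by (rule bond_mult_L2[OF GL(1)]) simp
      have "l2norm M (\<lambda>\<omega>. gain (v j) (J j) T \<omega> - gain (v k) (J k) T \<omega>) = l2norm M (\<lambda>\<omega>. ?D \<omega> * G j \<omega> - ?D \<omega> * G k \<omega>)"
      proof (rule l2norm_cong_AE[OF L2_measurable[OF L2_diff[OF gL gL]] L2_measurable[OF L2_diff[OF DL DL]]])
        show "AE \<omega> in M. gain (v j) (J j) T \<omega> - gain (v k) (J k) T \<omega> = ?D \<omega> * G j \<omega> - ?D \<omega> * G k \<omega>"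
          using DG[of j] DG[of k] by eventually_elim simp
      qed
      then show ?thesis using gain_diff_bound(2)[OF v v c, of j k] by simp
    qed
    have "\<exists>K. \<forall>j\<ge>K. \<forall>k\<ge>K. l2norm P (\<lambda>z. case_prod (v j) z - case_prod (v k) z) < e" if e: "0 < e" for e
    proof -
      obtain K where Kj: "\<forall>j\<ge>K. \<forall>k\<ge>K. l2norm M (\<lambda>\<omega>. ?D \<omega> * G j \<omega> - ?D \<omega> * G k \<omega>) < e / (c + 1)"
        using L2_tends_Cauchy[OF tD, of "e / (c + 1)"] e c(1) by auto
      have "l2norm P (\<lambda>z. case_prod (v j) z - case_prod (v k) z) < e" if "K \<le> j" "K \<le> k" for j k
      proof -
        have "l2norm P (\<lambda>z. case_prod (v j) z - case_prod (v k) z) \<le> c * (e / (c + 1))"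
          using order_trans[OF cd mult_left_mono[OF less_imp_le c(1)]] Kj that by blast
        also have "\<dots> < e" using c(1) e by (simp add: field_simps)
        finally show ?thesis .
      qed
      then show ?thesis by blast
    qed
    from L2_adapted_tends[OF ito_integrand[OF v] this] obtain w where w: "w \<in> L2_adapted M T W"
      "L2_tends P (\<lambda>k. case_prod (v k)) (case_prod w)" by blast
    obtain I where I: "ito w I" using ito_exists'[OF w(1)] by blast
    have "L2_tends M (\<lambda>k. gain (v k) (J k) T) (gain w I T)"
    proof (rule L2_tends_I[OF gL gain_L2(1)[OF I T_in] gain_diff_bound(1)[OF v I]])
      show "(\<lambda>k. (sqrt T * K + 1) * l2norm P (\<lambda>z. case_prod (v k) z - case_prod w z)) \<longlonglongrightarrow> 0"
        using w(2) unfolding L2_tends_def by (intro tendsto_mult_right_zero) blast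
    qed
    from L2_tends_bounded_mult[OF this bond_measurable[of 1] exp_TI_bound[OF _ T_in, of _ 1]]
    have "L2_tends M (\<lambda>k \<omega>. exp (1 * TI r T \<omega>) * gain (v k) (J k) T \<omega>) (\<lambda>\<omega>. exp (1 * TI r T \<omega>) * gain w I T \<omega>)" by simp
    moreover have "L2_tends M (\<lambda>k \<omega>. exp (1 * TI r T \<omega>) * gain (v k) (J k) T \<omega>) g"
    proof (rule L2_tends_I[OF _ GL(2)])
      show "(\<lambda>\<omega>. exp (1 * TI r T \<omega>) * gain (v k) (J k) T \<omega>) \<in> L2 M" for k by (rule bond_mult_L2[OF gL]) simp
      show "(\<lambda>k. l2norm M (\<lambda>\<omega>. G k \<omega> - g \<omega>)) \<longlonglongrightarrow> 0" using G(1) by (simp add: L2_tends_def)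
      fix k
      show "l2norm M (\<lambda>\<omega>. exp (1 * TI r T \<omega>) * gain (v k) (J k) T \<omega> - g \<omega>) \<le> l2norm M (\<lambda>\<omega>. G k \<omega> - g \<omega>)"
      proof (rule eq_refl[OF l2norm_cong_AE[OF L2_measurable[OF L2_diff[OF bond_mult_L2[OF gL] GL(2)]] L2_measurable[OF L2_diff[OF GL]]]])
        show "AE \<omega> in M. exp (1 * TI r T \<omega>) * gain (v k) (J k) T \<omega> - g \<omega> = G k \<omega> - g \<omega>"
          using Gv[of k] by eventually_elim simp
      qed simp
    qed
    ultimately have "AE \<omega> in M. g \<omega> = exp (1 * TI r T \<omega>) * gain w I T \<omega>" by (intro L2_tends_unique)
    then show ?thesis by (intro attainable_I[OF I L2_measurable[OF GL(2)]]) simp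
  qed
  show "\<not> (AE \<omega> in M. g \<omega> = c)" if g: "g \<in> attainable" and c: "c \<noteq> 0" for g c
  proof
    assume gc: "AE \<omega> in M. g \<omega> = c"
    obtain v J where v: "ito v J" "AE \<omega> in M. g \<omega> = exp (TI r T \<omega>) * gain v J T \<omega>" using g unfolding attainable_def by blast
    \<comment> \<open>Division by \<open>c\<close> settles the sign, and the constant 1 is worth at
      least \<open>exp (- (C * T))\<close> after discounting: a gain bounded below by a positive
      number, contrary to \<open>no_arbitrage\<close>.\<close>
    note lin = ito_linear[OF ito_zero v(1), of "1 / c"]
    have "AE \<omega> in M. exp (- (C * T)) \<le> gain (\<lambda>t \<omega>. 0 + 1 / c * v t \<omega>) (\<lambda>t \<omega>. 0 + 1 / c * J t \<omega>) T \<omega>"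
      using gc v(2) gain_diff[OF ito_zero v(1), of "1 / c"] AE_space
    proof eventually_elim
      case (elim \<omega>)
      have "exp (TI r T \<omega>) * gain v J T \<omega> = c" using elim(1,2) by simp
      then have "gain v J T \<omega> = c * exp (- TI r T \<omega>)" by (simp add: exp_minus field_simps)
      then have "1 / c * gain v J T \<omega> = exp (- TI r T \<omega>)" using c by simp
      moreover have "exp (- (C * T)) \<le> exp (- TI r T \<omega>)" using TI_r_bound[OF elim(4) T_in] by simp
      ultimately show ?case using elim(3) g0 by simp
    qed
    then show False by (intro no_arbitrage[OF lin, of "exp (- (C * T))"]) simp_all
  qed
qed

end

text \<open>The coefficients \<open>r0\<close> and \<open>risk_premium r0 \<mu> \<sigma>\<close> of the wealth equation are only almost everywhere equal to
  the everywhere bounded processes \<open>r\<close> and \<open>\<rho>\<close>.\<close>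

locale asset = market M T W r C \<rho> K
  for M :: "'a measure" and T W r C \<rho> K +
  fixes r0 \<mu> \<sigma> :: "'a process" and c :: real
  assumes r0: "case_prod r0 \<in> borel_measurable P" "AE z in P. case_prod r0 z = case_prod r z"
    and rp: "case_prod (risk_premium r0 \<mu> \<sigma>) \<in> borel_measurable P"
      "AE z in P. case_prod (risk_premium r0 \<mu> \<sigma>) z = case_prod \<rho> z"
    and \<sigma>: "adapted M T W \<sigma>" and c: "0 < c"
    and \<sigma>_bound: "AE z in P. inverse c \<le> case_prod \<sigma> z \<and> case_prod \<sigma> z \<le> c"
begin

lemma position_L2_adapted:
  assumes "p \<in> L2_adapted M T W" shows "(\<lambda>t \<omega>. p t \<omega> * \<sigma> t \<omega>) \<in> L2_adapted M T W"
proof -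
  have "AE z in P. \<bar>case_prod \<sigma> z\<bar> \<le> c"
    using \<sigma>_bound
  proof eventually_elim
    case (elim z)
    then have "0 < case_prod \<sigma> z" using c by (meson order_less_le_trans positive_imp_inverse_positive)
    then show ?case using elim by simp
  qed
  from L2_adapted_mult[OF assms \<sigma> this] show ?thesis by (simp add: mult.commute)
qed

lemma section_coefficients:
  "AE \<omega> in M. AE t in R. r0 t \<omega> = r t \<omega> \<and> risk_premium r0 \<mu> \<sigma> t \<omega> = \<rho> t \<omega>"
proof (rule AE_P_iff)
  show "AE (t, \<omega>) in P. r0 t \<omega> = r t \<omega> \<and> risk_premium r0 \<mu> \<sigma> t \<omega> = \<rho> t \<omega>"
    using r0(2) rp(2) by eventually_elim auto
qed

context
  fixes p :: "'a process"
  assumes p: "p \<in> L2_adapted M T W"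
begin

abbreviation (input) "u \<equiv> (\<lambda>t \<omega>. p t \<omega> * \<sigma> t \<omega>)"

lemma u: "u \<in> L2_adapted M T W" by (rule position_L2_adapted[OF p])

lemma \<rho>u_integrable: "AE \<omega> in M. integrable R (\<lambda>s. \<rho> s \<omega> * u s \<omega>)"
  using AE_section_integrable[OF \<rho>_mult_L2[OF u]] by simp

text \<open>In a scenario where the given and the bounded coefficients agree for almost every time,
  both have the same time integrals; the wealth equation may thus be solved with the bounded
  ones.\<close>

lemma drift:
  assumes \<omega>: "\<omega> \<in> space M" and co: "AE t in R. r0 t \<omega> = r t \<omega> \<and> risk_premium r0 \<mu> \<sigma> t \<omega> = \<rho> t \<omega>"
    and f: "integrable R (\<lambda>s. \<rho> s \<omega> * u s \<omega>)" and X: "continuous_on {0..T} X"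
  defines "a \<equiv> \<lambda>t. r0 t \<omega> * X t + p t \<omega> * \<sigma> t \<omega> * risk_premium r0 \<mu> \<sigma> t \<omega>"
  shows "set_integrable lborel {0..T} a"
    and "t \<in> {0..T} \<Longrightarrow> (LINT s:{0..t}|lborel. a s) = pint (\<lambda>s. r s \<omega> * X s + \<rho> s \<omega> * u s \<omega>) t"
proof -
  have um: "(\<lambda>t. p t \<omega> * \<sigma> t \<omega>) \<in> borel_measurable R"
    using section_measurable(2)[OF L2_measurable, of "case_prod u", OF _ \<omega>] u by (simp add: L2_adapted_iff)
  have am: "a \<in> borel_measurable R"
    unfolding a_def using section_measurable(2)[OF r0(1) \<omega>] section_measurable(2)[OF rp(1) \<omega>]
    by (intro borel_measurable_add borel_measurable_times um continuous_measurable_R[OF X]) simp_all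
  have bi: "integrable R (\<lambda>s. r s \<omega> * X s + \<rho> s \<omega> * u s \<omega>)"
    by (intro Bochner_Integration.integrable_add f integrable_bounded_mult_R[OF continuous_integrable_R[OF X] r_section[OF \<omega>] r_bound])
  have ab: "AE s in R. r s \<omega> * X s + \<rho> s \<omega> * u s \<omega> = a s"
    using co by eventually_elim (simp add: a_def)
  have "integrable R a"
    by (rule integrable_cong_AE_imp[OF bi am]) (use ab in \<open>auto elim: eventually_mono\<close>)
  then show "set_integrable lborel {0..T} a" by (simp add: set_integrable_R)
  show "(LINT s:{0..t}|lborel. a s) = pint (\<lambda>s. r s \<omega> * X s + \<rho> s \<omega> * u s \<omega>) t" if "t \<in> {0..T}"
    unfolding set_integral_pint[OF that]
    by (rule pint_cong_AE[OF _ am]) (use ab bi in \<open>auto elim: eventually_mono\<close>)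
qed

text \<open>The pathwise solution formula is written with the processes \<open>w\<close> and
  \<open>I\<close>, which are adapted, so adaptedness of \<open>X\<close> follows from that of time
  integrals. A version of \<open>I\<close> whose paths are all continuous is needed to make
  \<open>r * I\<close> an admissible integrand in time.\<close>

lemma wealth_exists: "\<exists>X. is_wealth M T W r0 \<mu> \<sigma> x p X" for x :: real
proof -
  obtain I where I: "is_ito_integral M T W u I" and Ic: "\<And>\<omega>. \<omega> \<in> space M \<Longrightarrow> continuous_on {0..T} (\<lambda>t. I t \<omega>)"
    using ito_exists[OF u] by blast
  have itoI: "ito u I" by (rule is_ito_integral_imp_ito[OF I])
  define w where "w = (\<lambda>t \<omega>. disc t \<omega> * (\<rho> t \<omega> * u t \<omega> + 1 * (r t \<omega> * I t \<omega>)))"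
  define X where "X = (\<lambda>t \<omega>. exp (TI r t \<omega>) * (x + TI w t \<omega>) + I t \<omega>)"
  have IA: "I \<in> L2_adapted M T W" by (rule ito_continuous_L2_adapted[OF itoI Ic])
  have w: "w \<in> L2_adapted M T W" unfolding w_def
    by (intro disc_mult_L2_adapted L2_adapted_diff \<rho>_mult u L2_adapted_mult[OF IA r_adapted, of C])
      (simp add: r_bound split_beta')
  have XF: "X t \<in> borel_measurable (F t)" if t: "t \<in> {0..T}" for t
  proof -
    have "(\<lambda>\<omega>. exp (TI r t \<omega>)) \<in> borel_measurable (F t)" using TI_r_adapted[OF t] by measurable
    then show ?thesis unfolding X_def
      by (intro borel_measurable_add borel_measurable_times borel_measurable_const TI_adapted[OF w t] ito_measurable[OF itoI t])
  qed
  have Xeq: "X t \<omega> = exp (pint (\<lambda>s. r s \<omega>) t) * (x + pint (\<lambda>s. exp (- pint (\<lambda>s. r s \<omega>) s) * (\<rho> s \<omega> * u s \<omega> + r s \<omega> * I s \<omega>)) t) + I t \<omega>" for t \<omega>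
    by (simp add: X_def w_def TI_pint disc_def)
  have main: "AE \<omega> in M. continuous_on {0..T} (\<lambda>t. X t \<omega>) \<and>
      set_integrable lborel {0..T} (\<lambda>t. r0 t \<omega> * X t \<omega> + p t \<omega> * \<sigma> t \<omega> * risk_premium r0 \<mu> \<sigma> t \<omega>) \<and>
      X 0 \<omega> = x \<and> (\<forall>t\<in>{0..T}. X t \<omega> = X 0 \<omega>
        + (LINT s:{0..t}|lborel. r0 s \<omega> * X s \<omega> + p s \<omega> * \<sigma> s \<omega> * risk_premium r0 \<mu> \<sigma> s \<omega>) + I t \<omega>)"
    using section_coefficients \<rho>u_integrable ito_0[OF itoI] AE_space
  proof eventually_elim
    case (elim \<omega>)
    have T0: "0 \<in> {0..T}" using T_pos by simp
    have Xc: "continuous_on {0..T} (\<lambda>t. X t \<omega>)"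
      by (rule linear_equation_solution(3)[OF r_section[OF elim(4)] r_bound elim(2) continuous_integrable_R[OF Ic[OF elim(4)]]
        T0 Ic[OF elim(4)], of x, folded Xeq])
    have eq: "X t \<omega> = x + pint (\<lambda>s. r s \<omega> * X s \<omega> + \<rho> s \<omega> * u s \<omega>) t + I t \<omega>" if "t \<in> {0..T}" for t
      by (rule linear_equation_solution(1)[OF r_section[OF elim(4)] r_bound elim(2) continuous_integrable_R[OF Ic[OF elim(4)]]
        that, of x, folded Xeq])
    have X0: "X 0 \<omega> = x" using eq[OF T0] elim(3) by (simp add: pint_0)
    show ?case using Xc X0 drift[OF elim(4,1,2) Xc] eq by simp
  qed
  have "has_ito_differential M T W X (\<lambda>t \<omega>. r0 t \<omega> * X t \<omega> + p t \<omega> * \<sigma> t \<omega> * risk_premium r0 \<mu> \<sigma> t \<omega>) u"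
    unfolding has_ito_differential_def
  proof (intro conjI exI[of _ I])
    show "\<forall>t\<in>{0..T}. X t \<in> borel_measurable (F t)" using XF by blast
    show "AE \<omega> in M. continuous_on {0..T} (\<lambda>t. X t \<omega>)" using main by eventually_elim simp
    show "AE \<omega> in M. set_integrable lborel {0..T} (\<lambda>t. r0 t \<omega> * X t \<omega> + p t \<omega> * \<sigma> t \<omega> * risk_premium r0 \<mu> \<sigma> t \<omega>)"
      using main by eventually_elim simp
    show "is_ito_integral M T W u I" by (rule I)
    show "AE \<omega> in M. \<forall>t\<in>{0..T}. X t \<omega> = X 0 \<omega>
        + (LINT s:{0..t}|lborel. r0 s \<omega> * X s \<omega> + p s \<omega> * \<sigma> s \<omega> * risk_premium r0 \<mu> \<sigma> s \<omega>) + I t \<omega>"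
      using main by eventually_elim blast
  qed
  moreover have "AE \<omega> in M. X 0 \<omega> = x" using main by eventually_elim simp
  ultimately show ?thesis unfolding is_wealth_def by blast
qed

text \<open>The explicit solution contains the rate acting on the undiscounted integral
  \<open>I\<close>. Integration by parts exchanges that term for the integral \<open>J\<close> of
  the discounted position, and what remains is a \<open>gain\<close>.\<close>

lemma wealth_terminal:
  assumes X: "is_wealth M T W r0 \<mu> \<sigma> x p X" and J: "ito (\<lambda>t \<omega>. disc t \<omega> * u t \<omega>) J"
  shows "AE \<omega> in M. X T \<omega> = x * exp (TI r T \<omega>) + exp (TI r T \<omega>) * gain (\<lambda>t \<omega>. disc t \<omega> * u t \<omega>) J T \<omega>"
proof -
  obtain I where I: "is_ito_integral M T W u I" and Ic: "\<And>\<omega>. \<omega> \<in> space M \<Longrightarrow> continuous_on {0..T} (\<lambda>t. I t \<omega>)"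
    using ito_exists[OF u] by blast
  have itoI: "ito u I" by (rule is_ito_integral_imp_ito[OF I])
  from X obtain I' where I': "is_ito_integral M T W u I'"
    and Xc: "AE \<omega> in M. continuous_on {0..T} (\<lambda>t. X t \<omega>)"
    and Xeq: "AE \<omega> in M. \<forall>t\<in>{0..T}. X t \<omega> = X 0 \<omega>
        + (LINT s:{0..t}|lborel. r0 s \<omega> * X s \<omega> + p s \<omega> * \<sigma> s \<omega> * risk_premium r0 \<mu> \<sigma> s \<omega>) + I' t \<omega>"
    and X0: "AE \<omega> in M. X 0 \<omega> = x"
    unfolding is_wealth_def has_ito_differential_def by blast
  have II: "AE \<omega> in M. \<forall>t\<in>{0..T}. I' t \<omega> = I t \<omega>" by (rule is_ito_integral_unique[OF I' I]) simp
  have w1: "AE \<omega> in M. integrable R (\<lambda>s. \<rho> s \<omega> * (disc s \<omega> * u s \<omega>))"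
    using AE_section_integrable[OF \<rho>_mult_L2[OF disc_mult_L2_adapted[OF u]]] by simp
  have Jd: "AE \<omega> in M. J T \<omega> = disc T \<omega> * I T \<omega> + pint (\<lambda>s. r s \<omega> * disc s \<omega> * I s \<omega>) T"
    by (rule ito_discount[OF itoI Ic J])
  show ?thesis
    using section_coefficients \<rho>u_integrable AE_space Xc Xeq X0 II Jd w1
  proof eventually_elim
    case (elim \<omega>)
    note \<omega> = elim(3)
    have eq: "X t \<omega> = x + pint (\<lambda>s. r s \<omega> * X s \<omega> + \<rho> s \<omega> * u s \<omega>) t + I t \<omega>" if t: "t \<in> {0..T}" for t
      using bspec[OF elim(5) t] bspec[OF elim(7) t] elim(6) drift(2)[OF \<omega> elim(1,2,4) t] by simp
    have d: "integrable R (\<lambda>s. r s \<omega> * disc s \<omega> * I s \<omega>)"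
    proof (rule integrable_bounded_mult_R[OF continuous_integrable_R[OF Ic[OF \<omega>]]])
      show "(\<lambda>s. r s \<omega> * disc s \<omega>) \<in> borel_measurable R"
        using borel_measurable_uminus[OF disc_pint(2)[OF \<omega> T_in]] by simp
      show "\<bar>r s \<omega> * disc s \<omega>\<bar> \<le> C * exp (C * T)" if "s \<in> {0..T}" for s
        using disc_pint(3)[OF \<omega> that] by (simp add: abs_mult)
    qed
    have "X T \<omega> = exp (pint (\<lambda>s. r s \<omega>) T) * (x + pint (\<lambda>s. exp (- pint (\<lambda>s. r s \<omega>) s) * (\<rho> s \<omega> * u s \<omega> + r s \<omega> * I s \<omega>)) T) + I T \<omega>"
      by (rule linear_equation_unique[OF r_section[OF \<omega>] r_bound elim(2) Ic[OF \<omega>] elim(4) eq T_in])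
    also have "pint (\<lambda>s. exp (- pint (\<lambda>s. r s \<omega>) s) * (\<rho> s \<omega> * u s \<omega> + r s \<omega> * I s \<omega>)) T
      = pint (\<lambda>s. \<rho> s \<omega> * (disc s \<omega> * u s \<omega>) + r s \<omega> * disc s \<omega> * I s \<omega>) T"
      by (rule pint_cong) (simp add: disc_def TI_pint algebra_simps)
    also have "\<dots> = pint (\<lambda>s. \<rho> s \<omega> * (disc s \<omega> * u s \<omega>)) T + pint (\<lambda>s. r s \<omega> * disc s \<omega> * I s \<omega>) T"
      by (rule pint_add[OF elim(9) d])
    also have "pint (\<lambda>s. r s \<omega> * disc s \<omega> * I s \<omega>) T = J T \<omega> - disc T \<omega> * I T \<omega>" using elim(8) by simp
    finally have "X T \<omega> = exp (TI r T \<omega>) * (x + (pint (\<lambda>s. \<rho> s \<omega> * (disc s \<omega> * u s \<omega>)) T + (J T \<omega> - disc T \<omega> * I T \<omega>))) + I T \<omega>"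
      by (simp only: TI_pint)
    moreover have "exp (TI r T \<omega>) * (disc T \<omega> * I T \<omega>) = I T \<omega>" by (simp add: disc_def exp_minus)
    ultimately show ?case by (auto simp: gain_def TI_pint algebra_simps)
  qed
qed

end

text \<open>\<open>wealth\<close> selects some solution. Existence shows that the selected process
  is one, and the terminal formula holds for every solution.\<close>

lemma terminal_wealth:
  assumes p: "p \<in> L2_adapted M T W"
  shows "wealth M T W r0 \<mu> \<sigma> x p T \<in> borel_measurable M"
    and "ito (\<lambda>t \<omega>. disc t \<omega> * (p t \<omega> * \<sigma> t \<omega>)) J \<Longrightarrow> AE \<omega> in M. wealth M T W r0 \<mu> \<sigma> x p T \<omega>
      = x * exp (TI r T \<omega>) + exp (TI r T \<omega>) * gain (\<lambda>t \<omega>. disc t \<omega> * (p t \<omega> * \<sigma> t \<omega>)) J T \<omega>"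
proof -
  have W: "is_wealth M T W r0 \<mu> \<sigma> x p (wealth M T W r0 \<mu> \<sigma> x p)"
    unfolding wealth_def by (rule someI_ex[OF wealth_exists[OF p]])
  then have "wealth M T W r0 \<mu> \<sigma> x p T \<in> borel_measurable (F T)"
    using T_in by (auto simp: is_wealth_def has_ito_differential_def)
  then show "wealth M T W r0 \<mu> \<sigma> x p T \<in> borel_measurable M" by (rule measurable_F_M) simp
  show "AE \<omega> in M. wealth M T W r0 \<mu> \<sigma> x p T \<omega>
      = x * exp (TI r T \<omega>) + exp (TI r T \<omega>) * gain (\<lambda>t \<omega>. disc t \<omega> * (p t \<omega> * \<sigma> t \<omega>)) J T \<omega>"
    if "ito (\<lambda>t \<omega>. disc t \<omega> * (p t \<omega> * \<sigma> t \<omega>)) J"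
    by (rule wealth_terminal[OF p W that])
qed

lemma ito_discounted_position: "p \<in> L2_adapted M T W \<Longrightarrow> \<exists>J. ito (\<lambda>t \<omega>. disc t \<omega> * (p t \<omega> * \<sigma> t \<omega>)) J"
  by (rule ito_exists'[OF disc_mult_L2_adapted[OF position_L2_adapted]])

lemma terminal_wealth_range:
  assumes p: "p \<in> L2_adapted M T W"
  shows "\<exists>s\<in>attainable. AE \<omega> in M. wealth M T W r0 \<mu> \<sigma> x p T \<omega> = x * exp (TI r T \<omega>) + s \<omega>"
proof -
  obtain J where J: "ito (\<lambda>t \<omega>. disc t \<omega> * (p t \<omega> * \<sigma> t \<omega>)) J" using ito_discounted_position[OF p] by blast
  have "(\<lambda>\<omega>. exp (TI r T \<omega>) * gain (\<lambda>t \<omega>. disc t \<omega> * (p t \<omega> * \<sigma> t \<omega>)) J T \<omega>) \<in> attainable"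
    by (rule attainable_I[OF J]) (use bond_mult_L2[OF gain_L2(1)[OF J T_in], of 1] in \<open>auto dest: L2_measurable\<close>)
  then show ?thesis by (intro bexI[of _ "\<lambda>\<omega>. exp (TI r T \<omega>) * gain (\<lambda>t \<omega>. disc t \<omega> * (p t \<omega> * \<sigma> t \<omega>)) J T \<omega>"] terminal_wealth(2)[OF p J])
qed

lemma terminal_wealth_onto:
  assumes s: "s \<in> attainable"
  shows "\<exists>p\<in>L2_adapted M T W. AE \<omega> in M. wealth M T W r0 \<mu> \<sigma> x p T \<omega> = x * exp (TI r T \<omega>) + s \<omega>"
proof -
  obtain v J where v: "ito v J" "AE \<omega> in M. s \<omega> = exp (TI r T \<omega>) * gain v J T \<omega>"
    using s unfolding attainable_def by blast
  \<comment> \<open>Volatility and discount factor are divided out, which reverses the passage from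
    a strategy to its discounted position. Both appear as bounded adapted multipliers, so
    \<open>p\<close> stays square-integrable.\<close>
  define p where "p = (\<lambda>t \<omega>. inverse (\<sigma> t \<omega>) * (exp (1 * TI r t \<omega>) * v t \<omega>))"
  have i: "adapted M T W (\<lambda>t \<omega>. inverse (\<sigma> t \<omega>))"
  proof -
    have "case_prod (\<lambda>t \<omega>. inverse (\<sigma> t \<omega>)) = (\<lambda>z. inverse (case_prod \<sigma> z))" by auto
    then show ?thesis using \<sigma> unfolding adapted_def by auto
  qed
  have ib: "AE z in P. \<bar>case_prod (\<lambda>t \<omega>. inverse (\<sigma> t \<omega>)) z\<bar> \<le> c"
    using \<sigma>_bound
  proof eventually_elim
    case (elim z)
    then have "0 < case_prod \<sigma> z" using c by (meson order_less_le_trans positive_imp_inverse_positive)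
    moreover have "inverse (case_prod \<sigma> z) \<le> inverse (inverse c)" using elim c by (intro le_imp_inverse_le) auto
    ultimately show ?case by (simp add: split_beta')
  qed
  have p: "p \<in> L2_adapted M T W" unfolding p_def
    using AE_P_exp_TI_bound[of 1] by (intro L2_adapted_mult[OF L2_adapted_mult[OF ito_integrand[OF v(1)] adapted_exp_TI] i ib]) simp
  obtain I where I: "ito (\<lambda>t \<omega>. disc t \<omega> * (p t \<omega> * \<sigma> t \<omega>)) I" using ito_discounted_position[OF p] by blast
  have "AE z in P. case_prod (\<lambda>t \<omega>. disc t \<omega> * (p t \<omega> * \<sigma> t \<omega>)) z = case_prod v z"
    using \<sigma>_bound
  proof eventually_elim
    case (elim z)
    then have "0 < case_prod \<sigma> z" using c by (meson order_less_le_trans positive_imp_inverse_positive)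
    then show ?case by (simp add: split_beta' p_def disc_def exp_minus field_simps)
  qed
  from gain_unique[OF I v(1) this] terminal_wealth(2)[OF p I, of x] v(2)
  have "AE \<omega> in M. wealth M T W r0 \<mu> \<sigma> x p T \<omega> = x * exp (TI r T \<omega>) + s \<omega>"
    by eventually_elim simp
  then show ?thesis using p by blast
qed

lemma terminal_wealth_injective:
  assumes p: "p \<in> L2_adapted M T W" "q \<in> L2_adapted M T W"
    and eq: "AE \<omega> in M. wealth M T W r0 \<mu> \<sigma> x p T \<omega> = wealth M T W r0 \<mu> \<sigma> x q T \<omega>"
  shows "same_process M T p q"
proof -
  obtain J where J: "ito (\<lambda>t \<omega>. disc t \<omega> * (p t \<omega> * \<sigma> t \<omega>)) J" using ito_discounted_position[OF p(1)] by blast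
  obtain I where I: "ito (\<lambda>t \<omega>. disc t \<omega> * (q t \<omega> * \<sigma> t \<omega>)) I" using ito_discounted_position[OF p(2)] by blast
  have "AE \<omega> in M. gain (\<lambda>t \<omega>. disc t \<omega> * (p t \<omega> * \<sigma> t \<omega>)) J T \<omega> = gain (\<lambda>t \<omega>. disc t \<omega> * (q t \<omega> * \<sigma> t \<omega>)) I T \<omega>"
    using eq terminal_wealth(2)[OF p(1) J, of x] terminal_wealth(2)[OF p(2) I, of x] by eventually_elim simp
  from gain_injective[OF J I this] \<sigma>_bound
  have "AE z in P. case_prod p z = case_prod q z"
  proof eventually_elim
    case (elim z)
    then have "0 < case_prod \<sigma> z" using c by (meson order_less_le_trans positive_imp_inverse_positive)
    then show ?case using elim(1) by (simp add: split_beta' disc_def)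
  qed
  then show ?thesis unfolding same_process_def by (simp add: split_beta')
qed

end

context brownian_setting
begin

lemma adapted_clip: "adapted M T W v \<Longrightarrow> adapted M T W (\<lambda>t \<omega>. clip b (v t \<omega>))"
proof -
  assume v: "adapted M T W v"
  have "case_prod (\<lambda>t \<omega>. clip b (v t \<omega>)) = (\<lambda>z. clip b (case_prod v z))" by auto
  then show ?thesis using v unfolding adapted_def by auto
qed

lemma adapted_risk_premium:
  assumes "adapted M T W r" "adapted M T W \<mu>" "adapted M T W \<sigma>"
  shows "adapted M T W (risk_premium r \<mu> \<sigma>)"
proof -
  have e: "case_prod (risk_premium r \<mu> \<sigma>) = (\<lambda>z. (case_prod \<mu> z - case_prod r z) / case_prod \<sigma> z)"
    by (auto simp: risk_premium_def)
  have et: "risk_premium r \<mu> \<sigma> t = (\<lambda>\<omega>. (\<mu> t \<omega> - r t \<omega>) / \<sigma> t \<omega>)" for t by (auto simp: risk_premium_def)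
  show ?thesis using assms unfolding adapted_def e et
    by (intro conjI ballI borel_measurable_divide borel_measurable_diff) blast+
qed

lemma risk_premium_bounded:
  assumes "essentially_bounded M T r" "essentially_bounded M T \<mu>" "0 < c"
    and "AE z in P. inverse c \<le> case_prod \<sigma> z \<and> case_prod \<sigma> z \<le> c"
  shows "\<exists>K\<ge>0. AE z in P. \<bar>case_prod (risk_premium r \<mu> \<sigma>) z\<bar> \<le> K"
proof -
  obtain A B where A: "AE (t, \<omega>) in P. \<bar>r t \<omega>\<bar> \<le> A" and B: "AE (t, \<omega>) in P. \<bar>\<mu> t \<omega>\<bar> \<le> B"
    using assms(1,2) unfolding essentially_bounded_def by blast
  have "AE z in P. \<bar>case_prod (risk_premium r \<mu> \<sigma>) z\<bar> \<le> (\<bar>A\<bar> + \<bar>B\<bar>) * c"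
    using A B assms(4)
  proof eventually_elim
    case (elim z)
    obtain t \<omega> where z: "z = (t, \<omega>)" by (cases z)
    have s: "inverse c \<le> \<sigma> t \<omega>" using elim z by simp
    then have p: "0 < \<sigma> t \<omega>" using assms(3) by (meson order_less_le_trans positive_imp_inverse_positive)
    have "\<bar>\<mu> t \<omega> - r t \<omega>\<bar> * inverse (\<sigma> t \<omega>) \<le> (\<bar>A\<bar> + \<bar>B\<bar>) * c"
    proof (rule mult_mono)
      show "inverse (\<sigma> t \<omega>) \<le> c" using le_imp_inverse_le[OF s] assms(3) by simp
      show "\<bar>\<mu> t \<omega> - r t \<omega>\<bar> \<le> \<bar>A\<bar> + \<bar>B\<bar>" using elim z by simp
    qed (use p in simp_all)
    then show ?case using p by (simp add: z risk_premium_def abs_mult divide_inverse)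
  qed
  then show ?thesis using assms(3) by (intro exI[of _ "(\<bar>A\<bar> + \<bar>B\<bar>) * c"]) simp
qed

end

theorem theorem4p3:
  fixes M :: "'a measure" and T :: real and W :: "'a process" and n :: nat
    and r \<rho> \<psi> \<xi> :: "'a process" and \<mu> \<sigma> :: "nat \<Rightarrow> 'a process"
    and x \<theta> \<gamma> :: "nat \<Rightarrow> real"
  assumes "prob_space M" and "complete_measure M" and "0 < T" and "brownian_motion M T W"
    and "2 \<le> n"
    and "\<And>i. i \<in> {1..n} \<Longrightarrow> \<theta> i \<in> {0..1}"
    and "\<And>i. i \<in> {1..n} \<Longrightarrow> 0 < \<gamma> i"
    and "adapted M T W r" and "essentially_bounded M T r" and "nonnegative M T r"
    and "\<And>i. i \<in> {1..n} \<Longrightarrow>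
           adapted M T W (\<mu> i) \<and> essentially_bounded M T (\<mu> i) \<and> nonnegative M T (\<mu> i)"
    and "\<And>i. i \<in> {1..n} \<Longrightarrow> adapted M T W (\<sigma> i) \<and>
           (\<exists>c>0. AE (t, \<omega>) in time_scenario M T. inverse c \<le> \<sigma> i t \<omega> \<and> \<sigma> i t \<omega> \<le> c)"
    and "bond_bsde_solution M T W r \<psi> \<xi>"
    and "\<And>i. i \<in> {1..n} \<Longrightarrow>
           0 < energy M T (\<lambda>t \<omega>. risk_premium r (\<mu> i) (\<sigma> i) t \<omega> * \<psi> t \<omega> + \<xi> t \<omega>)"
    and "\<And>i. i \<in> {1..n} \<Longrightarrow> same_process M T (risk_premium r (\<mu> i) (\<sigma> i)) \<rho>"
    and "\<not> same_process M T \<rho> (\<lambda>t \<omega>. 0)"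
    and "Psi n \<theta> < 1"
  shows "\<exists>\<pi>. nash_equilibrium M T W n r \<mu> \<sigma> x \<theta> \<gamma> \<pi> \<and>
           (\<forall>\<pi>'. nash_equilibrium M T W n r \<mu> \<sigma> x \<theta> \<gamma> \<pi>' \<longrightarrow>
              (\<forall>i\<in>{1..n}. same_process M T (\<pi>' i) (\<pi> i)))"
proof -
  interpret prob_space M by (rule assms(1))
  interpret brownian_setting M T W by unfold_locales (rule assms(3), rule assms(4))
  have one: "1 \<in> {1..n}" using assms(5) by simp
  define rp where "rp = (\<lambda>i. risk_premium r (\<mu> i) (\<sigma> i))"
  have rp_ad: "adapted M T W (rp i)" if "i \<in> {1..n}" for i
    unfolding rp_def using assms(8) assms(11)[OF that] assms(12)[OF that] by (intro adapted_risk_premium) auto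
  have "\<forall>i. \<exists>c. i \<in> {1..n} \<longrightarrow> 0 < c \<and> (AE z in P. inverse c \<le> case_prod (\<sigma> i) z \<and> case_prod (\<sigma> i) z \<le> c)"
    using assms(12) by (simp add: split_beta')
  then obtain c where c: "\<And>i. i \<in> {1..n} \<Longrightarrow> 0 < c i"
    and c_bound: "\<And>i. i \<in> {1..n} \<Longrightarrow> AE z in P. inverse (c i) \<le> case_prod (\<sigma> i) z \<and> case_prod (\<sigma> i) z \<le> c i"
    unfolding choice_iff by blast
  obtain C where "AE (t, \<omega>) in P. \<bar>r t \<omega>\<bar> \<le> C" using assms(9) unfolding essentially_bounded_def by blast
  then have C: "AE z in P. \<bar>case_prod r z\<bar> \<le> \<bar>C\<bar>" by eventually_elim auto
  obtain K where K0: "0 \<le> K" and K: "AE z in P. \<bar>case_prod (rp 1) z\<bar> \<le> K"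
    using risk_premium_bounded[OF assms(9) _ c[OF one] c_bound[OF one]] assms(11)[OF one] unfolding rp_def by blast
  \<comment> \<open>Truncation at the essential bound changes \<open>r\<close> only on a null set
    and makes the bound hold everywhere.\<close>
  define rb where "rb = (\<lambda>t \<omega>. clip \<bar>C\<bar> (r t \<omega>))"
  \<comment> \<open>The common process is built from the premium of agent 1, which is adapted;
    \<open>\<rho>\<close> itself is given only through equality almost everywhere.\<close>
  define \<rho>b where "\<rho>b = (\<lambda>t \<omega>. clip K (rp 1 t \<omega>))"
  have rp_eq: "AE z in P. case_prod (rp i) z = case_prod \<rho>b z" if i: "i \<in> {1..n}" for i
  proof -
    have s: "AE z in P. case_prod (rp j) z = case_prod \<rho> z" if "j \<in> {1..n}" for j
      using assms(15)[OF that] by (simp add: same_process_def rp_def split_beta')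
    show ?thesis using s[OF i] s[OF one] K by eventually_elim (auto simp: \<rho>b_def clip_bound)
  qed
  have r_eq: "AE z in P. case_prod r z = case_prod rb z"
    using C by eventually_elim (auto simp: rb_def clip_bound)
  interpret m: market M T W rb "\<bar>C\<bar>" \<rho>b K
  proof unfold_locales
    show "adapted M T W rb" unfolding rb_def by (rule adapted_clip[OF assms(8)])
    show "adapted M T W \<rho>b" unfolding \<rho>b_def by (rule adapted_clip[OF rp_ad[OF one]])
    show "\<bar>rb t \<omega>\<bar> \<le> \<bar>C\<bar>" for t \<omega> unfolding rb_def by (rule clip_bound(1)) simp
    show "\<bar>\<rho>b t \<omega>\<bar> \<le> K" for t \<omega> unfolding \<rho>b_def by (rule clip_bound(1)[OF K0])
  qed
  have a: "asset M T W rb \<bar>C\<bar> \<rho>b K r (\<mu> i) (\<sigma> i) (c i)" if i: "i \<in> {1..n}" for i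
  proof (intro asset.intro asset_axioms.intro)
    show "market M T W rb \<bar>C\<bar> \<rho>b K" by (rule m.market_axioms)
    show "case_prod r \<in> borel_measurable P" using assms(8) by (simp add: adapted_def)
    show "case_prod (risk_premium r (\<mu> i) (\<sigma> i)) \<in> borel_measurable P"
      using rp_ad[OF i] by (simp add: adapted_def rp_def)
    show "AE z in P. case_prod (risk_premium r (\<mu> i) (\<sigma> i)) z = case_prod \<rho>b z"
      using rp_eq[OF i] by (simp add: rp_def)
    show "adapted M T W (\<sigma> i)" using assms(12)[OF i] by blast
  qed (rule r_eq, rule c[OF i], rule c_bound[OF i])
  interpret g: gains_space M m.attainable by (rule m.gains_space_attainable)
  let ?X = "\<lambda>i p. wealth M T W r (\<mu> i) (\<sigma> i) (x i) p T"
  have rel: "relative_terminal_wealth M T W n r \<mu> \<sigma> x \<theta> \<pi> i = g.relative n \<theta> (\<lambda>k. ?X k (\<pi> k)) i" for \<pi> i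
    by (intro ext) (simp add: relative_terminal_wealth_def g.relative_def)
  show ?thesis
    unfolding nash_equilibrium_def payoff_def Let_def rel
  proof (rule g.unique_equilibrium[OF assms(5) assms(6) assms(7) assms(17), where e = "\<lambda>\<omega>. exp (TI rb T \<omega>)"])
    show "(\<lambda>\<omega>. exp (TI rb T \<omega>)) \<in> L2 M" using m.bond_mult_L2[OF L2_const, of 1 1] by simp
    fix i p assume i: "i \<in> {1..n}"
    show "?X i p \<in> borel_measurable M" if "p \<in> L2_adapted M T W"
      by (rule asset.terminal_wealth(1)[OF a[OF i] that])
    show "\<exists>s\<in>m.attainable. AE \<omega> in M. ?X i p \<omega> = x i * exp (TI rb T \<omega>) + s \<omega>" if "p \<in> L2_adapted M T W"
      by (rule asset.terminal_wealth_range[OF a[OF i] that])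
    show "same_process M T p q" if "p \<in> L2_adapted M T W" "q \<in> L2_adapted M T W" "AE \<omega> in M. ?X i p \<omega> = ?X i q \<omega>" for q
      by (rule asset.terminal_wealth_injective[OF a[OF i] that])
  next
    fix i s assume i: "i \<in> {1..n}"
    show "\<exists>p\<in>L2_adapted M T W. AE \<omega> in M. ?X i p \<omega> = x i * exp (TI rb T \<omega>) + s \<omega>" if "s \<in> m.attainable"
      by (rule asset.terminal_wealth_onto[OF a[OF i] that])
  qed
qed

end
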